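(* Let $d\ge2$, let $\Omega\subset\mathbb R^d$ be a bounded domain and let $\alpha\in(0,1)$. If $\Omega\in\mathrm{Lip}_\alpha$, then $$N_{\mathrm D}(\Omega,\lambda)=C_{d,W}\,\mu_d(\Omega)\,\lambda^d+O\bigl(\lambda^{d-\alpha}\bigr),\qquad\lambda\to+\infty.$$ If $\Omega\in\mathrm{lip}_\alpha$, then $$N_{\mathrm D}(\Omega,\lambda)=C_{d,W}\,\mu_d(\Omega)\,\lambda^d+o\bigl(\lambda^{d-\alpha}\bigr),\qquad\lambda\to+\infty.$$
   Context: A domain is an open connected set. $N_{\mathrm D}(\Omega,\lambda)$ is the number of eigenvalues (with multiplicity) of the Dirichlet Laplacian on $\Omega$ lying strictly below $\lambda^2$. $\mu_d$ is Lebesgue measure; $C_{d,W}:=(2\pi)^{-d}\omega_d$ with $\omega_d$ the volume of the unit ball of $\mathbb R^d$. Cubes are open with edges parallel to the coordinate axes; $Q_a^{(n)}$ is an $n$-dimensional cube of edge length $a$. For a function $f$ on a cube $Q$ and $\alpha\in(0,1]$, $|f|_\alpha:=\sup_{x,y\in Q}|f(x)-f(y)|/|x-y|^\alpha$. $\mathrm{Lip}_\alpha$ is the space of functions $f$ on a cube with $|f|_\alpha<\infty$, and $\mathrm{lip}_\alpha$ is the closure of $\mathrm{Lip}_1$ in $\mathrm{Lip}_\alpha$ with respect to the seminorm $|\cdot|_\alpha$. Write $x=(x',x_d)$; for a continuous $f$ and $b\in\mathbb R$, $G_{f,b}:=\{x: b<x_d<f(x')\}$ with $x'$ in the domain of definition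 of $f$. If $X$ is a space of continuous real-valued functions on a cube $Q^{(d-1)}$ (here $X=\mathrm{Lip}_\alpha$ or $\mathrm{lip}_\alpha$), then $\Omega\in X$ means: for each $z\in\partial\Omega$ there are a neighbourhood $\mathcal O_z$ of $z$, a linear orthogonal map $U:\mathbb R^d\to\mathbb R^d$, a cube $Q_a^{(d-1)}\subset Q^{(d-1)}$, $f\in X$ and $b\in\mathbb R$ with $U(\mathcal O_z\cap\Omega)=\{x\in G_{f,b}:x'\in Q_a^{(d-1)}\}$. *)

theory Defs
  imports "HOL-Analysis.Analysis" "HOL-Library.Landau_Symbols" "HOL-Library.Extended_Nat"
begin

section \<open>The Dirichlet Laplacian and its counting function\<close>

definition grad :: "('a::euclidean_space \<Rightarrow> real) \<Rightarrow> 'a \<Rightarrow> 'a" where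
  "grad f x = (\<Sum>b\<in>Basis. frechet_derivative f (at x) b *\<^sub>R b)"

primrec C_diff :: "nat \<Rightarrow> ('a::euclidean_space \<Rightarrow> real) \<Rightarrow> bool" where
  "C_diff 0 f \<longleftrightarrow> continuous_on UNIV f"
| "C_diff (Suc k) f \<longleftrightarrow>
     (\<forall>x. f differentiable (at x)) \<and> (\<forall>b\<in>Basis. C_diff k (\<lambda>x. grad f x \<bullet> b))"

definition test_functions :: "'a::euclidean_space set \<Rightarrow> ('a \<Rightarrow> real) set" where
  "test_functions \<Omega> = {\<phi>. (\<forall>k. C_diff k \<phi>) \<and>
     compact (closure {x. \<phi> x \<noteq> 0}) \<and> closure {x. \<phi> x \<noteq> 0} \<subseteq> \<Omega>}"

text \<open>Elements of \<open>L\<^sup>2\<close> are represented by functions; almost everywhere equal functions are not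
  identified here but only when dimensions are computed, in \<open>ae_dim\<close> below. Only the values
  on \<open>\<Omega>\<close> matter.\<close>

definition L2 :: "'a::euclidean_space set \<Rightarrow> ('a \<Rightarrow> 'b::euclidean_space) set" where
  "L2 \<Omega> = {f \<in> borel_measurable (lebesgue_on \<Omega>). integrable (lebesgue_on \<Omega>) (\<lambda>x. (norm (f x))\<^sup>2)}"

definition weak_gradient ::
  "'a::euclidean_space set \<Rightarrow> ('a \<Rightarrow> real) \<Rightarrow> ('a \<Rightarrow> 'a) \<Rightarrow> bool" where
  "weak_gradient \<Omega> u g \<longleftrightarrow> (\<forall>\<phi>\<in>test_functions \<Omega>. \<forall>b\<in>Basis.
     (\<integral>x. u x * (grad \<phi> x \<bullet> b) \<partial>lebesgue_on \<Omega>) = - (\<integral>x. (g x \<bullet> b) * \<phi> x \<partial>lebesgue_on \<Omega>))"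

text \<open>\<open>W12 \<Omega> u g\<close> says that \<open>u\<close> belongs to the Sobolev space \<open>W\<^sup>1\<^sup>,\<^sup>2(\<Omega>)\<close> and that \<open>g\<close> is its weak
  gradient (which \<open>u\<close> determines almost everywhere on \<open>\<Omega>\<close>). \<open>W12_0\<close> is the closure of the test
  functions in the Sobolev norm.\<close>

definition W12 :: "'a::euclidean_space set \<Rightarrow> ('a \<Rightarrow> real) \<Rightarrow> ('a \<Rightarrow> 'a) \<Rightarrow> bool" where
  "W12 \<Omega> u g \<longleftrightarrow> u \<in> L2 \<Omega> \<and> g \<in> L2 \<Omega> \<and> weak_gradient \<Omega> u g"

definition W12_0 :: "'a::euclidean_space set \<Rightarrow> ('a \<Rightarrow> real) \<Rightarrow> ('a \<Rightarrow> 'a) \<Rightarrow> bool" where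
  "W12_0 \<Omega> u g \<longleftrightarrow> W12 \<Omega> u g \<and>
     (\<exists>\<phi> :: nat \<Rightarrow> 'a \<Rightarrow> real. (\<forall>n. \<phi> n \<in> test_functions \<Omega>) \<and>
        (\<lambda>n. \<integral>x. (\<phi> n x - u x)\<^sup>2 \<partial>lebesgue_on \<Omega>) \<longlonglongrightarrow> 0 \<and>
        (\<lambda>n. \<integral>x. (norm (grad (\<phi> n) x - g x))\<^sup>2 \<partial>lebesgue_on \<Omega>) \<longlonglongrightarrow> 0)"

text \<open>The graph of the Dirichlet Laplacian \<open>- \<Delta>\<close> (with the sign that makes it nonnegative): the
  self-adjoint operator in \<open>L\<^sup>2(\<Omega>)\<close> generated by the form \<open>\<integral> \<nabla>u \<bullet> \<nabla>v\<close> with form domain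
  \<open>W12_0\<close>. The pair \<open>(u, w)\<close> is in the graph iff \<open>u\<close> is in the operator domain and
  \<open>- \<Delta> u = w\<close>.\<close>

definition dirichlet_laplacian ::
  "'a::euclidean_space set \<Rightarrow> (('a \<Rightarrow> real) \<times> ('a \<Rightarrow> real)) set" where
  "dirichlet_laplacian \<Omega> = {(u, w). w \<in> L2 \<Omega> \<and> (\<exists>g. W12_0 \<Omega> u g \<and>
     (\<forall>v h. W12_0 \<Omega> v h \<longrightarrow>
        (\<integral>x. g x \<bullet> h x \<partial>lebesgue_on \<Omega>) = (\<integral>x. w x * v x \<partial>lebesgue_on \<Omega>)))}"

definition dirichlet_eigenspace :: "'a::euclidean_space set \<Rightarrow> real \<Rightarrow> ('a \<Rightarrow> real) set" where
  "dirichlet_eigenspace \<Omega> \<mu> = {u. (u, \<lambda>x. \<mu> * u x) \<in> dirichlet_laplacian \<Omega>}"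

text \<open>The dimension of a space of functions modulo equality almost everywhere on \<open>\<Omega>\<close>.\<close>

definition ae_independent :: "'a::euclidean_space set \<Rightarrow> nat \<Rightarrow> (nat \<Rightarrow> 'a \<Rightarrow> real) \<Rightarrow> bool" where
  "ae_independent \<Omega> n u \<longleftrightarrow>
     (\<forall>c :: nat \<Rightarrow> real. (AE x in lebesgue_on \<Omega>. (\<Sum>i<n. c i * u i x) = 0) \<longrightarrow> (\<forall>i<n. c i = 0))"

definition ae_dim :: "'a::euclidean_space set \<Rightarrow> ('a \<Rightarrow> real) set \<Rightarrow> enat" where
  "ae_dim \<Omega> V = Sup {enat n |n. \<exists>u. (\<forall>i<n. u i \<in> V) \<and> ae_independent \<Omega> n u}"

text \<open>The sum of the multiplicities of all eigenvalues below \<open>l\<^sup>2\<close>, as a supremum over finite sets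
  of reals; a real that is not an eigenvalue has multiplicity \<open>0\<close>.\<close>

definition N_D :: "'a::euclidean_space set \<Rightarrow> real \<Rightarrow> enat" where
  "N_D \<Omega> l = (SUP F\<in>{F. finite F \<and> F \<subseteq> {..<l\<^sup>2}}. \<Sum>\<mu>\<in>F. ae_dim \<Omega> (dirichlet_eigenspace \<Omega> \<mu>))"

definition C_W :: "nat \<Rightarrow> real" where
  "C_W d = unit_ball_vol (real d) / (2 * pi) ^ d"


section \<open>Domains whose boundary is locally the graph of a Hoelder function\<close>

definition is_cube :: "real \<Rightarrow> 'a::euclidean_space set \<Rightarrow> bool" where
  "is_cube a Q \<longleftrightarrow> a > 0 \<and> (\<exists>c. Q = box c (c + a *\<^sub>R One))"

text \<open>In the supremum, pairs with \<open>x = y\<close> contribute \<open>0 / 0 = 0\<close>.\<close>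

definition holder_seminorm ::
  "real \<Rightarrow> 'a::euclidean_space set \<Rightarrow> ('a \<Rightarrow> real) \<Rightarrow> ereal" where
  "holder_seminorm \<alpha> Q f = (SUP (x, y)\<in>Q \<times> Q. ereal (\<bar>f x - f y\<bar> / norm (x - y) powr \<alpha>))"

definition Lip :: "real \<Rightarrow> 'a::euclidean_space set \<Rightarrow> ('a \<Rightarrow> real) set" where
  "Lip \<alpha> Q = {f. holder_seminorm \<alpha> Q f < \<infinity>}"

definition little_lip :: "real \<Rightarrow> 'a::euclidean_space set \<Rightarrow> ('a \<Rightarrow> real) set" where
  "little_lip \<alpha> Q =
     {f \<in> Lip \<alpha> Q. \<forall>\<epsilon>>0. \<exists>g\<in>Lip 1 Q. holder_seminorm \<alpha> Q (\<lambda>x. f x - g x) < ereal \<epsilon>}"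

text \<open>From here on \<open>\<real>\<^sup>d\<close> is the Euclidean space \<open>'a \<times> real\<close>, where \<open>'a\<close> is \<open>\<real>\<^sup>d\<^sup>-\<^sup>1\<close> and a point
  is \<open>x = (x', x\<^sub>d)\<close>. As a Euclidean space \<open>'a\<close> has dimension at least \<open>1\<close>, so that \<open>d \<ge> 2\<close>.\<close>

definition subgraph ::
  "'a::euclidean_space set \<Rightarrow> ('a \<Rightarrow> real) \<Rightarrow> real \<Rightarrow> ('a \<times> real) set" where
  "subgraph Q f b = {(x', xd). x' \<in> Q \<and> b < xd \<and> xd < f x'}"

definition domain_of_class ::
  "'a::euclidean_space set \<Rightarrow> ('a \<Rightarrow> real) set \<Rightarrow> ('a \<times> real) set \<Rightarrow> bool" where
  "domain_of_class Q X \<Omega> \<longleftrightarrow> (\<forall>z\<in>frontier \<Omega>.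
     \<exists>Oz U a Qa f b. open Oz \<and> z \<in> Oz \<and> orthogonal_transformation U \<and>
       is_cube a Qa \<and> Qa \<subseteq> Q \<and> f \<in> X \<and>
       U ` (Oz \<inter> \<Omega>) = {x \<in> subgraph Q f b. fst x \<in> Qa})"

text \<open>The maps \<open>U\<close> are linear, without translations, so the position of the ambient cube \<open>Q\<close>
  matters; it is not prescribed but part of the data.\<close>

definition Lip_domain :: "real \<Rightarrow> ('a::euclidean_space \<times> real) set \<Rightarrow> bool" where
  "Lip_domain \<alpha> \<Omega> \<longleftrightarrow> (\<exists>a Q. is_cube a Q \<and> domain_of_class Q (Lip \<alpha> Q) \<Omega>)"

definition little_lip_domain :: "real \<Rightarrow> ('a::euclidean_space \<times> real) set \<Rightarrow> bool" where
  "little_lip_domain \<alpha> \<Omega> \<longleftrightarrow> (\<exists>a Q. is_cube a Q \<and> domain_of_class Q (little_lip \<alpha> Q) \<Omega>)"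

end

theory Submission
  imports Defs "HOL-Complex_Analysis.Great_Picard"
begin

text \<open>
  Dirichlet--Neumann bracketing. Write \<open>\<Omega>\<close> as the union of its maximal dyadic cells of side at
  least \<open>2\<^sup>-\<^sup>J \<sim> 1 / \<lambda>\<close> and of a boundary layer of cells of side \<open>2\<^sup>-\<^sup>J\<close>. Extending functions on
  the inner cells by zero bounds the counting function from below. For the upper bound, functions in
  \<open>W\<^sub>0\<^sup>1\<^sup>,\<^sup>2\<close> are extended by zero to whole cells, where the Neumann inequality applies; the
  cells of the boundary layer contribute \<open>O(1)\<close> eigenvalues each. A cube of side \<open>2\<^sup>-\<^sup>j\<close> satisfies
  the Weyl law with error \<open>O((1 + 2\<^sup>-\<^sup>j \<lambda>)\<^sup>d\<^sup>-\<^sup>1)\<close>, and the Hoelder condition shows that the boundary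
  meets \<open>O(2\<^sup>j\<^sup>(\<^sup>d\<^sup>-\<^sup>\<alpha>\<^sup>))\<close> cells of side \<open>2\<^sup>-\<^sup>j\<close>, respectively \<open>o\<close> of this. As \<open>\<alpha> < 1\<close>, the sum of
  the errors over \<open>j \<le> J\<close> is geometric and dominated by its last term.

  No spectral theorem is needed: an upper bound for the number of eigenvalues follows from finitely
  many linear conditions that force the Rayleigh quotient above \<open>\<lambda>\<^sup>2\<close>, and eigenfunctions are
  produced by minimising the Rayleigh quotient successively. Compactness of minimising sequences comes
  from the Neumann inequality on a large cube, whose proof uses only Bessel's inequality for sine
  products and the density of cosine products (Stone--Weierstrass).
\<close>

section \<open>Square integrable functions\<close>

text \<open>No regularity of the boundary is used before the cells that it meets are counted. A cell
  sticking out of the domain does no harm, because test functions are zero there and can be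
  integrated over the whole cell. The Neumann inequality needs no boundary condition either: the
  derivative in direction \<open>b\<close> is tested against products with a sine in that one
  direction, which vanish on the two faces where a boundary term could arise; what remains are the
  cosine coefficients of the function itself, multiplied by the frequency. The two remainder
  estimates share one proof. \<open>osc_bound\<close> splits the oscillation of a boundary function
  as \<open>H * norm (x - y) powr \<alpha> + L * norm (x - y)\<close>. The part with
  \<open>L\<close> affects only lower-order terms, while the leading coefficient of the remainder is
  linear in the numbers \<open>H\<close>, up to an arbitrarily small error. Its factors must be
  fixed together with the finite set of charts and before \<open>H\<close> is chosen: for the little
  class \<open>H\<close> is then taken small, at the price of a large \<open>L\<close>. This order
  of quantifiers shapes the statements from \<open>chart_boundary_count\<close> to
  \<open>Weyl_remainder\<close>.\<close>

lemma L2_iff: "f \<in> L2 \<Omega> \<longleftrightarrow> f \<in> borel_measurable (lebesgue_on \<Omega>) \<and>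
    integrable (lebesgue_on \<Omega>) (\<lambda>x. (norm (f x))\<^sup>2)"
  by (simp add: L2_def)

lemma L2_inner_integrable:
  fixes f g :: "'a::euclidean_space \<Rightarrow> 'b::euclidean_space"
  assumes "f \<in> L2 \<Omega>" "g \<in> L2 \<Omega>"
  shows "integrable (lebesgue_on \<Omega>) (\<lambda>x. f x \<bullet> g x)"
proof (rule Bochner_Integration.integrable_bound)
  show "integrable (lebesgue_on \<Omega>) (\<lambda>x. (norm (f x))\<^sup>2 + (norm (g x))\<^sup>2)"
    using assms by (auto simp: L2_iff)
  show "(\<lambda>x. f x \<bullet> g x) \<in> borel_measurable (lebesgue_on \<Omega>)"
    using assms by (auto simp: L2_iff)
  have "\<bar>f x \<bullet> g x\<bar> \<le> (norm (f x))\<^sup>2 + (norm (g x))\<^sup>2" for x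
  proof -
    have "\<bar>f x \<bullet> g x\<bar> \<le> norm (f x) * norm (g x)"
      by (rule Cauchy_Schwarz_ineq2)
    also have "\<dots> \<le> (norm (f x))\<^sup>2 + (norm (g x))\<^sup>2"
    proof -
      have "2 * (norm (f x) * norm (g x)) \<le> (norm (f x))\<^sup>2 + (norm (g x))\<^sup>2"
        using sum_squares_bound[of "norm (f x)" "norm (g x)"] by simp
      moreover have "0 \<le> norm (f x) * norm (g x)" by simp
      ultimately show ?thesis by linarith
    qed
    finally show ?thesis .
  qed
  then show "AE x in lebesgue_on \<Omega>. norm (f x \<bullet> g x) \<le> norm ((norm (f x))\<^sup>2 + (norm (g x))\<^sup>2)"
    by (auto intro!: AE_I2 order_trans[OF _ abs_ge_self])
qed

lemma L2_mult_integrable: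
  fixes f g :: "'a::euclidean_space \<Rightarrow> real"
  assumes "f \<in> L2 \<Omega>" "g \<in> L2 \<Omega>"
  shows "integrable (lebesgue_on \<Omega>) (\<lambda>x. f x * g x)"
  using L2_inner_integrable[OF assms] by simp

lemma L2_add:
  assumes "f \<in> L2 \<Omega>" "g \<in> L2 \<Omega>"
  shows "(\<lambda>x. f x + g x) \<in> L2 \<Omega>"
proof -
  have "integrable (lebesgue_on \<Omega>) (\<lambda>x. (norm (f x))\<^sup>2 + 2 * (f x \<bullet> g x) + (norm (g x))\<^sup>2)"
    using assms L2_inner_integrable[OF assms] by (auto simp: L2_iff)
  then have "integrable (lebesgue_on \<Omega>) (\<lambda>x. (norm (f x + g x))\<^sup>2)"
    by (simp add: power2_norm_eq_inner inner_add_left inner_add_right inner_commute algebra_simps)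
  with assms show ?thesis by (auto simp: L2_iff)
qed

lemma L2_scaleR:
  assumes "f \<in> L2 \<Omega>"
  shows "(\<lambda>x. c *\<^sub>R f x) \<in> L2 \<Omega>"
  using assms by (auto simp: L2_iff power_mult_distrib)

lemma L2_cmult:
  fixes f :: "'a::euclidean_space \<Rightarrow> real"
  assumes "f \<in> L2 \<Omega>"
  shows "(\<lambda>x. c * f x) \<in> L2 \<Omega>"
  using L2_scaleR[OF assms, of c] by simp

lemma L2_zero: "(\<lambda>x. 0) \<in> L2 \<Omega>"
  by (auto simp: L2_iff)

lemma L2_diff:
  assumes "f \<in> L2 \<Omega>" "g \<in> L2 \<Omega>"
  shows "(\<lambda>x. f x - g x) \<in> L2 \<Omega>"
  using L2_add[OF assms(1) L2_scaleR[OF assms(2), of "-1"]] by simp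

lemma L2_sum:
  assumes "\<And>i. i \<in> I \<Longrightarrow> f i \<in> L2 \<Omega>"
  shows "(\<lambda>x. \<Sum>i\<in>I. f i x) \<in> L2 \<Omega>"
proof (cases "finite I")
  case True
  then show ?thesis using assms
    by (induction I) (auto intro: L2_zero L2_add)
qed (auto intro: L2_zero)

lemma L2_inner_const:
  assumes "f \<in> L2 \<Omega>"
  shows "(\<lambda>x. f x \<bullet> b) \<in> L2 \<Omega>"
proof -
  have "integrable (lebesgue_on \<Omega>) (\<lambda>x. (norm (f x \<bullet> b))\<^sup>2)"
  proof (rule Bochner_Integration.integrable_bound)
    show "integrable (lebesgue_on \<Omega>) (\<lambda>x. (norm b)\<^sup>2 * (norm (f x))\<^sup>2)"
      using assms by (auto simp: L2_iff)
    show "(\<lambda>x. (norm (f x \<bullet> b))\<^sup>2) \<in> borel_measurable (lebesgue_on \<Omega>)"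
      using assms by (auto simp: L2_iff)
    show "AE x in lebesgue_on \<Omega>. norm ((norm (f x \<bullet> b))\<^sup>2) \<le> norm ((norm b)\<^sup>2 * (norm (f x))\<^sup>2)"
    proof (rule AE_I2)
      fix x
      have "(f x \<bullet> b)\<^sup>2 \<le> (norm (f x))\<^sup>2 * (norm b)\<^sup>2"
        by (metis Cauchy_Schwarz_ineq power2_norm_eq_inner)
      then show "norm ((norm (f x \<bullet> b))\<^sup>2) \<le> norm ((norm b)\<^sup>2 * (norm (f x))\<^sup>2)"
        by (simp add: mult.commute)
    qed
  qed
  with assms show ?thesis by (auto simp: L2_iff)
qed

lemma L2_Cauchy_Schwarz:
  fixes f g :: "'a::euclidean_space \<Rightarrow> 'b::euclidean_space"
  assumes f: "f \<in> L2 \<Omega>" and g: "g \<in> L2 \<Omega>"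
  shows "(\<integral>x. f x \<bullet> g x \<partial>lebesgue_on \<Omega>)\<^sup>2 \<le>
    (\<integral>x. (norm (f x))\<^sup>2 \<partial>lebesgue_on \<Omega>) * (\<integral>x. (norm (g x))\<^sup>2 \<partial>lebesgue_on \<Omega>)"
proof -
  let ?M = "lebesgue_on \<Omega>"
  define A B C where "A = (\<integral>x. (norm (f x))\<^sup>2 \<partial>?M)" and "B = (\<integral>x. f x \<bullet> g x \<partial>?M)"
    and "C = (\<integral>x. (norm (g x))\<^sup>2 \<partial>?M)"
  have int: "integrable ?M (\<lambda>x. (norm (f x))\<^sup>2)" "integrable ?M (\<lambda>x. (norm (g x))\<^sup>2)"
    "integrable ?M (\<lambda>x. f x \<bullet> g x)"
    using f g L2_inner_integrable[OF f g] by (auto simp: L2_iff)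
  \<comment> \<open>The form in two parameters allows \<open>s = C\<close> and \<open>t = B\<close>
    below, so that the main case needs no division.\<close>
  have q: "0 \<le> s\<^sup>2 * A - 2 * s * t * B + t\<^sup>2 * C" for s t
  proof -
    have "0 \<le> (\<integral>x. (norm (s *\<^sub>R f x - t *\<^sub>R g x))\<^sup>2 \<partial>?M)" by simp
    also have "(\<lambda>x. (norm (s *\<^sub>R f x - t *\<^sub>R g x))\<^sup>2) =
        (\<lambda>x. s\<^sup>2 * (norm (f x))\<^sup>2 - 2 * s * t * (f x \<bullet> g x) + t\<^sup>2 * (norm (g x))\<^sup>2)"
      by (rule ext) (simp add: power2_norm_eq_inner inner_diff_left inner_diff_right inner_commute
          algebra_simps, simp add: power2_eq_square)
    also have "(\<integral>x. s\<^sup>2 * (norm (f x))\<^sup>2 - 2 * s * t * (f x \<bullet> g x) + t\<^sup>2 * (norm (g x))\<^sup>2 \<partial>?M) =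
        s\<^sup>2 * A - 2 * s * t * B + t\<^sup>2 * C"
      using int by (simp add: A_def B_def C_def)
    finally show ?thesis .
  qed
  have A0: "A \<ge> 0" and C0: "C \<ge> 0" by (auto simp: A_def C_def)
  show ?thesis
  proof (cases "C = 0")
    case True
    have "B = 0"
    proof (rule ccontr)
      assume "B \<noteq> 0"
      \<comment> \<open>If \<open>C = 0\<close>, the form is affine in \<open>t\<close>; this
        \<open>t\<close> gives it the value \<open>-1\<close>.\<close>
      have "0 \<le> A - 2 * ((A + 1) / (2 * B)) * B" using q[of 1 "(A + 1) / (2 * B)"] True by simp
      also have "\<dots> = - 1" using \<open>B \<noteq> 0\<close> by (simp add: field_simps)
      finally show False by simp
    qed
    with True show ?thesis by (simp add: A_def B_def C_def)
  next
    case False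
    have "0 \<le> C\<^sup>2 * A - 2 * C * B * B + B\<^sup>2 * C" using q[of C B] by simp
    also have "\<dots> = C * (A * C - B\<^sup>2)" by (simp add: power2_eq_square algebra_simps)
    finally have "0 \<le> A * C - B\<^sup>2" using False C0 by (simp add: zero_le_mult_iff)
    then show ?thesis by (simp add: A_def B_def C_def)
  qed
qed

definition L2_tendsto ::
  "'a::euclidean_space set \<Rightarrow> (nat \<Rightarrow> 'a \<Rightarrow> 'b::euclidean_space) \<Rightarrow> ('a \<Rightarrow> 'b) \<Rightarrow> bool" where
  "L2_tendsto \<Omega> F f \<longleftrightarrow> (\<lambda>n. \<integral>x. (norm (F n x - f x))\<^sup>2 \<partial>lebesgue_on \<Omega>) \<longlonglongrightarrow> 0"

lemma norm_add_sq_le: "(norm (a + b))\<^sup>2 \<le> 2 * (norm a)\<^sup>2 + 2 * (norm b)\<^sup>2"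
  for a b :: "'b::real_inner"
proof -
  have "(norm (a + b))\<^sup>2 + (norm (a - b))\<^sup>2 = 2 * (norm a)\<^sup>2 + 2 * (norm b)\<^sup>2"
    by (simp add: power2_norm_eq_inner inner_diff_left inner_diff_right inner_add_left
        inner_add_right inner_commute)
  moreover have "0 \<le> (norm (a - b))\<^sup>2" by simp
  ultimately show ?thesis by linarith
qed

lemma L2_norm_add_le:
  assumes "f \<in> L2 \<Omega>" "g \<in> L2 \<Omega>"
  shows "(\<integral>x. (norm (f x + g x))\<^sup>2 \<partial>lebesgue_on \<Omega>) \<le>
    2 * (\<integral>x. (norm (f x))\<^sup>2 \<partial>lebesgue_on \<Omega>) + 2 * (\<integral>x. (norm (g x))\<^sup>2 \<partial>lebesgue_on \<Omega>)"
proof -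
  have "(\<integral>x. (norm (f x + g x))\<^sup>2 \<partial>lebesgue_on \<Omega>) \<le>
     (\<integral>x. 2 * (norm (f x))\<^sup>2 + 2 * (norm (g x))\<^sup>2 \<partial>lebesgue_on \<Omega>)"
    using assms L2_add[OF assms]
    by (intro integral_mono) (auto simp: L2_iff norm_add_sq_le)
  also have "\<dots> = 2 * (\<integral>x. (norm (f x))\<^sup>2 \<partial>lebesgue_on \<Omega>) + 2 * (\<integral>x. (norm (g x))\<^sup>2 \<partial>lebesgue_on \<Omega>)"
    using assms by (auto simp: L2_iff)
  finally show ?thesis .
qed

lemma L2_tendsto_add:
  assumes F: "L2_tendsto \<Omega> F f" and G: "L2_tendsto \<Omega> G g"
    and L2: "\<And>n. F n \<in> L2 \<Omega>" "\<And>n. G n \<in> L2 \<Omega>" "f \<in> L2 \<Omega>" "g \<in> L2 \<Omega>"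
  shows "L2_tendsto \<Omega> (\<lambda>n x. F n x + G n x) (\<lambda>x. f x + g x)"
  unfolding L2_tendsto_def
proof (rule tendsto_sandwich[OF _ _ tendsto_const])
  show "(\<lambda>n. 2 * (\<integral>x. (norm (F n x - f x))\<^sup>2 \<partial>lebesgue_on \<Omega>) +
      2 * (\<integral>x. (norm (G n x - g x))\<^sup>2 \<partial>lebesgue_on \<Omega>)) \<longlonglongrightarrow> 0"
    using tendsto_add[OF tendsto_mult_left[OF F[unfolded L2_tendsto_def], of 2]
        tendsto_mult_left[OF G[unfolded L2_tendsto_def], of 2]] by simp
  show "\<forall>\<^sub>F n in sequentially. (\<integral>x. (norm (F n x + G n x - (f x + g x)))\<^sup>2 \<partial>lebesgue_on \<Omega>) \<le>
     2 * (\<integral>x. (norm (F n x - f x))\<^sup>2 \<partial>lebesgue_on \<Omega>) +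
      2 * (\<integral>x. (norm (G n x - g x))\<^sup>2 \<partial>lebesgue_on \<Omega>)"
  proof (rule always_eventually, rule allI)
    fix n
    show "(\<integral>x. (norm (F n x + G n x - (f x + g x)))\<^sup>2 \<partial>lebesgue_on \<Omega>) \<le>
     2 * (\<integral>x. (norm (F n x - f x))\<^sup>2 \<partial>lebesgue_on \<Omega>) +
      2 * (\<integral>x. (norm (G n x - g x))\<^sup>2 \<partial>lebesgue_on \<Omega>)"
      using L2_norm_add_le[OF L2_diff[OF L2(1) L2(3)] L2_diff[OF L2(2) L2(4)], of n n]
      by (simp only: add_diff_add)
  qed
qed auto

lemma L2_tendsto_scaleR:
  assumes F: "L2_tendsto \<Omega> F f"
  shows "L2_tendsto \<Omega> (\<lambda>n x. c *\<^sub>R F n x) (\<lambda>x. c *\<^sub>R f x)"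
proof -
  have "(norm (c *\<^sub>R F n x - c *\<^sub>R f x))\<^sup>2 = c\<^sup>2 * (norm (F n x - f x))\<^sup>2" for n x
    by (simp flip: scaleR_right_diff_distrib add: power_mult_distrib)
  then show ?thesis
    using tendsto_mult_left[OF F[unfolded L2_tendsto_def], of "c\<^sup>2"]
    unfolding L2_tendsto_def by simp
qed

lemma L2_tendsto_const: "L2_tendsto \<Omega> (\<lambda>n. f) f"
  by (simp add: L2_tendsto_def)

lemma L2_tendsto_inner:
  fixes F G :: "nat \<Rightarrow> 'a::euclidean_space \<Rightarrow> 'b::euclidean_space"
  assumes F: "L2_tendsto \<Omega> F f" and G: "L2_tendsto \<Omega> G g"
    and L2: "\<And>n. F n \<in> L2 \<Omega>" "\<And>n. G n \<in> L2 \<Omega>" "f \<in> L2 \<Omega>" "g \<in> L2 \<Omega>"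
  shows "(\<lambda>n. \<integral>x. F n x \<bullet> G n x \<partial>lebesgue_on \<Omega>) \<longlonglongrightarrow> (\<integral>x. f x \<bullet> g x \<partial>lebesgue_on \<Omega>)"
proof -
  let ?M = "lebesgue_on \<Omega>"
  \<comment> \<open>By Cauchy-Schwarz an inner product tends to 0 as soon as the product of the
    squared norms does. This covers the three cross terms of the expansion around the
    limits.\<close>
  have z: "(\<lambda>n. \<integral>x. P n x \<bullet> Q n x \<partial>?M) \<longlonglongrightarrow> 0"
    if P: "\<And>n. P n \<in> L2 \<Omega>" and Q: "\<And>n. Q n \<in> L2 \<Omega>"
      and lim: "(\<lambda>n. (\<integral>x. (norm (P n x))\<^sup>2 \<partial>?M) * (\<integral>x. (norm (Q n x))\<^sup>2 \<partial>?M)) \<longlonglongrightarrow> 0"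
    for P Q :: "nat \<Rightarrow> 'a \<Rightarrow> 'b"
  proof -
    have "(\<lambda>n. (\<integral>x. P n x \<bullet> Q n x \<partial>?M)\<^sup>2) \<longlonglongrightarrow> 0"
      by (rule tendsto_sandwich[OF _ _ tendsto_const lim])
        (auto intro!: always_eventually L2_Cauchy_Schwarz P Q)
    from tendsto_real_sqrt[OF this] show ?thesis
      by (simp add: tendsto_rabs_zero_iff)
  qed
  have 1: "(\<lambda>n. \<integral>x. (F n x - f x) \<bullet> (G n x - g x) \<partial>?M) \<longlonglongrightarrow> 0"
    using tendsto_mult[OF F[unfolded L2_tendsto_def] G[unfolded L2_tendsto_def]]
    by (intro z L2_diff L2) auto
  have 2: "(\<lambda>n. \<integral>x. f x \<bullet> (G n x - g x) \<partial>?M) \<longlonglongrightarrow> 0"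
    using tendsto_mult[OF tendsto_const G[unfolded L2_tendsto_def]]
    by (intro z L2_diff L2) auto
  have 3: "(\<lambda>n. \<integral>x. (F n x - f x) \<bullet> g x \<partial>?M) \<longlonglongrightarrow> 0"
    using tendsto_mult[OF F[unfolded L2_tendsto_def] tendsto_const]
    by (intro z L2_diff L2) auto
  have "(\<integral>x. F n x \<bullet> G n x \<partial>?M) = (\<integral>x. (F n x - f x) \<bullet> (G n x - g x) \<partial>?M) +
      (\<integral>x. f x \<bullet> (G n x - g x) \<partial>?M) + (\<integral>x. (F n x - f x) \<bullet> g x \<partial>?M) + (\<integral>x. f x \<bullet> g x \<partial>?M)" for n
  proof -
    have "(\<integral>x. F n x \<bullet> G n x \<partial>?M) = (\<integral>x. (F n x - f x) \<bullet> (G n x - g x) +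
      f x \<bullet> (G n x - g x) + (F n x - f x) \<bullet> g x + f x \<bullet> g x \<partial>?M)"
      by (rule Bochner_Integration.integral_cong) (auto simp: inner_diff_left inner_diff_right)
    also have "\<dots> = (\<integral>x. (F n x - f x) \<bullet> (G n x - g x) \<partial>?M) +
      (\<integral>x. f x \<bullet> (G n x - g x) \<partial>?M) + (\<integral>x. (F n x - f x) \<bullet> g x \<partial>?M) + (\<integral>x. f x \<bullet> g x \<partial>?M)"
      by (simp add: L2_inner_integrable L2_diff L2)
    finally show ?thesis .
  qed
  then show ?thesis
    using tendsto_add[OF tendsto_add[OF tendsto_add[OF 1 2] 3] tendsto_const[of "\<integral>x. f x \<bullet> g x \<partial>?M"]]
    by simp
qed

lemma L2_norm_zero_iff:
  assumes "f \<in> L2 \<Omega>"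
  shows "(\<integral>x. (norm (f x))\<^sup>2 \<partial>lebesgue_on \<Omega>) = 0 \<longleftrightarrow> (AE x in lebesgue_on \<Omega>. f x = 0)"
  using assms by (subst integral_nonneg_eq_0_iff_AE) (auto simp: L2_iff)

lemma L2_nn_integral:
  assumes "f \<in> L2 \<Omega>"
  shows "(\<integral>\<^sup>+x. ennreal ((norm (f x))\<^sup>2) \<partial>lebesgue_on \<Omega>) =
    ennreal (\<integral>x. (norm (f x))\<^sup>2 \<partial>lebesgue_on \<Omega>)"
  using assms by (intro nn_integral_eq_integral) (auto simp: L2_iff)

section \<open>Completeness of the space of square integrable functions\<close>

text \<open>The increments are \<open>O(2 ^ (- k))\<close> and hence summable. The hypothesis is
  what finiteness of a weighted series of squared increments yields at a single point.\<close>

lemma convergent_of_weighted_differences: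
  fixes X :: "nat \<Rightarrow> 'b::banach"
  assumes "\<And>k. 4 ^ k * (norm (X (Suc k) - X k))\<^sup>2 \<le> C"
  shows "convergent X"
proof -
  have C0: "0 \<le> C" using order_trans[OF zero_le_power2 assms[of 0, simplified]] .
  have b: "norm (X (Suc k) - X k) \<le> sqrt C * (1/2) ^ k" for k
  proof -
    have "(norm (X (Suc k) - X k))\<^sup>2 \<le> C * (1/4) ^ k"
      using assms[of k] by (simp add: power_divide field_simps)
    also have "\<dots> = (sqrt C * (1/2) ^ k)\<^sup>2"
    proof -
      have "((1/4::real)) ^ k = (1/2) ^ k * (1/2) ^ k"
        by (simp flip: power_mult_distrib)
      then show ?thesis using C0 by (simp add: power2_eq_square)
    qed
    finally show ?thesis by (rule power2_le_imp_le) (use C0 in simp)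
  qed
  have "summable (\<lambda>k. X (Suc k) - X k)"
    by (rule summable_comparison_test'[of "\<lambda>k. sqrt C * (1/2) ^ k" 0])
      (use b in \<open>auto intro!: summable_mult\<close>)
  then have "convergent (\<lambda>n. \<Sum>k<n. X (Suc k) - X k)"
    by (simp add: summable_iff_convergent)
  then have "convergent (\<lambda>n. X n - X 0)" by (simp add: sum_lessThan_telescope)
  then obtain L where "(\<lambda>n. X n - X 0) \<longlonglongrightarrow> L" by (auto simp: convergent_def)
  from tendsto_add[OF this tendsto_const[of "X 0"]] show ?thesis
    by (auto simp: convergent_def)
qed

text \<open>Riesz-Fischer: a rapidly converging subsequence converges almost everywhere, and Fatou's
  lemma transfers the Cauchy bounds to the pointwise limit.\<close>

lemma L2_complete:
  fixes F :: "nat \<Rightarrow> 'a::euclidean_space \<Rightarrow> 'b::euclidean_space"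
  assumes F: "\<And>n. F n \<in> L2 \<Omega>"
    and Cauchy: "\<And>e. e > 0 \<Longrightarrow> \<exists>N. \<forall>m\<ge>N. \<forall>n\<ge>N. (\<integral>x. (norm (F m x - F n x))\<^sup>2 \<partial>lebesgue_on \<Omega>) < e"
  obtains f where "f \<in> L2 \<Omega>" "L2_tendsto \<Omega> F f"
proof -
  let ?M = "lebesgue_on \<Omega>"
  have [measurable]: "F n \<in> borel_measurable ?M" for n using F by (auto simp: L2_iff)
  \<comment> \<open>The rate \<open>(1/8) ^ k\<close> beats the weight \<open>4 ^ k\<close> in
    \<open>D\<close> below, so that the weighted integrals are at most
    \<open>(1/2) ^ k\<close>.\<close>
  have "\<exists>N. \<forall>m\<ge>N. \<forall>n\<ge>N. (\<integral>x. (norm (F m x - F n x))\<^sup>2 \<partial>?M) < (1/8) ^ k" for k :: nat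
    by (rule Cauchy) simp
  then obtain N where N: "\<And>k m n. m \<ge> N k \<Longrightarrow> n \<ge> N k \<Longrightarrow>
      (\<integral>x. (norm (F m x - F n x))\<^sup>2 \<partial>?M) < (1/8) ^ k" by metis
  \<comment> \<open>Partial sums make the index monotone and at least \<open>N k\<close>; the
    summand \<open>k\<close> drives it to infinity.\<close>
  define r where "r k = (\<Sum>i\<le>k. N i) + k" for k
  have rN: "r k \<ge> N k" for k
    unfolding r_def using member_le_sum[of k "{..k}" N] by simp
  have rmono: "r k \<le> r (Suc k)" for k by (simp add: r_def)
  have rk: "r k \<ge> k" for k by (simp add: r_def)
  define D where "D k x = 4 ^ k * (norm (F (r (Suc k)) x - F (r k) x))\<^sup>2" for k x
  have D0: "D k x \<ge> 0" for k x by (simp add: D_def)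
  have [measurable]: "D k \<in> borel_measurable ?M" for k unfolding D_def by measurable
  have Dint: "(\<integral>\<^sup>+x. ennreal (D k x) \<partial>?M) \<le> ennreal ((1/2) ^ k)" for k
  proof -
    have "(\<integral>\<^sup>+x. ennreal (D k x) \<partial>?M) =
        ennreal (4 ^ k) * (\<integral>\<^sup>+x. ennreal ((norm (F (r (Suc k)) x - F (r k) x))\<^sup>2) \<partial>?M)"
      unfolding D_def by (subst nn_integral_cmult[symmetric]) (auto simp: ennreal_mult)
    also have "\<dots> = ennreal (4 ^ k * (\<integral>x. (norm (F (r (Suc k)) x - F (r k) x))\<^sup>2 \<partial>?M))"
      by (subst L2_nn_integral[OF L2_diff[OF F F]]) (simp add: ennreal_mult)
    also have "\<dots> \<le> ennreal (4 ^ k * (1/8) ^ k)"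
      using N[of k "r (Suc k)" "r k"] rN[of k] rmono[of k]
      by (intro ennreal_leI mult_left_mono) auto
    also have "(4::real) ^ k * (1/8) ^ k = (1/2) ^ k"
      by (simp flip: power_mult_distrib)
    finally show ?thesis .
  qed
  have "(\<integral>\<^sup>+x. (\<Sum>k. ennreal (D k x)) \<partial>?M) = (\<Sum>k. \<integral>\<^sup>+x. ennreal (D k x) \<partial>?M)"
    by (intro nn_integral_suminf) auto
  also have "\<dots> \<le> (\<Sum>k. ennreal ((1/2) ^ k))"
    by (intro suminf_le Dint) auto
  also have "\<dots> = ennreal (\<Sum>k. (1/2) ^ k)"
    by (intro suminf_ennreal2) auto
  also have "\<dots> < \<infinity>" by simp
  finally have "AE x in ?M. (\<Sum>k. ennreal (D k x)) \<noteq> \<infinity>"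
    by (intro nn_integral_PInf_AE) auto
  moreover have "convergent (\<lambda>k. F (r k) x)" if fin: "(\<Sum>k. ennreal (D k x)) \<noteq> \<infinity>" for x
  proof (rule convergent_of_weighted_differences)
    fix k
    have "ennreal (D k x) \<le> (\<Sum>k. ennreal (D k x))"
      using sum_le_suminf[of "\<lambda>k. ennreal (D k x)" "{k}"] by simp
    from enn2real_mono[OF this] fin have "D k x \<le> enn2real (\<Sum>k. ennreal (D k x))"
      by (simp only: enn2real_ennreal[OF D0] less_top infinity_ennreal_def simp_thms)
    then show "4 ^ k * (norm (F (r (Suc k)) x - F (r k) x))\<^sup>2 \<le> enn2real (\<Sum>k. ennreal (D k x))"
      unfolding D_def .
  qed
  ultimately have conv: "AE x in ?M. convergent (\<lambda>k. F (r k) x)" by auto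
  define f where "f x = lim (\<lambda>k. F (r k) x)" for x
  have fm [measurable]: "f \<in> borel_measurable ?M"
    unfolding f_def by (rule borel_measurable_lim_metric) auto
  \<comment> \<open>Fatou's lemma along the subsequence: the Cauchy bound for
    \<open>F n - F (r k)\<close> survives the limit in \<open>k\<close>. It controls every late
    \<open>F n\<close>, not only the members of the subsequence.\<close>
  have bound: "(\<integral>\<^sup>+x. ennreal ((norm (F n x - f x))\<^sup>2) \<partial>?M) \<le> ennreal e"
    if e: "e > 0" and n: "n \<ge> N'" and N': "\<forall>m\<ge>N'. \<forall>n\<ge>N'. (\<integral>x. (norm (F m x - F n x))\<^sup>2 \<partial>?M) < e"
    for e n N'
  proof -
    have "(\<integral>\<^sup>+x. ennreal ((norm (F n x - f x))\<^sup>2) \<partial>?M) =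
        (\<integral>\<^sup>+x. liminf (\<lambda>k. ennreal ((norm (F n x - F (r k) x))\<^sup>2)) \<partial>?M)"
    proof (rule nn_integral_cong_AE)
      show "AE x in ?M. ennreal ((norm (F n x - f x))\<^sup>2) =
        liminf (\<lambda>k. ennreal ((norm (F n x - F (r k) x))\<^sup>2))"
        using conv
      proof eventually_elim
        case (elim x)
        then have "(\<lambda>k. F (r k) x) \<longlonglongrightarrow> f x" by (simp add: f_def convergent_LIMSEQ_iff)
        then have "(\<lambda>k. ennreal ((norm (F n x - F (r k) x))\<^sup>2)) \<longlonglongrightarrow> ennreal ((norm (F n x - f x))\<^sup>2)"
          by (intro tendsto_ennrealI tendsto_intros)
        then show ?case by (rule lim_imp_Liminf[OF trivial_limit_sequentially, symmetric])
      qed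
    qed
    also have "\<dots> \<le> liminf (\<lambda>k. \<integral>\<^sup>+x. ennreal ((norm (F n x - F (r k) x))\<^sup>2) \<partial>?M)"
      by (rule nn_integral_liminf) auto
    also have "\<dots> \<le> liminf (\<lambda>k. ennreal e)"
    proof (rule Liminf_mono)
      show "\<forall>\<^sub>F k in sequentially. (\<integral>\<^sup>+x. ennreal ((norm (F n x - F (r k) x))\<^sup>2) \<partial>?M) \<le> ennreal e"
        using eventually_ge_at_top[of N']
      proof eventually_elim
        case (elim k)
        then have "r k \<ge> N'" using rk[of k] by simp
        then show ?case
          using N'[rule_format, OF n \<open>r k \<ge> N'\<close>]
          by (subst L2_nn_integral[OF L2_diff[OF F F]]) (rule ennreal_leI, rule less_imp_le)
      qed
    qed
    also have "\<dots> = ennreal e" by (rule Liminf_const) simp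
    finally show ?thesis .
  qed
  have L2d: "(\<lambda>x. F n x - f x) \<in> L2 \<Omega>"
    if e: "e > 0" and n: "n \<ge> N'" and N': "\<forall>m\<ge>N'. \<forall>n\<ge>N'. (\<integral>x. (norm (F m x - F n x))\<^sup>2 \<partial>?M) < e"
    for e n N'
  proof -
    have "(\<integral>\<^sup>+x. ennreal ((norm (F n x - f x))\<^sup>2) \<partial>?M) < \<infinity>"
      using order_le_less_trans[OF bound[OF that] ennreal_less_top] by simp
    then have "integrable ?M (\<lambda>x. (norm (F n x - f x))\<^sup>2)"
      by (intro integrableI_bounded) simp_all
    then show ?thesis by (simp add: L2_iff)
  qed
  obtain N1 where N1: "\<forall>m\<ge>N1. \<forall>n\<ge>N1. (\<integral>x. (norm (F m x - F n x))\<^sup>2 \<partial>?M) < 1"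
    using Cauchy[of 1] by auto
  have fL: "f \<in> L2 \<Omega>"
    using L2_diff[OF F[of N1] L2d[OF _ _ N1, of N1]] by simp
  have "L2_tendsto \<Omega> F f"
    unfolding L2_tendsto_def
  proof (rule LIMSEQ_I)
    fix e :: real assume "e > 0"
    then obtain N' where N': "\<forall>m\<ge>N'. \<forall>n\<ge>N'. (\<integral>x. (norm (F m x - F n x))\<^sup>2 \<partial>?M) < e / 2"
      using Cauchy[of "e / 2"] by auto
    show "\<exists>no. \<forall>n\<ge>no. norm ((\<integral>x. (norm (F n x - f x))\<^sup>2 \<partial>?M) - 0) < e"
    proof (intro exI allI impI)
      fix n assume "n \<ge> N'"
      have "ennreal (\<integral>x. (norm (F n x - f x))\<^sup>2 \<partial>?M) \<le> ennreal (e / 2)"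
        using bound[OF _ \<open>n \<ge> N'\<close> N'] \<open>e > 0\<close> L2_nn_integral[OF L2_diff[OF F fL]] by simp
      then have "(\<integral>x. (norm (F n x - f x))\<^sup>2 \<partial>?M) \<le> e / 2"
        using \<open>e > 0\<close> by (simp add: ennreal_le_iff)
      then show "norm ((\<integral>x. (norm (F n x - f x))\<^sup>2 \<partial>?M) - 0) < e"
        using \<open>e > 0\<close> by simp
    qed
  qed
  with fL show ?thesis by (rule that)
qed

section \<open>Gradients and smooth cut-offs\<close>

lemma grad_inner_Basis:
  assumes "b \<in> Basis"
  shows "grad f x \<bullet> b = frechet_derivative f (at x) b"
  using assms by (simp add: grad_def inner_sum_left inner_Basis if_distrib sum.delta' cong: if_cong)

lemma has_derivative_grad:
  assumes "f differentiable (at x)"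
  shows "(f has_derivative (\<lambda>h. grad f x \<bullet> h)) (at x)"
proof -
  let ?D = "frechet_derivative f (at x)"
  have D: "(f has_derivative ?D) (at x)" using assms by (simp add: frechet_derivative_works)
  then interpret bounded_linear ?D by (rule has_derivative_bounded_linear)
  have "?D h = grad f x \<bullet> h" for h
  proof -
    have "?D h = ?D (\<Sum>b\<in>Basis. (h \<bullet> b) *\<^sub>R b)" by (simp add: euclidean_representation)
    also have "\<dots> = (\<Sum>b\<in>Basis. (h \<bullet> b) * (grad f x \<bullet> b))"
      by (simp add: sum scaleR grad_inner_Basis)
    also have "\<dots> = grad f x \<bullet> h"
      by (subst euclidean_inner[of "grad f x" h]) (simp add: mult.commute)
    finally show ?thesis .
  qed
  with D show ?thesis by (metis (no_types, lifting) ext)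
qed

lemma grad_eqI:
  assumes "(f has_derivative (\<lambda>h. G \<bullet> h)) (at x)"
  shows "grad f x = G"
proof (rule euclidean_eqI)
  fix b :: 'a assume "b \<in> Basis"
  then show "grad f x \<bullet> b = G \<bullet> b"
    using frechet_derivative_at[OF assms] by (metis grad_inner_Basis)
qed

lemma C_diff_differentiable: "C_diff (Suc k) f \<Longrightarrow> f differentiable (at x)"
  by simp

lemma C_diff_Suc_imp: "C_diff (Suc k) f \<Longrightarrow> C_diff k f"
proof (induction k arbitrary: f)
  case 0
  then show ?case
    by (auto intro!: continuous_at_imp_continuous_on differentiable_imp_continuous_within)
next
  case (Suc k)
  then show ?case by (metis C_diff.simps(2))
qed

lemma C_diff_SucI:
  assumes "\<And>x. (f has_derivative (\<lambda>h. G x \<bullet> h)) (at x)"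
    and "\<And>b. b \<in> Basis \<Longrightarrow> C_diff k (\<lambda>x. G x \<bullet> b)"
  shows "C_diff (Suc k) f"
proof -
  have "grad f = G" using grad_eqI[OF assms(1)] by auto
  with assms show ?thesis by (auto simp: differentiable_def)
qed

lemma C_diff_const: "C_diff k (\<lambda>x. c)"
proof (induction k arbitrary: c)
  case (Suc k)
  show ?case
    by (rule C_diff_SucI[where G="\<lambda>x. 0"]) (use Suc in \<open>auto\<close>)
qed auto

lemma grad_add:
  assumes "f differentiable (at x)" "g differentiable (at x)"
  shows "grad (\<lambda>x. f x + g x) x = grad f x + grad g x"
  by (rule grad_eqI)
    (use has_derivative_add[OF has_derivative_grad[OF assms(1)] has_derivative_grad[OF assms(2)]]
      in \<open>simp add: inner_add_left\<close>)

lemma grad_mult: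
  assumes "f differentiable (at x)" "g differentiable (at x)"
  shows "grad (\<lambda>x. f x * g x) x = f x *\<^sub>R grad g x + g x *\<^sub>R grad f x"
  by (rule grad_eqI)
    (use has_derivative_mult[OF has_derivative_grad[OF assms(1)] has_derivative_grad[OF assms(2)]]
      in \<open>simp add: inner_add_left mult.commute\<close>)

lemma grad_cmult:
  assumes "f differentiable (at x)"
  shows "grad (\<lambda>x. c * f x) x = c *\<^sub>R grad f x"
  by (rule grad_eqI)
    (use has_derivative_mult_right[OF has_derivative_grad[OF assms(1)], of c] in simp)

lemma C_diff_add: "C_diff k f \<Longrightarrow> C_diff k g \<Longrightarrow> C_diff k (\<lambda>x. f x + g x)"
proof (induction k arbitrary: f g)
  case 0
  then show ?case by (auto intro: continuous_intros)
next
  case (Suc k)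
  then show ?case
    by (auto simp: grad_add inner_add_left)
qed

lemma C_diff_mult: "C_diff k f \<Longrightarrow> C_diff k g \<Longrightarrow> C_diff k (\<lambda>x. f x * g x)"
proof (induction k arbitrary: f g)
  case 0
  then show ?case by (auto intro: continuous_intros)
next
  case (Suc k)
  note [intro] = C_diff_Suc_imp[OF Suc.prems(1)] C_diff_Suc_imp[OF Suc.prems(2)]
  from Suc.prems show ?case
    by (auto simp: grad_mult inner_add_left intro!: C_diff_add Suc.IH)
qed

lemma C_diff_cmult: "C_diff k f \<Longrightarrow> C_diff k (\<lambda>x. c * f x)"
  by (rule C_diff_mult[OF C_diff_const])

lemma C_diff_prod:
  assumes "\<And>i. i \<in> I \<Longrightarrow> C_diff k (f i)"
  shows "C_diff k (\<lambda>x. \<Prod>i\<in>I. f i x)"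
proof (cases "finite I")
  case True
  then show ?thesis using assms
    by (induction I) (auto intro: C_diff_const C_diff_mult)
qed (auto intro: C_diff_const)

lemma C_diff_real_SucI:
  assumes "\<And>t. (f has_real_derivative f' t) (at t)" "C_diff k f'"
  shows "C_diff (Suc k) f"
  by (rule C_diff_SucI[where G=f'])
    (use assms in \<open>auto simp: has_field_derivative_def\<close>)

lemma C_diff_real_SucD:
  fixes f :: "real \<Rightarrow> real"
  assumes "C_diff (Suc k) f"
  shows "(f has_real_derivative grad f t) (at t)" "C_diff k (grad f)"
  using has_derivative_grad[of f t] assms by (auto simp: has_field_derivative_def)

lemma C_diff_compose_affine:
  fixes f :: "real \<Rightarrow> real" and v :: "'a::euclidean_space"
  assumes "C_diff k f"
  shows "C_diff k (\<lambda>x::'a. f (x \<bullet> v + c))"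
  using assms
proof (induction k arbitrary: f)
  case 0
  then show ?case
    by (auto intro!: continuous_intros continuous_on_compose2[of UNIV f])
next
  case (Suc k)
  show ?case
  proof (rule C_diff_SucI[where G="\<lambda>x. grad f (x \<bullet> v + c) *\<^sub>R v"])
    fix x :: 'a
    have "(f has_derivative (\<lambda>h. grad f (x \<bullet> v + c) * h)) (at (x \<bullet> v + c))"
      using C_diff_real_SucD(1)[OF Suc.prems] by (simp add: has_field_derivative_def)
    moreover have "((\<lambda>x. x \<bullet> v + c) has_derivative (\<lambda>h. h \<bullet> v)) (at x)"
      by (auto intro!: derivative_eq_intros)
    ultimately have "((\<lambda>x. f (x \<bullet> v + c)) has_derivative (\<lambda>h. grad f (x \<bullet> v + c) * (h \<bullet> v))) (at x)"
      by (rule has_derivative_compose[rotated])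
    then show "((\<lambda>x. f (x \<bullet> v + c)) has_derivative (\<lambda>h. (grad f (x \<bullet> v + c) *\<^sub>R v) \<bullet> h)) (at x)"
      by (simp add: inner_commute)
  next
    fix b :: 'a
    show "C_diff k (\<lambda>x. (grad f (x \<bullet> v + c) *\<^sub>R v) \<bullet> b)"
      using C_diff_mult[OF Suc.IH[OF C_diff_real_SucD(2)[OF Suc.prems]] C_diff_const] by simp
  qed
qed

lemma C_diff_inverse:
  assumes "C_diff k f" "\<And>x. f x \<noteq> 0"
  shows "C_diff k (\<lambda>x. 1 / f x)"
  using assms
proof (induction k arbitrary: f)
  case 0
  then show ?case by (auto intro!: continuous_intros)
next
  case (Suc k)
  show ?case
  proof (rule C_diff_SucI[where G="\<lambda>x. (- 1 * ((1 / f x) * (1 / f x))) *\<^sub>R grad f x"])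
    fix x
    have "(f has_derivative (\<lambda>h. grad f x \<bullet> h)) (at x)"
      using Suc.prems by (intro has_derivative_grad) auto
    from Deriv.has_derivative_inverse[OF Suc.prems(2) this]
    show "((\<lambda>x. 1 / f x) has_derivative (\<lambda>h. ((- 1 * ((1 / f x) * (1 / f x))) *\<^sub>R grad f x) \<bullet> h)) (at x)"
      by (simp add: inverse_eq_divide field_simps)
  next
    fix b :: 'a assume "b \<in> Basis"
    have "C_diff k (\<lambda>x. 1 / f x)" by (rule Suc.IH[OF C_diff_Suc_imp]) (use Suc.prems in auto)
    moreover have "C_diff k (\<lambda>x. grad f x \<bullet> b)" using Suc.prems \<open>b \<in> Basis\<close> by auto
    ultimately have "C_diff k (\<lambda>x. (- 1 * ((1 / f x) * (1 / f x))) * (grad f x \<bullet> b))"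
      by (intro C_diff_mult C_diff_cmult)
    then show "C_diff k (\<lambda>x. ((- 1 * ((1 / f x) * (1 / f x))) *\<^sub>R grad f x) \<bullet> b)"
      by simp
  qed
qed

lemma C_diff_sin_cos: "C_diff k (sin :: real \<Rightarrow> real)" "C_diff k (cos :: real \<Rightarrow> real)"
proof (induction k)
  case 0
  { case 1 show ?case by (auto intro: continuous_intros) next
    case 2 show ?case by (auto intro: continuous_intros) }
next
  case (Suc k)
  { case 1 show ?case by (rule C_diff_real_SucI[OF DERIV_sin Suc(2)]) next
    case 2
    have "C_diff k (\<lambda>x::real. - 1 * sin x)" by (rule C_diff_cmult[OF Suc(1)])
    then show ?case
      by (intro C_diff_real_SucI[of cos "\<lambda>x. - sin x"]) (auto intro!: derivative_eq_intros) }
qed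

section \<open>A smooth transition function\<close>

text \<open>The functions \<open>exp (- (1 / t)) / t ^ m\<close>, extended by 0. The derivative of
  each is a linear combination of others, so smoothness of all of them follows from one induction on
  the order.\<close>

definition flat_exp :: "nat \<Rightarrow> real \<Rightarrow> real" where
  "flat_exp m t = (if t \<le> 0 then 0 else exp (- (1 / t)) / t ^ m)"

lemma flat_exp_tendsto_0: "(flat_exp m \<longlongrightarrow> 0) (at 0)"
proof (rule filterlim_split_at)
  have "\<forall>\<^sub>F t in at_left (0::real). 0 = flat_exp m t"
    by (auto simp: flat_exp_def eventually_at_filter)
  then show "(flat_exp m \<longlongrightarrow> 0) (at_left 0)"
    by (rule Lim_transform_eventually[OF tendsto_const])
  have "((\<lambda>t::real. (1 / t) ^ m / exp (1 / t)) \<longlongrightarrow> 0) (at_right 0)"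
    using filterlim_compose[OF tendsto_power_div_exp_0[of m] filterlim_inverse_at_top_right]
    by (simp add: inverse_eq_divide)
  moreover have "\<forall>\<^sub>F t in at_right (0::real). (1 / t) ^ m / exp (1 / t) = flat_exp m t"
    by (auto simp: flat_exp_def eventually_at_filter exp_minus field_simps)
  ultimately show "(flat_exp m \<longlongrightarrow> 0) (at_right 0)"
    by (rule Lim_transform_eventually)
qed

lemma flat_exp_deriv:
  "(flat_exp m has_real_derivative flat_exp (m + 2) t - real m * flat_exp (m + 1) t) (at t)"
proof (cases t "0::real" rule: linorder_cases)
  case less
  have "((\<lambda>t. 0) has_real_derivative 0) (at t)" by simp
  then have "(flat_exp m has_real_derivative 0) (at t)"
    by (rule has_field_derivative_transform_within_open[of _ _ _ "{..<0}"])
      (use less in \<open>auto simp: flat_exp_def\<close>)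
  then show ?thesis using less by (simp add: flat_exp_def)
next
  case equal
  \<comment> \<open>Away from 0 the difference quotient at 0 is \<open>flat_exp (Suc m)\<close>,
    which tends to 0.\<close>
  have "((\<lambda>y. (flat_exp m y - flat_exp m 0) / (y - 0)) \<longlongrightarrow> 0) (at 0)"
    by (rule Lim_transform_eventually[OF flat_exp_tendsto_0[of "Suc m"]])
      (auto simp: flat_exp_def eventually_at_filter field_simps)
  then have "(flat_exp m has_real_derivative 0) (at 0)"
    by (simp add: has_field_derivative_iff)
  then show ?thesis using equal by (simp add: flat_exp_def)
next
  case greater
  have "((\<lambda>t. exp (- (1 / t)) / t ^ m) has_real_derivative
      (exp (- (1 / t)) * (1 / t\<^sup>2) * t ^ m - exp (- (1 / t)) * (real m * t ^ (m - 1))) / (t ^ m * t ^ m)) (at t)"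
    using greater by (auto intro!: derivative_eq_intros simp: power2_eq_square)
  also have "(exp (- (1 / t)) * (1 / t\<^sup>2) * t ^ m - exp (- (1 / t)) * (real m * t ^ (m - 1))) / (t ^ m * t ^ m) =
      flat_exp (m + 2) t - real m * flat_exp (m + 1) t"
    using greater by (cases m) (auto simp: flat_exp_def field_simps power2_eq_square)
  finally show ?thesis
    by (rule has_field_derivative_transform_within_open[of _ _ _ "{0<..}"])
      (use greater in \<open>auto simp: flat_exp_def\<close>)
qed

lemma C_diff_flat_exp: "C_diff k (flat_exp m)"
proof (induction k arbitrary: m)
  case 0
  show ?case
    using flat_exp_deriv by (auto intro!: continuous_at_imp_continuous_on DERIV_isCont)
next
  case (Suc k)
  have "C_diff k (\<lambda>t. flat_exp (m + 2) t + (- real m) * flat_exp (m + 1) t)"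
    by (intro C_diff_add C_diff_cmult Suc)
  then show ?case
    by (intro C_diff_real_SucI[OF flat_exp_deriv]) simp
qed

text \<open>With \<open>f = flat_exp 0\<close>, the quotient \<open>f t / (f t + f (1 - t))\<close>
  is smooth because at each \<open>t\<close> one of the two summands is positive. Its derivative
  vanishes outside the unit interval and is therefore bounded. The bound \<open>M\<close> and the
  vanishing beyond 1 are what the cut-off of sines near the faces of a cube requires.\<close>

lemma smooth_step:
  obtains h M where "\<forall>k. C_diff k (h :: real \<Rightarrow> real)" "\<forall>t\<le>0. h t = 0" "\<forall>t\<ge>1. h t = 1"
    "\<forall>t. 0 \<le> h t \<and> h t \<le> 1" "\<forall>t. \<bar>grad h t\<bar> \<le> M" "\<forall>t>1. grad h t = 0"
proof -
  define h where "h t = flat_exp 0 t * (1 / (flat_exp 0 t + flat_exp 0 (1 - t)))" for t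
  have nn: "flat_exp 0 t \<ge> 0" for t by (simp add: flat_exp_def)
  have pos: "flat_exp 0 t > 0" if "t > 0" for t using that by (simp add: flat_exp_def)
  have den: "flat_exp 0 t + flat_exp 0 (1 - t) > 0" for t
    using pos[of t] pos[of "1 - t"] nn[of t] nn[of "1 - t"] by (cases "t > 0") (auto intro: add_pos_nonneg add_nonneg_pos)
  have C: "C_diff k h" for k
    unfolding h_def
    using C_diff_compose_affine[OF C_diff_flat_exp[of k 0], of "-1::real" 1] den
    by (intro C_diff_mult C_diff_inverse C_diff_add C_diff_flat_exp) (auto simp: add.commute less_imp_neq[symmetric])
  have 0: "h t = 0" if "t \<le> 0" for t using that by (simp add: h_def flat_exp_def)
  have 1: "h t = 1" if "t \<ge> 1" for t using that by (simp add: h_def flat_exp_def)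
  have cont: "continuous_on UNIV (grad h)"
    using C_diff_real_SucD(2)[OF C[of "Suc 0"]] by simp
  have "compact (grad h ` {0..1})"
    by (intro compact_continuous_image continuous_on_subset[OF cont]) auto
  then obtain M where M: "\<forall>y\<in>grad h ` {0..1}. \<bar>y\<bar> \<le> M"
    by (metis bounded_real compact_imp_bounded)
  have g0: "grad h t = 0" if "t < 0 \<or> t > 1" for t
  proof -
    let ?S = "if t < 0 then {..<0::real} else {1<..}"
    have "(h has_real_derivative 0) (at t)"
      by (rule has_field_derivative_transform_within_open[of "\<lambda>s. if t < 0 then 0 else 1" _ _ ?S])
        (use that 0 1 in \<open>auto split: if_splits\<close>)
    then show ?thesis
      using DERIV_unique C_diff_real_SucD(1)[OF C] by blast
  qed
  have "0 \<le> M" using M by force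
  then have "\<bar>grad h t\<bar> \<le> M" for t
    using M g0[of t] by (cases "t < 0 \<or> t > 1") auto
  moreover have "0 \<le> h t" "h t \<le> 1" for t
    using nn[of t] nn[of "1 - t"] den[of t] by (auto simp: h_def divide_simps)
  ultimately show ?thesis using that[of h M] C 0 1 g0 by blast
qed

lemma test_functions_add:
  assumes "\<phi> \<in> test_functions \<Omega>" "\<psi> \<in> test_functions \<Omega>"
  shows "(\<lambda>x. \<phi> x + \<psi> x) \<in> test_functions \<Omega>"
proof -
  have "{x. \<phi> x + \<psi> x \<noteq> 0} \<subseteq> closure {x. \<phi> x \<noteq> 0} \<union> closure {x. \<psi> x \<noteq> 0}"
    using closure_subset[of "{x. \<phi> x \<noteq> 0}"] closure_subset[of "{x. \<psi> x \<noteq> 0}"] by force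
  then have sub: "closure {x. \<phi> x + \<psi> x \<noteq> 0} \<subseteq> closure {x. \<phi> x \<noteq> 0} \<union> closure {x. \<psi> x \<noteq> 0}"
    by (rule closure_minimal) auto
  have "compact (closure {x. \<phi> x \<noteq> 0} \<union> closure {x. \<psi> x \<noteq> 0})"
    using assms by (auto simp: test_functions_def)
  then have "compact (closure {x. \<phi> x + \<psi> x \<noteq> 0})"
    using sub by (meson closed_closure compact_eq_bounded_closed bounded_subset)
  then show ?thesis using assms sub
    by (auto simp: test_functions_def intro!: C_diff_add)
qed

lemma test_functions_cmult:
  assumes "\<phi> \<in> test_functions \<Omega>"
  shows "(\<lambda>x. c * \<phi> x) \<in> test_functions \<Omega>"
proof (cases "c = 0")
  case True
  then show ?thesis by (simp add: test_functions_def C_diff_const)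
next
  case False
  then show ?thesis using assms by (simp add: test_functions_def C_diff_cmult)
qed

lemma test_functions_C_diff: "\<phi> \<in> test_functions \<Omega> \<Longrightarrow> C_diff k \<phi>"
  by (simp add: test_functions_def)

lemma test_functions_differentiable: "\<phi> \<in> test_functions \<Omega> \<Longrightarrow> \<phi> differentiable (at x)"
  using test_functions_C_diff[of \<phi> \<Omega> "Suc 0"] by simp

lemma continuous_on_grad:
  assumes "C_diff (Suc k) f"
  shows "continuous_on UNIV (grad f)"
proof -
  have "C_diff k (\<lambda>x. grad f x \<bullet> b)" if "b \<in> Basis" for b using assms that by simp
  then have "continuous_on UNIV (\<lambda>x. grad f x \<bullet> b)" if "b \<in> Basis" for b
    using that by (induction k) (auto dest: C_diff_Suc_imp simp del: C_diff.simps(2))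
  then show ?thesis by (rule continuous_on_componentwise[THEN iffD2, rule_format])
qed

lemma C_diff_continuous: "C_diff k f \<Longrightarrow> continuous_on UNIV f"
  by (induction k) (auto dest: C_diff_Suc_imp simp del: C_diff.simps(2))

lemma grad_eq_0_outside:
  assumes "x \<notin> closure {x. f x \<noteq> 0}"
  shows "grad f x = 0"
proof (rule grad_eqI)
  have "((\<lambda>x. 0) has_derivative (\<lambda>h. 0 \<bullet> h)) (at x)" by simp
  then show "(f has_derivative (\<lambda>h. 0 \<bullet> h)) (at x)"
    by (rule has_derivative_transform_within_open[of _ _ _ _ "- closure {x. f x \<noteq> 0}"])
      (use assms closure_subset[of "{x. f x \<noteq> 0}"] in auto)
qed

text \<open>Translation invariance of the integral, applied to difference quotients.\<close>

lemma integral_directional_derivative_eq_0: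
  fixes F G :: "'a::euclidean_space \<Rightarrow> real"
  assumes F [measurable]: "F \<in> borel_measurable borel" and G [measurable]: "G \<in> borel_measurable borel"
    and supp: "\<And>x. norm x > R \<Longrightarrow> F x = 0" and bd: "\<And>x. \<bar>F x\<bar> \<le> M"
    and lip: "\<And>x h. \<bar>F (x + h *\<^sub>R b) - F x\<bar> \<le> M * \<bar>h\<bar>"
    and lim: "AE x in lborel. ((\<lambda>h. (F (x + h *\<^sub>R b) - F x) / h) \<longlongrightarrow> G x) (at 0)"
  shows "integral\<^sup>L lborel G = 0"
proof -
  define h where "h n = 1 / real (Suc n)" for n
  have h: "h n > 0" "h n \<le> 1" for n by (auto simp: h_def)
  have h0: "h \<longlonglongrightarrow> 0" unfolding h_def by (rule LIMSEQ_Suc[OF lim_1_over_n])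
  then have hat: "filterlim h (at 0) sequentially"
    using h(1) by (auto simp: filterlim_at intro!: always_eventually) (metis less_irrefl)
  define q where "q n x = (F (x + h n *\<^sub>R b) - F x) / h n" for n x
  have M0: "M \<ge> 0" using bd[of 0] by simp
  have intF: "integrable lborel F"
  proof (rule integrableI_bounded_set[of "cball 0 R" _ _ M])
    show "AE x\<in>cball 0 R in lborel. norm (F x) \<le> M" using bd by auto
    show "emeasure lborel (cball (0::'a) R) < \<infinity>" by (rule emeasure_bounded_finite[OF bounded_cball])
  qed (use supp in auto)
  have tr: "integrable lborel (\<lambda>x. F (x + c))" "(\<integral>x. F (x + c) \<partial>lborel) = (\<integral>x. F x \<partial>lborel)" for c
  proof -
    have d: "lborel = distr lborel borel (\<lambda>x::'a. x + c)"
    proof -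
      have "(\<lambda>x::'a. x + c) = (+) c" by (auto simp: add.commute)
      then show ?thesis using lborel_distr_plus[of c] by simp
    qed
    show "integrable lborel (\<lambda>x. F (x + c))"
      using intF by (subst (asm) d) (simp add: integrable_distr_eq)
    show "(\<integral>x. F (x + c) \<partial>lborel) = (\<integral>x. F x \<partial>lborel)"
      by (subst (2) d) (simp add: integral_distr)
  qed
  \<comment> \<open>By translation invariance every difference quotient has integral 0.\<close>
  have q0: "integral\<^sup>L lborel (q n) = 0" for n
  proof -
    have "q n = (\<lambda>x. (F (x + h n *\<^sub>R b) - F x) / h n)" by (auto simp: q_def)
    then show ?thesis using tr[of "h n *\<^sub>R b"] intF by simp
  qed
  \<comment> \<open>The Lipschitz bound along \<open>b\<close> dominates all quotients by
    \<open>M\<close>, and as the steps are at most 1, they vanish outside the ball of radius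
    \<open>R + norm b\<close>.\<close>
  have "(\<lambda>n. integral\<^sup>L lborel (q n)) \<longlonglongrightarrow> integral\<^sup>L lborel G"
  proof (rule integral_dominated_convergence[where w="\<lambda>x. M * indicator (cball 0 (R + norm b)) x"])
    show "integrable lborel (\<lambda>x. M * indicator (cball (0::'a) (R + norm b)) x)"
      by (intro integrable_mult_right integrable_real_indicator)
        (simp_all add: emeasure_bounded_finite[OF bounded_cball, unfolded infinity_ennreal_def])
    show "AE x in lborel. (\<lambda>n. q n x) \<longlonglongrightarrow> G x"
      using lim by eventually_elim (auto simp: q_def intro: filterlim_compose[OF _ hat])
    show "AE x in lborel. norm (q n x) \<le> M * indicator (cball 0 (R + norm b)) x" for n
    proof (rule AE_I2)
      fix x
      show "norm (q n x) \<le> M * indicator (cball 0 (R + norm b)) x"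
      proof (cases "norm x \<le> R + norm b")
        case True
        have "\<bar>F (x + h n *\<^sub>R b) - F x\<bar> \<le> M * h n" using lip[of x "h n"] h(1)[of n] by simp
        then show ?thesis using True h(1)[of n] by (simp add: q_def abs_divide divide_le_eq)
      next
        case False
        have "norm (h n *\<^sub>R b) \<le> norm b" using h[of n] by (simp add: mult_left_le_one_le)
        moreover have "norm x \<le> norm (x + h n *\<^sub>R b) + norm (h n *\<^sub>R b)"
          by (metis add_diff_cancel norm_triangle_ineq4)
        ultimately have "norm (x + h n *\<^sub>R b) > R" "norm x > R"
          using False norm_ge_zero[of b] by linarith+
        then show ?thesis using M0 by (simp add: q_def supp)
      qed
    qed
    show "q n \<in> borel_measurable lborel" for n unfolding q_def by measurable
  qed auto
  then have "(\<lambda>n. 0) \<longlonglongrightarrow> integral\<^sup>L lborel G" by (simp add: q0)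
  then show ?thesis by (simp add: LIMSEQ_const_iff)
qed

lemma directional_derivative:
  assumes "f differentiable (at (x + t *\<^sub>R b))"
  shows "((\<lambda>t. f (x + t *\<^sub>R b)) has_real_derivative grad f (x + t *\<^sub>R b) \<bullet> b) (at t)"
proof -
  have "((\<lambda>t. x + t *\<^sub>R b) has_derivative (\<lambda>s. s *\<^sub>R b)) (at t)"
    by (auto intro!: derivative_eq_intros)
  from has_derivative_compose[OF this has_derivative_grad[OF assms]]
  show ?thesis by (simp add: has_field_derivative_def mult_commute_abs)
qed

lemma directional_quotient_tendsto:
  assumes "f differentiable (at x)"
  shows "((\<lambda>h. (f (x + h *\<^sub>R b) - f x) / h) \<longlongrightarrow> grad f x \<bullet> b) (at 0)"
  using directional_derivative[of f x 0 b] assms by (simp add: has_field_derivative_iff)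

text \<open>Mean value theorem along the segment. The condition \<open>s * h \<ge> 0\<close>
  restricts \<open>s\<close> to the side of \<open>h\<close>, so the gradient is bounded only
  between the two points; this matters when the bound holds on a box only.\<close>

lemma increment_le:
  assumes "\<And>x. f differentiable (at x)" "\<And>s. \<bar>s\<bar> \<le> \<bar>h\<bar> \<Longrightarrow> s * h \<ge> 0 \<Longrightarrow> \<bar>grad f (x + s *\<^sub>R b) \<bullet> b\<bar> \<le> M"
  shows "\<bar>f (x + h *\<^sub>R b) - f x\<bar> \<le> M * \<bar>h\<bar>"
proof (cases h "0::real" rule: linorder_cases)
  case less
  obtain z where z: "h < z" "z < 0" "f (x + 0 *\<^sub>R b) - f (x + h *\<^sub>R b) = (0 - h) * (grad f (x + z *\<^sub>R b) \<bullet> b)"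
    using MVT2[OF less, of "\<lambda>t. f (x + t *\<^sub>R b)" "\<lambda>t. grad f (x + t *\<^sub>R b) \<bullet> b"] directional_derivative[OF assms(1)] by blast
  have "\<bar>grad f (x + z *\<^sub>R b) \<bullet> b\<bar> \<le> M" using z by (intro assms(2)) (auto simp: mult_nonpos_nonpos)
  then have "\<bar>h\<bar> * \<bar>grad f (x + z *\<^sub>R b) \<bullet> b\<bar> \<le> \<bar>h\<bar> * M" by (intro mult_left_mono) auto
  moreover have "\<bar>f (x + h *\<^sub>R b) - f x\<bar> = \<bar>h\<bar> * \<bar>grad f (x + z *\<^sub>R b) \<bullet> b\<bar>"
    using z(3) by (simp add: abs_minus_commute[of "f (x + h *\<^sub>R b)"] abs_mult)
  ultimately show ?thesis by (simp add: mult.commute)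
next
  case greater
  obtain z where z: "0 < z" "z < h" "f (x + h *\<^sub>R b) - f (x + 0 *\<^sub>R b) = (h - 0) * (grad f (x + z *\<^sub>R b) \<bullet> b)"
    using MVT2[OF greater, of "\<lambda>t. f (x + t *\<^sub>R b)" "\<lambda>t. grad f (x + t *\<^sub>R b) \<bullet> b"] directional_derivative[OF assms(1)] by blast
  have "\<bar>grad f (x + z *\<^sub>R b) \<bullet> b\<bar> \<le> M" using z by (intro assms(2)) auto
  then have "\<bar>h\<bar> * \<bar>grad f (x + z *\<^sub>R b) \<bullet> b\<bar> \<le> \<bar>h\<bar> * M" by (intro mult_left_mono) auto
  moreover have "\<bar>f (x + h *\<^sub>R b) - f x\<bar> = \<bar>h\<bar> * \<bar>grad f (x + z *\<^sub>R b) \<bullet> b\<bar>"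
    using z(3) by (simp add: abs_mult)
  ultimately show ?thesis by (simp add: mult.commute)
qed auto

lemma borel_measurable_grad [measurable]:
  "C_diff (Suc k) f \<Longrightarrow> grad f \<in> borel_measurable borel"
  by (intro borel_measurable_continuous_onI continuous_on_grad)

lemma integral_grad_compact_support:
  fixes f :: "'a::euclidean_space \<Rightarrow> real"
  assumes C: "C_diff (Suc 0) f" and K: "compact (closure {x. f x \<noteq> 0})"
  shows "(\<integral>x. grad f x \<bullet> b \<partial>lborel) = 0"
proof -
  let ?K = "closure {x. f x \<noteq> 0}"
  have out: "f x = 0" "grad f x = 0" if "x \<notin> ?K" for x
    using that closure_subset[of "{x. f x \<noteq> 0}"] grad_eq_0_outside[OF that] by auto
  obtain R where R: "\<And>x. x \<in> ?K \<Longrightarrow> norm x \<le> R"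
    using K by (meson bounded_iff compact_imp_bounded)
  have "compact (f ` ?K)"
    by (intro compact_continuous_image K continuous_on_subset[OF C_diff_continuous[OF C]]) auto
  then obtain M1 where M1: "\<And>x. x \<in> ?K \<Longrightarrow> \<bar>f x\<bar> \<le> M1"
    by (metis bounded_real compact_imp_bounded imageI)
  have "compact ((\<lambda>x. grad f x \<bullet> b) ` ?K)"
    by (intro compact_continuous_image K continuous_on_subset[OF continuous_on_inner[OF continuous_on_grad[OF C] continuous_on_const]]) auto
  then obtain M2 where M2: "\<And>x. x \<in> ?K \<Longrightarrow> \<bar>grad f x \<bullet> b\<bar> \<le> M2"
    by (metis (mono_tags, lifting) bounded_real compact_imp_bounded imageI)
  define M where "M = \<bar>M1\<bar> + \<bar>M2\<bar>"
  have B: "\<bar>f x\<bar> \<le> M" "\<bar>grad f x \<bullet> b\<bar> \<le> M" for x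
    using M1[of x] M2[of x] out[of x] by (cases "x \<in> ?K"; force simp: M_def)+
  have [measurable]: "f \<in> borel_measurable borel" "grad f \<in> borel_measurable borel"
    using C_diff_continuous[OF C] borel_measurable_continuous_onI borel_measurable_grad[OF C] by auto
  show ?thesis
  proof (rule integral_directional_derivative_eq_0[where F=f and R=R and M=M and b=b])
    show "f x = 0" if "norm x > R" for x
      using R[of x] out(1)[of x] that by fastforce
    show "\<bar>f (x + h *\<^sub>R b) - f x\<bar> \<le> M * \<bar>h\<bar>" for x h
      by (rule increment_le) (use B C in auto)
    show "AE x in lborel. ((\<lambda>h. (f (x + h *\<^sub>R b) - f x) / h) \<longlongrightarrow> grad f x \<bullet> b) (at 0)"
      using C by (intro AE_I2 directional_quotient_tendsto) auto
  qed (use B in auto)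
qed

text \<open>Cut off to the box, \<open>f\<close> is still Lipschitz in direction \<open>b\<close>: a
  motion along \<open>b\<close> crosses no faces but the two orthogonal to \<open>b\<close>, and
  there \<open>f\<close> vanishes. Nothing is required on the other faces, which is why mixed
  products of sines and cosines can be used as test functions.\<close>

lemma integral_grad_box:
  fixes f :: "'a::euclidean_space \<Rightarrow> real"
  assumes C: "C_diff (Suc 0) f" and b: "b \<in> Basis"
    and face: "\<And>x. x \<in> cbox l u \<Longrightarrow> x \<bullet> b = l \<bullet> b \<or> x \<bullet> b = u \<bullet> b \<Longrightarrow> f x = 0"
  shows "(\<integral>x. indicator (cbox l u) x * (grad f x \<bullet> b) \<partial>lborel) = 0"
proof -
  let ?K = "cbox l u"
  have K: "compact ?K" by simp
  obtain R where R: "\<And>x. x \<in> ?K \<Longrightarrow> norm x \<le> R"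
    using K by (meson bounded_iff compact_imp_bounded)
  have "compact (f ` ?K)"
    by (intro compact_continuous_image K continuous_on_subset[OF C_diff_continuous[OF C]]) auto
  then obtain M1 where M1: "\<And>x. x \<in> ?K \<Longrightarrow> \<bar>f x\<bar> \<le> M1"
    by (metis bounded_real compact_imp_bounded imageI)
  have "compact ((\<lambda>x. grad f x \<bullet> b) ` ?K)"
    by (intro compact_continuous_image K continuous_on_subset[OF continuous_on_inner[OF continuous_on_grad[OF C] continuous_on_const]]) auto
  then obtain M2 where M2: "\<And>x. x \<in> ?K \<Longrightarrow> \<bar>grad f x \<bullet> b\<bar> \<le> M2"
    by (metis (mono_tags, lifting) bounded_real compact_imp_bounded imageI)
  define M where "M = \<bar>M1\<bar> + \<bar>M2\<bar>"
  have B: "\<bar>f x\<bar> \<le> M" "\<bar>grad f x \<bullet> b\<bar> \<le> M" if "x \<in> ?K" for x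
    using M1[of x] M2[of x] that by (force simp: M_def)+
  have M0: "M \<ge> 0" by (simp add: M_def)
  define F where "F x = indicator ?K x * f x" for x
  have [measurable]: "f \<in> borel_measurable borel" "grad f \<in> borel_measurable borel"
    using C_diff_continuous[OF C] borel_measurable_continuous_onI borel_measurable_grad[OF C] by auto
  have diff: "f differentiable (at x)" for x using C by simp
  have cx: "x + s *\<^sub>R b \<in> ?K" if "x \<in> ?K" "x + h *\<^sub>R b \<in> ?K" "\<bar>s\<bar> \<le> \<bar>h\<bar>" "s * h \<ge> 0" for x h s
  proof (cases "h = 0")
    case True with that show ?thesis by simp
  next
    case False
    have "x + s *\<^sub>R b = (1 - s / h) *\<^sub>R x + (s / h) *\<^sub>R (x + h *\<^sub>R b)"
      using False by (simp add: algebra_simps)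
    moreover have "0 \<le> s / h" using that(4) by (simp add: zero_le_divide_iff zero_le_mult_iff)
    moreover have "s / h \<le> 1" using that(3,4) False by (auto simp: divide_le_eq zero_le_mult_iff abs_if split: if_splits)
    ultimately show ?thesis
      using convexD_alt[OF convex_box(1) that(1,2), of "s / h"] by simp
  qed
  \<comment> \<open>A step that leaves the box passes through a zero of \<open>f\<close> on a face,
    so \<open>f x\<close> itself is bounded by the length of the step.\<close>
  have inout: "\<bar>f x\<bar> \<le> M * \<bar>h\<bar>" if x: "x \<in> ?K" and out: "x + h *\<^sub>R b \<notin> ?K" for x h
  proof -
    have other: "(x + s *\<^sub>R b) \<bullet> i = x \<bullet> i" if "i \<in> Basis" "i \<noteq> b" for i s
      using that b by (simp add: inner_add_left inner_Basis)
    have self: "(x + s *\<^sub>R b) \<bullet> b = x \<bullet> b + s" for s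
      using b by (simp add: inner_add_left)
    have inK: "x + s *\<^sub>R b \<in> ?K \<longleftrightarrow> l \<bullet> b \<le> x \<bullet> b + s \<and> x \<bullet> b + s \<le> u \<bullet> b" for s
    proof
      assume "x + s *\<^sub>R b \<in> ?K"
      then show "l \<bullet> b \<le> x \<bullet> b + s \<and> x \<bullet> b + s \<le> u \<bullet> b" using b self[of s] by (auto simp: mem_box)
    next
      assume s: "l \<bullet> b \<le> x \<bullet> b + s \<and> x \<bullet> b + s \<le> u \<bullet> b"
      have "l \<bullet> i \<le> (x + s *\<^sub>R b) \<bullet> i \<and> (x + s *\<^sub>R b) \<bullet> i \<le> u \<bullet> i" if "i \<in> Basis" for i
        using s x that other[OF that, of s] self[of s] by (cases "i = b") (auto simp: mem_box)
      then show "x + s *\<^sub>R b \<in> ?K" by (auto simp: mem_box)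
    qed
    have xb: "l \<bullet> b \<le> x \<bullet> b" "x \<bullet> b \<le> u \<bullet> b" using x b by (auto simp: mem_box)
    \<comment> \<open>\<open>x + s *\<^sub>R b\<close> is the point where the line meets the face
      ahead: the lower one if \<open>h < 0\<close>, otherwise the upper one.\<close>
    define s where "s = (if h < 0 then l \<bullet> b - x \<bullet> b else u \<bullet> b - x \<bullet> b)"
    have sh: "\<bar>s\<bar> \<le> \<bar>h\<bar>" and s0: "s * h \<ge> 0" and sK: "x + s *\<^sub>R b \<in> ?K"
      using out xb unfolding inK s_def by (auto simp: mult_nonpos_nonpos)
    have "f (x + s *\<^sub>R b) = 0"
      by (rule face[OF sK]) (auto simp: self s_def)
    moreover have "\<bar>f (x + s *\<^sub>R b) - f x\<bar> \<le> M * \<bar>s\<bar>"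
      by (rule increment_le[OF diff]) (use cx[OF x sK] B in auto)
    ultimately have "\<bar>f x\<bar> \<le> M * \<bar>s\<bar>" by simp
    also have "\<dots> \<le> M * \<bar>h\<bar>" using sh M0 by (rule mult_left_mono)
    finally show ?thesis .
  qed
  show ?thesis
  proof (rule integral_directional_derivative_eq_0[where F=F and R=R and M=M and b=b])
    show "F x = 0" if "norm x > R" for x using R[of x] that by (auto simp: F_def indicator_def)
    show "\<bar>F x\<bar> \<le> M" for x using B[of x] M0 by (auto simp: F_def indicator_def)
    show "\<bar>F (x + h *\<^sub>R b) - F x\<bar> \<le> M * \<bar>h\<bar>" for x h
    proof (cases "x \<in> ?K"; cases "x + h *\<^sub>R b \<in> ?K")
      assume 1: "x \<in> ?K" "x + h *\<^sub>R b \<in> ?K"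
      then have "\<bar>f (x + h *\<^sub>R b) - f x\<bar> \<le> M * \<bar>h\<bar>"
        by (intro increment_le[OF diff]) (use cx[OF 1] B in auto)
      then show ?thesis using 1 by (simp add: F_def)
    next
      assume "x \<in> ?K" "x + h *\<^sub>R b \<notin> ?K"
      then show ?thesis using inout[of x h] by (simp add: F_def)
    next
      assume 1: "x \<notin> ?K" "x + h *\<^sub>R b \<in> ?K"
      then show ?thesis using inout[of "x + h *\<^sub>R b" "- h"] by (simp add: F_def)
    qed (use M0 in \<open>auto simp: F_def\<close>)
    \<comment> \<open>Only boundary points of the box are exceptional: in its interior
      \<open>F\<close> agrees with \<open>f\<close> nearby, and off the closed box it is locally
      0.\<close>
    show "AE x in lborel. ((\<lambda>h. (F (x + h *\<^sub>R b) - F x) / h) \<longlongrightarrow> indicator ?K x * (grad f x \<bullet> b)) (at 0)"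
    proof (rule AE_I')
      show "?K - box l u \<in> null_sets lborel"
        by (rule null_sets_cbox_Diff_box)
      show "{x \<in> space lborel. \<not> ((\<lambda>h. (F (x + h *\<^sub>R b) - F x) / h) \<longlongrightarrow> indicator ?K x * (grad f x \<bullet> b)) (at 0)} \<subseteq> ?K - box l u"
      proof (safe; rule ccontr)
        fix x assume nl: "\<not> ((\<lambda>h. (F (x + h *\<^sub>R b) - F x) / h) \<longlongrightarrow> indicator ?K x * (grad f x \<bullet> b)) (at 0)"
        have tx: "((\<lambda>h. x + h *\<^sub>R b) \<longlongrightarrow> x) (at 0)"
        proof -
          have "((\<lambda>h. x + h *\<^sub>R b) \<longlongrightarrow> x + 0 *\<^sub>R b) (at 0)" by (intro tendsto_intros)
          then show ?thesis by simp
        qed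
        { assume xb: "x \<in> box l u"
          then have xK: "x \<in> ?K" using box_subset_cbox by blast
          have "\<forall>\<^sub>F h in at 0. x + h *\<^sub>R b \<in> box l u"
            by (rule topological_tendstoD[OF tx open_box xb])
          then have "\<forall>\<^sub>F h in at 0. (f (x + h *\<^sub>R b) - f x) / h = (F (x + h *\<^sub>R b) - F x) / h"
            by eventually_elim (use xK box_subset_cbox in \<open>force simp: F_def\<close>)
          from Lim_transform_eventually[OF directional_quotient_tendsto[OF diff] this]
          show False using nl xK by simp }
        { assume xK: "x \<notin> ?K"
          have "\<forall>\<^sub>F h in at 0. x + h *\<^sub>R b \<in> - ?K"
            by (rule topological_tendstoD[OF tx]) (use xK in auto)
          then have "\<forall>\<^sub>F h in at 0. 0 = (F (x + h *\<^sub>R b) - F x) / h"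
            by eventually_elim (use xK in \<open>simp add: F_def\<close>)
          from Lim_transform_eventually[OF tendsto_const this]
          show False using nl xK by simp }
      qed
    qed
    show "F \<in> borel_measurable borel" unfolding F_def by measurable
    show "(\<lambda>x. indicator ?K x * (grad f x \<bullet> b)) \<in> borel_measurable borel" by measurable
  qed
qed

section \<open>Borel integrands and test functions as square integrable functions\<close>

text \<open>For Borel integrands the completed measure on \<open>S\<close> can be exchanged for
  \<open>lborel\<close>, where translation invariance and the product formula are available.\<close>

lemma lebesgue_on_borel:
  fixes f :: "'a::euclidean_space \<Rightarrow> 'b::{banach, second_countable_topology}"
  assumes S: "S \<in> sets borel" and f: "f \<in> borel_measurable borel"
  shows "integrable (lebesgue_on S) f \<longleftrightarrow> integrable lborel (\<lambda>x. indicator S x *\<^sub>R f x)"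
    and "integral\<^sup>L (lebesgue_on S) f = (\<integral>x. indicator S x *\<^sub>R f x \<partial>lborel)"
    and "f \<in> borel_measurable (lebesgue_on S)"
proof -
  have SL: "S \<inter> space lebesgue \<in> sets lebesgue" using S by simp
  have m: "(\<lambda>x. indicator S x *\<^sub>R f x) \<in> borel_measurable lborel" using S f by measurable
  show "integrable (lebesgue_on S) f \<longleftrightarrow> integrable lborel (\<lambda>x. indicator S x *\<^sub>R f x)"
    by (subst integrable_restrict_space[OF SL]) (rule integrable_completion[OF m])
  show "integral\<^sup>L (lebesgue_on S) f = (\<integral>x. indicator S x *\<^sub>R f x \<partial>lborel)"
    by (subst integral_restrict_space[OF SL]) (rule integral_completion[OF m])
  have "f \<in> borel_measurable lborel" using f by simp
  then have "f \<in> borel_measurable lebesgue" by (rule measurable_completion)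
  then show "f \<in> borel_measurable (lebesgue_on S)" by (rule measurable_restrict_space1)
qed

lemma L2_bounded:
  fixes f :: "'a::euclidean_space \<Rightarrow> 'b::euclidean_space"
  assumes S: "S \<in> sets borel" "bounded S" and f: "f \<in> borel_measurable borel"
    and bd: "\<And>x. x \<in> S \<Longrightarrow> norm (f x) \<le> M"
  shows "f \<in> L2 S"
proof -
  have "integrable lborel (\<lambda>x. indicator S x *\<^sub>R (norm (f x))\<^sup>2)"
  proof (rule integrableI_bounded_set[of S _ _ "M\<^sup>2"])
    show "emeasure lborel S < \<infinity>" using S(2) by (rule emeasure_bounded_finite)
    show "AE x\<in>S in lborel. norm (indicator S x *\<^sub>R (norm (f x))\<^sup>2) \<le> M\<^sup>2"
      using bd by (auto intro!: AE_I2 power_mono)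
    show "(\<lambda>x. indicator S x *\<^sub>R (norm (f x))\<^sup>2) \<in> borel_measurable lborel"
      using S f by measurable
  qed (use S in auto)
  moreover have "(\<lambda>x. (norm (f x))\<^sup>2) \<in> borel_measurable borel" using f by measurable
  ultimately have "integrable (lebesgue_on S) (\<lambda>x. (norm (f x))\<^sup>2)"
    by (simp only: lebesgue_on_borel(1)[OF S(1)])
  then show ?thesis
    unfolding L2_iff using lebesgue_on_borel(3)[OF S(1) f] by blast
qed

lemma compact_support_lebesgue_on:
  fixes f :: "'a::euclidean_space \<Rightarrow> 'b::{banach, second_countable_topology}"
  assumes S: "S \<in> sets borel" and f: "continuous_on UNIV f"
    and K: "compact K" "K \<subseteq> S" and out: "\<And>x. x \<notin> K \<Longrightarrow> f x = 0"
  shows "integrable (lebesgue_on S) f"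
    and "integrable lborel f"
    and "integral\<^sup>L (lebesgue_on S) f = integral\<^sup>L lborel f"
proof -
  have m: "f \<in> borel_measurable borel" using f by (rule borel_measurable_continuous_onI)
  have eq: "(\<lambda>x. indicator K x *\<^sub>R f x) = f" using out by (auto simp: indicator_def)
  have eqS: "(\<lambda>x. indicator S x *\<^sub>R f x) = f" using out K by (force simp: indicator_def)
  show i: "integrable lborel f"
    using borel_integrable_compact[OF K(1), of f] continuous_on_subset[OF f] by (simp add: eq)
  show "integrable (lebesgue_on S) f"
    using lebesgue_on_borel(1)[OF S m] i by (simp add: eqS)
  show "integral\<^sup>L (lebesgue_on S) f = integral\<^sup>L lborel f"
    using lebesgue_on_borel(2)[OF S m] by (simp add: eqS)
qed

lemma test_functions_L2:
  assumes "open \<Omega>" "\<phi> \<in> test_functions \<Omega>"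
  shows "\<phi> \<in> L2 \<Omega>" "grad \<phi> \<in> L2 \<Omega>"
proof -
  let ?K = "closure {x. \<phi> x \<noteq> 0}"
  have K: "compact ?K" "?K \<subseteq> \<Omega>" using assms by (auto simp: test_functions_def)
  have S: "\<Omega> \<in> sets borel" using assms by simp
  have c: "continuous_on UNIV \<phi>" "continuous_on UNIV (grad \<phi>)"
    using C_diff_continuous continuous_on_grad test_functions_C_diff[OF assms(2)] by blast+
  have out: "\<phi> x = 0" "grad \<phi> x = 0" if "x \<notin> ?K" for x
    using that closure_subset[of "{x. \<phi> x \<noteq> 0}"] grad_eq_0_outside[OF that] by auto
  have "integrable (lebesgue_on \<Omega>) (\<lambda>x. (norm (\<phi> x))\<^sup>2)"
    by (rule compact_support_lebesgue_on(1)[OF S _ K])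
      (intro continuous_on_power continuous_on_norm c, drule out(1), simp)
  then show "\<phi> \<in> L2 \<Omega>"
    using lebesgue_on_borel(3)[OF S borel_measurable_continuous_onI[OF c(1)]] by (simp add: L2_iff)
  have "integrable (lebesgue_on \<Omega>) (\<lambda>x. (norm (grad \<phi> x))\<^sup>2)"
    by (rule compact_support_lebesgue_on(1)[OF S _ K])
      (intro continuous_on_power continuous_on_norm c, drule out(2), simp)
  then show "grad \<phi> \<in> L2 \<Omega>"
    using lebesgue_on_borel(3)[OF S borel_measurable_continuous_onI[OF c(2)]] by (simp add: L2_iff)
qed

lemma test_functions_weak_gradient:
  fixes \<Omega> :: "'a::euclidean_space set"
  assumes "open \<Omega>" "\<phi> \<in> test_functions \<Omega>"
  shows "weak_gradient \<Omega> \<phi> (grad \<phi>)"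
  unfolding weak_gradient_def
proof (intro ballI)
  fix \<psi> and b :: 'a assume psi: "\<psi> \<in> test_functions \<Omega>" and b: "b \<in> Basis"
  let ?f = "\<lambda>x. \<phi> x * \<psi> x"
  let ?K = "closure {x. \<phi> x \<noteq> 0}"
  have K: "compact ?K" "?K \<subseteq> \<Omega>" using assms by (auto simp: test_functions_def)
  have S: "\<Omega> \<in> sets borel" using assms by simp
  have C: "C_diff (Suc 0) ?f"
    using test_functions_C_diff[OF assms(2)] test_functions_C_diff[OF psi] by (rule C_diff_mult)
  have sub: "closure {x. ?f x \<noteq> 0} \<subseteq> ?K" by (intro closure_mono) auto
  then have K': "compact (closure {x. ?f x \<noteq> 0})"
    using K by (meson closed_closure compact_eq_bounded_closed bounded_subset)
  have out: "grad ?f x \<bullet> b = 0" if "x \<notin> ?K" for x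
  proof -
    have "x \<notin> closure {x. ?f x \<noteq> 0}" using that sub by blast
    from grad_eq_0_outside[OF this] show ?thesis by simp
  qed
  have "0 = (\<integral>x. grad ?f x \<bullet> b \<partial>lborel)"
    by (rule integral_grad_compact_support[OF C K', symmetric])
  also have "\<dots> = (\<integral>x. grad ?f x \<bullet> b \<partial>lebesgue_on \<Omega>)"
    by (rule compact_support_lebesgue_on(3)[OF S _ K out, symmetric])
      (intro continuous_intros continuous_on_grad[OF C])
  also have "\<dots> = (\<integral>x. \<phi> x * (grad \<psi> x \<bullet> b) + (grad \<phi> x \<bullet> b) * \<psi> x \<partial>lebesgue_on \<Omega>)"
    by (simp add: grad_mult test_functions_differentiable[OF psi]
        test_functions_differentiable[OF assms(2)] inner_add_left mult.commute)
  also have "\<dots> = (\<integral>x. \<phi> x * (grad \<psi> x \<bullet> b) \<partial>lebesgue_on \<Omega>) + (\<integral>x. (grad \<phi> x \<bullet> b) * \<psi> x \<partial>lebesgue_on \<Omega>)"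
    by (intro Bochner_Integration.integral_add L2_mult_integrable L2_inner_const)
      (use test_functions_L2[OF assms] test_functions_L2[OF assms(1) psi] in auto)
  finally show "(\<integral>x. \<phi> x * (grad \<psi> x \<bullet> b) \<partial>lebesgue_on \<Omega>) = - (\<integral>x. (grad \<phi> x \<bullet> b) * \<psi> x \<partial>lebesgue_on \<Omega>)"
    by simp
qed

section \<open>The Dirichlet Sobolev space\<close>

lemma W12_0_iff:
  "W12_0 \<Omega> u g \<longleftrightarrow> u \<in> L2 \<Omega> \<and> g \<in> L2 \<Omega> \<and> weak_gradient \<Omega> u g \<and>
     (\<exists>\<phi>. (\<forall>n. \<phi> n \<in> test_functions \<Omega>) \<and> L2_tendsto \<Omega> \<phi> u \<and> L2_tendsto \<Omega> (\<lambda>n. grad (\<phi> n)) g)"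
  by (simp add: W12_0_def W12_def L2_tendsto_def conj_assoc)

lemma W12_0_L2: "W12_0 \<Omega> u g \<Longrightarrow> u \<in> L2 \<Omega>" "W12_0 \<Omega> u g \<Longrightarrow> g \<in> L2 \<Omega>"
  by (auto simp: W12_0_iff)

lemma weak_gradient_limit:
  assumes O: "open \<Omega>"
    and wg: "\<And>n. weak_gradient \<Omega> (U n) (G n)"
    and U: "L2_tendsto \<Omega> U u" and G: "L2_tendsto \<Omega> G g"
    and L2: "\<And>n. U n \<in> L2 \<Omega>" "\<And>n. G n \<in> L2 \<Omega>" "u \<in> L2 \<Omega>" "g \<in> L2 \<Omega>"
  shows "weak_gradient \<Omega> u g"
  unfolding weak_gradient_def
proof (intro ballI)
  fix \<psi> and b :: 'a assume psi: "\<psi> \<in> test_functions \<Omega>" and b: "b \<in> Basis"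
  note psiL = test_functions_L2[OF O psi]
  have 1: "(\<lambda>n. \<integral>x. U n x * (grad \<psi> x \<bullet> b) \<partial>lebesgue_on \<Omega>) \<longlonglongrightarrow> (\<integral>x. u x * (grad \<psi> x \<bullet> b) \<partial>lebesgue_on \<Omega>)"
    using L2_tendsto_inner[OF U L2_tendsto_const L2(1) L2_inner_const[OF psiL(2)] L2(3) L2_inner_const[OF psiL(2)], of b]
    by simp
  have "(\<lambda>x. \<psi> x *\<^sub>R b) \<in> L2 \<Omega>"
  proof -
    have "(\<lambda>x. norm (\<psi> x *\<^sub>R b) ^ 2) = (\<lambda>x. (norm b)\<^sup>2 * norm (\<psi> x) ^ 2)"
      by (auto simp: power_mult_distrib)
    moreover have "(\<lambda>x. \<psi> x *\<^sub>R b) \<in> borel_measurable (lebesgue_on \<Omega>)"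
      using psiL(1) by (intro borel_measurable_scaleR) (auto simp: L2_iff)
    ultimately show ?thesis using psiL(1) by (simp add: L2_iff)
  qed
  from L2_tendsto_inner[OF G L2_tendsto_const L2(2) this L2(4) this]
  have 2: "(\<lambda>n. \<integral>x. (G n x \<bullet> b) * \<psi> x \<partial>lebesgue_on \<Omega>) \<longlonglongrightarrow> (\<integral>x. (g x \<bullet> b) * \<psi> x \<partial>lebesgue_on \<Omega>)"
    by (simp add: mult.commute)
  have "(\<lambda>n. \<integral>x. U n x * (grad \<psi> x \<bullet> b) \<partial>lebesgue_on \<Omega>) = (\<lambda>n. - (\<integral>x. (G n x \<bullet> b) * \<psi> x \<partial>lebesgue_on \<Omega>))"
    using wg psi b by (simp add: weak_gradient_def)
  with 1 have "(\<lambda>n. - (\<integral>x. (G n x \<bullet> b) * \<psi> x \<partial>lebesgue_on \<Omega>)) \<longlonglongrightarrow> (\<integral>x. u x * (grad \<psi> x \<bullet> b) \<partial>lebesgue_on \<Omega>)"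
    by simp
  from LIMSEQ_unique[OF this tendsto_minus[OF 2]]
  show "(\<integral>x. u x * (grad \<psi> x \<bullet> b) \<partial>lebesgue_on \<Omega>) = - (\<integral>x. (g x \<bullet> b) * \<psi> x \<partial>lebesgue_on \<Omega>)" .
qed

text \<open>The weak gradient relation comes for free: it holds for test functions and is stable
  under limits in L2. Only the approximating sequence has to be supplied.\<close>

lemma W12_0I:
  assumes O: "open \<Omega>" and L2: "u \<in> L2 \<Omega>" "g \<in> L2 \<Omega>"
    and \<phi>: "\<And>n. \<phi> n \<in> test_functions \<Omega>" "L2_tendsto \<Omega> \<phi> u" "L2_tendsto \<Omega> (\<lambda>n. grad (\<phi> n)) g"
  shows "W12_0 \<Omega> u g"
proof -
  have "weak_gradient \<Omega> u g"
    by (rule weak_gradient_limit[OF O _ \<phi>(2,3)])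
      (use test_functions_weak_gradient[OF O \<phi>(1)] test_functions_L2[OF O \<phi>(1)] L2 in auto)
  then show ?thesis using assms by (auto simp: W12_0_iff)
qed

lemma W12_0_add:
  assumes O: "open \<Omega>" and u: "W12_0 \<Omega> u g" and v: "W12_0 \<Omega> v h"
  shows "W12_0 \<Omega> (\<lambda>x. u x + v x) (\<lambda>x. g x + h x)"
proof -
  obtain \<phi> where \<phi>: "\<And>n. \<phi> n \<in> test_functions \<Omega>" "L2_tendsto \<Omega> \<phi> u" "L2_tendsto \<Omega> (\<lambda>n. grad (\<phi> n)) g"
    using u by (auto simp: W12_0_iff)
  obtain \<psi> where \<psi>: "\<And>n. \<psi> n \<in> test_functions \<Omega>" "L2_tendsto \<Omega> \<psi> v" "L2_tendsto \<Omega> (\<lambda>n. grad (\<psi> n)) h"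
    using v by (auto simp: W12_0_iff)
  note L = W12_0_L2[OF u] W12_0_L2[OF v] test_functions_L2[OF O \<phi>(1)] test_functions_L2[OF O \<psi>(1)]
  have "grad (\<lambda>x. \<phi> n x + \<psi> n x) = (\<lambda>x. grad (\<phi> n) x + grad (\<psi> n) x)" for n
    by (intro ext grad_add test_functions_differentiable[OF \<phi>(1)] test_functions_differentiable[OF \<psi>(1)])
  then show ?thesis
    by (intro W12_0I[OF O, where \<phi>="\<lambda>n x. \<phi> n x + \<psi> n x"] L2_add test_functions_add)
      (use \<phi> \<psi> L in \<open>auto intro!: L2_tendsto_add\<close>)
qed

lemma W12_0_cmult:
  assumes O: "open \<Omega>" and u: "W12_0 \<Omega> u g"
  shows "W12_0 \<Omega> (\<lambda>x. c * u x) (\<lambda>x. c *\<^sub>R g x)"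
proof -
  obtain \<phi> where \<phi>: "\<And>n. \<phi> n \<in> test_functions \<Omega>" "L2_tendsto \<Omega> \<phi> u" "L2_tendsto \<Omega> (\<lambda>n. grad (\<phi> n)) g"
    using u by (auto simp: W12_0_iff)
  have "grad (\<lambda>x. c * \<phi> n x) = (\<lambda>x. c *\<^sub>R grad (\<phi> n) x)" for n
    by (intro ext grad_cmult test_functions_differentiable[OF \<phi>(1)])
  then show ?thesis
    using L2_tendsto_scaleR[OF \<phi>(2), of c] L2_tendsto_scaleR[OF \<phi>(3), of c] W12_0_L2[OF u]
    by (intro W12_0I[OF O, where \<phi>="\<lambda>n x. c * \<phi> n x"] L2_cmult L2_scaleR test_functions_cmult \<phi>(1))
      auto
qed

lemma W12_0_zero: "open \<Omega> \<Longrightarrow> W12_0 \<Omega> (\<lambda>x. 0) (\<lambda>x. 0)"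
  by (rule W12_0I[where \<phi>="\<lambda>n x. 0"])
    (auto simp: L2_zero test_functions_def C_diff_const L2_tendsto_def grad_eqI[of "\<lambda>x. 0" 0])

lemma W12_0_sum:
  assumes O: "open \<Omega>" and u: "\<And>i. i \<in> I \<Longrightarrow> W12_0 \<Omega> (u i) (g i)"
  shows "W12_0 \<Omega> (\<lambda>x. \<Sum>i\<in>I. c i *\<^sub>R u i x) (\<lambda>x. \<Sum>i\<in>I. c i *\<^sub>R g i x)"
proof (cases "finite I")
  case True
  then show ?thesis using u
    by (induction I) (auto intro!: W12_0_zero O W12_0_add W12_0_cmult)
qed (use W12_0_zero[OF O] in simp)

text \<open>For each \<open>n\<close> one test function is taken whose squared distances to
  \<open>U n\<close> and \<open>G n\<close> are below \<open>1 / (n + 1)\<close>; these test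
  functions approximate the limit pair.\<close>

lemma W12_0_closed:
  assumes O: "open \<Omega>" and W: "\<And>n. W12_0 \<Omega> (U n) (G n)"
    and L2: "u \<in> L2 \<Omega>" "g \<in> L2 \<Omega>"
    and U: "L2_tendsto \<Omega> U u" and G: "L2_tendsto \<Omega> G g"
  shows "W12_0 \<Omega> u g"
proof -
  let ?M = "lebesgue_on \<Omega>"
  have "\<exists>\<phi>\<in>test_functions \<Omega>. (\<integral>x. (norm (\<phi> x - U n x))\<^sup>2 \<partial>?M) < 1 / real (Suc n) \<and>
      (\<integral>x. (norm (grad \<phi> x - G n x))\<^sup>2 \<partial>?M) < 1 / real (Suc n)" for n
  proof -
    obtain \<phi> where \<phi>: "\<And>k. \<phi> k \<in> test_functions \<Omega>" "L2_tendsto \<Omega> \<phi> (U n)" "L2_tendsto \<Omega> (\<lambda>k. grad (\<phi> k)) (G n)"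
      using W[of n] by (auto simp: W12_0_iff)
    have "\<forall>\<^sub>F k in sequentially. (\<integral>x. (norm (\<phi> k x - U n x))\<^sup>2 \<partial>?M) < 1 / real (Suc n)"
      "\<forall>\<^sub>F k in sequentially. (\<integral>x. (norm (grad (\<phi> k) x - G n x))\<^sup>2 \<partial>?M) < 1 / real (Suc n)"
      by (rule order_tendstoD[OF \<phi>(2)[unfolded L2_tendsto_def]] order_tendstoD[OF \<phi>(3)[unfolded L2_tendsto_def]]; simp)+
    then have "\<forall>\<^sub>F k in sequentially. (\<integral>x. (norm (\<phi> k x - U n x))\<^sup>2 \<partial>?M) < 1 / real (Suc n) \<and>
      (\<integral>x. (norm (grad (\<phi> k) x - G n x))\<^sup>2 \<partial>?M) < 1 / real (Suc n)"
      by eventually_elim auto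
    from eventually_happens'[OF sequentially_bot this] show ?thesis using \<phi>(1) by blast
  qed
  then have "\<forall>n. \<exists>\<phi>. \<phi> \<in> test_functions \<Omega> \<and> (\<integral>x. (norm (\<phi> x - U n x))\<^sup>2 \<partial>?M) < 1 / real (Suc n) \<and>
      (\<integral>x. (norm (grad \<phi> x - G n x))\<^sup>2 \<partial>?M) < 1 / real (Suc n)" by blast
  from choice[OF this] obtain \<phi> where \<phi>: "\<And>n. \<phi> n \<in> test_functions \<Omega>"
      "\<And>n. (\<integral>x. (norm (\<phi> n x - U n x))\<^sup>2 \<partial>?M) < 1 / real (Suc n)"
      "\<And>n. (\<integral>x. (norm (grad (\<phi> n) x - G n x))\<^sup>2 \<partial>?M) < 1 / real (Suc n)"
    by blast
  have z: "(\<lambda>n. 1 / real (Suc n)) \<longlonglongrightarrow> 0" by (rule LIMSEQ_Suc[OF lim_1_over_n])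
  note L = test_functions_L2[OF O \<phi>(1)] W12_0_L2[OF W]
  have "L2_tendsto \<Omega> (\<lambda>n x. \<phi> n x - U n x) (\<lambda>x. 0)"
    unfolding L2_tendsto_def
    by (rule tendsto_sandwich[OF _ _ tendsto_const z]) (use \<phi>(2) in \<open>auto intro!: always_eventually less_imp_le\<close>)
  from L2_tendsto_add[OF this U] L L2 have 1: "L2_tendsto \<Omega> \<phi> u"
    by (simp add: L2_diff L2_zero)
  have "L2_tendsto \<Omega> (\<lambda>n x. grad (\<phi> n) x - G n x) (\<lambda>x. 0)"
    unfolding L2_tendsto_def
    by (rule tendsto_sandwich[OF _ _ tendsto_const z]) (use \<phi>(3) in \<open>auto intro!: always_eventually less_imp_le\<close>)
  from L2_tendsto_add[OF this G] L L2 have 2: "L2_tendsto \<Omega> (\<lambda>n. grad (\<phi> n)) g"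
    by (simp add: L2_diff L2_zero)
  show ?thesis by (rule W12_0I[OF O L2 \<phi>(1) 1 2])
qed

section \<open>Variational bounds for the counting function\<close>

text \<open>Gaussian elimination, by induction on the set of equations. General finite index sets
  suit both variational bounds: the unknowns are coefficients of eigenfunctions in one and of trial
  functions in the other.\<close>

lemma homogeneous_system_nontrivial_solution:
  fixes A :: "'i \<Rightarrow> 'j \<Rightarrow> real"
  assumes "finite I" "finite J" "card I < card J"
  shows "\<exists>c. (\<exists>j\<in>J. c j \<noteq> 0) \<and> (\<forall>i\<in>I. (\<Sum>j\<in>J. c j * A i j) = 0)"
  using assms
proof (induction I arbitrary: J A rule: finite_induct)
  case empty
  then have "J \<noteq> {}" by auto
  then show ?case by (intro exI[of _ "\<lambda>_. 1"]) auto
next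
  case (insert i I)
  show ?case
  proof (cases "\<forall>j\<in>J. A i j = 0")
    case True
    have "card I < card J" using insert by simp
    from insert.IH[OF insert.prems(1) this, of A] obtain c where
      "\<exists>j\<in>J. c j \<noteq> 0" "\<forall>k\<in>I. (\<Sum>j\<in>J. c j * A k j) = 0" by auto
    with True show ?thesis by (intro exI[of _ c]) auto
  next
    case False
    then obtain p where p: "p \<in> J" "A i p \<noteq> 0" by auto
    \<comment> \<open>The new equation is solved for the unknown \<open>p\<close> and substituted
      into the others.\<close>
    let ?J = "J - {p}"
    have "card I < card ?J" using insert p by (simp add: card_Diff_singleton)
    from insert.IH[OF _ this, of "\<lambda>k j. A k j - A k p * A i j / A i p"] insert.prems(1)
    obtain c where c: "\<exists>j\<in>?J. c j \<noteq> 0"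
      "\<And>k. k \<in> I \<Longrightarrow> (\<Sum>j\<in>?J. c j * (A k j - A k p * A i j / A i p)) = 0" by auto
    define s where "s = (\<Sum>j\<in>?J. c j * A i j)"
    define d where "d j = (if j = p then - s / A i p else c j)" for j
    have sum: "(\<Sum>j\<in>J. d j * A k j) = - s / A i p * A k p + (\<Sum>j\<in>?J. c j * A k j)" for k
      using insert.prems(1) p by (simp add: sum.remove[of J p] d_def)
    have "(\<Sum>j\<in>J. d j * A k j) = 0" if "k \<in> insert i I" for k
    proof (cases "k = i")
      case True
      then show ?thesis using p by (simp add: sum s_def)
    next
      case False
      then have "k \<in> I" using that by simp
      have "0 = (\<Sum>j\<in>?J. c j * A k j) - (\<Sum>j\<in>?J. (c j * A i j) * (A k p / A i p))"
        using c(2)[OF \<open>k \<in> I\<close>] by (simp add: sum_subtractf[symmetric] algebra_simps)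
      also have "(\<Sum>j\<in>?J. (c j * A i j) * (A k p / A i p)) = s * (A k p / A i p)"
        by (simp only: s_def sum_distrib_right)
      finally show ?thesis by (simp add: sum)
    qed
    moreover have "\<exists>j\<in>J. d j \<noteq> 0" using c(1) by (auto simp: d_def)
    ultimately show ?thesis by blast
  qed
qed

section \<open>Inner products and weak eigenfunctions\<close>

definition L2_ip :: "'a::euclidean_space set \<Rightarrow> ('a \<Rightarrow> 'b::euclidean_space) \<Rightarrow> ('a \<Rightarrow> 'b) \<Rightarrow> real" where
  "L2_ip \<Omega> f g = (\<integral>x. f x \<bullet> g x \<partial>lebesgue_on \<Omega>)"

lemma L2_ip_commute: "L2_ip \<Omega> f g = L2_ip \<Omega> g f"
  by (simp add: L2_ip_def inner_commute)

lemma L2_ip_self: "L2_ip \<Omega> f f = (\<integral>x. (norm (f x))\<^sup>2 \<partial>lebesgue_on \<Omega>)"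
  by (simp add: L2_ip_def power2_norm_eq_inner)

lemma L2_ip_self_nonneg: "0 \<le> L2_ip \<Omega> f f"
  by (simp add: L2_ip_self)

lemma L2_ip_zero_left: "L2_ip \<Omega> (\<lambda>x. 0) g = 0"
  by (simp add: L2_ip_def)

lemma L2_ip_add_left:
  assumes "f \<in> L2 \<Omega>" "g \<in> L2 \<Omega>" "h \<in> L2 \<Omega>"
  shows "L2_ip \<Omega> (\<lambda>x. f x + g x) h = L2_ip \<Omega> f h + L2_ip \<Omega> g h"
  using assms by (simp add: L2_ip_def inner_add_left L2_inner_integrable)

lemma L2_ip_diff_left:
  assumes "f \<in> L2 \<Omega>" "g \<in> L2 \<Omega>" "h \<in> L2 \<Omega>"
  shows "L2_ip \<Omega> (\<lambda>x. f x - g x) h = L2_ip \<Omega> f h - L2_ip \<Omega> g h"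
  using assms by (simp add: L2_ip_def inner_diff_left L2_inner_integrable)

lemma L2_ip_scaleR_left: "L2_ip \<Omega> (\<lambda>x. c *\<^sub>R f x) h = c * L2_ip \<Omega> f h"
  by (simp add: L2_ip_def)

lemma L2_ip_sum_left:
  assumes "\<And>i. i \<in> I \<Longrightarrow> f i \<in> L2 \<Omega>" "h \<in> L2 \<Omega>"
  shows "L2_ip \<Omega> (\<lambda>x. \<Sum>i\<in>I. c i *\<^sub>R f i x) h = (\<Sum>i\<in>I. c i * L2_ip \<Omega> (f i) h)"
proof (cases "finite I")
  case True
  then show ?thesis using assms
    by (induction I) (auto simp: L2_ip_zero_left L2_ip_add_left L2_ip_scaleR_left L2_sum L2_scaleR)
qed (simp add: L2_ip_zero_left)

lemma L2_ip_add_right: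
  assumes "f \<in> L2 \<Omega>" "g \<in> L2 \<Omega>" "h \<in> L2 \<Omega>"
  shows "L2_ip \<Omega> h (\<lambda>x. f x + g x) = L2_ip \<Omega> h f + L2_ip \<Omega> h g"
  using L2_ip_add_left[OF assms] by (simp add: L2_ip_commute)

lemma L2_ip_diff_right:
  assumes "f \<in> L2 \<Omega>" "g \<in> L2 \<Omega>" "h \<in> L2 \<Omega>"
  shows "L2_ip \<Omega> h (\<lambda>x. f x - g x) = L2_ip \<Omega> h f - L2_ip \<Omega> h g"
  using L2_ip_diff_left[OF assms] by (simp add: L2_ip_commute)

lemma L2_ip_scaleR_right: "L2_ip \<Omega> h (\<lambda>x. c *\<^sub>R f x) = c * L2_ip \<Omega> h f"
  by (simp add: L2_ip_def)

lemma L2_ip_sum_right: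
  assumes "\<And>i. i \<in> I \<Longrightarrow> f i \<in> L2 \<Omega>" "h \<in> L2 \<Omega>"
  shows "L2_ip \<Omega> h (\<lambda>x. \<Sum>i\<in>I. c i *\<^sub>R f i x) = (\<Sum>i\<in>I. c i * L2_ip \<Omega> h (f i))"
  using L2_ip_sum_left[OF assms, where c=c] by (simp add: L2_ip_commute)

lemma L2_ip_cong_AE0:
  assumes "AE x in lebesgue_on \<Omega>. f x = 0"
  shows "L2_ip \<Omega> f g = 0"
proof -
  have "AE x in lebesgue_on \<Omega>. f x \<bullet> g x = 0" using assms by eventually_elim simp
  then show ?thesis unfolding L2_ip_def by (rule integral_eq_zero_AE)
qed

lemma L2_ip_Cauchy_Schwarz:
  "f \<in> L2 \<Omega> \<Longrightarrow> g \<in> L2 \<Omega> \<Longrightarrow> (L2_ip \<Omega> f g)\<^sup>2 \<le> L2_ip \<Omega> f f * L2_ip \<Omega> g g"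
  using L2_Cauchy_Schwarz by (simp add: L2_ip_self) (simp add: L2_ip_def)

lemma L2_ip_orthogonal_sum:
  assumes "finite I" "\<And>i. i \<in> I \<Longrightarrow> f i \<in> L2 \<Omega>"
    and orth: "\<And>i j. i \<in> I \<Longrightarrow> j \<in> I \<Longrightarrow> i \<noteq> j \<Longrightarrow> L2_ip \<Omega> (f i) (f j) = 0"
  shows "L2_ip \<Omega> (\<lambda>x. \<Sum>i\<in>I. c i *\<^sub>R f i x) (\<lambda>x. \<Sum>i\<in>I. c i *\<^sub>R f i x) =
    (\<Sum>i\<in>I. (c i)\<^sup>2 * L2_ip \<Omega> (f i) (f i))"
proof -
  have "L2_ip \<Omega> (\<lambda>x. \<Sum>i\<in>I. c i *\<^sub>R f i x) (\<lambda>x. \<Sum>i\<in>I. c i *\<^sub>R f i x) =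
      (\<Sum>i\<in>I. c i * L2_ip \<Omega> (f i) (\<lambda>x. \<Sum>i\<in>I. c i *\<^sub>R f i x))"
    by (intro L2_ip_sum_left L2_sum L2_scaleR assms)
  also have "\<dots> = (\<Sum>i\<in>I. c i * (\<Sum>j\<in>I. c j * L2_ip \<Omega> (f i) (f j)))"
    by (intro sum.cong refl arg_cong2[where f="(*)"] L2_ip_sum_right assms)
  also have "\<dots> = (\<Sum>i\<in>I. (c i)\<^sup>2 * L2_ip \<Omega> (f i) (f i))"
  proof (rule sum.cong[OF refl])
    fix i assume i: "i \<in> I"
    have "(\<Sum>j\<in>I. c j * L2_ip \<Omega> (f i) (f j)) = (\<Sum>j\<in>I. if j = i then c i * L2_ip \<Omega> (f i) (f i) else 0)"
      by (intro sum.cong refl) (use orth[OF i] in auto)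
    also have "\<dots> = c i * L2_ip \<Omega> (f i) (f i)" using i assms(1) by simp
    finally show "c i * (\<Sum>j\<in>I. c j * L2_ip \<Omega> (f i) (f j)) = (c i)\<^sup>2 * L2_ip \<Omega> (f i) (f i)"
      by (simp add: power2_eq_square)
  qed
  finally show ?thesis .
qed

lemma W12_0_diff:
  assumes "open \<Omega>" "W12_0 \<Omega> u g" "W12_0 \<Omega> v h"
  shows "W12_0 \<Omega> (\<lambda>x. u x - v x) (\<lambda>x. g x - h x)"
  using W12_0_add[OF assms(1,2) W12_0_cmult[OF assms(1,3), of "-1"]] by simp

text \<open>The eigenvalue equation in weak form. The gradient \<open>g\<close> is carried along as
  data, so that it never has to be selected from the relation \<open>W12_0\<close>.\<close>

definition weak_eigen ::
  "'a::euclidean_space set \<Rightarrow> real \<Rightarrow> ('a \<Rightarrow> real) \<Rightarrow> ('a \<Rightarrow> 'a) \<Rightarrow> bool" where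
  "weak_eigen \<Omega> \<mu> u g \<longleftrightarrow> W12_0 \<Omega> u g \<and> (\<forall>v h. W12_0 \<Omega> v h \<longrightarrow> L2_ip \<Omega> g h = \<mu> * L2_ip \<Omega> u v)"

lemma dirichlet_eigenspace_iff: "u \<in> dirichlet_eigenspace \<Omega> \<mu> \<longleftrightarrow> (\<exists>g. weak_eigen \<Omega> \<mu> u g)"
proof -
  have "(\<integral>x. (\<mu> * u x) * v x \<partial>lebesgue_on \<Omega>) = \<mu> * L2_ip \<Omega> u v" for v
    by (simp add: L2_ip_def mult.assoc)
  then show ?thesis
    unfolding dirichlet_eigenspace_def dirichlet_laplacian_def weak_eigen_def
    by (auto simp: L2_ip_def[where 'b='a] intro!: L2_cmult dest: W12_0_L2)
qed

lemma weak_eigen_W12_0: "weak_eigen \<Omega> \<mu> u g \<Longrightarrow> W12_0 \<Omega> u g"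
  by (simp add: weak_eigen_def)

lemma weak_eigenD:
  "weak_eigen \<Omega> \<mu> u g \<Longrightarrow> W12_0 \<Omega> v h \<Longrightarrow> L2_ip \<Omega> g h = \<mu> * L2_ip \<Omega> u v"
  unfolding weak_eigen_def by blast

lemma weak_eigen_orthogonal:
  assumes u: "weak_eigen \<Omega> \<mu> u g" and v: "weak_eigen \<Omega> \<nu> v h" and ne: "\<mu> \<noteq> \<nu>"
  shows "L2_ip \<Omega> u v = 0"
proof -
  have "\<mu> * L2_ip \<Omega> u v = L2_ip \<Omega> g h"
    using weak_eigenD[OF u weak_eigen_W12_0[OF v]] by simp
  also have "\<dots> = L2_ip \<Omega> h g" by (rule L2_ip_commute)
  also have "\<dots> = \<nu> * L2_ip \<Omega> v u"
    by (rule weak_eigenD[OF v weak_eigen_W12_0[OF u]])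
  finally show ?thesis using ne by (simp add: L2_ip_commute[of _ v])
qed

lemma weak_eigen_sum:
  assumes O: "open \<Omega>" and u: "\<And>i. i \<in> I \<Longrightarrow> weak_eigen \<Omega> \<mu> (u i) (g i)"
  shows "weak_eigen \<Omega> \<mu> (\<lambda>x. \<Sum>i\<in>I. c i *\<^sub>R u i x) (\<lambda>x. \<Sum>i\<in>I. c i *\<^sub>R g i x)"
  unfolding weak_eigen_def
proof (intro conjI allI impI)
  have W: "W12_0 \<Omega> (u i) (g i)" if "i \<in> I" for i using u[OF that] by (simp add: weak_eigen_def)
  then show "W12_0 \<Omega> (\<lambda>x. \<Sum>i\<in>I. c i *\<^sub>R u i x) (\<lambda>x. \<Sum>i\<in>I. c i *\<^sub>R g i x)"
    by (rule W12_0_sum[OF O])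
  fix v h assume vh: "W12_0 \<Omega> v h"
  have "L2_ip \<Omega> (\<lambda>x. \<Sum>i\<in>I. c i *\<^sub>R g i x) h = (\<Sum>i\<in>I. c i * L2_ip \<Omega> (g i) h)"
    by (intro L2_ip_sum_left W12_0_L2[OF W] W12_0_L2[OF vh])
  also have "\<dots> = (\<Sum>i\<in>I. c i * (\<mu> * L2_ip \<Omega> (u i) v))"
    by (intro sum.cong refl) (simp add: weak_eigenD[OF u vh])
  also have "\<dots> = \<mu> * (\<Sum>i\<in>I. c i * L2_ip \<Omega> (u i) v)"
    by (simp add: sum_distrib_left mult_ac)
  also have "(\<Sum>i\<in>I. c i * L2_ip \<Omega> (u i) v) = L2_ip \<Omega> (\<lambda>x. \<Sum>i\<in>I. c i *\<^sub>R u i x) v"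
    by (intro L2_ip_sum_left[symmetric] W12_0_L2[OF W] W12_0_L2[OF vh])
  finally show "L2_ip \<Omega> (\<lambda>x. \<Sum>i\<in>I. c i *\<^sub>R g i x) h = \<mu> * L2_ip \<Omega> (\<lambda>x. \<Sum>i\<in>I. c i *\<^sub>R u i x) v" .
qed

section \<open>Upper bound for the counting function from finitely many functionals\<close>

text \<open>A supremum that is at least \<open>n\<close> strictly exceeds \<open>n - 1\<close>, so
  some independent family has at least \<open>n\<close> members; its first \<open>n\<close> members
  remain independent, by padding the coefficients with zeros.\<close>

lemma ae_dim_ge_family:
  assumes "enat n \<le> ae_dim \<Omega> V"
  obtains u where "\<And>i. i < n \<Longrightarrow> u i \<in> V" "ae_independent \<Omega> n u"
proof (cases n)
  case 0
  then show ?thesis by (intro that[of "\<lambda>_ _. 0"]) (auto simp: ae_independent_def)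
next
  case (Suc n')
  then have "enat n' < Sup {enat n |n. \<exists>u. (\<forall>i<n. u i \<in> V) \<and> ae_independent \<Omega> n u}"
    using assms by (simp add: ae_dim_def Suc_ile_eq)
  then obtain k u where k: "n' < k" "\<forall>i<k. u i \<in> V" "ae_independent \<Omega> k u"
    by (auto simp: less_Sup_iff)
  have "n \<le> k" using k Suc by simp
  have "ae_independent \<Omega> n u"
    unfolding ae_independent_def
  proof (intro allI impI)
    fix c i assume c: "AE x in lebesgue_on \<Omega>. (\<Sum>i<n. c i * u i x) = 0" and i: "i < n"
    have "(\<Sum>i<k. (if i < n then c i else 0) * u i x) = (\<Sum>i<n. c i * u i x)" for x
    proof -
      have "(\<Sum>i<k. (if i < n then c i else 0) * u i x) = (\<Sum>i<k. if i < n then c i * u i x else 0)"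
        by (intro sum.cong) auto
      also have "\<dots> = (\<Sum>i\<in>{..<k} \<inter> {i. i < n}. c i * u i x)"
        by (simp add: sum.If_cases)
      also have "{..<k} \<inter> {i. i < n} = {..<n}" using \<open>n \<le> k\<close> by auto
      finally show ?thesis .
    qed
    then have "\<forall>i<k. (if i < n then c i else 0) = 0"
      using k(3)[unfolded ae_independent_def, rule_format, of "\<lambda>i. if i < n then c i else 0"] c by simp
    then show "c i = 0" using i \<open>n \<le> k\<close> by (metis less_le_trans)
  qed
  with k \<open>n \<le> k\<close> show ?thesis by (intro that[of u]) auto
qed

text \<open>Multiplicities are not known to be finite in advance. It suffices to bound every choice
  of finitely many independent eigenfunctions from each eigenspace.\<close>

lemma enat_sum_le_of_finite_approx:
  fixes a :: "'i \<Rightarrow> enat"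
  assumes F: "finite F" and le: "\<And>n. (\<And>i. i \<in> F \<Longrightarrow> enat (n i) \<le> a i) \<Longrightarrow> (\<Sum>i\<in>F. n i) \<le> m"
  shows "(\<Sum>i\<in>F. a i) \<le> enat m"
proof (cases "\<exists>i\<in>F. a i = \<infinity>")
  case True
  then obtain i where i: "i \<in> F" "a i = \<infinity>" by auto
  \<comment> \<open>Taking \<open>Suc m\<close> at an infinite summand and 0 elsewhere contradicts
    the hypothesis.\<close>
  have "(\<Sum>j\<in>F. if j = i then Suc m else 0) \<le> m"
    by (rule le) (use i in \<open>auto simp: zero_enat_def[symmetric]\<close>)
  then show ?thesis using i F by simp
next
  case False
  have a: "a i = enat (the_enat (a i))" if "i \<in> F" for i
    using False that by (cases "a i") auto
  have "(\<Sum>i\<in>F. a i) = (\<Sum>i\<in>F. enat (the_enat (a i)))" by (intro sum.cong refl a)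
  also have "\<dots> = enat (\<Sum>i\<in>F. the_enat (a i))"
    using F by (induction F) (auto simp: zero_enat_def)
  also have "\<dots> \<le> enat m"
    using le[of "\<lambda>i. the_enat (a i)"] a by simp
  finally show ?thesis .
qed

text \<open>With more than \<open>card I\<close> independent eigenfunctions below
  \<open>l\<^sup>2\<close>, a nontrivial combination would be orthogonal to every
  \<open>e i\<close>. For it the hypothesis says that the Rayleigh quotient is at least
  \<open>l\<^sup>2\<close>, while orthogonality of the eigenspaces makes it smaller. Finiteness of
  \<open>N_D\<close> is part of the conclusion.\<close>

lemma N_D_le:
  fixes e :: "'i \<Rightarrow> 'a::euclidean_space \<Rightarrow> real"
  assumes O: "open \<Omega>" and I: "finite I" and e: "\<And>i. i \<in> I \<Longrightarrow> e i \<in> L2 \<Omega>"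
    and ineq: "\<And>u g. W12_0 \<Omega> u g \<Longrightarrow>
      l\<^sup>2 * L2_ip \<Omega> u u \<le> K * (\<Sum>i\<in>I. (L2_ip \<Omega> u (e i))\<^sup>2) + L2_ip \<Omega> g g"
  shows "N_D \<Omega> l \<le> enat (card I)"
  unfolding N_D_def
proof (rule SUP_least, rule enat_sum_le_of_finite_approx)
  fix F assume F: "F \<in> {F. finite F \<and> F \<subseteq> {..<l\<^sup>2}}"
  then show fin: "finite F" by simp
  from F have sub: "\<mu> < l\<^sup>2" if "\<mu> \<in> F" for \<mu> using that by auto
  fix n assume n: "\<And>\<mu>. \<mu> \<in> F \<Longrightarrow> enat (n \<mu>) \<le> ae_dim \<Omega> (dirichlet_eigenspace \<Omega> \<mu>)"
  have "\<exists>u. (\<forall>i<n \<mu>. u i \<in> dirichlet_eigenspace \<Omega> \<mu>) \<and> ae_independent \<Omega> (n \<mu>) u" if "\<mu> \<in> F" for \<mu>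
    using ae_dim_ge_family[OF n[OF that]] by metis
  then obtain u where u: "\<And>\<mu> i. \<mu> \<in> F \<Longrightarrow> i < n \<mu> \<Longrightarrow> u \<mu> i \<in> dirichlet_eigenspace \<Omega> \<mu>"
    and ind: "\<And>\<mu>. \<mu> \<in> F \<Longrightarrow> ae_independent \<Omega> (n \<mu>) (u \<mu>)" by metis
  then obtain g where g: "\<And>\<mu> i. \<mu> \<in> F \<Longrightarrow> i < n \<mu> \<Longrightarrow> weak_eigen \<Omega> \<mu> (u \<mu> i) (g \<mu> i)"
    unfolding dirichlet_eigenspace_iff by metis
  show "(\<Sum>\<mu>\<in>F. n \<mu>) \<le> card I"
  proof (rule ccontr)
    assume gt: "\<not> (\<Sum>\<mu>\<in>F. n \<mu>) \<le> card I"
    \<comment> \<open>Unknowns are indexed by an eigenvalue together with a position in its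
      eigenspace.\<close>
    define J where "J = Sigma F (\<lambda>\<mu>. {..<n \<mu>})"
    have "card I < card J" "finite J"
      using gt fin by (auto simp: J_def)
    from homogeneous_system_nontrivial_solution[OF I this(2,1), of "\<lambda>i (\<mu>, k). L2_ip \<Omega> (u \<mu> k) (e i)"]
    obtain c where c: "\<exists>j\<in>J. c j \<noteq> 0"
      "\<And>i. i \<in> I \<Longrightarrow> (\<Sum>(\<mu>, k)\<in>J. c (\<mu>, k) * L2_ip \<Omega> (u \<mu> k) (e i)) = 0"
      by (auto simp: case_prod_unfold)
    define w h where "w \<mu> x = (\<Sum>k<n \<mu>. c (\<mu>, k) *\<^sub>R u \<mu> k x)" and
      "h \<mu> x = (\<Sum>k<n \<mu>. c (\<mu>, k) *\<^sub>R g \<mu> k x)" for \<mu> x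
    have eig: "weak_eigen \<Omega> \<mu> (w \<mu>) (h \<mu>)" if "\<mu> \<in> F" for \<mu>
      unfolding w_def[abs_def] h_def[abs_def] by (rule weak_eigen_sum[OF O]) (use g[OF that] in auto)
    then have W: "W12_0 \<Omega> (w \<mu>) (h \<mu>)" if "\<mu> \<in> F" for \<mu> using that by (simp add: weak_eigen_def)
    note L = W12_0_L2[OF W]
    have orth: "L2_ip \<Omega> (w \<mu>) (w \<nu>) = 0" if "\<mu> \<in> F" "\<nu> \<in> F" "\<mu> \<noteq> \<nu>" for \<mu> \<nu>
      using weak_eigen_orthogonal[OF eig eig] that by blast
    have hh: "L2_ip \<Omega> (h \<mu>) (h \<nu>) = \<mu> * L2_ip \<Omega> (w \<mu>) (w \<nu>)" if "\<mu> \<in> F" "\<nu> \<in> F" for \<mu> \<nu>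
      by (rule weak_eigenD[OF eig[OF that(1)] W[OF that(2)]])
    \<comment> \<open>The factor 1 brings the sums into the shape expected by
      \<open>W12_0_sum\<close> and \<open>L2_ip_orthogonal_sum\<close>.\<close>
    define U G where "U x = (\<Sum>\<mu>\<in>F. 1 *\<^sub>R w \<mu> x)" and "G x = (\<Sum>\<mu>\<in>F. 1 *\<^sub>R h \<mu> x)" for x
    have WU: "W12_0 \<Omega> U G" unfolding U_def[abs_def] G_def[abs_def] by (rule W12_0_sum[OF O W])
    have "L2_ip \<Omega> U (e i) = 0" if "i \<in> I" for i
    proof -
      have "L2_ip \<Omega> U (e i) = (\<Sum>\<mu>\<in>F. 1 * L2_ip \<Omega> (w \<mu>) (e i))"
        unfolding U_def[abs_def] by (intro L2_ip_sum_left L e that)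
      also have "\<dots> = (\<Sum>\<mu>\<in>F. \<Sum>k<n \<mu>. c (\<mu>, k) * L2_ip \<Omega> (u \<mu> k) (e i))"
        unfolding w_def[abs_def]
      proof (intro sum.cong refl, subst L2_ip_sum_left)
        fix \<mu> k assume "\<mu> \<in> F" "k \<in> {..<n \<mu>}"
        then show "u \<mu> k \<in> L2 \<Omega>" using g[of \<mu> k] W12_0_L2 by (auto simp: weak_eigen_def)
      qed (use e that in auto)
      also have "\<dots> = (\<Sum>(\<mu>, k)\<in>J. c (\<mu>, k) * L2_ip \<Omega> (u \<mu> k) (e i))"
        unfolding J_def using fin by (subst sum.Sigma) auto
      finally show ?thesis using c(2)[OF that] by simp
    qed
    then have "l\<^sup>2 * L2_ip \<Omega> U U \<le> L2_ip \<Omega> G G" using ineq[OF WU] by simp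
    moreover have "L2_ip \<Omega> U U = (\<Sum>\<mu>\<in>F. L2_ip \<Omega> (w \<mu>) (w \<mu>))"
      unfolding U_def[abs_def] by (subst L2_ip_orthogonal_sum[OF fin L(1) orth]) auto
    moreover have "L2_ip \<Omega> G G = (\<Sum>\<mu>\<in>F. \<mu> * L2_ip \<Omega> (w \<mu>) (w \<mu>))"
      unfolding G_def[abs_def] by (subst L2_ip_orthogonal_sum[OF fin L(2)]) (auto simp: hh orth)
    \<comment> \<open>All summands are nonnegative, so each vanishes; independence inside each
      eigenspace then kills every coefficient.\<close>
    ultimately have le0: "(\<Sum>\<mu>\<in>F. (l\<^sup>2 - \<mu>) * L2_ip \<Omega> (w \<mu>) (w \<mu>)) \<le> 0"
      by (simp add: sum_distrib_left sum_subtractf left_diff_distrib)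
    have nn: "0 \<le> (l\<^sup>2 - \<mu>) * L2_ip \<Omega> (w \<mu>) (w \<mu>)" if "\<mu> \<in> F" for \<mu>
      using sub[OF that] by (intro mult_nonneg_nonneg L2_ip_self_nonneg) auto
    have "(\<Sum>\<mu>\<in>F. (l\<^sup>2 - \<mu>) * L2_ip \<Omega> (w \<mu>) (w \<mu>)) = 0"
      by (rule order_antisym[OF le0 sum_nonneg[OF nn]])
    then have "(l\<^sup>2 - \<mu>) * L2_ip \<Omega> (w \<mu>) (w \<mu>) = 0" if "\<mu> \<in> F" for \<mu>
      using sum_nonneg_eq_0_iff[of F "\<lambda>\<mu>. (l\<^sup>2 - \<mu>) * L2_ip \<Omega> (w \<mu>) (w \<mu>)"] fin nn that by blast
    then have "L2_ip \<Omega> (w \<mu>) (w \<mu>) = 0" if "\<mu> \<in> F" for \<mu> using sub[OF that] that by force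
    then have "AE x in lebesgue_on \<Omega>. w \<mu> x = 0" if "\<mu> \<in> F" for \<mu>
      using that L2_norm_zero_iff[OF L(1)[OF that]] by (simp add: L2_ip_self)
    then have "\<forall>k<n \<mu>. c (\<mu>, k) = 0" if "\<mu> \<in> F" for \<mu>
      using ind[OF that, unfolded ae_independent_def, rule_format, of "\<lambda>k. c (\<mu>, k)"] that
      unfolding w_def by simp
    then show False using c(1) by (auto simp: J_def)
  qed
qed

section \<open>Lower bound for the counting function by successive minimisation\<close>

text \<open>A substitute for Rellich's theorem. The hypothesis \<open>compact\<close> says that up
  to finitely many functionals, \<open>L\<close> times the squared norm is bounded by the squared
  gradient norm. Along a diagonal subsequence all functionals converge, and then the inequality for
  differences makes their norms small, since \<open>L\<close> is arbitrary.\<close>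

lemma L2_cauchy_subsequence:
  fixes U :: "nat \<Rightarrow> 'a::euclidean_space \<Rightarrow> real"
  assumes O: "open \<Omega>" and W: "\<And>n. W12_0 \<Omega> (U n) (G n)"
    and C: "\<And>n. L2_ip \<Omega> (U n) (U n) \<le> C" "\<And>n. L2_ip \<Omega> (G n) (G n) \<le> C"
    and compact: "\<And>L::nat. \<exists>(m::nat) e K. K \<ge> 0 \<and> (\<forall>i<m. e i \<in> L2 \<Omega>) \<and> (\<forall>u g. W12_0 \<Omega> u g \<longrightarrow>
      real L * L2_ip \<Omega> u u \<le> K * (\<Sum>i<m. (L2_ip \<Omega> u (e i))\<^sup>2) + L2_ip \<Omega> g g)"
  obtains r :: "nat \<Rightarrow> nat" where "strict_mono r"
    "\<forall>\<epsilon>>0. \<exists>N. \<forall>a\<ge>N. \<forall>b\<ge>N.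
       L2_ip \<Omega> (\<lambda>x. U (r a) x - U (r b) x) (\<lambda>x. U (r a) x - U (r b) x) < \<epsilon>"
proof -
  note L = W12_0_L2[OF W]
  have C0: "C \<ge> 0" using order_trans[OF L2_ip_self_nonneg C(1)] .
  have "\<forall>L::nat. \<exists>(m::nat) e K. K \<ge> 0 \<and> (\<forall>i<m. e i \<in> L2 \<Omega>) \<and> (\<forall>u g. W12_0 \<Omega> u g \<longrightarrow>
      real L * L2_ip \<Omega> u u \<le> K * (\<Sum>i<m. (L2_ip \<Omega> u (e i))\<^sup>2) + L2_ip \<Omega> g g)"
    using compact by blast
  from choice[OF this] obtain m :: "nat \<Rightarrow> nat" where
    "\<forall>L. \<exists>e K. K \<ge> 0 \<and> (\<forall>i<m L. e i \<in> L2 \<Omega>) \<and> (\<forall>u g. W12_0 \<Omega> u g \<longrightarrow>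
      real L * L2_ip \<Omega> u u \<le> K * (\<Sum>i<m L. (L2_ip \<Omega> u (e i))\<^sup>2) + L2_ip \<Omega> g g)" by blast
  from choice[OF this] obtain e where
    "\<forall>L. \<exists>K. K \<ge> 0 \<and> (\<forall>i<m L. e L i \<in> L2 \<Omega>) \<and> (\<forall>u g. W12_0 \<Omega> u g \<longrightarrow>
      real L * L2_ip \<Omega> u u \<le> K * (\<Sum>i<m L. (L2_ip \<Omega> u (e L i))\<^sup>2) + L2_ip \<Omega> g g)" by blast
  from choice[OF this] obtain K where K0: "\<And>L. K L \<ge> 0"
    and e: "\<And>L i. i < m L \<Longrightarrow> e L i \<in> L2 \<Omega>"
    and ineq: "\<And>L u g. W12_0 \<Omega> u g \<Longrightarrow>
      real L * L2_ip \<Omega> u u \<le> K L * (\<Sum>i<m L. (L2_ip \<Omega> u (e L i))\<^sup>2) + L2_ip \<Omega> g g" by blast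
  \<comment> \<open>Division by \<open>E\<close> bounds all coefficients by the common constant
    \<open>1 + C\<close>, as the diagonal extraction over all pairs \<open>(L, i)\<close> requires.
    The factor is restored in \<open>cf\<close>.\<close>
  define E where "E L i = 1 + L2_ip \<Omega> (e L i) (e L i)" for L i
  have E1: "E L i \<ge> 1" for L i using L2_ip_self_nonneg[of \<Omega> "e L i"] by (simp add: E_def)
  define f where "f n p = (if snd p < m (fst p) then L2_ip \<Omega> (U n) (e (fst p) (snd p)) / E (fst p) (snd p) else 0)"
    for n :: nat and p :: "nat \<times> nat"
  have fb: "norm (f n p) \<le> 1 + C" for n p
  proof (cases "snd p < m (fst p)")
    case True
    let ?e = "e (fst p) (snd p)" and ?E = "E (fst p) (snd p)"
    have "(L2_ip \<Omega> (U n) ?e)\<^sup>2 \<le> L2_ip \<Omega> (U n) (U n) * L2_ip \<Omega> ?e ?e"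
      by (rule L2_ip_Cauchy_Schwarz[OF L(1) e[OF True]])
    also have "\<dots> \<le> (1 + C) * ?E"
      using C(1)[of n] C0 by (intro mult_mono) (auto simp: E_def L2_ip_self_nonneg)
    also have "\<dots> \<le> ((1 + C) * ?E)\<^sup>2"
    proof -
      have "1 * 1 \<le> (1 + C) * ?E" using C0 E1 by (intro mult_mono) auto
      then show ?thesis by (intro self_le_power) auto
    qed
    finally have "\<bar>L2_ip \<Omega> (U n) ?e\<bar> \<le> (1 + C) * ?E"
      using C0 E1[of "fst p" "snd p"] by (intro power2_le_imp_le[of "\<bar>_\<bar>"]) auto
    then show ?thesis using True E1[of "fst p" "snd p"] by (simp add: f_def abs_divide divide_le_eq)
  qed (use C0 in \<open>simp add: f_def\<close>)
  obtain r :: "nat \<Rightarrow> nat" where r: "strict_mono r" and conv: "\<And>p. \<exists>l. (\<lambda>n. f (r n) p) \<longlonglongrightarrow> l"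
    using function_convergent_subsequence[of UNIV f "1 + C"] fb by (metis UNIV_I countableI_type)
  have cf: "\<exists>l. (\<lambda>n. L2_ip \<Omega> (U (r n)) (e L i)) \<longlonglongrightarrow> l" if "i < m L" for L i
  proof -
    obtain l where "(\<lambda>n. f (r n) (L, i)) \<longlonglongrightarrow> l" using conv by blast
    from tendsto_mult_right[OF this, of "E L i"]
    have "(\<lambda>n. f (r n) (L, i) * E L i) \<longlonglongrightarrow> l * E L i" .
    moreover have "f (r n) (L, i) * E L i = L2_ip \<Omega> (U (r n)) (e L i)" for n
      using that E1[of L i] by (simp add: f_def)
    ultimately show ?thesis by auto
  qed
  show ?thesis
  proof (rule that[OF r], intro allI impI)
    fix \<epsilon> :: real assume eps: "\<epsilon> > 0"
    \<comment> \<open>For differences the right-hand side of the inequality will be at most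
      \<open>1 + 4 * C\<close>; this \<open>L\<close> is large enough to make its quotient by
      \<open>L\<close> smaller than \<open>\<epsilon>\<close>.\<close>
    obtain L :: nat where Lb: "real L > (8 * C + 1) / \<epsilon>" using reals_Archimedean2 by blast
    then have Lp: "real L > 0" using eps C0 by (smt (verit) divide_nonneg_pos)
    have "\<forall>i. \<exists>l. i < m L \<longrightarrow> (\<lambda>n. L2_ip \<Omega> (U (r n)) (e L i)) \<longlonglongrightarrow> l" using cf by blast
    from choice[OF this] obtain l where l: "\<And>i. i < m L \<Longrightarrow> (\<lambda>n. L2_ip \<Omega> (U (r n)) (e L i)) \<longlonglongrightarrow> l i" by blast
    define S where "S n = (\<Sum>i<m L. (L2_ip \<Omega> (U (r n)) (e L i) - l i)\<^sup>2)" for n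
    have "S \<longlonglongrightarrow> (\<Sum>i<m L. (l i - l i)\<^sup>2)"
      unfolding S_def by (intro tendsto_sum tendsto_power tendsto_diff tendsto_const l) simp
    then have "S \<longlonglongrightarrow> 0" by simp
    \<comment> \<open>Chosen so that \<open>K L * q \<le> 1\<close>, also when
      \<open>K L = 0\<close>.\<close>
    define q where "q = 1 / (K L + 1)"
    have q0: "q > 0" using K0[of L] by (simp add: q_def)
    from \<open>S \<longlonglongrightarrow> 0\<close> have "\<forall>\<^sub>F n in sequentially. S n < q / 4"
      using q0 K0[of L] by (intro order_tendstoD(2)) auto
    then obtain N where N: "\<And>n. n \<ge> N \<Longrightarrow> S n < q / 4"
      by (auto simp: eventually_sequentially)
    show "\<exists>N. \<forall>a\<ge>N. \<forall>b\<ge>N. L2_ip \<Omega> (\<lambda>x. U (r a) x - U (r b) x) (\<lambda>x. U (r a) x - U (r b) x) < \<epsilon>"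
    proof (intro exI allI impI)
      fix a b assume ab: "a \<ge> N" "b \<ge> N"
      let ?u = "\<lambda>x. U (r a) x - U (r b) x" and ?g = "\<lambda>x. G (r a) x - G (r b) x"
      have "(\<Sum>i<m L. (L2_ip \<Omega> ?u (e L i))\<^sup>2) \<le>
          (\<Sum>i<m L. 2 * (L2_ip \<Omega> (U (r a)) (e L i) - l i)\<^sup>2 + 2 * (L2_ip \<Omega> (U (r b)) (e L i) - l i)\<^sup>2)"
      proof (rule sum_mono)
        fix i assume "i \<in> {..<m L}"
        then have "L2_ip \<Omega> ?u (e L i) = (L2_ip \<Omega> (U (r a)) (e L i) - l i) + (- (L2_ip \<Omega> (U (r b)) (e L i) - l i))"
          by (simp add: L2_ip_diff_left L e)
        then show "(L2_ip \<Omega> ?u (e L i))\<^sup>2 \<le> 2 * (L2_ip \<Omega> (U (r a)) (e L i) - l i)\<^sup>2 + 2 * (L2_ip \<Omega> (U (r b)) (e L i) - l i)\<^sup>2"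
          using norm_add_sq_le[of "L2_ip \<Omega> (U (r a)) (e L i) - l i" "- (L2_ip \<Omega> (U (r b)) (e L i) - l i)"]
          by (simp add: power2_commute)
      qed
      also have "\<dots> = 2 * S a + 2 * S b" by (simp add: S_def sum.distrib sum_distrib_left)
      also have "\<dots> \<le> q" using N[OF ab(1)] N[OF ab(2)] by linarith
      finally have "K L * (\<Sum>i<m L. (L2_ip \<Omega> ?u (e L i))\<^sup>2) \<le> K L * q"
        using K0 by (intro mult_left_mono)
      also have "\<dots> \<le> 1" using K0[of L] by (simp add: q_def divide_le_eq)
      finally have 1: "K L * (\<Sum>i<m L. (L2_ip \<Omega> ?u (e L i))\<^sup>2) \<le> 1" .
      have "L2_ip \<Omega> ?g ?g \<le> 2 * L2_ip \<Omega> (G (r a)) (G (r a)) + 2 * L2_ip \<Omega> (G (r b)) (G (r b))"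
        using L2_norm_add_le[OF L(2) L2_scaleR[OF L(2), of "-1"], of "r a" "r b"] by (simp add: L2_ip_self)
      also have "\<dots> \<le> 4 * C" using C(2)[of "r a"] C(2)[of "r b"] by simp
      finally have "real L * L2_ip \<Omega> ?u ?u \<le> 1 + 4 * C"
        using ineq[OF W12_0_diff[OF O W W], of L "r a" "r b"] 1 by linarith
      also have "\<dots> \<le> 8 * C + 1" using C0 by simp
      also have "\<dots> < real L * \<epsilon>" using Lb eps by (simp add: field_simps)
      finally show "L2_ip \<Omega> ?u ?u < \<epsilon>" using Lp by simp
    qed
  qed
qed

text \<open>First-order condition at a minimum. The test value
  \<open>t = - a / (\<bar>b\<bar> + 1)\<close> would make the expression at most
  \<open>- a\<^sup>2 / (\<bar>b\<bar> + 1)\<close>.\<close>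

lemma linear_coeff_zero:
  fixes a b :: real
  assumes "\<And>t. 0 \<le> 2 * t * a + t\<^sup>2 * b"
  shows "a = 0"
proof (rule ccontr)
  assume "a \<noteq> 0"
  define t where "t = - a / (\<bar>b\<bar> + 1)"
  define B where "B = \<bar>b\<bar> + 1"
  have B: "B > 0" "b \<le> B" by (auto simp: B_def)
  have t: "t = - a / B" by (simp add: t_def B_def)
  have "2 * t * a + t\<^sup>2 * b \<le> 2 * t * a + t\<^sup>2 * B"
    using B(2) by (simp add: mult_left_mono)
  also have "\<dots> = - (a\<^sup>2 / B)"
    using B(1) by (simp add: t power2_eq_square field_simps)
  also have "\<dots> < 0" using B(1) \<open>a \<noteq> 0\<close> by simp
  finally have "2 * t * a + t\<^sup>2 * b < 0" .
  then show False using assms[of t] by simp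
qed

lemma L2_ip_add_scaled_self:
  fixes f g :: "'a::euclidean_space \<Rightarrow> 'b::euclidean_space"
  assumes "f \<in> L2 \<Omega>" "g \<in> L2 \<Omega>"
  shows "L2_ip \<Omega> (\<lambda>x. f x + t *\<^sub>R g x) (\<lambda>x. f x + t *\<^sub>R g x) =
    L2_ip \<Omega> f f + 2 * t * L2_ip \<Omega> f g + t\<^sup>2 * L2_ip \<Omega> g g"
  using assms L2_scaleR[OF assms(2), of t]
  by (simp add: L2_ip_add_left L2_ip_add_right L2_add L2_ip_commute[of \<Omega> "\<lambda>x. t *\<^sub>R g x"]
      L2_ip_scaleR_right L2_ip_commute[of \<Omega> g f])
    (simp add: L2_ip_def power2_eq_square algebra_simps)

text \<open>The Rayleigh quotient is minimised over the orthogonal complement of the eigenfunctions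
  already found. The pair \<open>v\<close>, \<open>h\<close> shows that the infimum is below
  \<open>\<Lambda>\<close>.\<close>

lemma exists_next_eigenfunction:
  fixes \<Omega> :: "'a::euclidean_space set" and u :: "nat \<Rightarrow> 'a \<Rightarrow> real"
  assumes O: "open \<Omega>"
    and compact: "\<And>L::nat. \<exists>(m::nat) e K. K \<ge> 0 \<and> (\<forall>i<m. e i \<in> L2 \<Omega>) \<and> (\<forall>u g. W12_0 \<Omega> u g \<longrightarrow>
      real L * L2_ip \<Omega> u u \<le> K * (\<Sum>i<m. (L2_ip \<Omega> u (e i))\<^sup>2) + L2_ip \<Omega> g g)"
    and eig: "\<And>i. i < m \<Longrightarrow> weak_eigen \<Omega> (\<mu> i) (u i) (g i)"
    and orth: "\<And>i j. i < m \<Longrightarrow> j < m \<Longrightarrow> L2_ip \<Omega> (u i) (u j) = (if i = j then 1 else 0)"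
    and v: "W12_0 \<Omega> v h" "\<And>i. i < m \<Longrightarrow> L2_ip \<Omega> v (u i) = 0" "L2_ip \<Omega> v v > 0"
      "L2_ip \<Omega> h h < \<Lambda> * L2_ip \<Omega> v v"
  obtains \<nu> w k where "weak_eigen \<Omega> \<nu> w k" "\<nu> < \<Lambda>" "L2_ip \<Omega> w w = 1" "\<forall>i<m. L2_ip \<Omega> w (u i) = 0"
proof -
  have uW: "W12_0 \<Omega> (u i) (g i)" if "i < m" for i using eig[OF that] by (rule weak_eigen_W12_0)
  note uL = W12_0_L2[OF uW]
  define P where "P w k \<longleftrightarrow> W12_0 \<Omega> w k \<and> (\<forall>i<m. L2_ip \<Omega> w (u i) = 0)" for w k
  define A where "A = {L2_ip \<Omega> k k |w k. P w k \<and> L2_ip \<Omega> w w = 1}"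
  define \<nu> where "\<nu> = Inf A"
  have P_add: "P (\<lambda>x. w x + t *\<^sub>R w' x) (\<lambda>x. k x + t *\<^sub>R k' x)" if "P w k" "P w' k'" for w k w' k' t
    using that W12_0_add[OF O _ W12_0_cmult[OF O], of w k w' k' t] uL(1)
    by (auto simp: P_def L2_ip_add_left L2_ip_scaleR_left[of _ _ "w'", simplified] W12_0_L2 L2_cmult)
  have P_scale: "P (\<lambda>x. t *\<^sub>R w x) (\<lambda>x. t *\<^sub>R k x)" if "P w k" for w k t
    using that W12_0_cmult[OF O, of w k t]
    by (auto simp: P_def L2_ip_scaleR_left[of _ _ w, simplified])
  have bdd: "bdd_below A" by (rule bdd_belowI[of _ 0]) (auto simp: A_def L2_ip_self_nonneg)
  have sc: "L2_ip \<Omega> (\<lambda>x. t *\<^sub>R f x) (\<lambda>x. t *\<^sub>R f x) = t\<^sup>2 * L2_ip \<Omega> f f" for t and f :: "'a \<Rightarrow> 'c::euclidean_space"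
    by (simp add: L2_ip_def power2_eq_square mult.assoc)
  have inA: "L2_ip \<Omega> k k / L2_ip \<Omega> w w \<in> A" if "P w k" "L2_ip \<Omega> w w > 0" for w k
  proof -
    define t where "t = 1 / sqrt (L2_ip \<Omega> w w)"
    have t2: "t\<^sup>2 = 1 / L2_ip \<Omega> w w" using that(2) by (simp add: t_def power_divide)
    show ?thesis
      unfolding A_def using P_scale[OF that(1), of t] sc[of t w] sc[of t k] that(2)
      by (intro CollectI exI[of _ "\<lambda>x. t *\<^sub>R w x"] exI[of _ "\<lambda>x. t *\<^sub>R k x"]) (simp add: t2)
  qed
  have Pv: "P v h" using v by (simp add: P_def)
  have ray: "\<nu> * L2_ip \<Omega> w w \<le> L2_ip \<Omega> k k" if "P w k" for w k
  proof (cases "L2_ip \<Omega> w w > 0")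
    case True
    have "\<nu> \<le> L2_ip \<Omega> k k / L2_ip \<Omega> w w"
      unfolding \<nu>_def by (rule cInf_lower[OF inA[OF that True] bdd])
    then show ?thesis using True by (simp add: pos_le_divide_eq)
  next
    case False
    then have "L2_ip \<Omega> w w = 0" using L2_ip_self_nonneg[of \<Omega> w] by simp
    then show ?thesis by (simp add: L2_ip_self_nonneg)
  qed
  have ne: "A \<noteq> {}" using inA[OF Pv v(3)] by auto
  have \<nu>0: "\<nu> \<ge> 0" unfolding \<nu>_def by (rule cInf_greatest[OF ne]) (auto simp: A_def L2_ip_self_nonneg)
  have \<nu>\<Lambda>: "\<nu> < \<Lambda>"
  proof -
    have "\<nu> \<le> L2_ip \<Omega> h h / L2_ip \<Omega> v v"
      unfolding \<nu>_def by (rule cInf_lower[OF inA[OF Pv v(3)] bdd])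
    also have "\<dots> < \<Lambda>" using v(3,4) by (simp add: pos_divide_less_eq)
    finally show ?thesis .
  qed
  have "\<exists>w k. P w k \<and> L2_ip \<Omega> w w = 1 \<and> L2_ip \<Omega> k k < \<nu> + 1 / real (Suc n)" for n
  proof -
    have "Inf A < \<nu> + 1 / real (Suc n)" by (simp add: \<nu>_def)
    from cInf_lessD[OF ne this] show ?thesis by (auto simp: A_def)
  qed
  then have "\<forall>n. \<exists>p. P (fst p) (snd p) \<and> L2_ip \<Omega> (fst p) (fst p) = 1 \<and> L2_ip \<Omega> (snd p) (snd p) < \<nu> + 1 / real (Suc n)"
    by simp
  from choice[OF this] obtain p where p: "\<And>n. P (fst (p n)) (snd (p n))" "\<And>n. L2_ip \<Omega> (fst (p n)) (fst (p n)) = 1"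
      "\<And>n. L2_ip \<Omega> (snd (p n)) (snd (p n)) < \<nu> + 1 / real (Suc n)" by blast
  define U G where "U n = fst (p n)" and "G n = snd (p n)" for n
  have UG: "P (U n) (G n)" "L2_ip \<Omega> (U n) (U n) = 1" "L2_ip \<Omega> (G n) (G n) < \<nu> + 1 / real (Suc n)" for n
    using p[of n] by (auto simp: U_def G_def)
  have W: "W12_0 \<Omega> (U n) (G n)" for n using UG(1) by (simp add: P_def)
  have C: "L2_ip \<Omega> (U n) (U n) \<le> \<nu> + 1" "L2_ip \<Omega> (G n) (G n) \<le> \<nu> + 1" for n
  proof -
    have "1 / real (Suc n) \<le> 1" by simp
    then show "L2_ip \<Omega> (U n) (U n) \<le> \<nu> + 1" "L2_ip \<Omega> (G n) (G n) \<le> \<nu> + 1"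
      using UG(2,3)[of n] \<nu>0 by linarith+
  qed
  obtain r :: "nat \<Rightarrow> nat" where r: "strict_mono r" and rc': "\<forall>\<epsilon>>0. \<exists>N. \<forall>a\<ge>N. \<forall>b\<ge>N.
       L2_ip \<Omega> (\<lambda>x. U (r a) x - U (r b) x) (\<lambda>x. U (r a) x - U (r b) x) < \<epsilon>"
    by (rule L2_cauchy_subsequence[where U=U and G=G, OF O W C compact]) (rule that)
  note rc = rc'[rule_format]
  have rn: "r n \<ge> n" for n using r by (rule seq_suble)
  have Gr: "L2_ip \<Omega> (G (r n)) (G (r n)) < \<nu> + 1 / real (Suc n)" for n
  proof -
    have "1 / real (Suc (r n)) \<le> 1 / real (Suc n)" using rn[of n] by (simp add: frac_le)
    then show ?thesis using UG(3)[of "r n"] by linarith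
  qed
  note L = W12_0_L2[OF W]
  \<comment> \<open>By \<open>ray\<close> the squared gradient norm of a sum is at least
    \<open>\<nu>\<close> times its squared norm, so the parallelogram identity bounds the gradient
    of the difference. Gradients of a minimising sequence thus converge strongly once the functions
    do, and no weak limits occur.\<close>
  have par: "L2_ip \<Omega> (\<lambda>x. G (r a) x - G (r b) x) (\<lambda>x. G (r a) x - G (r b) x) \<le>
      2 / real (Suc a) + 2 / real (Suc b) + \<nu> * L2_ip \<Omega> (\<lambda>x. U (r a) x - U (r b) x) (\<lambda>x. U (r a) x - U (r b) x)" for a b
  proof -
    have "\<nu> * L2_ip \<Omega> (\<lambda>x. U (r a) x + 1 *\<^sub>R U (r b) x) (\<lambda>x. U (r a) x + 1 *\<^sub>R U (r b) x) \<le>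
        L2_ip \<Omega> (\<lambda>x. G (r a) x + 1 *\<^sub>R G (r b) x) (\<lambda>x. G (r a) x + 1 *\<^sub>R G (r b) x)"
      by (rule ray[OF P_add[OF UG(1) UG(1)]])
    moreover have "L2_ip \<Omega> (\<lambda>x. U (r a) x + 1 *\<^sub>R U (r b) x) (\<lambda>x. U (r a) x + 1 *\<^sub>R U (r b) x) =
        2 + 2 * L2_ip \<Omega> (U (r a)) (U (r b))"
      using L2_ip_add_scaled_self[OF L(1) L(1), of "r a" 1 "r b"] UG(2) by simp
    moreover have dU: "L2_ip \<Omega> (\<lambda>x. U (r a) x - U (r b) x) (\<lambda>x. U (r a) x - U (r b) x) =
        2 - 2 * L2_ip \<Omega> (U (r a)) (U (r b))"
      using L2_ip_add_scaled_self[OF L(1) L(1), of "r a" "-1" "r b"] UG(2) by simp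
    moreover note L2_ip_add_scaled_self[OF L(2) L(2), of "r a" 1 "r b"]
      L2_ip_add_scaled_self[OF L(2) L(2), of "r a" "-1" "r b"]
    ultimately show ?thesis
      using Gr[of a] Gr[of b] unfolding dU by (simp add: algebra_simps)
  qed
  obtain w where w: "w \<in> L2 \<Omega>" "L2_tendsto \<Omega> (\<lambda>n. U (r n)) w"
    using L2_complete[of "\<lambda>n. U (r n)"] L rc by (auto simp: L2_ip_self)
  have Gc: "\<exists>N. \<forall>a\<ge>N. \<forall>b\<ge>N. (\<integral>x. (norm (G (r a) x - G (r b) x))\<^sup>2 \<partial>lebesgue_on \<Omega>) < \<epsilon>" if "\<epsilon> > 0" for \<epsilon>
  proof -
    obtain N1 where N1: "\<forall>a\<ge>N1. \<forall>b\<ge>N1.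
       L2_ip \<Omega> (\<lambda>x. U (r a) x - U (r b) x) (\<lambda>x. U (r a) x - U (r b) x) < \<epsilon> / (2 * (\<nu> + 1))"
      using rc[of "\<epsilon> / (2 * (\<nu> + 1))"] \<open>\<epsilon> > 0\<close> \<nu>0 by auto
    obtain N2 :: nat where N2: "real N2 > 8 / \<epsilon>" using reals_Archimedean2 by blast
    show ?thesis
    proof (intro exI allI impI)
      fix a b assume ab: "a \<ge> max N1 N2" "b \<ge> max N1 N2"
      have q: "2 / real (Suc j) < \<epsilon> / 4" if "j \<ge> N2" for j
      proof -
        have "8 / \<epsilon> < real (Suc j)" using N2 that by linarith
        then show ?thesis using \<open>\<epsilon> > 0\<close> by (simp add: field_simps)
      qed
      let ?d = "L2_ip \<Omega> (\<lambda>x. U (r a) x - U (r b) x) (\<lambda>x. U (r a) x - U (r b) x)"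
      have "\<nu> * ?d \<le> (\<nu> + 1) * ?d" by (intro mult_right_mono L2_ip_self_nonneg) simp
      also have "\<dots> < (\<nu> + 1) * (\<epsilon> / (2 * (\<nu> + 1)))"
        using N1 ab \<nu>0 by (intro mult_strict_left_mono) auto
      also have "\<dots> = \<epsilon> / 2" using \<nu>0 by (simp add: field_simps)
      finally have "\<nu> * ?d < \<epsilon> / 2" .
      then show "(\<integral>x. (norm (G (r a) x - G (r b) x))\<^sup>2 \<partial>lebesgue_on \<Omega>) < \<epsilon>"
        using par[of a b] q[of a] q[of b] ab by (simp add: L2_ip_self)
    qed
  qed
  obtain k where k: "k \<in> L2 \<Omega>" "L2_tendsto \<Omega> (\<lambda>n. G (r n)) k"
    using L2_complete[of "\<lambda>n. G (r n)" \<Omega>, OF L(2) Gc] by blast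
  have Wwk: "W12_0 \<Omega> w k"
    by (rule W12_0_closed[OF O W w(1) k(1) w(2) k(2)])
  have ww: "L2_ip \<Omega> w w = 1"
    using L2_tendsto_inner[OF w(2) w(2) L(1) L(1) w(1) w(1)] UG(2)
    by (auto simp: L2_ip_def LIMSEQ_const_iff)
  have wu: "L2_ip \<Omega> w (u i) = 0" if "i < m" for i
    using L2_tendsto_inner[OF w(2) L2_tendsto_const L(1) uL(1)[OF that] w(1) uL(1)[OF that]] UG(1) that
    by (auto simp: L2_ip_def P_def LIMSEQ_const_iff)
  have Pwk: "P w k" using Wwk wu by (simp add: P_def)
  have kk: "L2_ip \<Omega> k k = \<nu>"
  proof (rule antisym)
    have 1: "(\<lambda>n. L2_ip \<Omega> (G (r n)) (G (r n))) \<longlonglongrightarrow> L2_ip \<Omega> k k"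
      using L2_tendsto_inner[OF k(2) k(2) L(2) L(2) k(1) k(1)] by (simp add: L2_ip_def)
    have 2: "(\<lambda>n. \<nu> + 1 / real (Suc n)) \<longlonglongrightarrow> \<nu> + 0"
      by (intro tendsto_add tendsto_const LIMSEQ_Suc[OF lim_1_over_n])
    show "L2_ip \<Omega> k k \<le> \<nu>"
      using LIMSEQ_le[OF 1 2] Gr less_imp_le by auto
    show "\<nu> \<le> L2_ip \<Omega> k k" using ray[OF Pwk] ww by simp
  qed
  \<comment> \<open>The Euler-Lagrange equation, so far only for variations that satisfy the
    orthogonality constraints.\<close>
  have EL: "L2_ip \<Omega> k k' = \<nu> * L2_ip \<Omega> w w'" if "P w' k'" for w' k'
  proof -
    have L': "w' \<in> L2 \<Omega>" "k' \<in> L2 \<Omega>" using that W12_0_L2 by (auto simp: P_def)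
    have "0 \<le> 2 * t * (L2_ip \<Omega> k k' - \<nu> * L2_ip \<Omega> w w') + t\<^sup>2 * (L2_ip \<Omega> k' k' - \<nu> * L2_ip \<Omega> w' w')" for t
      using ray[OF P_add[OF Pwk that, of t]]
      unfolding L2_ip_add_scaled_self[OF w(1) L'(1)] L2_ip_add_scaled_self[OF k(1) L'(2)] ww kk
      by (simp add: algebra_simps)
    from linear_coeff_zero[OF this] show ?thesis by simp
  qed
  have "weak_eigen \<Omega> \<nu> w k"
    unfolding weak_eigen_def
  proof (intro conjI Wwk allI impI)
    fix v h assume vh: "W12_0 \<Omega> v h"
    \<comment> \<open>\<open>pu\<close> is the projection of \<open>v\<close> onto the span of the
      earlier eigenfunctions. It is orthogonal to \<open>w\<close>, and \<open>pg\<close> is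
      orthogonal to \<open>k\<close>, so subtracting it changes neither side of the
      equation.\<close>
    define c where "c i = L2_ip \<Omega> v (u i)" for i
    define pu where "pu x = (\<Sum>i<m. c i *\<^sub>R u i x)" for x
    define pg where "pg x = (\<Sum>i<m. c i *\<^sub>R g i x)" for x
    have Wp: "W12_0 \<Omega> pu pg" unfolding pu_def[abs_def] pg_def[abs_def]
      by (rule W12_0_sum[OF O]) (use uW in auto)
    note vL = W12_0_L2[OF vh] and pL = W12_0_L2[OF Wp]
    have pui: "L2_ip \<Omega> pu (u i) = c i" if "i < m" for i
    proof -
      have "L2_ip \<Omega> pu (u i) = (\<Sum>j<m. c j * L2_ip \<Omega> (u j) (u i))"
        unfolding pu_def[abs_def] by (rule L2_ip_sum_left) (use uL that in auto)
      also have "\<dots> = (\<Sum>j<m. if j = i then c i else 0)"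
        by (intro sum.cong refl) (use orth that in auto)
      finally show ?thesis using that by simp
    qed
    have "P (\<lambda>x. v x - pu x) (\<lambda>x. h x - pg x)"
      unfolding P_def using W12_0_diff[OF O vh Wp] uL pL vL pui
      by (auto simp: L2_ip_diff_left c_def)
    from EL[OF this] have "L2_ip \<Omega> k h - L2_ip \<Omega> k pg = \<nu> * (L2_ip \<Omega> w v - L2_ip \<Omega> w pu)"
      using vL pL w k by (simp add: L2_ip_diff_right)
    moreover have "L2_ip \<Omega> w pu = (\<Sum>i<m. c i * L2_ip \<Omega> w (u i))"
      unfolding pu_def[abs_def] by (rule L2_ip_sum_right) (use uL w in auto)
    moreover have "L2_ip \<Omega> k pg = (\<Sum>i<m. c i * L2_ip \<Omega> k (g i))"
      unfolding pg_def[abs_def] by (rule L2_ip_sum_right) (use uL k in auto)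
    moreover have "L2_ip \<Omega> k (g i) = 0" if "i < m" for i
      using weak_eigenD[OF eig[OF that] Wwk] wu[OF that] by (simp add: L2_ip_commute[of \<Omega> k] L2_ip_commute[of \<Omega> "u i"])
    ultimately show "L2_ip \<Omega> k h = \<nu> * L2_ip \<Omega> w v" using wu by simp
  qed
  then show ?thesis using that \<nu>\<Lambda> ww wu by blast
qed

lemma ae_dim_ge_orthonormal:
  fixes u :: "'i \<Rightarrow> 'a::euclidean_space \<Rightarrow> real"
  assumes S: "finite S" and V: "\<And>i. i \<in> S \<Longrightarrow> u i \<in> V" and L: "\<And>i. i \<in> S \<Longrightarrow> u i \<in> L2 \<Omega>"
    and orth: "\<And>i j. i \<in> S \<Longrightarrow> j \<in> S \<Longrightarrow> L2_ip \<Omega> (u i) (u j) = (if i = j then 1 else 0)"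
  shows "enat (card S) \<le> ae_dim \<Omega> V"
proof -
  obtain f where f: "bij_betw f {0..<card S} S" using ex_bij_betw_nat_finite[OF S] by blast
  have fS: "f i \<in> S" if "i < card S" for i using f that by (auto dest: bij_betwE)
  have finj: "f i = f j \<longleftrightarrow> i = j" if "i < card S" "j < card S" for i j
    using f that by (auto simp: bij_betw_def inj_on_def)
  have "ae_independent \<Omega> (card S) (\<lambda>i. u (f i))"
    unfolding ae_independent_def
  proof (intro allI impI)
    fix c j assume c: "AE x in lebesgue_on \<Omega>. (\<Sum>i<card S. c i * u (f i) x) = 0" and j: "j < card S"
    have "L2_ip \<Omega> (\<lambda>x. \<Sum>i<card S. c i *\<^sub>R u (f i) x) (u (f j)) = 0"
      by (rule L2_ip_cong_AE0) (use c in simp)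
    moreover have "L2_ip \<Omega> (\<lambda>x. \<Sum>i<card S. c i *\<^sub>R u (f i) x) (u (f j)) =
        (\<Sum>i<card S. c i * L2_ip \<Omega> (u (f i)) (u (f j)))"
      by (rule L2_ip_sum_left) (use L fS j in auto)
    moreover have "\<dots> = (\<Sum>i<card S. if i = j then c j else 0)"
      by (intro sum.cong refl) (use orth fS finj j in auto)
    ultimately show "c j = 0" using j by simp
  qed
  moreover have "\<forall>i<card S. u (f i) \<in> V" using V fS by simp
  ultimately have "\<exists>w. (\<forall>i<card S. w i \<in> V) \<and> ae_independent \<Omega> (card S) w"
    by (intro exI[of _ "\<lambda>i. u (f i)"] conjI)
  then have "enat (card S) \<in> {enat n |n. \<exists>w. (\<forall>i<n. w i \<in> V) \<and> ae_independent \<Omega> n w}"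
    by (intro CollectI exI[of _ "card S"] conjI refl)
  then show ?thesis unfolding ae_dim_def by (rule Sup_upper)
qed

text \<open>As long as fewer than \<open>card J\<close> orthonormal eigenfunctions below
  \<open>l\<^sup>2\<close> are known, the trial functions provide an admissible competitor for the
  next minimisation.\<close>

lemma N_D_ge:
  fixes \<Omega> :: "'a::euclidean_space set" and v :: "'j \<Rightarrow> 'a \<Rightarrow> real"
  assumes O: "open \<Omega>"
    and compact: "\<And>L::nat. \<exists>(m::nat) e K. K \<ge> 0 \<and> (\<forall>i<m. e i \<in> L2 \<Omega>) \<and> (\<forall>u g. W12_0 \<Omega> u g \<longrightarrow>
      real L * L2_ip \<Omega> u u \<le> K * (\<Sum>i<m. (L2_ip \<Omega> u (e i))\<^sup>2) + L2_ip \<Omega> g g)"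
    and J: "finite J" and W: "\<And>j. j \<in> J \<Longrightarrow> W12_0 \<Omega> (v j) (h j)"
    and vorth: "\<And>i j. i \<in> J \<Longrightarrow> j \<in> J \<Longrightarrow> i \<noteq> j \<Longrightarrow> L2_ip \<Omega> (v i) (v j) = 0"
    and horth: "\<And>i j. i \<in> J \<Longrightarrow> j \<in> J \<Longrightarrow> i \<noteq> j \<Longrightarrow> L2_ip \<Omega> (h i) (h j) = 0"
    and pos: "\<And>j. j \<in> J \<Longrightarrow> L2_ip \<Omega> (v j) (v j) > 0"
    and lt: "\<And>j. j \<in> J \<Longrightarrow> L2_ip \<Omega> (h j) (h j) < l\<^sup>2 * L2_ip \<Omega> (v j) (v j)"
  shows "enat (card J) \<le> N_D \<Omega> l"
proof -
  have "\<exists>\<mu> u g. (\<forall>i<m. weak_eigen \<Omega> (\<mu> i) (u i) (g i) \<and> \<mu> i < l\<^sup>2) \<and>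
     (\<forall>i<m. \<forall>j<m. L2_ip \<Omega> (u i) (u j) = (if i = j then 1 else 0))" if "m \<le> card J" for m :: nat
    using that
  proof (induction m)
    case 0
    then show ?case by auto
  next
    case (Suc m)
    from Suc.IH[OF Suc_leD[OF Suc.prems]] obtain \<mu> u g where
      "\<forall>i<m. weak_eigen \<Omega> (\<mu> i) (u i) (g i) \<and> \<mu> i < l\<^sup>2"
      "\<forall>i<m. \<forall>j<m. L2_ip \<Omega> (u i) (u j) = (if i = j then 1 else 0)" by blast
    then have IH: "\<And>i. i < m \<Longrightarrow> weak_eigen \<Omega> (\<mu> i) (u i) (g i)" "\<And>i. i < m \<Longrightarrow> \<mu> i < l\<^sup>2"
      "\<And>i j. i < m \<Longrightarrow> j < m \<Longrightarrow> L2_ip \<Omega> (u i) (u j) = (if i = j then 1 else 0)" by simp_all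
    have uL: "u i \<in> L2 \<Omega>" if "i < m" for i
      using W12_0_L2[OF weak_eigen_W12_0[OF IH(1)[OF that]]] by simp
    \<comment> \<open>There are fewer constraints than trial functions, so a nontrivial combination
      is orthogonal to the eigenfunctions found so far. Orthogonality of the \<open>v j\<close> and
      of the \<open>h j\<close> keeps its Rayleigh quotient below \<open>l\<^sup>2\<close>.\<close>
    have "card {..<m} < card J" using Suc.prems by simp
    from homogeneous_system_nontrivial_solution[OF _ J this, of "\<lambda>i j. L2_ip \<Omega> (v j) (u i)"]
    obtain c where c: "\<exists>j\<in>J. c j \<noteq> 0" "\<And>i. i < m \<Longrightarrow> (\<Sum>j\<in>J. c j * L2_ip \<Omega> (v j) (u i)) = 0"
      by auto
    define V H where "V x = (\<Sum>j\<in>J. c j *\<^sub>R v j x)" and "H x = (\<Sum>j\<in>J. c j *\<^sub>R h j x)" for x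
    have WV: "W12_0 \<Omega> V H" unfolding V_def[abs_def] H_def[abs_def] by (rule W12_0_sum[OF O W])
    have VV: "L2_ip \<Omega> V V = (\<Sum>j\<in>J. (c j)\<^sup>2 * L2_ip \<Omega> (v j) (v j))"
      unfolding V_def[abs_def] by (rule L2_ip_orthogonal_sum[OF J W12_0_L2(1)[OF W] vorth])
    have HH: "L2_ip \<Omega> H H = (\<Sum>j\<in>J. (c j)\<^sup>2 * L2_ip \<Omega> (h j) (h j))"
      unfolding H_def[abs_def] by (rule L2_ip_orthogonal_sum[OF J W12_0_L2(2)[OF W] horth])
    obtain p where p: "p \<in> J" "c p \<noteq> 0" using c(1) by auto
    have Vpos: "L2_ip \<Omega> V V > 0"
      unfolding VV by (rule sum_pos2[OF J p(1)]) (use p pos less_imp_le[OF pos] in auto)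
    have "(\<Sum>j\<in>J. (c j)\<^sup>2 * L2_ip \<Omega> (h j) (h j)) < (\<Sum>j\<in>J. (c j)\<^sup>2 * (l\<^sup>2 * L2_ip \<Omega> (v j) (v j)))"
    proof (rule sum_strict_mono_ex1[OF J])
      show "\<forall>j\<in>J. (c j)\<^sup>2 * L2_ip \<Omega> (h j) (h j) \<le> (c j)\<^sup>2 * (l\<^sup>2 * L2_ip \<Omega> (v j) (v j))"
        using mult_left_mono[OF less_imp_le[OF lt] zero_le_power2] by blast
      show "\<exists>j\<in>J. (c j)\<^sup>2 * L2_ip \<Omega> (h j) (h j) < (c j)\<^sup>2 * (l\<^sup>2 * L2_ip \<Omega> (v j) (v j))"
        using p lt[OF p(1)] by (intro bexI[of _ p]) (auto intro!: mult_strict_left_mono)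
    qed
    then have HV: "L2_ip \<Omega> H H < l\<^sup>2 * L2_ip \<Omega> V V"
      by (simp add: HH VV sum_distrib_left mult_ac)
    have Vu: "L2_ip \<Omega> V (u i) = 0" if "i < m" for i
    proof -
      have "L2_ip \<Omega> V (u i) = (\<Sum>j\<in>J. c j * L2_ip \<Omega> (v j) (u i))"
        unfolding V_def[abs_def] by (rule L2_ip_sum_left) (use W12_0_L2(1)[OF W] uL[OF that] in auto)
      then show ?thesis using c(2)[OF that] by simp
    qed
    obtain \<nu> w k where w: "weak_eigen \<Omega> \<nu> w k" "\<nu> < l\<^sup>2" "L2_ip \<Omega> w w = 1" "\<forall>i<m. L2_ip \<Omega> w (u i) = 0"
      by (rule exists_next_eigenfunction[where u=u and g=g and \<mu>=\<mu> and m=m, OF O compact IH(1) IH(3) WV Vu Vpos HV]) (assumption | rule that)+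
    have uw: "\<forall>i<m. L2_ip \<Omega> (u i) w = 0" using w(4) by (subst L2_ip_commute)
    show ?case
    proof (intro exI conjI allI impI)
      fix i assume "i < Suc m"
      then show "weak_eigen \<Omega> ((\<mu>(m := \<nu>)) i) ((u(m := w)) i) ((g(m := k)) i)"
        "(\<mu>(m := \<nu>)) i < l\<^sup>2"
        using IH(1,2) w by (auto simp: less_Suc_eq)
      fix j assume "j < Suc m"
      then show "L2_ip \<Omega> ((u(m := w)) i) ((u(m := w)) j) = (if i = j then 1 else 0)"
        using \<open>i < Suc m\<close> IH(3) w(3,4) uw by (auto simp: less_Suc_eq)
    qed
  qed
  from this[OF order_refl] obtain \<mu> u g where
    "\<forall>i<card J. weak_eigen \<Omega> (\<mu> i) (u i) (g i) \<and> \<mu> i < l\<^sup>2"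
    "\<forall>i<card J. \<forall>j<card J. L2_ip \<Omega> (u i) (u j) = (if i = j then 1 else 0)" by blast
  then have eig: "\<And>i. i < card J \<Longrightarrow> weak_eigen \<Omega> (\<mu> i) (u i) (g i)"
    "\<And>i. i < card J \<Longrightarrow> \<mu> i < l\<^sup>2"
    "\<And>i j. i < card J \<Longrightarrow> j < card J \<Longrightarrow> L2_ip \<Omega> (u i) (u j) = (if i = j then 1 else 0)" by simp_all
  \<comment> \<open>\<open>N_D\<close> sums over eigenvalues, so the eigenfunctions are sorted into
    groups \<open>S \<nu>\<close> with a common eigenvalue.\<close>
  define F where "F = \<mu> ` {..<card J}"
  define S where "S \<nu> = {i. i < card J \<and> \<mu> i = \<nu>}" for \<nu>
  have fin: "finite F" "\<And>\<nu>. finite (S \<nu>)" by (auto simp: F_def S_def)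
  have "(\<Union>\<nu>\<in>F. S \<nu>) = {..<card J}" by (auto simp: F_def S_def)
  then have "card J = card (\<Union>\<nu>\<in>F. S \<nu>)" by simp
  also have "\<dots> = (\<Sum>\<nu>\<in>F. card (S \<nu>))"
    by (rule card_UN_disjoint) (use fin in \<open>auto simp: S_def\<close>)
  finally have "enat (card J) = (\<Sum>\<nu>\<in>F. enat (card (S \<nu>)))"
    using fin(1) by (simp add: of_nat_eq_enat[symmetric])
  also have "\<dots> \<le> (\<Sum>\<nu>\<in>F. ae_dim \<Omega> (dirichlet_eigenspace \<Omega> \<nu>))"
  proof (rule sum_mono)
    fix \<nu> assume "\<nu> \<in> F"
    have e: "weak_eigen \<Omega> \<nu> (u i) (g i)" if "i \<in> S \<nu>" for i
      using eig(1)[of i] that by (auto simp: S_def)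
    show "enat (card (S \<nu>)) \<le> ae_dim \<Omega> (dirichlet_eigenspace \<Omega> \<nu>)"
    proof (rule ae_dim_ge_orthonormal[OF fin(2), of _ u])
      fix i assume i: "i \<in> S \<nu>"
      show "u i \<in> dirichlet_eigenspace \<Omega> \<nu>" using e[OF i] by (auto simp: dirichlet_eigenspace_iff)
      show "u i \<in> L2 \<Omega>" by (rule W12_0_L2(1)[OF weak_eigen_W12_0[OF e[OF i]]])
      fix j assume "j \<in> S \<nu>"
      with i show "L2_ip \<Omega> (u i) (u j) = (if i = j then 1 else 0)" using eig(3) by (simp add: S_def)
    qed
  qed
  also have "\<dots> \<le> N_D \<Omega> l"
    unfolding N_D_def by (rule SUP_upper) (use fin eig(2) in \<open>auto simp: F_def\<close>)
  finally show ?thesis .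
qed

section \<open>The Neumann inequality on a cube\<close>

lemma integral_prod_Basis:
  fixes f :: "'a::euclidean_space \<Rightarrow> real \<Rightarrow> real"
  assumes int: "\<And>b. b \<in> Basis \<Longrightarrow> integrable lborel (f b)"
  shows "(\<integral>x. (\<Prod>b\<in>Basis. f b (x \<bullet> b)) \<partial>lborel) = (\<Prod>b\<in>Basis. \<integral>t. f b t \<partial>lborel)"
proof -
  interpret product_sigma_finite "\<lambda>_::'a. lborel :: real measure"
    by standard
  have m: "f b \<in> borel_measurable borel" if "b \<in> Basis" for b
    using borel_measurable_integrable[OF int[OF that]] by simp
  have "(\<integral>x. (\<Prod>b\<in>Basis. f b (x \<bullet> b)) \<partial>lborel) =
      (\<integral>y. (\<Prod>b\<in>Basis. f b ((\<Sum>i\<in>Basis. y i *\<^sub>R i) \<bullet> b)) \<partial>(\<Pi>\<^sub>M b\<in>Basis. lborel))"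
    by (subst lborel_eq, subst integral_distr) (use m in measurable)
  also have "\<dots> = (\<integral>y. (\<Prod>b\<in>Basis. f b (y b)) \<partial>(\<Pi>\<^sub>M b\<in>Basis. lborel))"
    by (intro Bochner_Integration.integral_cong refl prod.cong)
      (simp add: inner_sum_left inner_Basis if_distrib sum.delta cong: if_cong)
  also have "\<dots> = (\<Prod>b\<in>Basis. \<integral>t. f b t \<partial>lborel)"
    by (rule product_integral_prod) (use int in auto)
  finally show ?thesis .
qed

lemma indicator_cbox_prod:
  "indicator (cbox l u) x = (\<Prod>b\<in>Basis. indicator {l \<bullet> b..u \<bullet> b} (x \<bullet> b) :: real)"
proof (cases "x \<in> cbox l u")
  case True
  then show ?thesis by (auto simp: mem_box intro!: prod.neutral[symmetric])
next
  case False
  then obtain b where "b \<in> Basis" "x \<bullet> b \<notin> {l \<bullet> b..u \<bullet> b}" by (auto simp: mem_box)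
  then have "\<exists>b\<in>Basis. indicator {l \<bullet> b..u \<bullet> b} (x \<bullet> b) = (0::real)" by (intro bexI[of _ b]) auto
  then show ?thesis using False by (simp add: prod_zero)
qed

lemma continuous_on_prod_Basis:
  fixes F :: "'a::euclidean_space \<Rightarrow> real \<Rightarrow> real"
  assumes "\<And>b. b \<in> Basis \<Longrightarrow> continuous_on UNIV (F b)"
  shows "continuous_on S (\<lambda>x. \<Prod>b\<in>Basis. F b (x \<bullet> b))"
  by (intro continuous_on_prod continuous_on_compose2[OF assms] continuous_intros) auto

lemma continuous_L2_cbox:
  fixes f :: "'a::euclidean_space \<Rightarrow> 'b::euclidean_space"
  assumes "continuous_on UNIV f"
  shows "f \<in> L2 (cbox l u)"
proof -
  have "compact (f ` cbox l u)"
    by (intro compact_continuous_image continuous_on_subset[OF assms]) auto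
  then obtain M where "\<And>x. x \<in> cbox l u \<Longrightarrow> norm (f x) \<le> M"
    by (metis bounded_iff compact_imp_bounded imageI)
  then show ?thesis
    by (intro L2_bounded borel_measurable_continuous_onI assms) auto
qed

lemma L2_ip_cbox:
  fixes f g :: "'a::euclidean_space \<Rightarrow> 'b::euclidean_space"
  assumes "f \<in> borel_measurable borel" "g \<in> borel_measurable borel" "S \<in> sets borel"
  shows "L2_ip S f g = (\<integral>x. indicator S x * (f x \<bullet> g x) \<partial>lborel)"
proof -
  have m: "(\<lambda>x. f x \<bullet> g x) \<in> borel_measurable borel" using assms by measurable
  show ?thesis using lebesgue_on_borel(2)[OF assms(3) m] by (simp add: L2_ip_def)
qed

lemma L2_ip_cbox_prod:
  fixes F G :: "'a::euclidean_space \<Rightarrow> real \<Rightarrow> real"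
  assumes F: "\<And>b. b \<in> Basis \<Longrightarrow> continuous_on UNIV (F b)"
    and G: "\<And>b. b \<in> Basis \<Longrightarrow> continuous_on UNIV (G b)"
  shows "L2_ip (cbox l u) (\<lambda>x. \<Prod>b\<in>Basis. F b (x \<bullet> b)) (\<lambda>x. \<Prod>b\<in>Basis. G b (x \<bullet> b)) =
    (\<Prod>b\<in>Basis. \<integral>t. (F b t * G b t) * indicator {l \<bullet> b..u \<bullet> b} t \<partial>lborel)"
proof -
  have "L2_ip (cbox l u) (\<lambda>x. \<Prod>b\<in>Basis. F b (x \<bullet> b)) (\<lambda>x. \<Prod>b\<in>Basis. G b (x \<bullet> b)) =
      (\<integral>x. (\<Prod>b\<in>Basis. (F b (x \<bullet> b) * G b (x \<bullet> b)) * indicator {l \<bullet> b..u \<bullet> b} (x \<bullet> b)) \<partial>lborel)"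
    by (subst L2_ip_cbox)
      (auto intro!: borel_measurable_continuous_onI continuous_on_prod_Basis F G
        simp: indicator_cbox_prod prod.distrib mult_ac)
  also have "\<dots> = (\<Prod>b\<in>Basis. \<integral>t. (F b t * G b t) * indicator {l \<bullet> b..u \<bullet> b} t \<partial>lborel)"
  proof (rule integral_prod_Basis)
    fix b :: 'a assume b: "b \<in> Basis"
    have "integrable lborel (\<lambda>t. indicator {l \<bullet> b..u \<bullet> b} t *\<^sub>R (F b t * G b t))"
      by (intro borel_integrable_compact continuous_on_mult continuous_on_subset[OF F[OF b]]
          continuous_on_subset[OF G[OF b]]) auto
    then show "integrable lborel (\<lambda>t. (F b t * G b t) * indicator {l \<bullet> b..u \<bullet> b} t)"
      by (simp add: mult.commute)
  qed
  finally show ?thesis .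
qed

section \<open>Products of sines and cosines on a cube\<close>

text \<open>For natural \<open>\<kappa>\<close>, these cosines are the Neumann modes of the interval
  from \<open>p\<close> to \<open>p + a\<close>; the sines below are its Dirichlet modes.\<close>

definition cosw :: "real \<Rightarrow> real \<Rightarrow> real \<Rightarrow> real \<Rightarrow> real" where
  "cosw p a \<kappa> t = cos (\<kappa> * pi / a * (t - p))"

definition sinw :: "real \<Rightarrow> real \<Rightarrow> real \<Rightarrow> real \<Rightarrow> real" where
  "sinw p a \<kappa> t = sin (\<kappa> * pi / a * (t - p))"

lemma sin_pi_Ints: "j \<in> \<int> \<Longrightarrow> sin (j * pi) = 0"
  by (auto elim!: Ints_cases simp: sin_zero_iff_int2)

lemma continuous_on_cosw [continuous_intros]: "continuous_on S (cosw p a \<kappa>)"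
  unfolding cosw_def[abs_def] by (intro continuous_intros)

lemma continuous_on_sinw [continuous_intros]: "continuous_on S (sinw p a \<kappa>)"
  unfolding sinw_def[abs_def] by (intro continuous_intros)

lemma integral_cosw:
  assumes a: "a > 0" and j: "j \<in> \<int>"
  shows "(\<integral>t. cosw p a j t * indicator {p..p + a} t \<partial>lborel) = (if j = 0 then a else 0)"
proof (cases "j = 0")
  case True
  then show ?thesis using a by (simp add: cosw_def)
next
  case False
  have "(\<integral>t. cosw p a j t * indicator {p..p + a} t \<partial>lborel) =
      a / (j * pi) * sinw p a j (p + a) - a / (j * pi) * sinw p a j p"
    by (rule integral_FTC_Icc_real)
      (use a False in \<open>auto simp: cosw_def[abs_def] sinw_def[abs_def] intro!: derivative_eq_intros continuous_intros\<close>)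
  then show ?thesis using a False sin_pi_Ints[OF j] by (simp add: sinw_def)
qed

lemma integrable_cosw: "integrable lborel (\<lambda>t. cosw p a j t * indicator {q..r} t)"
  using borel_integrable_compact[OF compact_Icc continuous_on_cosw[of "{q..r}" p a j]]
  by (simp add: mult.commute)

lemma integral_cosw_cosw:
  assumes a: "a > 0" and k: "\<kappa> \<in> \<nat>" "\<nu> \<in> \<nat>"
  shows "(\<integral>t. (cosw p a \<kappa> t * cosw p a \<nu> t) * indicator {p..p + a} t \<partial>lborel) =
    (if \<kappa> = \<nu> then if \<kappa> = 0 then a else a / 2 else 0)"
proof -
  have I: "\<kappa> - \<nu> \<in> \<int>" "\<kappa> + \<nu> \<in> \<int>" using k by (simp_all add: Ints_diff Ints_add subsetD[OF Nats_subset_Ints])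
  have nn: "\<kappa> \<ge> 0" "\<nu> \<ge> 0" using k by (auto elim!: Nats_cases)
  have "(\<integral>t. (cosw p a \<kappa> t * cosw p a \<nu> t) * indicator {p..p + a} t \<partial>lborel) =
      (\<integral>t. (1/2) * (cosw p a (\<kappa> - \<nu>) t * indicator {p..p + a} t) +
        (1/2) * (cosw p a (\<kappa> + \<nu>) t * indicator {p..p + a} t) \<partial>lborel)"
    by (intro Bochner_Integration.integral_cong refl)
      (simp add: cosw_def cos_times_cos algebra_simps add_divide_distrib diff_divide_distrib)
  also have "\<dots> = (1/2) * (if \<kappa> - \<nu> = 0 then a else 0) + (1/2) * (if \<kappa> + \<nu> = 0 then a else 0)"
    by (simp add: integrable_cosw integral_cosw[OF a I(1)] integral_cosw[OF a I(2)])
  finally show ?thesis using nn by auto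
qed

lemma integral_sinw_sinw:
  assumes a: "a > 0" and k: "\<kappa> \<in> \<nat>" "\<nu> \<in> \<nat>"
  shows "(\<integral>t. (sinw p a \<kappa> t * sinw p a \<nu> t) * indicator {p..p + a} t \<partial>lborel) =
    (if \<kappa> = \<nu> \<and> \<kappa> \<noteq> 0 then a / 2 else 0)"
proof -
  have I: "\<kappa> - \<nu> \<in> \<int>" "\<kappa> + \<nu> \<in> \<int>" using k by (simp_all add: Ints_diff Ints_add subsetD[OF Nats_subset_Ints])
  have nn: "\<kappa> \<ge> 0" "\<nu> \<ge> 0" using k by (auto elim!: Nats_cases)
  have "(\<integral>t. (sinw p a \<kappa> t * sinw p a \<nu> t) * indicator {p..p + a} t \<partial>lborel) =
      (\<integral>t. (1/2) * (cosw p a (\<kappa> - \<nu>) t * indicator {p..p + a} t) -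
        (1/2) * (cosw p a (\<kappa> + \<nu>) t * indicator {p..p + a} t) \<partial>lborel)"
    by (intro Bochner_Integration.integral_cong refl)
      (simp add: cosw_def sinw_def sin_times_sin algebra_simps add_divide_distrib diff_divide_distrib)
  also have "\<dots> = (1/2) * (if \<kappa> - \<nu> = 0 then a else 0) - (1/2) * (if \<kappa> + \<nu> = 0 then a else 0)"
    by (simp add: integrable_cosw integral_cosw[OF a I(1)] integral_cosw[OF a I(2)])
  finally show ?thesis using nn by auto
qed

definition nat_lattice :: "'a::euclidean_space set" where
  "nat_lattice = {k. \<forall>b\<in>Basis. k \<bullet> b \<in> \<nat>}"

text \<open>\<open>mixk c a B k\<close> has a sine factor in the directions of \<open>B\<close> and cosine factors in the others.\<close>

definition mixk :: "'a::euclidean_space \<Rightarrow> real \<Rightarrow> 'a set \<Rightarrow> 'a \<Rightarrow> 'a \<Rightarrow> real" where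
  "mixk c a B k x = (\<Prod>b\<in>Basis. (if b \<in> B then sinw else cosw) (c \<bullet> b) a (k \<bullet> b) (x \<bullet> b))"

text \<open>The squared norm of \<open>mixk c a B k\<close> on its cube. A sine factor of frequency
  0 vanishes, whence the entry 0; a cosine factor of frequency 0 is constant, whence
  \<open>a\<close> in place of \<open>a / 2\<close>.\<close>

definition mix_norm :: "real \<Rightarrow> 'a::euclidean_space set \<Rightarrow> 'a \<Rightarrow> real" where
  "mix_norm a B k = (\<Prod>b\<in>Basis. if b \<in> B then (if k \<bullet> b = 0 then 0 else a / 2) else (if k \<bullet> b = 0 then a else a / 2))"

abbreviation cube :: "'a::euclidean_space \<Rightarrow> real \<Rightarrow> 'a set" where
  "cube c a \<equiv> cbox c (c + a *\<^sub>R One)"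

lemma continuous_on_mixk [continuous_intros]: "continuous_on S (mixk c a B k)"
  unfolding mixk_def[abs_def] by (intro continuous_on_prod_Basis) (auto intro: continuous_intros)

lemma mixk_L2: "mixk c a B k \<in> L2 (cbox l u)"
  by (intro continuous_L2_cbox continuous_on_mixk)

lemma L2_ip_mixk:
  assumes a: "a > 0" and k: "k \<in> nat_lattice" "m \<in> nat_lattice"
  shows "L2_ip (cube c a) (mixk c a B k) (mixk c a B m) = (if k = m then mix_norm a B k else 0)"
proof -
  have "L2_ip (cube c a) (mixk c a B k) (mixk c a B m) = (\<Prod>b\<in>Basis.
      \<integral>t. ((if b \<in> B then sinw else cosw) (c \<bullet> b) a (k \<bullet> b) t *
        (if b \<in> B then sinw else cosw) (c \<bullet> b) a (m \<bullet> b) t) * indicator {c \<bullet> b..(c + a *\<^sub>R One) \<bullet> b} t \<partial>lborel)"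
    unfolding mixk_def[abs_def] by (rule L2_ip_cbox_prod) (auto intro: continuous_intros)
  also have "\<dots> = (\<Prod>b\<in>Basis. if k \<bullet> b = m \<bullet> b then
      (if b \<in> B then (if k \<bullet> b = 0 then 0 else a / 2) else (if k \<bullet> b = 0 then a else a / 2)) else 0)"
  proof (rule prod.cong[OF refl])
    fix b :: 'a assume b: "b \<in> Basis"
    have kb: "k \<bullet> b \<in> \<nat>" "m \<bullet> b \<in> \<nat>" using k b by (auto simp: nat_lattice_def)
    have cb: "(c + a *\<^sub>R One) \<bullet> b = c \<bullet> b + a" using b by (simp add: inner_add_left)
    show "(\<integral>t. ((if b \<in> B then sinw else cosw) (c \<bullet> b) a (k \<bullet> b) t *
        (if b \<in> B then sinw else cosw) (c \<bullet> b) a (m \<bullet> b) t) * indicator {c \<bullet> b..(c + a *\<^sub>R One) \<bullet> b} t \<partial>lborel) =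
      (if k \<bullet> b = m \<bullet> b then
      (if b \<in> B then (if k \<bullet> b = 0 then 0 else a / 2) else (if k \<bullet> b = 0 then a else a / 2)) else 0)"
      unfolding cb using integral_cosw_cosw[OF a kb, of "c \<bullet> b"] integral_sinw_sinw[OF a kb, of "c \<bullet> b"]
      by (cases "b \<in> B") auto
  qed
  also have "\<dots> = (if k = m then mix_norm a B k else 0)"
  proof (cases "k = m")
    case True
    show ?thesis unfolding True mix_norm_def by simp
  next
    case False
    then obtain b where "b \<in> Basis" "k \<bullet> b \<noteq> m \<bullet> b" by (meson euclidean_eqI)
    then have "(\<Prod>b\<in>Basis. if k \<bullet> b = m \<bullet> b then
      (if b \<in> B then (if k \<bullet> b = 0 then 0 else a / 2) else (if k \<bullet> b = 0 then a else a / 2)) else 0) = 0"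
      by (intro prod_zero bexI[of _ b]) auto
    then show ?thesis using False by simp
  qed
  finally show ?thesis .
qed

lemma mix_norm_pos:
  assumes "a > 0" "\<And>b. b \<in> B \<Longrightarrow> b \<in> Basis \<Longrightarrow> k \<bullet> b \<noteq> 0"
  shows "mix_norm a B k > 0"
  unfolding mix_norm_def using assms by (intro prod_pos) auto

lemma mix_norm_eq:
  assumes "\<And>b. b \<in> B \<Longrightarrow> b \<in> Basis \<Longrightarrow> k \<bullet> b \<noteq> 0"
  shows "mix_norm a B k = mix_norm a {} k"
  unfolding mix_norm_def using assms by (intro prod.cong) auto

section \<open>Bessel's inequality and approximation\<close>

lemma L2_ip_diff_orthogonal_combination:
  fixes f :: "'a::euclidean_space \<Rightarrow> real"
  assumes "finite I" "f \<in> L2 S" "\<And>i. i \<in> I \<Longrightarrow> e i \<in> L2 S"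
    and orth: "\<And>i j. i \<in> I \<Longrightarrow> j \<in> I \<Longrightarrow> i \<noteq> j \<Longrightarrow> L2_ip S (e i) (e j) = 0"
  shows "L2_ip S (\<lambda>x. f x - (\<Sum>i\<in>I. p i *\<^sub>R e i x)) (\<lambda>x. f x - (\<Sum>i\<in>I. p i *\<^sub>R e i x)) =
    L2_ip S f f - 2 * (\<Sum>i\<in>I. p i * L2_ip S f (e i)) + (\<Sum>i\<in>I. (p i)\<^sup>2 * L2_ip S (e i) (e i))"
proof -
  define q where "q x = (\<Sum>i\<in>I. p i *\<^sub>R e i x)" for x
  have q: "q \<in> L2 S" unfolding q_def[abs_def] by (intro L2_sum L2_scaleR assms)
  have "L2_ip S (\<lambda>x. f x + (-1) *\<^sub>R q x) (\<lambda>x. f x + (-1) *\<^sub>R q x) =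
      L2_ip S f f - 2 * L2_ip S f q + L2_ip S q q"
    using L2_ip_add_scaled_self[OF assms(2) q, of "-1"] by simp
  moreover have "L2_ip S f q = (\<Sum>i\<in>I. p i * L2_ip S f (e i))"
    unfolding q_def[abs_def] by (intro L2_ip_sum_right assms)
  moreover have "L2_ip S q q = (\<Sum>i\<in>I. (p i)\<^sup>2 * L2_ip S (e i) (e i))"
    unfolding q_def[abs_def] by (intro L2_ip_orthogonal_sum assms)
  ultimately show ?thesis by (simp add: q_def)
qed

lemma Bessel_inequality:
  fixes f :: "'a::euclidean_space \<Rightarrow> real"
  assumes I: "finite I" and f: "f \<in> L2 S" and e: "\<And>i. i \<in> I \<Longrightarrow> e i \<in> L2 S"
    and orth: "\<And>i j. i \<in> I \<Longrightarrow> j \<in> I \<Longrightarrow> i \<noteq> j \<Longrightarrow> L2_ip S (e i) (e j) = 0"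
    and N: "\<And>i. i \<in> I \<Longrightarrow> L2_ip S (e i) (e i) = N i" "\<And>i. i \<in> I \<Longrightarrow> N i > 0"
  shows "(\<Sum>i\<in>I. (L2_ip S f (e i))\<^sup>2 / N i) \<le> L2_ip S f f"
proof -
  let ?p = "\<lambda>i. L2_ip S f (e i) / N i"
  have "0 \<le> L2_ip S f f - 2 * (\<Sum>i\<in>I. ?p i * L2_ip S f (e i)) + (\<Sum>i\<in>I. (?p i)\<^sup>2 * L2_ip S (e i) (e i))"
  proof -
    have "0 \<le> L2_ip S (\<lambda>x. f x - (\<Sum>i\<in>I. ?p i *\<^sub>R e i x)) (\<lambda>x. f x - (\<Sum>i\<in>I. ?p i *\<^sub>R e i x))"
      by (rule L2_ip_self_nonneg)
    also have "\<dots> = L2_ip S f f - 2 * (\<Sum>i\<in>I. ?p i * L2_ip S f (e i)) + (\<Sum>i\<in>I. (?p i)\<^sup>2 * L2_ip S (e i) (e i))"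
      by (rule L2_ip_diff_orthogonal_combination[where e=e, OF I f e orth])
    finally show ?thesis .
  qed
  moreover have "(\<Sum>i\<in>I. (?p i)\<^sup>2 * L2_ip S (e i) (e i)) = (\<Sum>i\<in>I. (L2_ip S f (e i))\<^sup>2 / N i)"
    using N by (intro sum.cong refl) (simp add: power2_eq_square field_simps)
  moreover have "(\<Sum>i\<in>I. ?p i * L2_ip S f (e i)) = (\<Sum>i\<in>I. (L2_ip S f (e i))\<^sup>2 / N i)"
    by (intro sum.cong refl) (simp add: power2_eq_square)
  ultimately show ?thesis by simp
qed

text \<open>A replacement for Parseval's identity: no coefficients \<open>p\<close> approximate
  better than the Fourier coefficients. An approximant with arbitrary coefficients is therefore
  sufficient, such as the one that Stone-Weierstrass provides.\<close>

lemma L2_ip_le_of_approximation: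
  fixes f :: "'a::euclidean_space \<Rightarrow> real"
  assumes I: "finite I" and f: "f \<in> L2 S" and e: "\<And>i. i \<in> I \<Longrightarrow> e i \<in> L2 S"
    and orth: "\<And>i j. i \<in> I \<Longrightarrow> j \<in> I \<Longrightarrow> i \<noteq> j \<Longrightarrow> L2_ip S (e i) (e j) = 0"
    and N: "\<And>i. i \<in> I \<Longrightarrow> L2_ip S (e i) (e i) = N i" "\<And>i. i \<in> I \<Longrightarrow> N i > 0"
  shows "L2_ip S f f \<le> (\<Sum>i\<in>I. (L2_ip S f (e i))\<^sup>2 / N i) +
    L2_ip S (\<lambda>x. f x - (\<Sum>i\<in>I. p i *\<^sub>R e i x)) (\<lambda>x. f x - (\<Sum>i\<in>I. p i *\<^sub>R e i x))"
proof -
  have "2 * (p i * L2_ip S f (e i)) - (p i)\<^sup>2 * L2_ip S (e i) (e i) \<le> (L2_ip S f (e i))\<^sup>2 / N i" if i: "i \<in> I" for i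
  proof -
    define A where "A = L2_ip S f (e i)"
    have "0 \<le> (A - p i * N i)\<^sup>2 / N i" using N(2)[OF i] by simp
    also have "\<dots> = A\<^sup>2 / N i - 2 * (p i * A) + (p i)\<^sup>2 * N i"
      using N(2)[OF i] by (simp add: power2_eq_square field_simps)
    finally show ?thesis using N(1)[OF i] by (simp add: A_def)
  qed
  then have "(\<Sum>i\<in>I. 2 * (p i * L2_ip S f (e i)) - (p i)\<^sup>2 * L2_ip S (e i) (e i)) \<le> (\<Sum>i\<in>I. (L2_ip S f (e i))\<^sup>2 / N i)"
    by (rule sum_mono)
  then have "2 * (\<Sum>i\<in>I. p i * L2_ip S f (e i)) - (\<Sum>i\<in>I. (p i)\<^sup>2 * L2_ip S (e i) (e i)) \<le>
      (\<Sum>i\<in>I. (L2_ip S f (e i))\<^sup>2 / N i)"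
    by (simp add: sum_subtractf sum_distrib_left)
  moreover have "L2_ip S (\<lambda>x. f x - (\<Sum>i\<in>I. p i *\<^sub>R e i x)) (\<lambda>x. f x - (\<Sum>i\<in>I. p i *\<^sub>R e i x)) =
    L2_ip S f f - 2 * (\<Sum>i\<in>I. p i * L2_ip S f (e i)) + (\<Sum>i\<in>I. (p i)\<^sup>2 * L2_ip S (e i) (e i))"
    by (rule L2_ip_diff_orthogonal_combination[where e=e, OF I f e orth])
  ultimately show ?thesis by linarith
qed

section \<open>Density of the cosine products\<close>

text \<open>Generated by the linear operations only; closure under products, which Stone-Weierstrass
  requires, comes from the product formula for cosines. The inductive form spares the handling of
  explicit finite sums until \<open>cos_polys_expand\<close>.\<close>

inductive_set cos_polys :: "'a::euclidean_space \<Rightarrow> real \<Rightarrow> ('a \<Rightarrow> real) set" for c a where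
  base: "k \<in> nat_lattice \<Longrightarrow> mixk c a {} k \<in> cos_polys c a"
| add: "f \<in> cos_polys c a \<Longrightarrow> g \<in> cos_polys c a \<Longrightarrow> (\<lambda>x. f x + g x) \<in> cos_polys c a"
| cmult: "f \<in> cos_polys c a \<Longrightarrow> (\<lambda>x. r * f x) \<in> cos_polys c a"

lemma zero_nat_lattice: "0 \<in> nat_lattice"
  by (simp add: nat_lattice_def)

lemma cos_polys_const: "(\<lambda>x. r) \<in> cos_polys c a"
proof -
  have 1: "mixk c a {} 0 x = 1" for x by (simp add: mixk_def cosw_def)
  have "mixk c a {} 0 \<in> cos_polys c a" by (rule cos_polys.base[OF zero_nat_lattice])
  from cos_polys.cmult[OF this, of r] show ?thesis by (simp add: 1)
qed

lemma cos_polys_sum: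
  assumes "\<And>i. i \<in> I \<Longrightarrow> f i \<in> cos_polys c a"
  shows "(\<lambda>x. \<Sum>i\<in>I. f i x) \<in> cos_polys c a"
proof (cases "finite I")
  case True
  then show ?thesis using assms
    by (induction I) (auto intro: cos_polys_const cos_polys.add)
qed (auto intro: cos_polys_const)

text \<open>The formula for a product of two cosines is applied in each coordinate and expanded over
  the subsets \<open>X\<close> of \<open>Basis\<close>: frequencies are subtracted in the directions
  of \<open>X\<close> and added in the others. As the cosine is even, absolute values keep the
  differences in \<open>nat_lattice\<close>.\<close>

lemma cos_polys_base_mult:
  assumes k: "k \<in> nat_lattice" and m: "m \<in> nat_lattice"
  shows "(\<lambda>x. mixk c a {} k x * mixk c a {} m x) \<in> cos_polys c a"
proof -
  define q where "q X = (\<Sum>b\<in>Basis. (if b \<in> X then \<bar>k \<bullet> b - m \<bullet> b\<bar> else k \<bullet> b + m \<bullet> b) *\<^sub>R b)" for X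
  have qb: "q X \<bullet> b = (if b \<in> X then \<bar>k \<bullet> b - m \<bullet> b\<bar> else k \<bullet> b + m \<bullet> b)" if "b \<in> Basis" for X b
    using that by (simp add: q_def inner_sum_left_Basis)
  have q: "q X \<in> nat_lattice" for X
    unfolding nat_lattice_def
  proof (intro CollectI ballI)
    fix b :: 'a assume b: "b \<in> Basis"
    have "k \<bullet> b \<in> \<nat>" "m \<bullet> b \<in> \<nat>" using k m b by (auto simp: nat_lattice_def)
    obtain i where "k \<bullet> b = real i" using \<open>k \<bullet> b \<in> \<nat>\<close> by (rule Nats_cases)
    moreover obtain j where "m \<bullet> b = real j" using \<open>m \<bullet> b \<in> \<nat>\<close> by (rule Nats_cases)
    moreover have "\<bar>real i - real j\<bar> = real (if i \<ge> j then i - j else j - i)" by auto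
    ultimately show "q X \<bullet> b \<in> \<nat>" using b by (simp add: qb) 
  qed
  have "mixk c a {} k x * mixk c a {} m x =
      (\<Sum>X\<in>Pow Basis. (1/2) ^ DIM('a) * mixk c a {} (q X) x)" for x
  proof -
    let ?A = "\<lambda>b. k \<bullet> b * pi / a * (x \<bullet> b - c \<bullet> b)" and ?B = "\<lambda>b. m \<bullet> b * pi / a * (x \<bullet> b - c \<bullet> b)"
    have "mixk c a {} k x * mixk c a {} m x = (\<Prod>b\<in>Basis. cos (?A b - ?B b) * (1/2) + cos (?A b + ?B b) * (1/2))"
      by (simp add: mixk_def cosw_def prod.distrib[symmetric] cos_times_cos add_divide_distrib)
    also have "\<dots> = (\<Sum>X\<in>Pow Basis. (\<Prod>b\<in>X. cos (?A b - ?B b) * (1/2)) * (\<Prod>b\<in>Basis - X. cos (?A b + ?B b) * (1/2)))"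
      by (rule prod_add) simp
    also have "\<dots> = (\<Sum>X\<in>Pow Basis. (1/2) ^ DIM('a) * mixk c a {} (q X) x)"
    proof (rule sum.cong[OF refl])
      fix X :: "'a set" assume "X \<in> Pow Basis"
      then have X: "X \<subseteq> Basis" by simp
      have "(\<Prod>b\<in>X. cos (?A b - ?B b) * (1/2)) * (\<Prod>b\<in>Basis - X. cos (?A b + ?B b) * (1/2)) =
        (\<Prod>b\<in>X. (1/2) * cosw (c \<bullet> b) a (q X \<bullet> b) (x \<bullet> b)) * (\<Prod>b\<in>Basis - X. (1/2) * cosw (c \<bullet> b) a (q X \<bullet> b) (x \<bullet> b))"
      proof (rule arg_cong2[where f="(*)"]; rule prod.cong[OF refl])
        fix b assume "b \<in> X"
        then have "q X \<bullet> b = \<bar>k \<bullet> b - m \<bullet> b\<bar>" using X by (subst qb) auto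
        moreover have "cos (\<bar>k \<bullet> b - m \<bullet> b\<bar> * pi / a * (x \<bullet> b - c \<bullet> b)) = cos (?A b - ?B b)"
        proof (cases "k \<bullet> b \<ge> m \<bullet> b")
          case True
          then show ?thesis by (simp add: diff_divide_distrib left_diff_distrib)
        next
          case False
          then have "\<bar>k \<bullet> b - m \<bullet> b\<bar> * pi / a * (x \<bullet> b - c \<bullet> b) = - (?A b - ?B b)"
            by (simp add: diff_divide_distrib left_diff_distrib)
          then show ?thesis by (simp only: cos_minus)
        qed
        ultimately show "cos (?A b - ?B b) * (1/2) = (1/2) * cosw (c \<bullet> b) a (q X \<bullet> b) (x \<bullet> b)"
          by (simp add: cosw_def)
      next
        fix b assume "b \<in> Basis - X"
        then have "q X \<bullet> b = k \<bullet> b + m \<bullet> b" by (subst qb) auto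
        then show "cos (?A b + ?B b) * (1/2) = (1/2) * cosw (c \<bullet> b) a (q X \<bullet> b) (x \<bullet> b)"
          by (simp add: cosw_def add_divide_distrib distrib_right)
      qed
      also have "\<dots> = (\<Prod>b\<in>Basis. (1/2) * cosw (c \<bullet> b) a (q X \<bullet> b) (x \<bullet> b))"
        by (subst mult.commute) (rule prod.subset_diff[OF X, symmetric], simp)
      also have "\<dots> = (1/2) ^ DIM('a) * mixk c a {} (q X) x"
        by (simp only: mixk_def prod.distrib prod_constant empty_iff if_False)
      finally show "(\<Prod>b\<in>X. cos (?A b - ?B b) * (1/2)) * (\<Prod>b\<in>Basis - X. cos (?A b + ?B b) * (1/2)) =
        (1/2) ^ DIM('a) * mixk c a {} (q X) x" .
    qed
    finally show ?thesis .
  qed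
  then show ?thesis
    by (simp only:) (intro cos_polys_sum cos_polys.cmult cos_polys.base q)
qed

lemma cos_polys_mult:
  assumes "f \<in> cos_polys c a" "g \<in> cos_polys c a"
  shows "(\<lambda>x. f x * g x) \<in> cos_polys c a"
  using assms
proof (induction f)
  case (base k)
  from base(2) show ?case
  proof (induction g)
    case (base m)
    show ?case by (rule cos_polys_base_mult[OF \<open>k \<in> nat_lattice\<close> base])
  next
    case (add f g)
    show ?case using cos_polys.add[OF add.IH] by (simp add: distrib_left)
  next
    case (cmult f r)
    show ?case using cos_polys.cmult[OF cmult.IH, of r] by (simp add: mult_ac)
  qed
next
  case (add f f')
  show ?case using cos_polys.add[OF add.IH(1)[OF add.prems] add.IH(2)[OF add.prems]] by (simp add: distrib_right)
next
  case (cmult f r)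
  show ?case using cos_polys.cmult[OF cmult.IH[OF cmult.prems], of r] by (simp add: mult.assoc)
qed

lemma cos_polys_expand:
  assumes "f \<in> cos_polys c a"
  shows "\<exists>I p. finite I \<and> I \<subseteq> nat_lattice \<and> f = (\<lambda>x. \<Sum>k\<in>I. p k *\<^sub>R mixk c a {} k x)"
  using assms
proof induction
  case (base k)
  then show ?case by (intro exI[of _ "{k}"] exI[of _ "\<lambda>_. 1"]) auto
next
  case (add f g)
  then obtain I p J q where IJ: "finite I" "I \<subseteq> nat_lattice" "f = (\<lambda>x. \<Sum>k\<in>I. p k *\<^sub>R mixk c a {} k x)"
    "finite J" "J \<subseteq> nat_lattice" "g = (\<lambda>x. \<Sum>k\<in>J. q k *\<^sub>R mixk c a {} k x)" by blast
  have "f x = (\<Sum>k\<in>I \<union> J. (if k \<in> I then p k else 0) *\<^sub>R mixk c a {} k x)" for x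
    using IJ by (simp add: if_distrib if_distribR sum.If_cases Int_absorb1 Int_Un_distrib2 cong: if_cong)
  moreover have "g x = (\<Sum>k\<in>I \<union> J. (if k \<in> J then q k else 0) *\<^sub>R mixk c a {} k x)" for x
    using IJ by (simp add: if_distrib if_distribR sum.If_cases Int_absorb1 Int_Un_distrib2 cong: if_cong)
  ultimately have "(\<lambda>x. f x + g x) = (\<lambda>x. \<Sum>k\<in>I \<union> J. ((if k \<in> I then p k else 0) + (if k \<in> J then q k else 0)) *\<^sub>R mixk c a {} k x)"
    by (intro ext) (simp add: distrib_right sum.distrib)
  then show ?case using IJ by (intro exI[of _ "I \<union> J"] exI[of _ "\<lambda>k. (if k \<in> I then p k else 0) + (if k \<in> J then q k else 0)"]) auto
next
  case (cmult f r)
  then obtain I p where "finite I" "I \<subseteq> nat_lattice" "f = (\<lambda>x. \<Sum>k\<in>I. p k *\<^sub>R mixk c a {} k x)" by blast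
  then show ?case by (intro exI[of _ I] exI[of _ "\<lambda>k. r * p k"]) (auto simp: sum_distrib_left mult.assoc)
qed

lemma Basis_nat_lattice: "b \<in> Basis \<Longrightarrow> b \<in> nat_lattice"
  by (auto simp: nat_lattice_def inner_Basis)

text \<open>Points are separated by the modes \<open>k = b\<close> with \<open>b\<close> a basis
  vector: across the cube the argument of the cosine runs from 0 to \<open>pi\<close>, where the
  cosine is injective.\<close>

lemma cos_polys_dense:
  assumes a: "a > 0" and f: "continuous_on (cube c a) f" and e: "e > 0"
  shows "\<exists>g\<in>cos_polys c a. \<forall>x\<in>cube c a. \<bar>f x - g x\<bar> < e"
proof -
  interpret function_ring_on "cos_polys c a" "cube c a"
  proof
    show "compact (cube c a)" by simp
    fix f assume "f \<in> cos_polys c a"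
    then show "continuous_on (cube c a) f"
      by induction (auto intro: continuous_intros)
  next
    fix x y assume xy: "x \<in> cube c a" "y \<in> cube c a" "x \<noteq> y"
    then obtain b where b: "b \<in> Basis" "x \<bullet> b \<noteq> y \<bullet> b" by (meson euclidean_eqI)
    have m: "mixk c a {} b z = cos (pi / a * (z \<bullet> b - c \<bullet> b))" for z
    proof -
      have "mixk c a {} b z = (\<Prod>b'\<in>Basis. if b' = b then cos (pi / a * (z \<bullet> b - c \<bullet> b)) else 1)"
        unfolding mixk_def cosw_def using b by (intro prod.cong refl) (auto simp: inner_Basis)
      then show ?thesis using b by (simp add: prod.delta)
    qed
    have r: "0 \<le> pi / a * (z \<bullet> b - c \<bullet> b)" "pi / a * (z \<bullet> b - c \<bullet> b) \<le> pi" if "z \<in> cube c a" for z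
    proof -
      have "c \<bullet> b \<le> z \<bullet> b" "z \<bullet> b \<le> c \<bullet> b + a" using that b by (auto simp: mem_box inner_add_left)
      then show "0 \<le> pi / a * (z \<bullet> b - c \<bullet> b)" using a by simp
      have "pi / a * (z \<bullet> b - c \<bullet> b) \<le> pi / a * a"
        using a \<open>z \<bullet> b \<le> c \<bullet> b + a\<close> by (intro mult_left_mono) auto
      then show "pi / a * (z \<bullet> b - c \<bullet> b) \<le> pi" using a by simp
    qed
    have "mixk c a {} b x \<noteq> mixk c a {} b y"
      unfolding m using cos_inj_pi[OF r[OF xy(1)] r[OF xy(2)]] b a by auto
    then show "\<exists>f\<in>cos_polys c a. f x \<noteq> f y"
      using cos_polys.base[OF Basis_nat_lattice[OF b(1)]] by blast
  qed (auto intro: cos_polys_const cos_polys_mult cos_polys.add)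
  show ?thesis by (rule Stone_Weierstrass_basic[OF f e])
qed

section \<open>Differentiation of the modes and the Neumann inequality\<close>

lemma C_diff_cosw_sinw: "C_diff n (cosw p a \<kappa>)" "C_diff n (sinw p a \<kappa>)"
proof -
  have "cosw p a \<kappa> = (\<lambda>t::real. cos (t \<bullet> (\<kappa> * pi / a) + (- (\<kappa> * pi / a * p))))"
    "sinw p a \<kappa> = (\<lambda>t::real. sin (t \<bullet> (\<kappa> * pi / a) + (- (\<kappa> * pi / a * p))))"
    unfolding cosw_def sinw_def fun_eq_iff
    by (simp_all only: inner_real_def mult.commute diff_conv_add_uminus distrib_right mult_minus_left simp_thms)
  then show "C_diff n (cosw p a \<kappa>)" "C_diff n (sinw p a \<kappa>)"
    by (simp_all only: C_diff_compose_affine C_diff_sin_cos)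
qed

lemma grad_sinw: "grad (sinw p a \<kappa>) t = (\<kappa> * pi / a) * cosw p a \<kappa> t"
proof -
  have "((\<lambda>t. sin (w * (t - p))) has_real_derivative w * cos (w * (t - p))) (at t)" for w
    by (auto intro!: derivative_eq_intros)
  then have "(sinw p a \<kappa> has_real_derivative (\<kappa> * pi / a) * cosw p a \<kappa> t) (at t)"
    unfolding sinw_def[abs_def] cosw_def by blast
  then show ?thesis using C_diff_real_SucD(1)[OF C_diff_cosw_sinw(2)] DERIV_unique by blast
qed

lemma C_diff_prod_Basis:
  fixes \<psi> :: "'a::euclidean_space \<Rightarrow> real \<Rightarrow> real"
  assumes "\<And>b. b \<in> Basis \<Longrightarrow> C_diff n (\<psi> b)"
  shows "C_diff n (\<lambda>x::'a. \<Prod>b\<in>Basis. \<psi> b (x \<bullet> b))"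
proof (rule C_diff_prod)
  fix b :: 'a assume "b \<in> Basis"
  from C_diff_compose_affine[OF assms[OF this], of b 0] show "C_diff n (\<lambda>x. \<psi> b (x \<bullet> b))" by simp
qed

lemma grad_prod_Basis:
  fixes \<psi> :: "'a::euclidean_space \<Rightarrow> real \<Rightarrow> real"
  assumes C: "\<And>b. b \<in> Basis \<Longrightarrow> C_diff (Suc 0) (\<psi> b)" and i: "i \<in> Basis"
  shows "grad (\<lambda>x. \<Prod>b\<in>Basis. \<psi> b (x \<bullet> b)) x \<bullet> i =
    (\<Prod>b\<in>Basis. if b = i then grad (\<psi> b) (x \<bullet> b) else \<psi> b (x \<bullet> b))"
proof -
  let ?f = "\<lambda>x. \<Prod>b\<in>Basis. \<psi> b (x \<bullet> b)" and ?r = "\<Prod>b\<in>Basis - {i}. \<psi> b (x \<bullet> b)"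
  have "?f differentiable (at (x + 0 *\<^sub>R i))"
    using C_diff_differentiable[OF C_diff_prod_Basis[OF C]] by simp
  from directional_derivative[OF this]
  have 1: "((\<lambda>t. ?f (x + t *\<^sub>R i)) has_real_derivative grad ?f x \<bullet> i) (at 0)" by simp
  have eq: "?f (x + t *\<^sub>R i) = \<psi> i (x \<bullet> i + t) * ?r" for t
  proof -
    have "?f (x + t *\<^sub>R i) = \<psi> i ((x + t *\<^sub>R i) \<bullet> i) * (\<Prod>b\<in>Basis - {i}. \<psi> b ((x + t *\<^sub>R i) \<bullet> b))"
      using i by (simp add: prod.remove)
    also have "(\<Prod>b\<in>Basis - {i}. \<psi> b ((x + t *\<^sub>R i) \<bullet> b)) = ?r"
      using i by (intro prod.cong refl) (auto simp: inner_add_left inner_Basis)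
    finally show ?thesis using i by (simp add: inner_add_left)
  qed
  have "((\<lambda>t. \<psi> i (x \<bullet> i + t)) has_real_derivative grad (\<psi> i) (x \<bullet> i)) (at 0)"
    using DERIV_shift[of "\<psi> i" "grad (\<psi> i) (x \<bullet> i)" 0 "x \<bullet> i"] C_diff_real_SucD(1)[OF C[OF i], of "x \<bullet> i"]
    by (simp add: add.commute)
  then have "((\<lambda>t. \<psi> i (x \<bullet> i + t) * ?r) has_real_derivative grad (\<psi> i) (x \<bullet> i) * ?r) (at 0)"
    by (rule DERIV_cmult_right)
  then have "grad ?f x \<bullet> i = grad (\<psi> i) (x \<bullet> i) * ?r"
    using 1 unfolding eq by (rule DERIV_unique[rotated])
  also have "\<dots> = (\<Prod>b\<in>Basis. if b = i then grad (\<psi> b) (x \<bullet> b) else \<psi> b (x \<bullet> b))"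
    using i by (subst prod.remove[of Basis i]) auto
  finally show ?thesis .
qed

lemma C_diff_mixk: "C_diff n (mixk c a B k)"
  unfolding mixk_def[abs_def] by (rule C_diff_prod_Basis) (auto intro: C_diff_cosw_sinw)

lemma grad_mixk_sin:
  assumes b: "b \<in> Basis" "b \<in> B"
  shows "grad (mixk c a B k) x \<bullet> b = (k \<bullet> b * pi / a) * mixk c a (B - {b}) k x"
proof -
  have "grad (mixk c a B k) x \<bullet> b = (\<Prod>i\<in>Basis. if i = b then grad ((if i \<in> B then sinw else cosw) (c \<bullet> i) a (k \<bullet> i)) (x \<bullet> i)
      else (if i \<in> B then sinw else cosw) (c \<bullet> i) a (k \<bullet> i) (x \<bullet> i))"
    unfolding mixk_def[abs_def] by (rule grad_prod_Basis) (use b in \<open>auto intro: C_diff_cosw_sinw simp del: C_diff.simps\<close>)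
  also have "\<dots> = (\<Prod>i\<in>Basis. (if i = b then (k \<bullet> b * pi / a) else 1) *
      (if i \<in> B - {b} then sinw else cosw) (c \<bullet> i) a (k \<bullet> i) (x \<bullet> i))"
    using b by (intro prod.cong refl) (auto simp: grad_sinw)
  finally show ?thesis using b by (simp add: prod.distrib prod.delta mixk_def)
qed

text \<open>The sine factor vanishes on both faces orthogonal to \<open>b\<close>, so no boundary
  term arises whatever the values of \<open>f\<close> there. The derivative of that sine is again a
  pure cosine mode.\<close>

lemma cube_integration_by_parts:
  assumes a: "a > 0" and f: "C_diff (Suc 0) f" and b: "b \<in> Basis" and k: "k \<in> nat_lattice"
  shows "L2_ip (cube c a) (\<lambda>x. grad f x \<bullet> b) (mixk c a {b} k) =
    - (k \<bullet> b * pi / a) * L2_ip (cube c a) f (mixk c a {} k)"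
proof -
  let ?s = "mixk c a {b} k"
  have [measurable]: "f \<in> borel_measurable borel" "grad f \<in> borel_measurable borel" "mixk c a B k \<in> borel_measurable borel" for B
    using C_diff_continuous[OF f] borel_measurable_continuous_onI borel_measurable_grad[OF f]
      borel_measurable_continuous_onI[OF continuous_on_mixk] by auto
  have C: "C_diff (Suc 0) (\<lambda>x. f x * ?s x)" by (intro C_diff_mult f C_diff_mixk)
  have kb: "k \<bullet> b \<in> \<int>" using k b Nats_subset_Ints by (auto simp: nat_lattice_def)
  have "(\<integral>x. indicator (cube c a) x * (grad (\<lambda>x. f x * ?s x) x \<bullet> b) \<partial>lborel) = 0"
  proof (rule integral_grad_box[OF C b])
    fix x assume x: "x \<in> cube c a" "x \<bullet> b = c \<bullet> b \<or> x \<bullet> b = (c + a *\<^sub>R One) \<bullet> b"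
    then have "sinw (c \<bullet> b) a (k \<bullet> b) (x \<bullet> b) = 0"
      using a b sin_pi_Ints[OF kb] by (auto simp: sinw_def inner_add_left)
    then have "?s x = 0" unfolding mixk_def using b by (intro prod_zero) auto
    then show "f x * ?s x = 0" by simp
  qed
  moreover have "grad (\<lambda>x. f x * ?s x) x \<bullet> b = (grad f x \<bullet> b) * ?s x + (k \<bullet> b * pi / a) * (f x * mixk c a {} k x)" for x
    unfolding grad_mult[OF C_diff_differentiable[OF f] C_diff_differentiable[OF C_diff_mixk]]
    using grad_mixk_sin[OF b, of "{b}" c a k x] by (simp add: inner_add_left algebra_simps)
  ultimately have "(\<integral>x. indicator (cube c a) x * ((grad f x \<bullet> b) * ?s x + (k \<bullet> b * pi / a) * (f x * mixk c a {} k x)) \<partial>lborel) = 0"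
    by simp
  moreover have "(\<integral>x. indicator (cube c a) x * ((grad f x \<bullet> b) * ?s x + (k \<bullet> b * pi / a) * (f x * mixk c a {} k x)) \<partial>lborel) =
     (\<integral>x. (grad f x \<bullet> b) * ?s x + (k \<bullet> b * pi / a) * (f x * mixk c a {} k x) \<partial>lebesgue_on (cube c a))"
    by (subst lebesgue_on_borel(2)) auto
  moreover have "\<dots> = L2_ip (cube c a) (\<lambda>x. grad f x \<bullet> b) ?s + (k \<bullet> b * pi / a) * L2_ip (cube c a) f (mixk c a {} k)"
    using L2_mult_integrable[OF continuous_L2_cbox[OF continuous_on_inner[OF continuous_on_grad[OF f] continuous_on_const]] mixk_L2, of c "c + a *\<^sub>R One" b c a "{b}" k]
      L2_mult_integrable[OF continuous_L2_cbox[OF C_diff_continuous[OF f]] mixk_L2, of c "c + a *\<^sub>R One" c a "{}" k]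
    by (simp add: L2_ip_def)
  ultimately show ?thesis by simp
qed

lemma finite_nat_lattice_ball: "finite {k \<in> nat_lattice. norm k < R}"
proof -
  define A where "A = PiE (Basis :: 'a set) (\<lambda>_. real ` {..nat \<lceil>R\<rceil>})"
  have "finite A" unfolding A_def by (intro finite_PiE) auto
  moreover have "{k \<in> nat_lattice. norm k < R} \<subseteq> (\<lambda>f. \<Sum>b\<in>Basis. f b *\<^sub>R b) ` A"
  proof
    fix k :: 'a assume k: "k \<in> {k \<in> nat_lattice. norm k < R}"
    have "restrict (\<lambda>b. k \<bullet> b) Basis \<in> A"
      unfolding A_def
    proof (intro restrict_PiE_iff[THEN iffD2] ballI)
      fix b :: 'a assume b: "b \<in> Basis"
      then obtain n where n: "k \<bullet> b = real n" using k by (auto simp: nat_lattice_def elim!: Nats_cases)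
      have "real n \<le> norm k" using Basis_le_norm[OF b, of k] n by simp
      then have "real n < R" using k by simp
      then have "n \<le> nat \<lceil>R\<rceil>" by linarith
      then show "k \<bullet> b \<in> real ` {..nat \<lceil>R\<rceil>}" using n by auto
    qed
    moreover have "k = (\<Sum>b\<in>Basis. restrict (\<lambda>b. k \<bullet> b) Basis b *\<^sub>R b)"
      by (simp add: euclidean_representation)
    ultimately show "k \<in> (\<lambda>f. \<Sum>b\<in>Basis. f b *\<^sub>R b) ` A" by blast
  qed
  ultimately show ?thesis using finite_surj by blast
qed

lemma norm_sq_Basis: "(norm x)\<^sup>2 = (\<Sum>b\<in>Basis. (x \<bullet> b)\<^sup>2)"
  unfolding power2_norm_eq_inner by (subst euclidean_inner) (simp add: power2_eq_square)

lemma L2_ip_grad_components: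
  fixes G :: "'a::euclidean_space \<Rightarrow> 'a"
  assumes "G \<in> L2 S"
  shows "L2_ip S G G = (\<Sum>b\<in>Basis. L2_ip S (\<lambda>x. G x \<bullet> b) (\<lambda>x. G x \<bullet> b))"
proof -
  have "L2_ip S G G = (\<integral>x. (\<Sum>b\<in>Basis. (G x \<bullet> b) \<bullet> (G x \<bullet> b)) \<partial>lebesgue_on S)"
    by (simp add: L2_ip_def euclidean_inner[of "G _" "G _"])
  also have "\<dots> = (\<Sum>b\<in>Basis. L2_ip S (\<lambda>x. G x \<bullet> b) (\<lambda>x. G x \<bullet> b))"
    unfolding L2_ip_def by (intro Bochner_Integration.integral_sum L2_inner_integrable L2_inner_const assms)
  finally show ?thesis .
qed

text \<open>Modes of frequency below \<open>l\<close> appear explicitly. For the others the factor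
  \<open>l\<^sup>2\<close> is dominated by the squared frequency, and the coefficients weighted in
  this way are coefficients of the partial derivatives with respect to orthogonal sine systems, to
  be summed by Bessel's inequality in each direction.\<close>

lemma Neumann_cube_inequality:
  fixes f :: "'a::euclidean_space \<Rightarrow> real"
  assumes a: "a > 0" and l: "l > 0" and f: "C_diff (Suc 0) f"
  shows "l\<^sup>2 * L2_ip (cube c a) f f \<le>
    l\<^sup>2 * (\<Sum>k | k \<in> nat_lattice \<and> norm k < l * a / pi. (L2_ip (cube c a) f (mixk c a {} k))\<^sup>2 / mix_norm a {} k)
     + L2_ip (cube c a) (grad f) (grad f)"
proof -
  let ?Q = "cube c a" and ?K = "{k. k \<in> nat_lattice \<and> norm k < l * a / pi}" and ?e = "mixk c a {}"
  let ?N = "mix_norm a {}"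
  define A where "A k = (L2_ip ?Q f (?e k))\<^sup>2 / ?N k" for k
  have N: "?N k > 0" for k by (rule mix_norm_pos[OF a]) simp
  have A0: "A k \<ge> 0" for k using N[of k] by (simp add: A_def)
  have fin: "finite ?K" using finite_nat_lattice_ball[of "l * a / pi"] by (simp add: conj_commute)
  have fL: "f \<in> L2 ?Q" "grad f \<in> L2 ?Q"
    using C_diff_continuous[OF f] continuous_on_grad[OF f] by (auto intro: continuous_L2_cbox)
  have cont: "continuous_on ?Q f" using continuous_on_subset[OF C_diff_continuous[OF f]] by auto
  define V where "V = measure lborel ?Q"
  have main: "l\<^sup>2 * L2_ip ?Q f f \<le> l\<^sup>2 * (\<Sum>k\<in>?K. A k) + L2_ip ?Q (grad f) (grad f) + l\<^sup>2 * (\<epsilon>\<^sup>2 * V)"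
    if eps: "\<epsilon> > 0" for \<epsilon>
  proof -
    \<comment> \<open>The approximant serves to select a finite set \<open>I\<close> of modes; its
      coefficients need not be those of \<open>f\<close>.\<close>
    obtain g where g: "g \<in> cos_polys c a" "\<And>x. x \<in> ?Q \<Longrightarrow> \<bar>f x - g x\<bar> < \<epsilon>"
      using cos_polys_dense[OF a cont eps] by blast
    obtain I p where I: "finite I" "I \<subseteq> nat_lattice" "g = (\<lambda>x. \<Sum>k\<in>I. p k *\<^sub>R ?e k x)"
      using cos_polys_expand[OF g(1)] by blast
    have orth: "L2_ip ?Q (mixk c a B i) (mixk c a B j) = 0" if "i \<in> I" "j \<in> I" "i \<noteq> j" for B i j
      using L2_ip_mixk[OF a, of i j c B] that I(2) by auto
    have self: "L2_ip ?Q (mixk c a B i) (mixk c a B i) = mix_norm a B i" if "i \<in> I" for B i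
      using L2_ip_mixk[OF a, of i i c B] that I(2) by auto
    have "L2_ip ?Q f f \<le> (\<Sum>k\<in>I. A k) + L2_ip ?Q (\<lambda>x. f x - g x) (\<lambda>x. f x - g x)"
      unfolding I(3) A_def
      by (rule L2_ip_le_of_approximation[OF I(1) fL(1) mixk_L2 orth self N])
    also have "L2_ip ?Q (\<lambda>x. f x - g x) (\<lambda>x. f x - g x) \<le> \<epsilon>\<^sup>2 * V"
    proof -
      have gL: "g \<in> L2 ?Q" unfolding I(3) by (intro L2_sum L2_scaleR mixk_L2)
      have "L2_ip ?Q (\<lambda>x. f x - g x) (\<lambda>x. f x - g x) \<le> (\<integral>x. \<epsilon>\<^sup>2 \<partial>lebesgue_on ?Q)"
        unfolding L2_ip_self
      proof (rule integral_mono)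
        show "integrable (lebesgue_on ?Q) (\<lambda>x. (norm (f x - g x))\<^sup>2)"
          using L2_diff[OF fL(1) gL] by (simp add: L2_iff)
        show "(norm (f x - g x))\<^sup>2 \<le> \<epsilon>\<^sup>2" if "x \<in> space (lebesgue_on ?Q)" for x
          using g(2)[of x] that by (intro power_mono) auto
      qed (intro finite_measure.integrable_const finite_measure_lebesgue_on lmeasurable_cbox)
      also have "\<dots> = \<epsilon>\<^sup>2 * V" by (simp add: V_def measure_restrict_space)
      finally show ?thesis .
    qed
    finally have 1: "L2_ip ?Q f f \<le> (\<Sum>k\<in>I. A k) + \<epsilon>\<^sup>2 * V" by simp
    have "l\<^sup>2 * (\<Sum>k\<in>I. A k) = l\<^sup>2 * (\<Sum>k\<in>I \<inter> ?K. A k) + l\<^sup>2 * (\<Sum>k\<in>I - ?K. A k)"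
      by (subst sum.Int_Diff[OF I(1), of _ ?K]) (simp add: distrib_left)
    also have "(\<Sum>k\<in>I \<inter> ?K. A k) \<le> (\<Sum>k\<in>?K. A k)"
      by (rule sum_mono2[OF fin]) (use A0 in auto)
    \<comment> \<open>Off \<open>?K\<close> the frequency \<open>norm k * pi / a\<close> is at least
      \<open>l\<close>.\<close>
    also have "l\<^sup>2 * (\<Sum>k\<in>I - ?K. A k) \<le> (\<Sum>k\<in>I. (norm k * pi / a)\<^sup>2 * A k)"
    proof -
      have "l\<^sup>2 * (\<Sum>k\<in>I - ?K. A k) \<le> (\<Sum>k\<in>I - ?K. (norm k * pi / a)\<^sup>2 * A k)"
        unfolding sum_distrib_left
      proof (rule sum_mono)
        fix k assume "k \<in> I - ?K"
        then have "l \<le> norm k * pi / a" using I(2) a by (auto simp: field_simps not_less)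
        then show "l\<^sup>2 * A k \<le> (norm k * pi / a)\<^sup>2 * A k"
          using l by (intro mult_right_mono A0 power_mono) auto
      qed
      also have "\<dots> \<le> (\<Sum>k\<in>I. (norm k * pi / a)\<^sup>2 * A k)"
        by (rule sum_mono2[OF I(1)]) (use A0 in auto)
      finally show ?thesis .
    qed
    also have "(\<Sum>k\<in>I. (norm k * pi / a)\<^sup>2 * A k) = (\<Sum>b\<in>Basis. \<Sum>k\<in>I. (k \<bullet> b * pi / a)\<^sup>2 * A k)"
      by (subst sum.swap) (simp add: norm_sq_Basis power_mult_distrib power_divide sum_distrib_right sum_divide_distrib)
    also have "\<dots> \<le> (\<Sum>b\<in>Basis. L2_ip ?Q (\<lambda>x. grad f x \<bullet> b) (\<lambda>x. grad f x \<bullet> b))"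
    proof (rule sum_mono)
      fix b :: 'a assume b: "b \<in> Basis"
      \<comment> \<open>Modes with \<open>k \<bullet> b = 0\<close> have weight 0. They must be
        removed because the corresponding sine products vanish and Bessel's inequality asks for
        positive norms.\<close>
      let ?I = "{k \<in> I. k \<bullet> b \<noteq> 0}"
      have "(\<Sum>k\<in>I. (k \<bullet> b * pi / a)\<^sup>2 * A k) = (\<Sum>k\<in>?I. (k \<bullet> b * pi / a)\<^sup>2 * A k)"
        by (rule sum.mono_neutral_right) (use I in auto)
      also have "\<dots> = (\<Sum>k\<in>?I. (L2_ip ?Q (\<lambda>x. grad f x \<bullet> b) (mixk c a {b} k))\<^sup>2 / mix_norm a {b} k)"
      proof (rule sum.cong[OF refl])
        fix k assume k: "k \<in> ?I"
        then have kn: "k \<in> nat_lattice" using I(2) by auto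
        have n: "mix_norm a {b} k = ?N k" by (rule mix_norm_eq) (use k in auto)
        have "(L2_ip ?Q (\<lambda>x. grad f x \<bullet> b) (mixk c a {b} k))\<^sup>2 = (k \<bullet> b * pi / a)\<^sup>2 * (L2_ip ?Q f (?e k))\<^sup>2"
          unfolding cube_integration_by_parts[OF a f b kn] by (simp add: power_mult_distrib power_divide)
        then show "(k \<bullet> b * pi / a)\<^sup>2 * A k = (L2_ip ?Q (\<lambda>x. grad f x \<bullet> b) (mixk c a {b} k))\<^sup>2 / mix_norm a {b} k"
          by (simp add: n A_def)
      qed
      also have "\<dots> \<le> L2_ip ?Q (\<lambda>x. grad f x \<bullet> b) (\<lambda>x. grad f x \<bullet> b)"
        by (rule Bessel_inequality) (use I(1) L2_inner_const[OF fL(2)] mixk_L2 orth self mix_norm_pos[OF a, of "{b}"] in auto)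
      finally show "(\<Sum>k\<in>I. (k \<bullet> b * pi / a)\<^sup>2 * A k) \<le> L2_ip ?Q (\<lambda>x. grad f x \<bullet> b) (\<lambda>x. grad f x \<bullet> b)" .
    qed
    also have "\<dots> = L2_ip ?Q (grad f) (grad f)" by (rule L2_ip_grad_components[OF fL(2), symmetric])
    finally have 2: "l\<^sup>2 * (\<Sum>k\<in>I. A k) \<le> l\<^sup>2 * (\<Sum>k\<in>?K. A k) + L2_ip ?Q (grad f) (grad f)"
      by (simp add: mult_left_mono)
    have "l\<^sup>2 * L2_ip ?Q f f \<le> l\<^sup>2 * ((\<Sum>k\<in>I. A k) + \<epsilon>\<^sup>2 * V)"
      by (rule mult_left_mono[OF 1]) simp
    with 2 show ?thesis by (simp add: distrib_left)
  qed
  have "((\<lambda>\<epsilon>. l\<^sup>2 * (\<Sum>k\<in>?K. A k) + L2_ip ?Q (grad f) (grad f) + l\<^sup>2 * (\<epsilon>\<^sup>2 * V)) \<longlongrightarrow>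
      l\<^sup>2 * (\<Sum>k\<in>?K. A k) + L2_ip ?Q (grad f) (grad f) + l\<^sup>2 * (0\<^sup>2 * V)) (at_right 0)"
    by (intro tendsto_intros)
  moreover have "\<forall>\<^sub>F \<epsilon> in at_right 0. l\<^sup>2 * L2_ip ?Q f f \<le>
      l\<^sup>2 * (\<Sum>k\<in>?K. A k) + L2_ip ?Q (grad f) (grad f) + l\<^sup>2 * (\<epsilon>\<^sup>2 * V)"
    using main by (auto simp: eventually_at_filter)
  ultimately show ?thesis
    using tendsto_lowerbound[of _ _ "at_right (0::real)"] by (fastforce simp: A_def)
qed

section \<open>Bracketing\<close>

lemma integral_indicator_AE_eq:
  fixes q :: "'a::euclidean_space \<Rightarrow> real"
  assumes "A \<in> sets borel" "B \<in> sets borel" "q \<in> borel_measurable borel"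
    and "A \<subseteq> B" "B - A \<in> null_sets lborel"
  shows "(\<integral>x. indicator A x * q x \<partial>lborel) = (\<integral>x. indicator B x * q x \<partial>lborel)"
proof (rule integral_cong_AE)
  have [measurable]: "A \<in> sets borel" "B \<in> sets borel" "q \<in> borel_measurable borel" using assms by auto
  show "(\<lambda>x. indicator A x * q x) \<in> borel_measurable lborel" "(\<lambda>x. indicator B x * q x) \<in> borel_measurable lborel"
    by measurable
  have "AE x in lborel. x \<notin> B - A" by (rule AE_not_in[OF assms(5)])
  then show "AE x in lborel. indicator A x * q x = indicator B x * q x"
    by eventually_elim (use assms(4) in \<open>auto simp: indicator_def\<close>)
qed

section \<open>Upper bound from a covering by cubes\<close>

text \<open>A cosine mode extended by 0. Division by the norm removes the weights from the Neumann
  inequality, so that plain squares remain, as \<open>N_D_le\<close> demands.\<close>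

definition cell_fun :: "'a::euclidean_space set \<Rightarrow> 'a \<Rightarrow> real \<Rightarrow> 'a \<Rightarrow> 'a \<Rightarrow> real" where
  "cell_fun H c a k x = indicator H x * (mixk c a {} k x / sqrt (mix_norm a {} k))"

lemma cell_fun_measurable: "H \<in> sets borel \<Longrightarrow> cell_fun H c a k \<in> borel_measurable borel"
  unfolding cell_fun_def[abs_def]
  by (intro borel_measurable_times borel_measurable_indicator borel_measurable_divide borel_measurable_const
      borel_measurable_continuous_onI continuous_on_mixk) auto

lemma abs_mixk_le_1: "\<bar>mixk c a B k x\<bar> \<le> 1"
  unfolding mixk_def abs_prod by (intro prod_le_1) (auto simp: cosw_def sinw_def)

lemma cell_fun_L2:
  assumes "open \<Omega>" "bounded \<Omega>" "H \<in> sets borel"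
  shows "cell_fun H c a k \<in> L2 \<Omega>"
proof (rule L2_bounded[where M="1 / \<bar>sqrt (mix_norm a {} k)\<bar>"])
  show "norm (cell_fun H c a k x) \<le> 1 / \<bar>sqrt (mix_norm a {} k)\<bar>" for x
    using abs_mixk_le_1[of c a "{}" k x]
    by (auto simp: cell_fun_def indicator_def abs_divide intro!: divide_right_mono)
qed (use assms cell_fun_measurable in auto)

text \<open>The sets \<open>H i\<close> are disjoint versions of the closed cubes, equal to them up
  to null sets: integrals split over the \<open>H i\<close>, while the Neumann inequality lives on
  the closed cubes. The cubes may protrude from \<open>\<Omega>\<close>.\<close>

locale cube_cover =
  fixes \<Omega> :: "'a::euclidean_space set" and T :: "'i set" and c :: "'i \<Rightarrow> 'a" and a :: "'i \<Rightarrow> real"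
    and H :: "'i \<Rightarrow> 'a set"
  assumes O: "open \<Omega>" "bounded \<Omega>" and T: "finite T" and a: "\<And>i. i \<in> T \<Longrightarrow> a i > 0"
    and H: "\<And>i. i \<in> T \<Longrightarrow> H i \<in> sets borel" "\<And>i. i \<in> T \<Longrightarrow> H i \<subseteq> cube (c i) (a i)"
      "\<And>i. i \<in> T \<Longrightarrow> cube (c i) (a i) - H i \<in> null_sets lborel"
    and disj: "disjoint_family_on H T" and cover: "\<Omega> \<subseteq> (\<Union>i\<in>T. H i)"
begin

lemma integral_split:
  fixes q :: "'a \<Rightarrow> real"
  assumes q: "continuous_on UNIV q" and K: "compact K" "K \<subseteq> \<Omega>" and out: "\<And>x. x \<notin> K \<Longrightarrow> q x = 0"
  shows "integral\<^sup>L (lebesgue_on \<Omega>) q = (\<Sum>i\<in>T. \<integral>x. indicator (cube (c i) (a i)) x * q x \<partial>lborel)"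
proof -
  have S: "\<Omega> \<in> sets borel" using O by simp
  have m: "q \<in> borel_measurable borel" by (rule borel_measurable_continuous_onI[OF q])
  note cs = compact_support_lebesgue_on[OF S q K out]
  have "q x = (\<Sum>i\<in>T. indicator (H i) x * q x)" for x
  proof (cases "q x = 0")
    case False
    then have "x \<in> \<Omega>" using out K by blast
    then obtain i where i: "i \<in> T" "x \<in> H i" using cover by blast
    have "indicator (H j) x * q x = (if j = i then q x else 0)" if "j \<in> T" for j
      using i that disj by (auto simp: disjoint_family_on_def indicator_def)
    then have "(\<Sum>j\<in>T. indicator (H j) x * q x) = (\<Sum>j\<in>T. if j = i then q x else 0)"
      by (intro sum.cong refl) auto
    then show ?thesis using i T by simp
  qed simp
  then have "integral\<^sup>L lborel q = (\<integral>x. (\<Sum>i\<in>T. indicator (H i) x * q x) \<partial>lborel)" by presburger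
  also have "\<dots> = (\<Sum>i\<in>T. \<integral>x. indicator (H i) x * q x \<partial>lborel)"
    using integrable_mult_indicator[OF _ cs(2)] H(1) by (intro Bochner_Integration.integral_sum) simp
  also have "\<dots> = (\<Sum>i\<in>T. \<integral>x. indicator (cube (c i) (a i)) x * q x \<partial>lborel)"
    by (intro sum.cong refl integral_indicator_AE_eq H m) auto
  finally show ?thesis using cs(3) by simp
qed

definition modes :: "real \<Rightarrow> ('i \<times> 'a) set" where
  "modes l = (SIGMA i:T. {k. k \<in> nat_lattice \<and> norm k < l * a i / pi})"

definition mode_fun :: "'i \<times> 'a \<Rightarrow> 'a \<Rightarrow> real" where
  "mode_fun p = cell_fun (H (fst p)) (c (fst p)) (a (fst p)) (snd p)"

lemma finite_modes: "finite (modes l)"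
  unfolding modes_def using finite_nat_lattice_ball by (intro finite_SigmaI T)

lemma mode_fun_L2: "p \<in> modes l \<Longrightarrow> mode_fun p \<in> L2 \<Omega>"
  unfolding mode_fun_def by (intro cell_fun_L2 O H) (auto simp: modes_def)

text \<open>A test function vanishes off \<open>\<Omega>\<close>, so its coefficient over
  \<open>\<Omega>\<close> equals the one over the entire cube.\<close>

lemma L2_ip_mode_fun:
  assumes phi: "\<phi> \<in> test_functions \<Omega>" and i: "i \<in> T"
  shows "(L2_ip \<Omega> \<phi> (mode_fun (i, k)))\<^sup>2 = (L2_ip (cube (c i) (a i)) \<phi> (mixk (c i) (a i) {} k))\<^sup>2 / mix_norm (a i) {} k"
proof -
  let ?N = "mix_norm (a i) {} k" and ?m = "mixk (c i) (a i) {} k"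
  have N: "?N > 0" by (rule mix_norm_pos[OF a[OF i]]) simp
  have S: "\<Omega> \<in> sets borel" using O by simp
  have m: "\<phi> \<in> borel_measurable borel" "?m \<in> borel_measurable borel"
    using C_diff_continuous[OF test_functions_C_diff[OF phi, of 0]] borel_measurable_continuous_onI continuous_on_mixk by blast+
  have out: "\<phi> x = 0" if "x \<notin> \<Omega>" for x
    using phi that closure_subset[of "{x. \<phi> x \<noteq> 0}"] by (auto simp: test_functions_def)
  have "L2_ip \<Omega> \<phi> (mode_fun (i, k)) = (\<integral>x. indicator \<Omega> x * (\<phi> x \<bullet> mode_fun (i, k) x) \<partial>lborel)"
    unfolding mode_fun_def by (rule L2_ip_cbox) (use m S H(1)[OF i] in \<open>auto intro: cell_fun_measurable\<close>)
  also have "\<dots> = (\<integral>x. (1 / sqrt ?N) * (indicator (H i) x * (\<phi> x * ?m x)) \<partial>lborel)"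
    by (intro Bochner_Integration.integral_cong refl)
      (use out in \<open>force simp: mode_fun_def cell_fun_def indicator_def\<close>)
  also have "\<dots> = (1 / sqrt ?N) * (\<integral>x. indicator (H i) x * (\<phi> x * ?m x) \<partial>lborel)"
    by simp
  also have "(\<integral>x. indicator (H i) x * (\<phi> x * ?m x) \<partial>lborel) = (\<integral>x. indicator (cube (c i) (a i)) x * (\<phi> x * ?m x) \<partial>lborel)"
    by (intro integral_indicator_AE_eq H i borel_measurable_times m) auto
  also have "\<dots> = L2_ip (cube (c i) (a i)) \<phi> ?m"
    by (subst L2_ip_cbox) (use m in auto)
  finally show ?thesis using N by (simp add: power_mult_distrib power_divide)
qed

lemma test_function_inequality:
  assumes l: "l > 0" and phi: "\<phi> \<in> test_functions \<Omega>"
  shows "l\<^sup>2 * L2_ip \<Omega> \<phi> \<phi> \<le> l\<^sup>2 * (\<Sum>p\<in>modes l. (L2_ip \<Omega> \<phi> (mode_fun p))\<^sup>2) + L2_ip \<Omega> (grad \<phi>) (grad \<phi>)"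
proof -
  let ?K = "closure {x. \<phi> x \<noteq> 0}"
  have K: "compact ?K" "?K \<subseteq> \<Omega>" using phi by (auto simp: test_functions_def)
  have C: "C_diff (Suc 0) \<phi>" by (rule test_functions_C_diff[OF phi])
  have c: "continuous_on UNIV \<phi>" "continuous_on UNIV (grad \<phi>)"
    using C_diff_continuous[OF C] continuous_on_grad[OF C] by blast+
  have m: "\<phi> \<in> borel_measurable borel" "grad \<phi> \<in> borel_measurable borel"
    using c borel_measurable_continuous_onI by blast+
  have out: "\<phi> x * \<phi> x = 0" "grad \<phi> x \<bullet> grad \<phi> x = 0" if "x \<notin> ?K" for x
    using that closure_subset[of "{x. \<phi> x \<noteq> 0}"] grad_eq_0_outside[OF that] by auto
  let ?Q = "\<lambda>i. cube (c i) (a i)"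
  have 1: "L2_ip \<Omega> \<phi> \<phi> = (\<Sum>i\<in>T. L2_ip (?Q i) \<phi> \<phi>)"
  proof -
    have "L2_ip \<Omega> \<phi> \<phi> = (\<Sum>i\<in>T. \<integral>x. indicator (?Q i) x * (\<phi> x * \<phi> x) \<partial>lborel)"
      unfolding L2_ip_def inner_real_def
      by (rule integral_split[OF _ K]) (intro continuous_intros c, drule out(1), simp)
    also have "\<dots> = (\<Sum>i\<in>T. L2_ip (?Q i) \<phi> \<phi>)"
      by (intro sum.cong refl) (subst L2_ip_cbox, use m in auto)
    finally show ?thesis .
  qed
  have 2: "L2_ip \<Omega> (grad \<phi>) (grad \<phi>) = (\<Sum>i\<in>T. L2_ip (?Q i) (grad \<phi>) (grad \<phi>))"
  proof -
    have "L2_ip \<Omega> (grad \<phi>) (grad \<phi>) = (\<Sum>i\<in>T. \<integral>x. indicator (?Q i) x * (grad \<phi> x \<bullet> grad \<phi> x) \<partial>lborel)"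
      unfolding L2_ip_def
      by (rule integral_split[OF _ K]) (intro continuous_intros c, drule out(2), simp)
    also have "\<dots> = (\<Sum>i\<in>T. L2_ip (?Q i) (grad \<phi>) (grad \<phi>))"
      by (intro sum.cong refl) (subst L2_ip_cbox, use m in auto)
    finally show ?thesis .
  qed
  have "l\<^sup>2 * L2_ip \<Omega> \<phi> \<phi> = (\<Sum>i\<in>T. l\<^sup>2 * L2_ip (?Q i) \<phi> \<phi>)"
    unfolding 1 by (simp add: sum_distrib_left)
  also have "\<dots> \<le> (\<Sum>i\<in>T. l\<^sup>2 * (\<Sum>k | k \<in> nat_lattice \<and> norm k < l * a i / pi.
      (L2_ip (?Q i) \<phi> (mixk (c i) (a i) {} k))\<^sup>2 / mix_norm (a i) {} k) + L2_ip (?Q i) (grad \<phi>) (grad \<phi>))"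
    by (intro sum_mono Neumann_cube_inequality a l C)
  also have "\<dots> = (\<Sum>i\<in>T. l\<^sup>2 * (\<Sum>k | k \<in> nat_lattice \<and> norm k < l * a i / pi.
      (L2_ip \<Omega> \<phi> (mode_fun (i, k)))\<^sup>2) + L2_ip (?Q i) (grad \<phi>) (grad \<phi>))"
    by (intro sum.cong refl) (simp add: L2_ip_mode_fun[OF phi])
  also have "\<dots> = l\<^sup>2 * (\<Sum>i\<in>T. \<Sum>k | k \<in> nat_lattice \<and> norm k < l * a i / pi.
      (L2_ip \<Omega> \<phi> (mode_fun (i, k)))\<^sup>2) + L2_ip \<Omega> (grad \<phi>) (grad \<phi>)"
    by (simp add: 2 sum.distrib sum_distrib_left)
  also have "(\<Sum>i\<in>T. \<Sum>k | k \<in> nat_lattice \<and> norm k < l * a i / pi. (L2_ip \<Omega> \<phi> (mode_fun (i, k)))\<^sup>2) =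
      (\<Sum>p\<in>modes l. (L2_ip \<Omega> \<phi> (mode_fun p))\<^sup>2)"
    unfolding modes_def using finite_nat_lattice_ball T
    by (subst sum.Sigma) (auto simp: case_prod_unfold)
  finally show ?thesis .
qed

lemma W12_0_inequality:
  assumes l: "l > 0" and u: "W12_0 \<Omega> u g"
  shows "l\<^sup>2 * L2_ip \<Omega> u u \<le> l\<^sup>2 * (\<Sum>p\<in>modes l. (L2_ip \<Omega> u (mode_fun p))\<^sup>2) + L2_ip \<Omega> g g"
proof -
  obtain \<phi> where \<phi>: "\<And>n. \<phi> n \<in> test_functions \<Omega>" "L2_tendsto \<Omega> \<phi> u" "L2_tendsto \<Omega> (\<lambda>n. grad (\<phi> n)) g"
    using u by (auto simp: W12_0_iff)
  note L = test_functions_L2[OF O(1) \<phi>(1)] W12_0_L2[OF u]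
  have A: "(\<lambda>n. L2_ip \<Omega> (\<phi> n) (\<phi> n)) \<longlonglongrightarrow> L2_ip \<Omega> u u"
    unfolding L2_ip_def by (rule L2_tendsto_inner[OF \<phi>(2) \<phi>(2) L(1) L(1) L(3) L(3)])
  have B: "(\<lambda>n. L2_ip \<Omega> (grad (\<phi> n)) (grad (\<phi> n))) \<longlonglongrightarrow> L2_ip \<Omega> g g"
    unfolding L2_ip_def by (rule L2_tendsto_inner[OF \<phi>(3) \<phi>(3) L(2) L(2) L(4) L(4)])
  have C: "(\<lambda>n. L2_ip \<Omega> (\<phi> n) (mode_fun p)) \<longlonglongrightarrow> L2_ip \<Omega> u (mode_fun p)" if "p \<in> modes l" for p
    unfolding L2_ip_def
    by (rule L2_tendsto_inner[OF \<phi>(2) L2_tendsto_const L(1) mode_fun_L2[OF that] L(3) mode_fun_L2[OF that]])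
  show ?thesis
  proof (rule LIMSEQ_le)
    show "(\<lambda>n. l\<^sup>2 * L2_ip \<Omega> (\<phi> n) (\<phi> n)) \<longlonglongrightarrow> l\<^sup>2 * L2_ip \<Omega> u u"
      by (intro tendsto_intros A)
    show "(\<lambda>n. l\<^sup>2 * (\<Sum>p\<in>modes l. (L2_ip \<Omega> (\<phi> n) (mode_fun p))\<^sup>2) + L2_ip \<Omega> (grad (\<phi> n)) (grad (\<phi> n))) \<longlonglongrightarrow>
       l\<^sup>2 * (\<Sum>p\<in>modes l. (L2_ip \<Omega> u (mode_fun p))\<^sup>2) + L2_ip \<Omega> g g"
      by (intro tendsto_intros B C)
    show "\<exists>N. \<forall>n\<ge>N. l\<^sup>2 * L2_ip \<Omega> (\<phi> n) (\<phi> n) \<le>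
       l\<^sup>2 * (\<Sum>p\<in>modes l. (L2_ip \<Omega> (\<phi> n) (mode_fun p))\<^sup>2) + L2_ip \<Omega> (grad (\<phi> n)) (grad (\<phi> n))"
      using test_function_inequality[OF l \<phi>(1)] by blast
  qed
qed

lemma N_D_le_modes:
  assumes "l > 0"
  shows "N_D \<Omega> l \<le> enat (card (modes l))"
  by (rule N_D_le[OF O(1) finite_modes mode_fun_L2 W12_0_inequality[OF assms]])

end

lemma bounded_subset_cube:
  assumes "bounded S"
  obtains c a where "a > 0" "S \<subseteq> cube c a"
proof -
  obtain B where B: "B > 0" "\<And>x. x \<in> S \<Longrightarrow> norm x \<le> B" using assms by (auto simp: bounded_pos)
  have "S \<subseteq> cube ((- B) *\<^sub>R One) (2 * B)"
  proof
    fix x assume "x \<in> S"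
    have "- B \<le> x \<bullet> b \<and> x \<bullet> b \<le> B" if "b \<in> Basis" for b
      using B(2)[OF \<open>x \<in> S\<close>] Basis_le_norm[OF that, of x] by linarith
    then show "x \<in> cube ((- B) *\<^sub>R One) (2 * B)"
      by (auto simp: mem_box inner_add_left inner_diff_left)
  qed
  with B show ?thesis by (intro that[of "2 * B" "(- B) *\<^sub>R One"]) auto
qed

text \<open>A single large cube covers \<open>\<Omega>\<close>, and the Neumann inequality on it has
  the form of the hypothesis \<open>compact\<close> used for the minimisation.\<close>

lemma bounded_domain_compactness:
  fixes \<Omega> :: "'a::euclidean_space set" and L :: nat
  assumes O: "open \<Omega>" "bounded \<Omega>"
  shows "\<exists>(m::nat) e K. K \<ge> 0 \<and> (\<forall>i<m. e i \<in> L2 \<Omega>) \<and> (\<forall>u g. W12_0 \<Omega> u g \<longrightarrow>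
      real L * L2_ip \<Omega> u u \<le> K * (\<Sum>i<m. (L2_ip \<Omega> u (e i))\<^sup>2) + L2_ip \<Omega> g g)"
proof -
  obtain c a where a: "a > 0" "\<Omega> \<subseteq> cube c a" by (rule bounded_subset_cube[OF O(2)])
  interpret cube_cover \<Omega> "{()}" "\<lambda>_. c" "\<lambda>_. a" "\<lambda>_. cube c a"
    by unfold_locales (use O a in \<open>auto simp: disjoint_family_on_def\<close>)
  \<comment> \<open>\<open>L + 1\<close> in place of \<open>L\<close> keeps \<open>l\<close>
    positive when \<open>L = 0\<close>.\<close>
  define l where "l = sqrt (real L + 1)"
  have l: "l > 0" "l\<^sup>2 = real L + 1" by (auto simp: l_def)
  obtain f where f: "bij_betw f {0..<card (modes l)} (modes l)"
    using ex_bij_betw_nat_finite[OF finite_modes] by blast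
  have "\<forall>i<card (modes l). mode_fun (f i) \<in> L2 \<Omega>"
  proof (intro allI impI)
    fix i assume "i < card (modes l)"
    then have "f i \<in> modes l" using bij_betwE[OF f] by simp
    then show "mode_fun (f i) \<in> L2 \<Omega>" by (rule mode_fun_L2)
  qed
  moreover have "real L * L2_ip \<Omega> u u \<le> l\<^sup>2 * (\<Sum>i<card (modes l). (L2_ip \<Omega> u (mode_fun (f i)))\<^sup>2) + L2_ip \<Omega> g g"
    if "W12_0 \<Omega> u g" for u g
  proof -
    have "real L * L2_ip \<Omega> u u \<le> l\<^sup>2 * L2_ip \<Omega> u u"
      by (intro mult_right_mono L2_ip_self_nonneg) (simp add: l)
    also have "\<dots> \<le> l\<^sup>2 * (\<Sum>p\<in>modes l. (L2_ip \<Omega> u (mode_fun p))\<^sup>2) + L2_ip \<Omega> g g"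
      by (rule W12_0_inequality[OF l(1) that])
    also have "(\<Sum>p\<in>modes l. (L2_ip \<Omega> u (mode_fun p))\<^sup>2) = (\<Sum>i<card (modes l). (L2_ip \<Omega> u (mode_fun (f i)))\<^sup>2)"
      using sum.reindex_bij_betw[OF f, of "\<lambda>p. (L2_ip \<Omega> u (mode_fun p))\<^sup>2"] by (simp add: lessThan_atLeast0)
    finally show ?thesis .
  qed
  ultimately show ?thesis
    by (intro exI[of _ "card (modes l)"] exI[of _ "\<lambda>i. mode_fun (f i)"] exI[of _ "l\<^sup>2"]) auto
qed

section \<open>Sine products as Dirichlet trial functions\<close>

lemma L2_tendsto_bounded:
  fixes F :: "nat \<Rightarrow> 'a::euclidean_space \<Rightarrow> 'b::euclidean_space"
  assumes S: "S \<in> sets borel" "bounded S"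
    and m: "\<And>n. F n \<in> borel_measurable borel" "f \<in> borel_measurable borel"
    and bd: "\<And>n x. x \<in> S \<Longrightarrow> norm (F n x) \<le> M" "\<And>x. x \<in> S \<Longrightarrow> norm (f x) \<le> M"
    and lim: "\<And>x. x \<in> S \<Longrightarrow> (\<lambda>n. F n x) \<longlonglongrightarrow> f x"
  shows "L2_tendsto S F f"
proof -
  have fin: "finite_measure (lebesgue_on S)"
    using S by (intro finite_measure_lebesgue_on bounded_set_imp_lmeasurable) auto
  have "(\<lambda>n. \<integral>x. (norm (F n x - f x))\<^sup>2 \<partial>lebesgue_on S) \<longlonglongrightarrow> (\<integral>x. 0 \<partial>lebesgue_on S)"
  proof (rule integral_dominated_convergence[where w="\<lambda>x. (2 * M)\<^sup>2"])
    show "integrable (lebesgue_on S) (\<lambda>x. (2 * M)\<^sup>2)"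
      by (rule finite_measure.integrable_const[OF fin])
    show "(\<lambda>x. (norm (F n x - f x))\<^sup>2) \<in> borel_measurable (lebesgue_on S)" for n
      by (rule lebesgue_on_borel(3)[OF S(1)]) (use m in measurable)
    show "AE x in lebesgue_on S. (\<lambda>n. (norm (F n x - f x))\<^sup>2) \<longlonglongrightarrow> 0"
    proof (rule AE_I2)
      fix x assume "x \<in> space (lebesgue_on S)"
      then have "(\<lambda>n. (norm (F n x - f x))\<^sup>2) \<longlonglongrightarrow> (norm (f x - f x))\<^sup>2"
        by (intro tendsto_intros lim) simp
      then show "(\<lambda>n. (norm (F n x - f x))\<^sup>2) \<longlonglongrightarrow> 0" by simp
    qed
    show "AE x in lebesgue_on S. norm ((norm (F n x - f x))\<^sup>2) \<le> (2 * M)\<^sup>2" for n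
    proof (rule AE_I2)
      fix x assume "x \<in> space (lebesgue_on S)"
      then have "norm (F n x - f x) \<le> 2 * M"
        using norm_triangle_ineq4[of "F n x" "f x"] bd(1)[of x n] bd(2)[of x] by simp
      then show "norm ((norm (F n x - f x))\<^sup>2) \<le> (2 * M)\<^sup>2" using power_mono[OF _ norm_ge_zero, of _ _ 2] by fastforce
    qed
  qed auto
  then show ?thesis by (simp add: L2_tendsto_def)
qed

text \<open>The derivative of a cut-off at distance about \<open>a / (n + 1)\<close> from the ends
  grows like \<open>n\<close>, but the sine vanishes linearly there. Hence the gradients stay
  bounded in \<open>n\<close> and dominated convergence applies to them.\<close>

lemma sinw_cutoff:
  fixes p a \<kappa> :: real
  assumes a: "a > 0" and \<kappa>: "\<kappa> \<in> \<nat>"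
  shows "\<exists>(\<psi> :: nat \<Rightarrow> real \<Rightarrow> real) B. (\<forall>n k. C_diff k (\<psi> n)) \<and>
    (\<forall>n t. t < p + a / real (Suc n) \<or> t > p + a - a / real (Suc n) \<longrightarrow> \<psi> n t = 0) \<and>
    (\<forall>n t. \<bar>\<psi> n t\<bar> \<le> 1) \<and>
    (\<forall>n t. p \<le> t \<longrightarrow> t \<le> p + a \<longrightarrow> \<bar>grad (\<psi> n) t\<bar> \<le> B) \<and>
    (\<forall>t. p < t \<longrightarrow> t < p + a \<longrightarrow> (\<lambda>n. \<psi> n t) \<longlonglongrightarrow> sinw p a \<kappa> t) \<and>
    (\<forall>t. p < t \<longrightarrow> t < p + a \<longrightarrow> (\<lambda>n. grad (\<psi> n) t) \<longlonglongrightarrow> grad (sinw p a \<kappa>) t)"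
proof -
  obtain h M where H: "\<forall>k. C_diff k (h :: real \<Rightarrow> real)" "\<forall>t\<le>0. h t = 0" "\<forall>t\<ge>1. h t = 1"
    "\<forall>t. 0 \<le> h t \<and> h t \<le> 1" "\<forall>t. \<bar>grad h t\<bar> \<le> M" "\<forall>t>1. grad h t = 0"
    by (rule smooth_step)
  have hC: "C_diff k h" for k using H by blast
  have h0: "h t = 0" if "t \<le> 0" for t using H that by blast
  have h1: "h t = 1" if "t \<ge> 1" for t using H that by blast
  have hb: "0 \<le> h t" "h t \<le> 1" for t using H by blast+
  have hM: "\<bar>grad h t\<bar> \<le> M" for t using H by blast
  have hg: "grad h t = 0" if "t > 1" for t using H that by blast
  have M0: "M \<ge> 0" using hM[of 0] by simp
  have \<kappa>0: "\<kappa> \<ge> 0" using \<kappa> by (auto elim: Nats_cases)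
  \<comment> \<open>\<open>w n\<close> is the reciprocal of the width: \<open>u n t\<close> is at
    most 0 up to one width from the left end and at least 1 beyond two widths. \<open>v n t\<close>
    does the same at the right end.\<close>
  define w where "w n = real (Suc n) / a" for n
  have w0: "w n > 0" for n using a by (simp add: w_def)
  define u where "u n t = w n * (t - p) - 1" for n t
  define v where "v n t = w n * (p + a - t) - 1" for n t
  define \<psi> where "\<psi> n t = (h (u n t) * h (v n t)) * sinw p a \<kappa> t" for n t
  have hu: "C_diff k (\<lambda>t. h (u n t))" for n k
  proof -
    have "u n t = t \<bullet> w n + (- (w n * p) - 1)" for t by (simp add: u_def algebra_simps)
    then show ?thesis using C_diff_compose_affine[OF hC, of k "w n" "- (w n * p) - 1"] by presburger
  qed
  have hv: "C_diff k (\<lambda>t. h (v n t))" for n k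
  proof -
    have "v n t = t \<bullet> (- w n) + (w n * (p + a) - 1)" for t by (simp add: v_def algebra_simps)
    then show ?thesis using C_diff_compose_affine[OF hC, of k "- w n" "w n * (p + a) - 1"] by presburger
  qed
  have C: "C_diff k (\<psi> n)" for n k
    unfolding \<psi>_def[abs_def] by (intro C_diff_mult hu hv C_diff_cosw_sinw)
  have out: "\<psi> n t = 0" if "t < p + a / real (Suc n) \<or> t > p + a - a / real (Suc n)" for n t
  proof -
    have wa: "w n * (a / real (Suc n)) = 1" using a by (simp add: w_def)
    have "u n t \<le> 0 \<or> v n t \<le> 0"
    proof (cases "t < p + a / real (Suc n)")
      case True
      then have "w n * (t - p) \<le> w n * (a / real (Suc n))" using w0[of n] by (intro mult_left_mono) auto
      then have "w n * (t - p) \<le> 1" by (simp only: wa)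
      then show ?thesis by (simp add: u_def)
    next
      case False
      then have "p + a - t \<le> a / real (Suc n)" using that by simp
      then have "w n * (p + a - t) \<le> w n * (a / real (Suc n))" using w0[of n] by (intro mult_left_mono) auto
      then have "w n * (p + a - t) \<le> 1" by (simp only: wa)
      then show ?thesis by (simp add: v_def)
    qed
    then show ?thesis using h0 by (auto simp: \<psi>_def)
  qed
  have b1: "\<bar>\<psi> n t\<bar> \<le> 1" for n t
  proof -
    have "\<bar>\<psi> n t\<bar> = h (u n t) * h (v n t) * \<bar>sinw p a \<kappa> t\<bar>" using hb by (simp add: \<psi>_def abs_mult)
    also have "\<dots> \<le> 1 * 1 * 1" using hb by (intro mult_mono mult_nonneg_nonneg) (auto simp: sinw_def)
    finally show ?thesis by simp
  qed
  have gr: "grad (\<psi> n) t = w n * grad h (u n t) * h (v n t) * sinw p a \<kappa> t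
      - w n * h (u n t) * grad h (v n t) * sinw p a \<kappa> t + h (u n t) * h (v n t) * grad (sinw p a \<kappa>) t" for n t
  proof -
    have du: "((\<lambda>t. h (u n t)) has_real_derivative grad h (u n t) * w n) (at t)"
      by (rule DERIV_chain2[OF C_diff_real_SucD(1)[OF hC]]) (auto simp: u_def intro!: derivative_eq_intros)
    have dv: "((\<lambda>t. h (v n t)) has_real_derivative grad h (v n t) * (- w n)) (at t)"
      by (rule DERIV_chain2[OF C_diff_real_SucD(1)[OF hC]]) (auto simp: v_def intro!: derivative_eq_intros)
    have "(\<psi> n has_real_derivative (grad h (u n t) * w n * h (v n t) + grad h (v n t) * (- w n) * h (u n t)) * sinw p a \<kappa> t
        + grad (sinw p a \<kappa>) t * (h (u n t) * h (v n t))) (at t)"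
      unfolding \<psi>_def[abs_def]
      by (intro DERIV_mult du dv C_diff_real_SucD(1)[OF C_diff_cosw_sinw(2)])
    from DERIV_unique[OF this C_diff_real_SucD(1)[OF C]]
    show ?thesis by (simp add: algebra_simps)
  qed
  have s1: "\<bar>sinw p a \<kappa> t\<bar> \<le> \<kappa> * pi / a * \<bar>t - p\<bar>" for t
    using abs_sin_x_le_abs_x[of "\<kappa> * pi / a * (t - p)"] a \<kappa>0 by (simp add: sinw_def abs_mult)
  \<comment> \<open>Vanishing at the right end is where the integrality of \<open>\<kappa>\<close>
    enters, through \<open>sin (\<kappa> * pi) = 0\<close>.\<close>
  have s2: "\<bar>sinw p a \<kappa> t\<bar> \<le> \<kappa> * pi / a * \<bar>p + a - t\<bar>" for t
  proof -
    let ?y = "\<kappa> * pi / a * (p + a - t)"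
    have "\<kappa> * pi / a * (t - p) = \<kappa> * pi - ?y" using a by (simp add: field_simps)
    moreover have "sin (\<kappa> * pi) = 0" using sin_pi_Ints \<kappa> Nats_subset_Ints by blast
    ultimately have "\<bar>sinw p a \<kappa> t\<bar> = \<bar>cos (\<kappa> * pi)\<bar> * \<bar>sin ?y\<bar>"
      by (simp only: sinw_def sin_diff abs_mult) (simp add: abs_mult)
    also have "\<dots> \<le> 1 * \<bar>?y\<bar>" by (intro mult_mono abs_sin_x_le_abs_x) auto
    also have "\<dots> = \<kappa> * pi / a * \<bar>p + a - t\<bar>" using a \<kappa>0 by (simp add: abs_mult)
    finally show ?thesis .
  qed
  define R where "R = \<kappa> * pi / a"
  have R0: "R \<ge> 0" using \<kappa>0 a by (simp add: R_def)
  \<comment> \<open>Either the step is already constant, or the distance \<open>y\<close> is at most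
    two widths, which cancels the factor \<open>w n\<close>.\<close>
  have key: "\<bar>w n * grad h z\<bar> * \<bar>s\<bar> \<le> 2 * M * R" if z: "z = w n * y - 1" and y: "y \<ge> 0" and s: "\<bar>s\<bar> \<le> R * y" for n z y s
  proof (cases "z > 1")
    case True
    then show ?thesis using hg[of z] M0 R0 by simp
  next
    case False
    have "\<bar>w n * grad h z\<bar> * \<bar>s\<bar> \<le> (w n * M) * (R * y)"
      using hM[of z] w0[of n] s M0 by (intro mult_mono) (auto simp: abs_mult)
    also have "\<dots> = M * R * (w n * y)" by simp
    also have "\<dots> \<le> M * R * 2" using False z M0 R0 by (intro mult_left_mono) auto
    finally show ?thesis by simp
  qed
  have b2: "\<bar>grad (\<psi> n) t\<bar> \<le> 4 * M * R + R" if t: "p \<le> t" "t \<le> p + a" for n t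
  proof -
    have h1': "\<bar>h z\<bar> \<le> 1" for z using hb[of z] by simp
    have k1: "\<bar>w n * grad h (u n t)\<bar> * \<bar>sinw p a \<kappa> t\<bar> \<le> 2 * M * R"
      by (rule key[of _ _ "t - p"]) (use t s1[of t] in \<open>auto simp: u_def R_def\<close>)
    have k2: "\<bar>w n * grad h (v n t)\<bar> * \<bar>sinw p a \<kappa> t\<bar> \<le> 2 * M * R"
      by (rule key[of _ _ "p + a - t"]) (use t s2[of t] in \<open>auto simp: v_def R_def\<close>)
    have "\<bar>w n * grad h (u n t) * h (v n t) * sinw p a \<kappa> t\<bar> = \<bar>h (v n t)\<bar> * (\<bar>w n * grad h (u n t)\<bar> * \<bar>sinw p a \<kappa> t\<bar>)"
      by (simp add: abs_mult)
    also have "\<dots> \<le> 1 * (2 * M * R)" by (rule mult_mono) (use k1 h1' in auto)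
    finally have t1: "\<bar>w n * grad h (u n t) * h (v n t) * sinw p a \<kappa> t\<bar> \<le> 2 * M * R" by simp
    have "\<bar>w n * h (u n t) * grad h (v n t) * sinw p a \<kappa> t\<bar> = \<bar>h (u n t)\<bar> * (\<bar>w n * grad h (v n t)\<bar> * \<bar>sinw p a \<kappa> t\<bar>)"
      by (simp add: abs_mult)
    also have "\<dots> \<le> 1 * (2 * M * R)" by (rule mult_mono) (use k2 h1' in auto)
    finally have t2: "\<bar>w n * h (u n t) * grad h (v n t) * sinw p a \<kappa> t\<bar> \<le> 2 * M * R" by simp
    have "\<bar>grad (sinw p a \<kappa>) t\<bar> = R * \<bar>cosw p a \<kappa> t\<bar>" unfolding grad_sinw R_def[symmetric] abs_mult using R0 by simp
    also have "\<dots> \<le> R * 1" using R0 by (intro mult_left_mono) (auto simp: cosw_def)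
    finally have g: "\<bar>grad (sinw p a \<kappa>) t\<bar> \<le> R" by simp
    have "\<bar>h (u n t) * h (v n t) * grad (sinw p a \<kappa>) t\<bar> = \<bar>h (u n t)\<bar> * \<bar>h (v n t)\<bar> * \<bar>grad (sinw p a \<kappa>) t\<bar>"
      by (simp add: abs_mult)
    also have "\<dots> \<le> 1 * 1 * R" using g h1' by (intro mult_mono) auto
    finally have t3: "\<bar>h (u n t) * h (v n t) * grad (sinw p a \<kappa>) t\<bar> \<le> R" by simp
    show ?thesis unfolding gr using t1 t2 t3 by linarith
  qed
  have ev: "\<forall>\<^sub>F n in sequentially. u n t > 1 \<and> v n t > 1" if t: "p < t" "t < p + a" for t
  proof -
    have big: "\<forall>\<^sub>F n in sequentially. w n * y - 1 > 1" if "y > 0" for y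
    proof -
      obtain N :: nat where N: "real N > 2 * a / y" using reals_Archimedean2 by blast
      have "w n * y - 1 > 1" if "n \<ge> N" for n
      proof -
        have "2 * a / y < real (Suc n)" using N that by linarith
        then have "2 * a < real (Suc n) * y" using \<open>y > 0\<close> by (simp add: pos_divide_less_eq)
        then have "2 < real (Suc n) / a * y" using a by (simp add: pos_less_divide_eq)
        then show ?thesis by (simp add: w_def)
      qed
      then show ?thesis by (auto simp: eventually_sequentially)
    qed
    show ?thesis using big[of "t - p"] big[of "p + a - t"] t by (auto simp: u_def v_def eventually_conj)
  qed
  have "(\<lambda>n. \<psi> n t) \<longlonglongrightarrow> sinw p a \<kappa> t \<and> (\<lambda>n. grad (\<psi> n) t) \<longlonglongrightarrow> grad (sinw p a \<kappa>) t"
    if t: "p < t" "t < p + a" for t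
  proof
    have "\<forall>\<^sub>F n in sequentially. sinw p a \<kappa> t = \<psi> n t"
      using ev[OF t] by eventually_elim (simp add: \<psi>_def h1)
    then show "(\<lambda>n. \<psi> n t) \<longlonglongrightarrow> sinw p a \<kappa> t" by (rule Lim_transform_eventually[OF tendsto_const])
    have "\<forall>\<^sub>F n in sequentially. grad (sinw p a \<kappa>) t = grad (\<psi> n) t"
      using ev[OF t] by eventually_elim (simp add: gr h1 hg)
    then show "(\<lambda>n. grad (\<psi> n) t) \<longlonglongrightarrow> grad (sinw p a \<kappa>) t" by (rule Lim_transform_eventually[OF tendsto_const])
  qed
  with C out b1 b2 show ?thesis
    by (intro exI[of _ \<psi>] exI[of _ "4 * M * R + R"]) simp
qed

text \<open>Products of one-dimensional cut-off sines are test functions supported inside the cube.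
  They and their gradients converge pointwise and boundedly, hence in L2.\<close>

lemma W12_0_sine_product:
  fixes \<Omega> :: "'a::euclidean_space set"
  assumes O: "open \<Omega>" "bounded \<Omega>" and a: "a > 0" and sub: "box c (c + a *\<^sub>R One) \<subseteq> \<Omega>" and k: "k \<in> nat_lattice"
  shows "W12_0 \<Omega> (\<lambda>x. indicator (box c (c + a *\<^sub>R One)) x *\<^sub>R mixk c a Basis k x)
     (\<lambda>x. indicator (box c (c + a *\<^sub>R One)) x *\<^sub>R grad (mixk c a Basis k) x)"
proof -
  let ?Q = "box c (c + a *\<^sub>R One)" and ?m = "mixk c a Basis k"
  have mk: "?m x = (\<Prod>b\<in>Basis. sinw (c \<bullet> b) a (k \<bullet> b) (x \<bullet> b))" for x by (simp add: mixk_def)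
  have memQ: "x \<in> ?Q \<longleftrightarrow> (\<forall>b\<in>Basis. c \<bullet> b < x \<bullet> b \<and> x \<bullet> b < c \<bullet> b + a)" for x
    by (auto simp: mem_box inner_add_left)
  have "\<exists>\<psi> B. (\<forall>n k. C_diff k (\<psi> n)) \<and>
    (\<forall>n t. t < c \<bullet> b + a / real (Suc n) \<or> t > c \<bullet> b + a - a / real (Suc n) \<longrightarrow> \<psi> n t = 0) \<and>
    (\<forall>n t. \<bar>\<psi> n t\<bar> \<le> 1) \<and>
    (\<forall>n t. c \<bullet> b \<le> t \<longrightarrow> t \<le> c \<bullet> b + a \<longrightarrow> \<bar>grad (\<psi> n) t\<bar> \<le> B) \<and>
    (\<forall>t. c \<bullet> b < t \<longrightarrow> t < c \<bullet> b + a \<longrightarrow> (\<lambda>n. \<psi> n t) \<longlonglongrightarrow> sinw (c \<bullet> b) a (k \<bullet> b) t) \<and>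
    (\<forall>t. c \<bullet> b < t \<longrightarrow> t < c \<bullet> b + a \<longrightarrow> (\<lambda>n. grad (\<psi> n) t) \<longlonglongrightarrow> grad (sinw (c \<bullet> b) a (k \<bullet> b)) t)"
    if b: "b \<in> Basis" for b
    using k b by (intro sinw_cutoff a) (simp add: nat_lattice_def)
  then have "\<forall>b. \<exists>\<psi> B. b \<in> Basis \<longrightarrow> (\<forall>n k. C_diff k (\<psi> n)) \<and>
    (\<forall>n t. t < c \<bullet> b + a / real (Suc n) \<or> t > c \<bullet> b + a - a / real (Suc n) \<longrightarrow> \<psi> n t = 0) \<and>
    (\<forall>n t. \<bar>\<psi> n t\<bar> \<le> 1) \<and>
    (\<forall>n t. c \<bullet> b \<le> t \<longrightarrow> t \<le> c \<bullet> b + a \<longrightarrow> \<bar>grad (\<psi> n) t\<bar> \<le> B) \<and>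
    (\<forall>t. c \<bullet> b < t \<longrightarrow> t < c \<bullet> b + a \<longrightarrow> (\<lambda>n. \<psi> n t) \<longlonglongrightarrow> sinw (c \<bullet> b) a (k \<bullet> b) t) \<and>
    (\<forall>t. c \<bullet> b < t \<longrightarrow> t < c \<bullet> b + a \<longrightarrow> (\<lambda>n. grad (\<psi> n) t) \<longlonglongrightarrow> grad (sinw (c \<bullet> b) a (k \<bullet> b)) t)"
    by blast
  from choice[OF this] obtain \<psi> where "\<forall>b. \<exists>B. b \<in> Basis \<longrightarrow> (\<forall>n k. C_diff k (\<psi> b n)) \<and>
    (\<forall>n t. t < c \<bullet> b + a / real (Suc n) \<or> t > c \<bullet> b + a - a / real (Suc n) \<longrightarrow> \<psi> b n t = 0) \<and>
    (\<forall>n t. \<bar>\<psi> b n t\<bar> \<le> 1) \<and>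
    (\<forall>n t. c \<bullet> b \<le> t \<longrightarrow> t \<le> c \<bullet> b + a \<longrightarrow> \<bar>grad (\<psi> b n) t\<bar> \<le> B) \<and>
    (\<forall>t. c \<bullet> b < t \<longrightarrow> t < c \<bullet> b + a \<longrightarrow> (\<lambda>n. \<psi> b n t) \<longlonglongrightarrow> sinw (c \<bullet> b) a (k \<bullet> b) t) \<and>
    (\<forall>t. c \<bullet> b < t \<longrightarrow> t < c \<bullet> b + a \<longrightarrow> (\<lambda>n. grad (\<psi> b n) t) \<longlonglongrightarrow> grad (sinw (c \<bullet> b) a (k \<bullet> b)) t)"
    by blast
  from choice[OF this] obtain B where P: "\<forall>b. b \<in> Basis \<longrightarrow> (\<forall>n k. C_diff k (\<psi> b n)) \<and>
    (\<forall>n t. t < c \<bullet> b + a / real (Suc n) \<or> t > c \<bullet> b + a - a / real (Suc n) \<longrightarrow> \<psi> b n t = 0) \<and>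
    (\<forall>n t. \<bar>\<psi> b n t\<bar> \<le> 1) \<and>
    (\<forall>n t. c \<bullet> b \<le> t \<longrightarrow> t \<le> c \<bullet> b + a \<longrightarrow> \<bar>grad (\<psi> b n) t\<bar> \<le> B b) \<and>
    (\<forall>t. c \<bullet> b < t \<longrightarrow> t < c \<bullet> b + a \<longrightarrow> (\<lambda>n. \<psi> b n t) \<longlonglongrightarrow> sinw (c \<bullet> b) a (k \<bullet> b) t) \<and>
    (\<forall>t. c \<bullet> b < t \<longrightarrow> t < c \<bullet> b + a \<longrightarrow> (\<lambda>n. grad (\<psi> b n) t) \<longlonglongrightarrow> grad (sinw (c \<bullet> b) a (k \<bullet> b)) t)"
    by blast
  have C: "C_diff j (\<psi> b n)" if "b \<in> Basis" for b n j using P that by blast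
  have out: "\<psi> b n t = 0" if "b \<in> Basis" "t < c \<bullet> b + a / real (Suc n) \<or> t > c \<bullet> b + a - a / real (Suc n)" for b n t
    using P that by blast
  have b1: "\<bar>\<psi> b n t\<bar> \<le> 1" if "b \<in> Basis" for b n t using P that by blast
  have b2: "\<bar>grad (\<psi> b n) t\<bar> \<le> B b" if "b \<in> Basis" "c \<bullet> b \<le> t" "t \<le> c \<bullet> b + a" for b n t using P that by blast
  have l1: "(\<lambda>n. \<psi> b n t) \<longlonglongrightarrow> sinw (c \<bullet> b) a (k \<bullet> b) t" if "b \<in> Basis" "c \<bullet> b < t" "t < c \<bullet> b + a" for b t using P that by blast
  have l2: "(\<lambda>n. grad (\<psi> b n) t) \<longlonglongrightarrow> grad (sinw (c \<bullet> b) a (k \<bullet> b)) t" if "b \<in> Basis" "c \<bullet> b < t" "t < c \<bullet> b + a" for b t using P that by blast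
  define \<phi> where "\<phi> n x = (\<Prod>b\<in>Basis. \<psi> b n (x \<bullet> b))" for n x
  have \<phi>C: "C_diff j (\<phi> n)" for j n unfolding \<phi>_def[abs_def] by (rule C_diff_prod_Basis[OF C])
  define K where "K n = cbox (c + (a / real (Suc n)) *\<^sub>R One) (c + (a - a / real (Suc n)) *\<^sub>R One)" for n
  have \<phi>out: "\<phi> n x = 0" if "x \<notin> K n" for n x
  proof -
    from that obtain b where b: "b \<in> Basis" "x \<bullet> b < c \<bullet> b + a / real (Suc n) \<or> x \<bullet> b > c \<bullet> b + a - a / real (Suc n)"
      by (auto simp: K_def mem_box inner_add_left not_le)
    then show ?thesis unfolding \<phi>_def by (intro prod_zero bexI[of _ b] out) auto
  qed
  have KQ: "K n \<subseteq> ?Q" for n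
  proof
    fix x assume x: "x \<in> K n"
    have "0 < a / real (Suc n)" using a by simp
    then show "x \<in> ?Q" unfolding memQ using x by (force simp: K_def mem_box inner_add_left)
  qed
  have supp: "closure {x. \<phi> n x \<noteq> 0} \<subseteq> K n" for n
    by (rule closure_minimal) (use \<phi>out in \<open>auto simp: K_def\<close>)
  have test: "\<phi> n \<in> test_functions \<Omega>" for n
  proof -
    have "compact (closure {x. \<phi> n x \<noteq> 0})"
      using supp[of n] by (metis K_def bounded_cbox bounded_subset closed_closure compact_eq_bounded_closed)
    then show ?thesis using \<phi>C supp[of n] KQ[of n] sub by (auto simp: test_functions_def)
  qed
  have QS: "?Q \<in> sets borel" by simp
  have meas: "\<phi> n \<in> borel_measurable borel" "grad (\<phi> n) \<in> borel_measurable borel"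
    "?m \<in> borel_measurable borel" "grad ?m \<in> borel_measurable borel" for n
    using borel_measurable_continuous_onI[OF C_diff_continuous[OF \<phi>C[of 0 n]]] borel_measurable_grad[OF \<phi>C[of "Suc 0" n]]
      borel_measurable_continuous_onI[OF continuous_on_mixk] borel_measurable_grad[OF C_diff_mixk] by blast+
  have im: "(\<lambda>x. indicator ?Q x *\<^sub>R ?m x) \<in> borel_measurable borel"
    "(\<lambda>x. indicator ?Q x *\<^sub>R grad ?m x) \<in> borel_measurable borel"
    using meas(3,4) by measurable
  have S: "\<Omega> \<in> sets borel" using O by simp
  have \<phi>1: "norm (\<phi> n x) \<le> 1" for n x
    unfolding \<phi>_def real_norm_def abs_prod by (intro prod_le_1) (use b1 in auto)
  have m1: "norm (indicator ?Q x *\<^sub>R ?m x) \<le> 1" for x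
    using abs_mixk_le_1[of c a Basis k x] by (auto simp: indicator_def)
  have lim1: "(\<lambda>n. \<phi> n x) \<longlonglongrightarrow> indicator ?Q x *\<^sub>R ?m x" for x
  proof (cases "x \<in> ?Q")
    case True
    have "(\<lambda>n. \<phi> n x) \<longlonglongrightarrow> ?m x"
      unfolding \<phi>_def mk by (intro tendsto_prod l1) (use True memQ in auto)
    then show ?thesis using True by simp
  next
    case False
    then have "\<phi> n x = 0" for n using KQ[of n] by (intro \<phi>out) auto
    then show ?thesis using False by simp
  qed
  have T1: "L2_tendsto \<Omega> \<phi> (\<lambda>x. indicator ?Q x *\<^sub>R ?m x)"
    by (rule L2_tendsto_bounded[OF S O(2) meas(1) im(1) \<phi>1 m1 lim1])
  define B' where "B' = (\<Sum>b\<in>Basis. \<bar>B b\<bar>)"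
  have BB: "B b \<le> B'" if "b \<in> Basis" for b
    unfolding B'_def using member_le_sum[of b Basis "\<lambda>b. \<bar>B b\<bar>"] that abs_ge_self[of "B b"] by force
  have B0: "B' \<ge> 0" by (simp add: B'_def sum_nonneg)
  have gcomp: "grad (\<phi> n) x \<bullet> i = (\<Prod>b\<in>Basis. if b = i then grad (\<psi> b n) (x \<bullet> b) else \<psi> b n (x \<bullet> b))" if "i \<in> Basis" for n x i
    unfolding \<phi>_def[abs_def] by (rule grad_prod_Basis[OF C that])
  have g0: "grad (\<phi> n) x = 0" if "x \<notin> ?Q" for n x
    by (rule grad_eq_0_outside) (use that supp[of n] KQ[of n] in auto)
  have gb: "norm (grad (\<phi> n) x) \<le> real DIM('a) * B'" for n x
  proof (cases "x \<in> ?Q")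
    case True
    have "\<bar>grad (\<phi> n) x \<bullet> i\<bar> \<le> B'" if i: "i \<in> Basis" for i
    proof -
      have "\<bar>grad (\<phi> n) x \<bullet> i\<bar> = \<bar>grad (\<psi> i n) (x \<bullet> i)\<bar> * (\<Prod>b\<in>Basis - {i}. \<bar>\<psi> b n (x \<bullet> b)\<bar>)"
        unfolding gcomp[OF i] using i by (subst prod.remove[of Basis i]) (auto simp: abs_mult abs_prod)
      also have "\<dots> \<le> B' * 1"
      proof (rule mult_mono)
        show "\<bar>grad (\<psi> i n) (x \<bullet> i)\<bar> \<le> B'"
          using b2[OF i, of "x \<bullet> i" n] BB[OF i] True i unfolding memQ by fastforce
        show "(\<Prod>b\<in>Basis - {i}. \<bar>\<psi> b n (x \<bullet> b)\<bar>) \<le> 1" by (intro prod_le_1) (use b1 in auto)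
      qed (use B0 in \<open>auto intro: prod_nonneg\<close>)
      finally show ?thesis by simp
    qed
    then have "(\<Sum>i\<in>Basis. \<bar>grad (\<phi> n) x \<bullet> i\<bar>) \<le> (\<Sum>i\<in>(Basis :: 'a set). B')" by (intro sum_mono)
    then show ?thesis using norm_le_l1[of "grad (\<phi> n) x"] by simp
  qed (use g0 B0 in simp)
  have lim2: "(\<lambda>n. grad (\<phi> n) x) \<longlonglongrightarrow> indicator ?Q x *\<^sub>R grad ?m x" for x
  proof (cases "x \<in> ?Q")
    case True
    have "(\<lambda>n. grad (\<phi> n) x \<bullet> i) \<longlonglongrightarrow> grad ?m x \<bullet> i" if i: "i \<in> Basis" for i
    proof -
      have "grad ?m x \<bullet> i = (\<Prod>b\<in>Basis. if b = i then grad (sinw (c \<bullet> b) a (k \<bullet> b)) (x \<bullet> b) else sinw (c \<bullet> b) a (k \<bullet> b) (x \<bullet> b))"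
        unfolding mk[abs_def] by (rule grad_prod_Basis[OF C_diff_cosw_sinw(2) i])
      moreover have "(\<lambda>n. grad (\<phi> n) x \<bullet> i) \<longlonglongrightarrow> (\<Prod>b\<in>Basis. if b = i then grad (sinw (c \<bullet> b) a (k \<bullet> b)) (x \<bullet> b) else sinw (c \<bullet> b) a (k \<bullet> b) (x \<bullet> b))"
        unfolding gcomp[OF i]
      proof (rule tendsto_prod)
        fix b :: 'a assume b: "b \<in> Basis"
        then show "(\<lambda>n. if b = i then grad (\<psi> b n) (x \<bullet> b) else \<psi> b n (x \<bullet> b)) \<longlonglongrightarrow>
           (if b = i then grad (sinw (c \<bullet> b) a (k \<bullet> b)) (x \<bullet> b) else sinw (c \<bullet> b) a (k \<bullet> b) (x \<bullet> b))"
          using l1[OF b, of "x \<bullet> b"] l2[OF b, of "x \<bullet> b"] True unfolding memQ by (cases "b = i") auto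
      qed
      ultimately show ?thesis by simp
    qed
    then have "(\<lambda>n. \<Sum>i\<in>Basis. (grad (\<phi> n) x \<bullet> i) *\<^sub>R i) \<longlonglongrightarrow> (\<Sum>i\<in>Basis. (grad ?m x \<bullet> i) *\<^sub>R i)"
      by (intro tendsto_sum tendsto_scaleR tendsto_const)
    then show ?thesis using True by (simp add: euclidean_representation)
  next
    case False
    then show ?thesis using g0 by simp
  qed
  have gm: "norm (indicator ?Q x *\<^sub>R grad ?m x) \<le> real DIM('a) * B'" for x
    using LIMSEQ_le_const2[OF tendsto_norm[OF lim2[of x]]] gb by blast
  have T2: "L2_tendsto \<Omega> (\<lambda>n. grad (\<phi> n)) (\<lambda>x. indicator ?Q x *\<^sub>R grad ?m x)"
    by (rule L2_tendsto_bounded[OF S O(2) meas(2) im(2) gb gm lim2])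
  show ?thesis
    by (rule W12_0I[OF O(1) L2_bounded[OF S O(2) im(1) m1] L2_bounded[OF S O(2) im(2) gm] test T1 T2])
qed

lemma L2_ip_indicator_box:
  fixes f g :: "'a::euclidean_space \<Rightarrow> 'b::euclidean_space"
  assumes O: "open \<Omega>" and sub: "box l u \<subseteq> \<Omega>" and m: "f \<in> borel_measurable borel" "g \<in> borel_measurable borel"
  shows "L2_ip \<Omega> (\<lambda>x. indicator (box l u) x *\<^sub>R f x) (\<lambda>x. indicator (box l u) x *\<^sub>R g x) = L2_ip (cbox l u) f g"
proof -
  have [measurable]: "\<Omega> \<in> sets borel" "f \<in> borel_measurable borel" "g \<in> borel_measurable borel" using O m by auto
  have "L2_ip \<Omega> (\<lambda>x. indicator (box l u) x *\<^sub>R f x) (\<lambda>x. indicator (box l u) x *\<^sub>R g x) =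
      (\<integral>x. indicator \<Omega> x * ((indicator (box l u) x *\<^sub>R f x) \<bullet> (indicator (box l u) x *\<^sub>R g x)) \<partial>lborel)"
    by (rule L2_ip_cbox) measurable
  also have "\<dots> = (\<integral>x. indicator (box l u) x * (f x \<bullet> g x) \<partial>lborel)"
    by (intro Bochner_Integration.integral_cong refl) (use sub in \<open>auto simp: indicator_def\<close>)
  also have "\<dots> = (\<integral>x. indicator (cbox l u) x * (f x \<bullet> g x) \<partial>lborel)"
    by (rule integral_indicator_AE_eq) (auto simp: box_subset_cbox null_sets_cbox_Diff_box)
  also have "\<dots> = L2_ip (cbox l u) f g" by (rule L2_ip_cbox[symmetric]) auto
  finally show ?thesis .
qed

text \<open>The derivative in direction \<open>b\<close> turns one sine into a cosine. As no
  coordinate of \<open>k\<close> is 0, the norm of the resulting mode does not change, and the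
  squared frequencies add up to that of \<open>k\<close>.\<close>

lemma L2_ip_grad_sine_product:
  assumes a: "a > 0" and k: "k \<in> nat_lattice" "k' \<in> nat_lattice" and k0: "\<And>b. b \<in> Basis \<Longrightarrow> k \<bullet> b \<noteq> 0"
  shows "L2_ip (cube c a) (grad (mixk c a Basis k)) (grad (mixk c a Basis k')) =
    (if k = k' then (norm k * pi / a)\<^sup>2 * mix_norm a Basis k else 0)"
proof -
  let ?Q = "cube c a"
  have gL: "grad (mixk c a Basis k) \<in> L2 ?Q" for k by (intro continuous_L2_cbox continuous_on_grad[OF C_diff_mixk])
  have "L2_ip ?Q (grad (mixk c a Basis k)) (grad (mixk c a Basis k')) =
      (\<integral>x. (\<Sum>b\<in>Basis. (grad (mixk c a Basis k) x \<bullet> b) \<bullet> (grad (mixk c a Basis k') x \<bullet> b)) \<partial>lebesgue_on ?Q)"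
    by (simp add: L2_ip_def euclidean_inner[of "grad _ _" "grad _ _"])
  also have "\<dots> = (\<Sum>b\<in>Basis. L2_ip ?Q (\<lambda>x. grad (mixk c a Basis k) x \<bullet> b) (\<lambda>x. grad (mixk c a Basis k') x \<bullet> b))"
    unfolding L2_ip_def by (intro Bochner_Integration.integral_sum L2_inner_integrable L2_inner_const gL)
  also have "\<dots> = (\<Sum>b\<in>Basis. if k = k' then (k \<bullet> b * pi / a)\<^sup>2 * mix_norm a Basis k else 0)"
  proof (rule sum.cong[OF refl])
    fix b :: 'a assume b: "b \<in> Basis"
    have g: "(\<lambda>x. grad (mixk c a Basis k) x \<bullet> b) = (\<lambda>x. (k \<bullet> b * pi / a) *\<^sub>R mixk c a (Basis - {b}) k x)" for k
      by (rule ext) (simp add: grad_mixk_sin[OF b b])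
    have n: "mix_norm a (Basis - {b}) k = mix_norm a Basis k"
      using mix_norm_eq[of "Basis - {b}" k a] mix_norm_eq[of Basis k a] k0 by auto
    show "L2_ip ?Q (\<lambda>x. grad (mixk c a Basis k) x \<bullet> b) (\<lambda>x. grad (mixk c a Basis k') x \<bullet> b) =
        (if k = k' then (k \<bullet> b * pi / a)\<^sup>2 * mix_norm a Basis k else 0)"
      unfolding g L2_ip_scaleR_left L2_ip_scaleR_right L2_ip_mixk[OF a k] n by (simp add: power2_eq_square)
  qed
  also have "\<dots> = (if k = k' then (norm k * pi / a)\<^sup>2 * mix_norm a Basis k else 0)"
    by (simp add: norm_sq_Basis power_mult_distrib power_divide sum_distrib_right sum_divide_distrib)
  finally show ?thesis .
qed

text \<open>Trial functions from one cube are orthogonal by the product formulas, those from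
  different cubes by disjointness. Lattice points with a zero coordinate are left out because their
  sine products vanish.\<close>

lemma N_D_ge_cubes:
  fixes \<Omega> :: "'a::euclidean_space set" and c :: "'i \<Rightarrow> 'a"
  assumes O: "open \<Omega>" "bounded \<Omega>" and T: "finite T" and a: "\<And>i. i \<in> T \<Longrightarrow> a i > 0"
    and sub: "\<And>i. i \<in> T \<Longrightarrow> box (c i) (c i + a i *\<^sub>R One) \<subseteq> \<Omega>"
    and disj: "\<And>i j. i \<in> T \<Longrightarrow> j \<in> T \<Longrightarrow> i \<noteq> j \<Longrightarrow> box (c i) (c i + a i *\<^sub>R One) \<inter> box (c j) (c j + a j *\<^sub>R One) = {}"
    and l: "l > 0"
  shows "enat (\<Sum>i\<in>T. card {k::'a. k \<in> nat_lattice \<and> (\<forall>b\<in>Basis. k \<bullet> b \<noteq> 0) \<and> norm k < l * a i / pi}) \<le> N_D \<Omega> l"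
proof -
  let ?K = "\<lambda>i. {k::'a. k \<in> nat_lattice \<and> (\<forall>b\<in>Basis. k \<bullet> b \<noteq> 0) \<and> norm k < l * a i / pi}"
  have finK: "finite (?K i)" for i
    by (rule finite_subset[OF _ finite_nat_lattice_ball[of "l * a i / pi"]]) auto
  define J where "J = Sigma T ?K"
  have J: "finite J" unfolding J_def by (intro finite_SigmaI T finK)
  let ?Q = "\<lambda>i. box (c i) (c i + a i *\<^sub>R One)"
  define v where "v p x = indicator (?Q (fst p)) x *\<^sub>R mixk (c (fst p)) (a (fst p)) Basis (snd p) x" for p :: "'i \<times> 'a" and x
  define h where "h p x = indicator (?Q (fst p)) x *\<^sub>R grad (mixk (c (fst p)) (a (fst p)) Basis (snd p)) x" for p :: "'i \<times> 'a" and x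
  have Jd: "fst p \<in> T" "snd p \<in> nat_lattice" "\<And>b. b \<in> Basis \<Longrightarrow> snd p \<bullet> b \<noteq> 0" "norm (snd p) < l * a (fst p) / pi"
    if "p \<in> J" for p using that by (auto simp: J_def)
  have meas: "mixk c a B k \<in> borel_measurable borel" "grad (mixk c a B k) \<in> borel_measurable borel" for c :: 'a and a B k
    using borel_measurable_continuous_onI[OF continuous_on_mixk] borel_measurable_grad[OF C_diff_mixk] by blast+
  have vv: "L2_ip \<Omega> (v p) (v q) = (if p = q then mix_norm (a (fst p)) Basis (snd p) else 0)" if p: "p \<in> J" and q: "q \<in> J" for p q
  proof (cases "fst p = fst q")
    case True
    have "L2_ip \<Omega> (v p) (v q) = L2_ip (cube (c (fst p)) (a (fst p))) (mixk (c (fst p)) (a (fst p)) Basis (snd p)) (mixk (c (fst p)) (a (fst p)) Basis (snd q))"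
      unfolding v_def[abs_def] True[symmetric] by (rule L2_ip_indicator_box[OF O(1) sub[OF Jd(1)[OF p]] meas(1) meas(1)])
    then show ?thesis using L2_ip_mixk[OF a[OF Jd(1)[OF p]] Jd(2)[OF p] Jd(2)[OF q]] True by (auto simp: prod_eq_iff)
  next
    case False
    then have 0: "v p x \<bullet> v q x = 0" for x
      using disj[OF Jd(1)[OF p] Jd(1)[OF q]] by (auto simp: v_def indicator_def)
    show ?thesis using False unfolding L2_ip_def 0 by auto
  qed
  have hh: "L2_ip \<Omega> (h p) (h q) = (if p = q then (norm (snd p) * pi / a (fst p))\<^sup>2 * mix_norm (a (fst p)) Basis (snd p) else 0)"
    if p: "p \<in> J" and q: "q \<in> J" for p q
  proof (cases "fst p = fst q")
    case True
    have "L2_ip \<Omega> (h p) (h q) = L2_ip (cube (c (fst p)) (a (fst p))) (grad (mixk (c (fst p)) (a (fst p)) Basis (snd p))) (grad (mixk (c (fst p)) (a (fst p)) Basis (snd q)))"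
      unfolding h_def[abs_def] True[symmetric] by (rule L2_ip_indicator_box[OF O(1) sub[OF Jd(1)[OF p]] meas(2) meas(2)])
    then show ?thesis using L2_ip_grad_sine_product[OF a[OF Jd(1)[OF p]] Jd(2)[OF p] Jd(2)[OF q] Jd(3)[OF p]] True by (auto simp: prod_eq_iff)
  next
    case False
    then have 0: "h p x \<bullet> h q x = 0" for x
      using disj[OF Jd(1)[OF p] Jd(1)[OF q]] by (auto simp: h_def indicator_def)
    show ?thesis using False unfolding L2_ip_def 0 by auto
  qed
  have "enat (card J) \<le> N_D \<Omega> l"
  proof (rule N_D_ge[OF O(1) bounded_domain_compactness[OF O] J, of v h])
    fix p assume p: "p \<in> J"
    show "W12_0 \<Omega> (v p) (h p)"
      unfolding v_def[abs_def] h_def[abs_def]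
      by (rule W12_0_sine_product[OF O a[OF Jd(1)[OF p]] sub[OF Jd(1)[OF p]] Jd(2)[OF p]])
    have N: "mix_norm (a (fst p)) Basis (snd p) > 0" by (rule mix_norm_pos[OF a[OF Jd(1)[OF p]] Jd(3)[OF p]])
    then show "L2_ip \<Omega> (v p) (v p) > 0" using vv[OF p p] by simp
    have "norm (snd p) * pi / a (fst p) < l" using Jd(4)[OF p] a[OF Jd(1)[OF p]] by (simp add: field_simps)
    then have "(norm (snd p) * pi / a (fst p))\<^sup>2 < l\<^sup>2"
      using a[OF Jd(1)[OF p]] by (intro power_strict_mono) auto
    then show "L2_ip \<Omega> (h p) (h p) < l\<^sup>2 * L2_ip \<Omega> (v p) (v p)"
      using N vv[OF p p] hh[OF p p] by simp
  qed (use vv hh in auto)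
  moreover have "card J = (\<Sum>i\<in>T. card (?K i))" unfolding J_def using T finK by (simp add: card_SigmaI)
  ultimately show ?thesis by simp
qed

section \<open>Lattice points in a ball\<close>

text \<open>The part of the ball in which exactly the coordinates in \<open>X\<close> are positive.
  All sign patterns are considered because the measure of the positive part is obtained from that of
  the ball by symmetry.\<close>

definition orthant :: "'a::euclidean_space set \<Rightarrow> real \<Rightarrow> 'a set" where
  "orthant X R = {x. (\<forall>b\<in>Basis. if b \<in> X then x \<bullet> b > 0 else x \<bullet> b < 0) \<and> norm x < R}"

lemma open_orthant: "open (orthant X R :: 'a::euclidean_space set)"
proof -
  have "orthant X R = (\<Inter>b\<in>Basis. if b \<in> X then {x::'a. x \<bullet> b > 0} else {x. x \<bullet> b < 0}) \<inter> ball 0 R"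
    by (auto simp: orthant_def split: if_splits)
  moreover have "open {x::'a. x \<bullet> b > 0}" "open {x::'a. x \<bullet> b < 0}" for b
    by (intro open_Collect_less continuous_intros)+
  ultimately show ?thesis by (auto intro!: open_Int open_INT)
qed

lemma borel_orthant: "(orthant X R :: 'a::euclidean_space set) \<in> sets borel"
  by (rule borel_open[OF open_orthant])

lemma bounded_orthant: "bounded (orthant X R :: 'a::euclidean_space set)"
  by (rule bounded_subset[OF bounded_ball[of 0 R]]) (auto simp: orthant_def)

lemma measure_orthant_reflect:
  "measure lborel (orthant X R :: 'a::euclidean_space set) = measure lborel (orthant Basis R :: 'a set)"
proof -
  define c :: "'a \<Rightarrow> real" where "c b = (if b \<in> X then 1 else - 1)" for b
  define T :: "'a \<Rightarrow> 'a" where "T x = 0 + (\<Sum>b\<in>Basis. (c b * (x \<bullet> b)) *\<^sub>R b)" for x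
  have Tb: "T x \<bullet> b = c b * (x \<bullet> b)" if "b \<in> Basis" for x b
    using that by (simp add: T_def inner_sum_left_Basis)
  have c1: "\<bar>c b\<bar> = 1" for b by (simp add: c_def)
  have "(\<Sum>b\<in>Basis. (T x \<bullet> b)\<^sup>2) = (\<Sum>b\<in>Basis. (x \<bullet> b)\<^sup>2)" for x
    by (intro sum.cong refl) (simp add: Tb power_mult_distrib c_def)
  then have "(norm (T x))\<^sup>2 = (norm x)\<^sup>2" for x unfolding norm_sq_Basis .
  then have nT: "norm (T x) = norm x" for x by (simp add: power2_eq_iff_nonneg)
  have vim: "T -` (orthant Basis R) = orthant X R"
    by (auto simp: orthant_def nT Tb c_def split: if_splits)
  have "lborel = density (distr lborel borel T) (\<lambda>_. (\<Prod>b\<in>Basis. \<bar>c b\<bar>))"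
    unfolding T_def by (rule lborel_affine_euclidean) (simp add: c_def)
  also have "\<dots> = distr lborel borel T" by (simp add: c1 density_1)
  finally have d: "lborel = distr lborel borel T" .
  have "T \<in> measurable lborel borel" unfolding T_def by measurable
  from emeasure_distr[OF this borel_orthant[of Basis R]]
  have "emeasure lborel (orthant Basis R :: 'a set) = emeasure lborel (orthant X R :: 'a set)"
    unfolding d[symmetric] vim by simp
  then show ?thesis by (simp add: measure_def)
qed

text \<open>The parts for all subsets of \<open>Basis\<close> are disjoint, have equal measure by
  reflection, and fill the ball up to coordinate hyperplanes.\<close>

lemma measure_orthant:
  assumes "R \<ge> 0"
  shows "measure lborel (orthant Basis R :: 'a::euclidean_space set) =
    (1/2) ^ DIM('a) * (unit_ball_vol (real DIM('a)) * R ^ DIM('a))"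
proof -
  let ?U = "\<Union>X\<in>Pow Basis. orthant X R :: 'a set"
  have fin: "emeasure lborel (orthant X R :: 'a set) \<noteq> \<infinity>" for X
    using emeasure_bounded_finite[OF bounded_orthant[of X R]] by simp
  have disj: "disjoint_family_on (\<lambda>X. orthant X R :: 'a set) (Pow Basis)"
    unfolding disjoint_family_on_def
  proof (intro ballI impI)
    fix X Y :: "'a set" assume XY: "X \<in> Pow Basis" "Y \<in> Pow Basis" "X \<noteq> Y"
    then obtain b where "b \<in> Basis" "b \<in> X \<longleftrightarrow> b \<notin> Y" by blast
    then show "orthant X R \<inter> orthant Y R = {}" by (fastforce simp: orthant_def)
  qed
  have "measure lborel ?U = (\<Sum>X\<in>Pow Basis. measure lborel (orthant X R :: 'a set))"
    using borel_orthant by (intro measure_finite_Union disj fin) auto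
  also have "\<dots> = 2 ^ DIM('a) * measure lborel (orthant Basis R :: 'a set)"
  proof -
    have "(\<Sum>X\<in>Pow Basis. measure lborel (orthant X R :: 'a set)) =
        (\<Sum>X\<in>Pow (Basis :: 'a set). measure lborel (orthant Basis R :: 'a set))"
      by (intro sum.cong refl measure_orthant_reflect)
    then show ?thesis by (simp add: card_Pow)
  qed
  finally have 1: "measure lborel ?U = 2 ^ DIM('a) * measure lborel (orthant Basis R :: 'a set)" .
  have "ball 0 R - ?U \<subseteq> (\<Union>b\<in>Basis. {x::'a. x \<bullet> b = 0})"
  proof
    fix x :: 'a assume x: "x \<in> ball 0 R - ?U"
    show "x \<in> (\<Union>b\<in>Basis. {x::'a. x \<bullet> b = 0})"
    proof (rule ccontr)
      assume "x \<notin> (\<Union>b\<in>Basis. {x::'a. x \<bullet> b = 0})"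
      then have "x \<in> orthant {b\<in>Basis. x \<bullet> b > 0} R" using x by (auto simp: orthant_def linorder_neq_iff)
      moreover have "{b\<in>Basis. x \<bullet> b > 0} \<in> Pow Basis" by simp
      ultimately have "x \<in> ?U" by (rule UN_I[rotated])
      then show False using x by simp
    qed
  qed
  moreover have "(\<Union>b\<in>Basis. {x::'a. x \<bullet> b = 0}) \<in> null_sets lborel"
  proof (rule null_sets.finite_UN)
    fix b :: 'a assume "b \<in> Basis"
    then have "negligible {x::'a. x \<bullet> b = 0}" by (rule negligible_standard_hyperplane)
    moreover have "closed {x::'a. x \<bullet> b = 0}" by (intro closed_Collect_eq continuous_intros)
    ultimately show "{x::'a. x \<bullet> b = 0} \<in> null_sets lborel"
      by (simp add: negligible_iff_null_sets null_sets_completion_iff)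
  qed auto
  moreover have "ball 0 R - ?U \<in> sets lborel" using borel_orthant by (intro sets.Diff sets.finite_UN) auto
  ultimately have "ball 0 R - ?U \<in> null_sets lborel" by (rule null_sets_subset[rotated 2])
  then have "measure lborel (ball (0::'a) R) = measure lborel (ball 0 R - (ball 0 R - ?U))"
    by (intro measure_Diff_null_set[symmetric]) auto
  also have "ball 0 R - (ball 0 R - ?U) = ?U" by (auto simp: orthant_def)
  finally have "measure lborel (ball (0::'a) R) = 2 ^ DIM('a) * measure lborel (orthant Basis R :: 'a set)"
    using 1 by simp
  moreover have "measure lborel (ball (0::'a) R) = unit_ball_vol (real DIM('a)) * R ^ DIM('a)"
    using content_ball[OF assms, of "0::'a"] by simp
  ultimately show ?thesis by (simp add: power_one_over field_simps)
qed

lemma nat_lattice_box_disjoint: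
  assumes "k \<in> nat_lattice" "m \<in> nat_lattice" "k \<noteq> m"
  shows "box k (k + One) \<inter> box m (m + One) = {}"
proof -
  obtain b where b: "b \<in> Basis" "k \<bullet> b \<noteq> m \<bullet> b" using assms(3) by (meson euclidean_eqI)
  have "k \<bullet> b \<in> \<nat>" "m \<bullet> b \<in> \<nat>" using assms b by (auto simp: nat_lattice_def)
  obtain i where i: "k \<bullet> b = real i" using \<open>k \<bullet> b \<in> \<nat>\<close> by (rule Nats_cases)
  obtain j where j: "m \<bullet> b = real j" using \<open>m \<bullet> b \<in> \<nat>\<close> by (rule Nats_cases)
  show ?thesis
  proof (rule ccontr)
    assume "\<not> ?thesis"
    then obtain x where "x \<in> box k (k + One)" "x \<in> box m (m + One)" by blast
    then have "real i < x \<bullet> b" "x \<bullet> b < real i + 1" "real j < x \<bullet> b" "x \<bullet> b < real j + 1"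
      using b i j by (auto simp: mem_box inner_add_left)
    then have "i = j" by linarith
    then show False using b i j by simp
  qed
qed

lemma norm_le_DIM:
  fixes x :: "'a::euclidean_space"
  assumes "\<And>b. b \<in> Basis \<Longrightarrow> \<bar>x \<bullet> b\<bar> \<le> r"
  shows "norm x \<le> real DIM('a) * r"
proof -
  have "(\<Sum>b\<in>Basis. \<bar>x \<bullet> b\<bar>) \<le> (\<Sum>b\<in>(Basis::'a set). r)" by (intro sum_mono assms)
  then show ?thesis using norm_le_l1[of x] by simp
qed

text \<open>Unit cubes with lower corner \<open>k\<close> are disjoint and lie in the positive part
  of the ball enlarged by the dimension, a crude bound for the diameter of a unit cube.\<close>

lemma lattice_count_le:
  assumes "R \<ge> 0"
  shows "real (card {k::'a::euclidean_space. k \<in> nat_lattice \<and> norm k < R}) \<le>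
    (1/2) ^ DIM('a) * (unit_ball_vol (real DIM('a)) * (R + real DIM('a)) ^ DIM('a))"
proof -
  let ?K = "{k::'a. k \<in> nat_lattice \<and> norm k < R}"
  have fin: "finite ?K" using finite_nat_lattice_ball[of R] by simp
  have "(\<Union>k\<in>?K. box k (k + One)) \<subseteq> orthant Basis (R + real DIM('a))"
  proof
    fix x assume "x \<in> (\<Union>k\<in>?K. box k (k + One))"
    then obtain k where k: "k \<in> nat_lattice" "norm k < R" "x \<in> box k (k + One)" by blast
    have b: "0 \<le> k \<bullet> b" "k \<bullet> b < x \<bullet> b" "x \<bullet> b < k \<bullet> b + 1" if "b \<in> Basis" for b
      using k that by (auto simp: nat_lattice_def mem_box inner_add_left Nats_altdef2 elim!: Nats_cases)
    have "norm (x - k) \<le> real DIM('a) * 1"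
      by (rule norm_le_DIM) (use b in \<open>force simp: inner_diff_left\<close>)
    then have "norm x < R + real DIM('a)" using k(2) norm_triangle_ineq[of "x - k" k] by simp
    moreover have "x \<bullet> b > 0" if "b \<in> Basis" for b using b[OF that] by linarith
    ultimately show "x \<in> orthant Basis (R + real DIM('a))" by (auto simp: orthant_def)
  qed
  then have "measure lborel (\<Union>k\<in>?K. box k (k + One)) \<le> measure lborel (orthant Basis (R + real DIM('a)) :: 'a set)"
    using borel_orthant fin emeasure_bounded_finite[OF bounded_orthant[of Basis "R + real DIM('a)"]]
    by (intro measure_mono_fmeasurable) (auto simp: fmeasurable_def intro!: sets.finite_UN)
  moreover have bf: "emeasure lborel (box k (k + One)) \<noteq> \<infinity>" for k :: 'a
    using emeasure_bounded_finite[OF bounded_box, of k "k + One"] by simp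
  moreover have "measure lborel (\<Union>k\<in>?K. box k (k + One)) = (\<Sum>k\<in>?K. measure lborel (box k (k + One)))"
    using fin nat_lattice_box_disjoint bf
    by (intro measure_finite_Union) (auto simp: disjoint_family_on_def)
  moreover have "measure lborel (box k (k + One)) = 1" for k :: 'a
    by (simp add: measure_lborel_box_eq inner_add_left)
  ultimately show ?thesis using measure_orthant[of "R + real DIM('a)", where 'a='a] assms by simp
qed

text \<open>Dually, unit cubes with upper corner \<open>k\<close> cover the positive part of the
  ball shrunk by the dimension; \<open>max 0\<close> covers small radii. Only subadditivity of the
  measure is used.\<close>

lemma lattice_count_ge:
  assumes "R \<ge> 0"
  shows "(1/2) ^ DIM('a) * (unit_ball_vol (real DIM('a)) * (max 0 (R - real DIM('a))) ^ DIM('a)) \<le>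
    real (card {k::'a::euclidean_space. k \<in> nat_lattice \<and> (\<forall>b\<in>Basis. k \<bullet> b \<noteq> 0) \<and> norm k < R})"
proof -
  let ?K = "{k::'a. k \<in> nat_lattice \<and> (\<forall>b\<in>Basis. k \<bullet> b \<noteq> 0) \<and> norm k < R}"
  let ?r = "max 0 (R - real DIM('a))"
  have fin: "finite ?K" by (rule finite_subset[OF _ finite_nat_lattice_ball[of R]]) auto
  have "orthant Basis ?r \<subseteq> (\<Union>k\<in>?K. cbox (k - One) k)"
  proof
    fix x :: 'a assume x: "x \<in> orthant Basis ?r"
    then have xb: "x \<bullet> b > 0" if "b \<in> Basis" for b using that by (auto simp: orthant_def)
    have xn: "norm x < R - real DIM('a)" using x norm_ge_zero[of x] by (auto simp: orthant_def max_def split: if_splits)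
    \<comment> \<open>Rounding up past the integer part makes each coordinate at least 1, so
      \<open>k\<close> avoids the coordinate hyperplanes, and \<open>x\<close> lies in the unit cube
      below \<open>k\<close>.\<close>
    define k where "k = (\<Sum>b\<in>Basis. (of_int \<lfloor>x \<bullet> b\<rfloor> + 1) *\<^sub>R b)"
    have kb: "k \<bullet> b = of_int \<lfloor>x \<bullet> b\<rfloor> + 1" if "b \<in> Basis" for b using that by (simp add: k_def inner_sum_left_Basis)
    have "k \<bullet> b \<in> \<nat> \<and> k \<bullet> b \<noteq> 0" if "b \<in> Basis" for b
    proof -
      have f0: "\<lfloor>x \<bullet> b\<rfloor> \<ge> 0" using xb[OF that] by simp
      then have "k \<bullet> b = real (nat \<lfloor>x \<bullet> b\<rfloor> + 1)" by (simp add: kb[OF that])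
      then show ?thesis by (metis Nats_1 add_is_0 of_nat_eq_0_iff of_nat_in_Nats one_neq_zero)
    qed
    moreover have fl: "of_int \<lfloor>x \<bullet> b\<rfloor> \<le> x \<bullet> b" "x \<bullet> b < of_int \<lfloor>x \<bullet> b\<rfloor> + 1" for b by linarith+
    have "norm (k - x) \<le> real DIM('a) * 1"
    proof (rule norm_le_DIM)
      fix b :: 'a assume "b \<in> Basis"
      then show "\<bar>(k - x) \<bullet> b\<bar> \<le> 1" using fl[of b] by (simp add: inner_diff_left kb abs_le_iff)
    qed
    then have "norm k < R" using xn norm_triangle_ineq[of "k - x" x] by simp
    moreover have "x \<in> cbox (k - One) k" using fl by (force simp: mem_box inner_diff_left kb less_imp_le)
    ultimately show "x \<in> (\<Union>k\<in>?K. cbox (k - One) k)" by (auto simp: nat_lattice_def)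
  qed
  then have "measure lborel (orthant Basis ?r :: 'a set) \<le> measure lborel (\<Union>k\<in>?K. cbox (k - One) k)"
    using borel_orthant fin by (intro measure_mono_fmeasurable) (auto intro!: fmeasurable.finite_UN fmeasurable_compact)
  also have "\<dots> \<le> (\<Sum>k\<in>?K. measure lborel (cbox (k - One) k))"
    using fin by (intro measure_UNION_le) (auto intro: fmeasurableD fmeasurable_compact)
  also have "\<dots> = real (card ?K)"
    by (simp add: measure_lborel_cbox_eq inner_diff_left)
  finally show ?thesis using measure_orthant[of ?r, where 'a='a] by simp
qed

lemma power_diff_le:
  fixes x y :: real
  assumes "0 \<le> y" "y \<le> x" "n > 0"
  shows "x ^ n - y ^ n \<le> real n * (x - y) * x ^ (n - 1)"
proof -
  have "x ^ n - y ^ n = (x - y) * (\<Sum>i<n. y ^ (n - Suc i) * x ^ i)"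
    by (rule power_diff_sumr2)
  also have "\<dots> \<le> (x - y) * (\<Sum>i<n. x ^ (n - 1))"
  proof (intro mult_left_mono sum_mono)
    fix i assume "i \<in> {..<n}"
    then have "n - 1 = (n - Suc i) + i" by auto
    then have "x ^ (n - 1) = x ^ (n - Suc i) * x ^ i" by (simp add: power_add)
    then show "y ^ (n - Suc i) * x ^ i \<le> x ^ (n - 1)" using assms by (simp add: mult_right_mono power_mono)
  qed (use assms in auto)
  finally show ?thesis by (simp add: mult_ac)
qed

text \<open>The modes of a cube of side \<open>a\<close> have frequencies
  \<open>norm k * pi / a\<close>, so \<open>y\<close> stands for \<open>l * a\<close>. The factor
  \<open>(2 * pi) ^ d\<close> in \<open>C_W\<close> is made up of \<open>2 ^ d\<close> sign patterns
  and of the scaling by \<open>pi\<close>. For \<open>y \<ge> 1\<close> the shift of the radius by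
  the dimension is of lower order.\<close>

lemma lattice_count_asymptotics:
  "\<exists>C0\<ge>0. \<forall>y\<ge>1.
     real (card {k::'a::euclidean_space. k \<in> nat_lattice \<and> norm k < y / pi}) \<le>
       C_W DIM('a) * y ^ DIM('a) + C0 * y ^ (DIM('a) - 1) \<and>
     C_W DIM('a) * y ^ DIM('a) - C0 * y ^ (DIM('a) - 1) \<le>
       real (card {k::'a. k \<in> nat_lattice \<and> (\<forall>b\<in>Basis. k \<bullet> b \<noteq> 0) \<and> norm k < y / pi})"
proof -
  let ?d = "DIM('a)"
  define w where "w = (1/2) ^ ?d * unit_ball_vol (real ?d)"
  have w0: "w \<ge> 0" by (simp add: w_def)
  \<comment> \<open>One factor \<open>?d\<close> is the exponent in \<open>power_diff_le\<close>,
    the other the shift of the radius; the power comes from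
    \<open>R + ?d \<le> (1 + ?d) * y\<close>.\<close>
  define C0 where "C0 = w * (real ?d * real ?d * (1 + real ?d) ^ (?d - 1))"
  have main: "w * (y / pi) ^ ?d = C_W ?d * y ^ ?d" for y :: real
    by (simp add: w_def C_W_def power_divide power_mult_distrib field_simps)
  have p: "0 \<le> 1 / pi" "1 / pi \<le> 1" using pi_gt3 by auto
  show ?thesis
  proof (intro exI[of _ C0] conjI allI impI)
    show "0 \<le> C0" using w0 by (simp add: C0_def)
    fix y :: real assume y: "1 \<le> y"
    define R where "R = y / pi"
    have R: "0 \<le> R" "R \<le> y" using y p mult_left_mono[of "1 / pi" 1 y] by (auto simp: R_def)
    have Rd: "R + real ?d \<le> (1 + real ?d) * y" 
    proof -
      have "real ?d * 1 \<le> real ?d * y" using y by (intro mult_left_mono) auto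
      then show ?thesis using R unfolding distrib_right by linarith
    qed
    have yb: "(R + real ?d) ^ (?d - 1) \<le> (1 + real ?d) ^ (?d - 1) * y ^ (?d - 1)"
      using power_mono[OF Rd, of "?d - 1"] R by (simp add: power_mult_distrib)
    have "w * (R + real ?d) ^ ?d \<le> w * (R ^ ?d + real ?d * real ?d * (R + real ?d) ^ (?d - 1))"
      using power_diff_le[of R "R + real ?d" ?d] R by (intro mult_left_mono w0) simp
    also have "\<dots> \<le> w * (R ^ ?d + real ?d * real ?d * ((1 + real ?d) ^ (?d - 1) * y ^ (?d - 1)))"
      using yb by (intro mult_left_mono w0 add_left_mono) auto
    also have "\<dots> = C_W ?d * y ^ ?d + C0 * y ^ (?d - 1)"
      using main[of y] by (simp add: R_def C0_def distrib_left mult_ac)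
    finally show "real (card {k::'a. k \<in> nat_lattice \<and> norm k < y / pi}) \<le> C_W ?d * y ^ ?d + C0 * y ^ (?d - 1)"
      using lattice_count_le[OF R(1), where 'a='a] by (simp add: w_def R_def mult.assoc)
    let ?r = "max 0 (R - real ?d)"
    have "w * (R ^ ?d - ?r ^ ?d) \<le> w * (real ?d * (R - ?r) * R ^ (?d - 1))"
      using R by (intro mult_left_mono w0 power_diff_le) auto
    also have "\<dots> \<le> w * (real ?d * real ?d * ((1 + real ?d) ^ (?d - 1) * y ^ (?d - 1)))"
    proof (intro mult_left_mono w0 mult_mono)
      have "R ^ (?d - 1) \<le> (R + real ?d) ^ (?d - 1)" using R by (intro power_mono) auto
      then show "R ^ (?d - 1) \<le> (1 + real ?d) ^ (?d - 1) * y ^ (?d - 1)" using yb by linarith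
    qed (use R in auto)
    also have "\<dots> = C0 * y ^ (?d - 1)" by (simp add: C0_def mult_ac)
    finally have "w * R ^ ?d - C0 * y ^ (?d - 1) \<le> w * ?r ^ ?d" by (simp add: right_diff_distrib)
    then show "C_W ?d * y ^ ?d - C0 * y ^ (?d - 1) \<le>
       real (card {k::'a. k \<in> nat_lattice \<and> (\<forall>b\<in>Basis. k \<bullet> b \<noteq> 0) \<and> norm k < y / pi})"
      using lattice_count_ge[OF R(1), where 'a='a] main[of y] by (simp add: w_def R_def mult.assoc)
  qed
qed

section \<open>Dyadic decomposition\<close>

text \<open>The index of the dyadic cell of side \<open>2 ^ (- j)\<close> containing
  \<open>x\<close>, kept as a vector with integer coordinates so that \<open>corner\<close> recovers
  the cell by scaling.\<close>

definition gidx :: "nat \<Rightarrow> 'a::euclidean_space \<Rightarrow> 'a" where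
  "gidx j x = (\<Sum>b\<in>Basis. of_int \<lfloor>2 ^ j * (x \<bullet> b)\<rfloor> *\<^sub>R b)"

text \<open>As fibres of \<open>gidx j\<close>, the cells of one level are half-open and partition
  the space by construction. For a vector that is no index the fibre is empty, so cells are
  described below for indices of the form \<open>gidx j x\<close>.\<close>

definition cell :: "nat \<Rightarrow> 'a::euclidean_space \<Rightarrow> 'a set" where
  "cell j p = {y. gidx j y = p}"

lemma gidx_inner: "b \<in> Basis \<Longrightarrow> gidx j x \<bullet> b = of_int \<lfloor>2 ^ j * (x \<bullet> b)\<rfloor>"
  by (simp add: gidx_def inner_sum_left_Basis)

lemma gidx_eq_iff: "gidx j x = gidx j y \<longleftrightarrow> (\<forall>b\<in>Basis. \<lfloor>2 ^ j * (x \<bullet> b)\<rfloor> = \<lfloor>2 ^ j * (y \<bullet> b)\<rfloor>)"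
  by (simp add: euclidean_eq_iff[of "gidx j x"] gidx_inner)

lemma floor_mult_power_eq:
  fixes s t :: real
  assumes "\<lfloor>2 ^ n * s\<rfloor> = \<lfloor>2 ^ n * t\<rfloor>"
  shows "\<lfloor>s\<rfloor> = \<lfloor>t\<rfloor>"
proof -
  have "\<lfloor>r\<rfloor> = \<lfloor>2 ^ n * r\<rfloor> div 2 ^ n" for r :: real
    using floor_divide_real_eq_div[of "2 ^ n" "2 ^ n * r"] by simp
  then show ?thesis using assms by metis
qed

lemma gidx_coarsen:
  assumes "gidx i x = gidx i y" "j \<le> i"
  shows "gidx j x = gidx j y"
  unfolding gidx_eq_iff
proof
  fix b :: 'a assume b: "b \<in> Basis"
  have "(2::real) ^ i = 2 ^ (i - j) * 2 ^ j" using assms(2) by (simp flip: power_add)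
  then have "\<lfloor>2 ^ (i - j) * (2 ^ j * (x \<bullet> b))\<rfloor> = \<lfloor>2 ^ (i - j) * (2 ^ j * (y \<bullet> b))\<rfloor>"
    using assms(1) b by (simp add: gidx_eq_iff mult.assoc)
  then show "\<lfloor>2 ^ j * (x \<bullet> b)\<rfloor> = \<lfloor>2 ^ j * (y \<bullet> b)\<rfloor>" by (rule floor_mult_power_eq)
qed

lemma mem_cell_gidx:
  "y \<in> cell j (gidx j x) \<longleftrightarrow>
    (\<forall>b\<in>Basis. gidx j x \<bullet> b / 2 ^ j \<le> y \<bullet> b \<and> y \<bullet> b < (gidx j x \<bullet> b + 1) / 2 ^ j)"
proof -
  have "\<lfloor>2 ^ j * (y \<bullet> b)\<rfloor> = \<lfloor>2 ^ j * (x \<bullet> b)\<rfloor> \<longleftrightarrow>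
      gidx j x \<bullet> b / 2 ^ j \<le> y \<bullet> b \<and> y \<bullet> b < (gidx j x \<bullet> b + 1) / 2 ^ j" if "b \<in> Basis" for b
  proof -
    have "\<lfloor>2 ^ j * (y \<bullet> b)\<rfloor> = \<lfloor>2 ^ j * (x \<bullet> b)\<rfloor> \<longleftrightarrow>
      of_int \<lfloor>2 ^ j * (x \<bullet> b)\<rfloor> \<le> 2 ^ j * (y \<bullet> b) \<and> 2 ^ j * (y \<bullet> b) < of_int \<lfloor>2 ^ j * (x \<bullet> b)\<rfloor> + 1"
      by (rule floor_eq_iff)
    then show ?thesis using that by (simp add: gidx_inner divide_le_eq less_divide_eq mult.commute)
  qed
  then show ?thesis by (auto simp: cell_def gidx_eq_iff)
qed

lemma self_mem_cell: "x \<in> cell j (gidx j x)"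
  by (simp add: cell_def)

definition corner :: "nat \<Rightarrow> 'a::euclidean_space \<Rightarrow> 'a" where
  "corner j p = (1 / 2 ^ j) *\<^sub>R p"

lemma cell_boxes:
  shows "box (corner j (gidx j x)) (corner j (gidx j x) + (1 / 2 ^ j) *\<^sub>R One) \<subseteq> cell j (gidx j x)"
    and "cell j (gidx j x) \<subseteq> cube (corner j (gidx j x)) (1 / 2 ^ j)"
  by (auto simp: mem_cell_gidx mem_box corner_def inner_add_left add_divide_distrib less_imp_le)

lemma borel_cell: "cell j (gidx j x) \<in> sets borel"
proof -
  have "cell j (gidx j x) = (\<Inter>b\<in>Basis. {y. gidx j x \<bullet> b / 2 ^ j \<le> y \<bullet> b} \<inter> {y. y \<bullet> b < (gidx j x \<bullet> b + 1) / 2 ^ j})"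
    by (auto simp: mem_cell_gidx)
  moreover have "{y::'a. r \<le> y \<bullet> b} \<in> sets borel" "{y::'a. y \<bullet> b < r} \<in> sets borel" for r b
    by (auto intro!: borel_closed borel_open closed_Collect_le open_Collect_less continuous_intros)
  ultimately show ?thesis by (auto intro!: sets.finite_INT)
qed

lemma cell_null: "cube (corner j (gidx j x)) (1 / 2 ^ j) - cell j (gidx j x) \<in> null_sets lborel"
proof (rule null_sets_subset[OF null_sets_cbox_Diff_box])
  show "cube (corner j (gidx j x)) (1 / 2 ^ j) - cell j (gidx j x) \<in> sets lborel"
    using borel_cell[of j x] by simp
qed (use cell_boxes(1)[of j x] in blast)

lemma measure_cell: "measure lborel (cell j (gidx j (x::'a::euclidean_space))) = (1 / 2 ^ j) ^ DIM('a)"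
proof -
  let ?Q = "cube (corner j (gidx j x)) (1 / 2 ^ j)" and ?C = "cell j (gidx j x)"
  have "?C = ?Q - (?Q - ?C)" using cell_boxes(2)[of j x] by blast
  then have "measure lborel ?C = measure lborel (?Q - (?Q - ?C))" by simp
  also have "\<dots> = measure lborel ?Q" by (rule measure_Diff_null_set[OF _ cell_null]) simp
  also have "\<dots> = (1 / 2 ^ j) ^ DIM('a)" by (simp add: measure_lborel_cbox_eq inner_add_left)
  finally show ?thesis .
qed

lemma emeasure_cell_finite: "emeasure lborel (cell j (gidx j x)) \<noteq> \<infinity>"
  using emeasure_bounded_finite[OF bounded_subset[OF bounded_cbox cell_boxes(2)], of j x] by simp

lemma connected_cell: "connected (cell j (gidx j x))"
proof -
  have "cell j (gidx j x) = (\<Inter>b\<in>Basis. {y. gidx j x \<bullet> b / 2 ^ j \<le> b \<bullet> y} \<inter> {y. b \<bullet> y < (gidx j x \<bullet> b + 1) / 2 ^ j})"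
    by (auto simp: mem_cell_gidx inner_commute)
  moreover have "convex {y::'a. r \<le> b \<bullet> y}" "convex {y::'a. b \<bullet> y < r}" for r b
    using convex_halfspace_ge[of r b] convex_halfspace_lt[of b r] by auto
  ultimately have "convex (cell j (gidx j x))" by (auto intro!: convex_INT convex_Int)
  then show ?thesis by (rule convex_connected)
qed

lemma finite_gidx:
  assumes "bounded S"
  shows "finite (gidx j ` (S :: 'a::euclidean_space set))"
proof -
  obtain B where B: "\<And>x. x \<in> S \<Longrightarrow> norm x \<le> B" using assms by (auto simp: bounded_iff)
  let ?A = "PiE (Basis :: 'a set) (\<lambda>_. {\<lfloor>- (2 ^ j * B)\<rfloor>..\<lfloor>2 ^ j * B\<rfloor>})"
  have "gidx j ` S \<subseteq> (\<lambda>f. \<Sum>b\<in>Basis. of_int (f b) *\<^sub>R b) ` ?A"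
  proof
    fix p assume "p \<in> gidx j ` S"
    then obtain x where x: "x \<in> S" "p = gidx j x" by blast
    have "restrict (\<lambda>b. \<lfloor>2 ^ j * (x \<bullet> b)\<rfloor>) Basis \<in> ?A"
    proof (intro restrict_PiE_iff[THEN iffD2] ballI)
      fix b :: 'a assume "b \<in> Basis"
      then have "\<bar>x \<bullet> b\<bar> \<le> B" using B[OF x(1)] Basis_le_norm[of b x] by linarith
      then have "- B \<le> x \<bullet> b" "x \<bullet> b \<le> B" by linarith+
      then have "2 ^ j * (- B) \<le> 2 ^ j * (x \<bullet> b)" "2 ^ j * (x \<bullet> b) \<le> 2 ^ j * B" by (intro mult_left_mono; simp)+
      then show "\<lfloor>2 ^ j * (x \<bullet> b)\<rfloor> \<in> {\<lfloor>- (2 ^ j * B)\<rfloor>..\<lfloor>2 ^ j * B\<rfloor>}" by (auto intro: floor_mono)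
    qed
    moreover have "p = (\<Sum>b\<in>Basis. of_int (restrict (\<lambda>b. \<lfloor>2 ^ j * (x \<bullet> b)\<rfloor>) Basis b) *\<^sub>R b)"
      by (simp add: x(2) gidx_def)
    ultimately show "p \<in> (\<lambda>f. \<Sum>b\<in>Basis. of_int (f b) *\<^sub>R b) ` ?A" by blast
  qed
  then show ?thesis by (rule finite_subset) (intro finite_imageI finite_PiE; simp)
qed

text \<open>The index of a child is twice that of its parent plus a vector of zeros and ones,
  encoded as the sum over a set of basis vectors. This limits a parent to \<open>2 ^ DIM('a)\<close>
  children.\<close>

lemma gidx_Suc:
  "\<exists>X\<subseteq>Basis. gidx (Suc j) x = 2 *\<^sub>R gidx j x + \<Sum>X"
proof -
  define X where "X = {b\<in>Basis. \<lfloor>2 ^ Suc j * (x \<bullet> b)\<rfloor> = 2 * \<lfloor>2 ^ j * (x \<bullet> b)\<rfloor> + 1}"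
  have "gidx (Suc j) x = 2 *\<^sub>R gidx j x + \<Sum>X"
  proof (rule euclidean_eqI)
    fix b :: 'a assume b: "b \<in> Basis"
    have "\<lfloor>2 ^ Suc j * (x \<bullet> b)\<rfloor> = 2 * \<lfloor>2 ^ j * (x \<bullet> b)\<rfloor> \<or> \<lfloor>2 ^ Suc j * (x \<bullet> b)\<rfloor> = 2 * \<lfloor>2 ^ j * (x \<bullet> b)\<rfloor> + 1"
    proof -
      have "(2::real) ^ Suc j * (x \<bullet> b) = 2 * (2 ^ j * (x \<bullet> b))" by simp
      then show ?thesis by linarith
    qed
    moreover have "\<Sum>X \<bullet> b = (if b \<in> X then 1 else 0)"
    proof -
      have "\<Sum>X \<bullet> b = (\<Sum>i\<in>X. if i = b then 1 else 0)"
        unfolding inner_sum_left using b by (intro sum.cong refl) (auto simp: X_def inner_Basis)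
      moreover have "finite X" by (simp add: X_def)
      ultimately show ?thesis by simp
    qed
    moreover have "b \<in> X \<longleftrightarrow> \<lfloor>2 ^ Suc j * (x \<bullet> b)\<rfloor> = 2 * \<lfloor>2 ^ j * (x \<bullet> b)\<rfloor> + 1" using b by (simp add: X_def)
    ultimately show "gidx (Suc j) x \<bullet> b = (2 *\<^sub>R gidx j x + \<Sum>X) \<bullet> b"
      by (auto simp: inner_add_left gidx_inner[OF b] simp del: power_Suc)
  qed
  then show ?thesis by (intro exI[of _ X]) (auto simp: X_def)
qed

section \<open>Maximal inner cells and the boundary layer\<close>

locale dyadic =
  fixes \<Omega> :: "'a::euclidean_space set"
  assumes O: "open \<Omega>" "bounded \<Omega>"
begin

definition inside :: "nat \<Rightarrow> 'a \<Rightarrow> bool" where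
  "inside j x \<longleftrightarrow> cell j (gidx j x) \<subseteq> \<Omega>"

text \<open>\<open>W j\<close> indexes the maximal cells inside \<open>\<Omega>\<close> of side \<open>2\<^sup>-\<^sup>j\<close>; \<open>R J\<close> indexes the cells of the boundary layer.\<close>

fun W :: "nat \<Rightarrow> 'a set" where
  "W 0 = gidx 0 ` {x\<in>\<Omega>. inside 0 x}"
| "W (Suc j) = gidx (Suc j) ` {x\<in>\<Omega>. inside (Suc j) x \<and> \<not> inside j x}"

definition R :: "nat \<Rightarrow> 'a set" where
  "R J = gidx J ` {x\<in>\<Omega>. \<not> inside J x}"

text \<open>The geometric quantity that governs the error: it controls both the inner cells of the
  next level and the boundary layer.\<close>

definition bcount :: "nat \<Rightarrow> nat" where
  "bcount j = card (gidx j ` frontier \<Omega>)"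

lemma cell_mono: "j \<le> i \<Longrightarrow> cell i (gidx i x) \<subseteq> cell j (gidx j x)"
  using gidx_coarsen by (fastforce simp: cell_def)

lemma inside_mono: "inside j x \<Longrightarrow> j \<le> i \<Longrightarrow> inside i x"
  using cell_mono by (fastforce simp: inside_def)

lemma inside_cong: "gidx j x = gidx j y \<Longrightarrow> inside j x = inside j y"
  by (simp add: inside_def)

lemma W_mem: "p \<in> W j \<Longrightarrow> \<exists>x\<in>\<Omega>. p = gidx j x \<and> inside j x \<and> (\<forall>i<j. \<not> inside i x)"
proof (cases j)
  case (Suc i)
  assume "p \<in> W j"
  then obtain x where "x \<in> \<Omega>" "p = gidx j x" "inside j x" "\<not> inside i x" using Suc by auto
  then show ?thesis using inside_mono[of _ x i] Suc by (intro bexI[of _ x]) (auto simp: less_Suc_eq_le)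
qed auto

text \<open>The cell is connected and meets both \<open>\<Omega>\<close> and its complement.\<close>

lemma not_inside_frontier:
  assumes "x \<in> \<Omega>" "\<not> inside j x"
  shows "gidx j x \<in> gidx j ` frontier \<Omega>"
proof -
  have "cell j (gidx j x) \<inter> \<Omega> \<noteq> {}" "cell j (gidx j x) - \<Omega> \<noteq> {}"
    using assms self_mem_cell[of x j] by (auto simp: inside_def)
  then have "cell j (gidx j x) \<inter> frontier \<Omega> \<noteq> {}"
    by (rule connected_Int_frontier[OF connected_cell])
  then obtain y where "y \<in> frontier \<Omega>" "gidx j y = gidx j x" by (auto simp: cell_def)
  then show ?thesis by (metis image_eqI)
qed

lemma finite_frontier_gidx: "finite (gidx j ` frontier \<Omega>)"
  by (intro finite_gidx bounded_subset[OF bounded_closure[OF O(2)]]) (auto simp: frontier_def)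

lemma finite_W: "finite (W j)"
  by (cases j) (auto intro!: finite_gidx bounded_subset[OF O(2)])

lemma finite_R: "finite (R J)"
  unfolding R_def by (auto intro!: finite_gidx bounded_subset[OF O(2)])

lemma card_R: "card (R J) \<le> bcount J"
  unfolding bcount_def R_def using not_inside_frontier by (intro card_mono finite_frontier_gidx) auto

text \<open>The parent of a maximal cell meets \<open>\<Omega>\<close> without lying inside it, so
  it contains a frontier point.\<close>

lemma card_W_Suc: "card (W (Suc j)) \<le> 2 ^ DIM('a) * bcount j"
proof -
  have sub: "W (Suc j) \<subseteq> (\<lambda>(q, X). 2 *\<^sub>R q + \<Sum>X) ` (gidx j ` frontier \<Omega> \<times> Pow Basis)"
  proof
    fix p assume "p \<in> W (Suc j)"
    then obtain x where x: "x \<in> \<Omega>" "p = gidx (Suc j) x" "\<not> inside j x" by auto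
    obtain X where X: "X \<subseteq> Basis" "gidx (Suc j) x = 2 *\<^sub>R gidx j x + \<Sum>X" using gidx_Suc by blast
    have "(gidx j x, X) \<in> gidx j ` frontier \<Omega> \<times> Pow Basis"
      using not_inside_frontier[OF x(1,3)] X(1) by simp
    moreover have "p = (\<lambda>(q, X). 2 *\<^sub>R q + \<Sum>X) (gidx j x, X)" using x(2) X(2) by simp
    ultimately show "p \<in> (\<lambda>(q, X). 2 *\<^sub>R q + \<Sum>X) ` (gidx j ` frontier \<Omega> \<times> Pow Basis)" by (rule rev_image_eqI)
  qed
  have "card (W (Suc j)) \<le> card (gidx j ` frontier \<Omega> \<times> Pow (Basis :: 'a set))"
    by (rule surj_card_le[OF _ sub]) (simp add: finite_frontier_gidx)
  then show ?thesis by (simp add: card_cartesian_product card_Pow bcount_def mult.commute)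
qed

definition Tset :: "nat \<Rightarrow> (nat \<times> 'a) set" where
  "Tset J = Sigma {..J} W"

lemma finite_Tset: "finite (Tset J)"
  unfolding Tset_def using finite_W by blast

lemma Tset_R_disjoint: "Tset J \<inter> ({J} \<times> R J) = {}"
proof -
  have False if pW: "p \<in> W J" and pR: "p \<in> R J" for p
  proof -
    obtain x where x: "p = gidx J x" "inside J x" using W_mem[OF pW] by blast
    obtain y where y: "p = gidx J y" "\<not> inside J y" using pR by (auto simp: R_def)
    show False using x y inside_cong[of J x y] by simp
  qed
  then show ?thesis by (auto simp: Tset_def)
qed

lemma index_gidx: "q \<in> Tset J \<union> {J} \<times> R J \<Longrightarrow> \<exists>x. snd q = gidx (fst q) x"
  using W_mem by (fastforce simp: Tset_def R_def)

text \<open>Cells of one level are fibres. If the levels differ, the coarser cell lies inside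
  \<open>\<Omega>\<close>, because the boundary layer sits at the finest level; a common point would
  then contradict maximality of the finer cell, or its membership in the layer.\<close>

lemma cells_disjoint:
  assumes p: "p \<in> Tset J \<union> {J} \<times> R J" and q: "q \<in> Tset J \<union> {J} \<times> R J" and "p \<noteq> q"
  shows "cell (fst p) (snd p) \<inter> cell (fst q) (snd q) = {}"
proof -
  have aux: False if p: "p \<in> Tset J \<union> {J} \<times> R J" and q: "q \<in> Tset J \<union> {J} \<times> R J"
    and lt: "fst p < fst q" and x: "gidx (fst p) x = snd p" "gidx (fst q) x = snd q" for p q x
  proof -
    have "fst q \<le> J" using q by (auto simp: Tset_def)
    then have "p \<in> Tset J" using p lt by auto
    then have pW: "snd p \<in> W (fst p)" by (auto simp: Tset_def)
    obtain y where y: "snd p = gidx (fst p) y" "inside (fst p) y" using W_mem[OF pW] by blast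
    then have ix: "inside (fst p) x" using inside_cong[of "fst p" x y] x by simp
    from q consider "snd q \<in> W (fst q)" | "fst q = J" "snd q \<in> R J" by (auto simp: Tset_def)
    then show False
    proof cases
      case 1
      obtain z where z: "snd q = gidx (fst q) z" "\<forall>i<fst q. \<not> inside i z" using W_mem[OF 1] by blast
      have "gidx (fst p) x = gidx (fst p) z" using gidx_coarsen[of "fst q" x z] x(2) z(1) lt by simp
      then show False using ix z(2) lt inside_cong by blast
    next
      case 2
      then obtain z where z: "snd q = gidx J z" "\<not> inside J z" by (auto simp: R_def)
      have "inside J x" using inside_mono[OF ix] lt 2(1) by simp
      then show False using inside_cong[of J x z] z x(2) 2(1) by simp
    qed
  qed
  show ?thesis
  proof (rule ccontr)
    assume "\<not> ?thesis"
    then obtain x where x: "gidx (fst p) x = snd p" "gidx (fst q) x = snd q" by (auto simp: cell_def)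
    show False
    proof (cases "fst p" "fst q" rule: linorder_cases)
      case less show ?thesis by (rule aux[OF p q less x])
    next
      case equal then show ?thesis using x \<open>p \<noteq> q\<close> by (simp add: prod_eq_iff)
    next
      case greater show ?thesis by (rule aux[OF q p greater x(2) x(1)])
    qed
  qed
qed

lemma cells_cover: "\<Omega> \<subseteq> (\<Union>p\<in>Tset J \<union> {J} \<times> R J. cell (fst p) (snd p))"
proof
  fix x assume x: "x \<in> \<Omega>"
  show "x \<in> (\<Union>p\<in>Tset J \<union> {J} \<times> R J. cell (fst p) (snd p))"
  proof (cases "inside J x")
    case False
    then have "(J, gidx J x) \<in> Tset J \<union> {J} \<times> R J" using x by (auto simp: R_def)
    then show ?thesis using self_mem_cell[of x J] by force
  next
    case True
    define j where "j = (LEAST j. inside j x)"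
    have j: "inside j x" "j \<le> J" using LeastI[of "\<lambda>j. inside j x" J] Least_le[of "\<lambda>j. inside j x" J] True by (auto simp: j_def)
    have n: "\<not> inside i x" if "i < j" for i using that not_less_Least unfolding j_def by blast
    have "gidx j x \<in> W j"
    proof (cases j)
      case 0 then show ?thesis using j x by auto
    next
      case (Suc i) then show ?thesis using j x n[of i] by auto
    qed
    then have "(j, gidx j x) \<in> Tset J \<union> {J} \<times> R J" using j by (auto simp: Tset_def)
    then show ?thesis using self_mem_cell[of x j] by force
  qed
qed

lemma cells_inside: "p \<in> Tset J \<Longrightarrow> cell (fst p) (snd p) \<subseteq> \<Omega>"
  using W_mem by (fastforce simp: Tset_def inside_def)

lemma measure_cells:
  assumes "q \<in> Tset J \<union> {J} \<times> R J"
  shows "measure lborel (cell (fst q) (snd q)) = (1 / 2 ^ fst q) ^ DIM('a)"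
    "cell (fst q) (snd q) \<in> sets lborel" "emeasure lborel (cell (fst q) (snd q)) \<noteq> \<infinity>"
proof -
  obtain x where x: "snd q = gidx (fst q) x" using index_gidx[OF assms] by blast
  show "measure lborel (cell (fst q) (snd q)) = (1 / 2 ^ fst q) ^ DIM('a)"
    "cell (fst q) (snd q) \<in> sets lborel" "emeasure lborel (cell (fst q) (snd q)) \<noteq> \<infinity>"
    unfolding x using measure_cell borel_cell emeasure_cell_finite[of "fst q" x] by auto
qed

lemma measure_bounds:
  shows "(\<Sum>p\<in>Tset J. (1 / 2 ^ fst p) ^ DIM('a)) \<le> measure lborel \<Omega>"
    and "measure lborel \<Omega> \<le> (\<Sum>p\<in>Tset J. (1 / 2 ^ fst p) ^ DIM('a)) + real (card (R J)) * (1 / 2 ^ J) ^ DIM('a)"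
proof -
  have f\<Omega>: "\<Omega> \<in> fmeasurable lborel"
    using O emeasure_bounded_finite[OF O(2)] by (auto simp: fmeasurable_def)
  have "(\<Sum>p\<in>Tset J. (1 / 2 ^ fst p) ^ DIM('a)) = (\<Sum>p\<in>Tset J. measure lborel (cell (fst p) (snd p)))"
    by (intro sum.cong refl) (simp add: measure_cells(1)[of _ J])
  also have "\<dots> = measure lborel (\<Union>p\<in>Tset J. cell (fst p) (snd p))"
  proof (rule measure_finite_Union[symmetric])
    show "disjoint_family_on (\<lambda>p. cell (fst p) (snd p)) (Tset J)"
      unfolding disjoint_family_on_def using cells_disjoint[of _ J] by blast
  qed (use measure_cells(2,3)[of _ J] finite_Tset in auto)
  also have "\<dots> \<le> measure lborel \<Omega>"
    by (rule measure_mono_fmeasurable) (use cells_inside f\<Omega> measure_cells(2)[of _ J] finite_Tset in \<open>auto intro!: sets.finite_UN\<close>)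
  finally show "(\<Sum>p\<in>Tset J. (1 / 2 ^ fst p) ^ DIM('a)) \<le> measure lborel \<Omega>" .
  let ?U = "Tset J \<union> {J} \<times> R J"
  have finU: "finite ?U" using finite_Tset finite_R by simp
  have "measure lborel \<Omega> \<le> measure lborel (\<Union>p\<in>?U. cell (fst p) (snd p))"
  proof (rule measure_mono_fmeasurable[OF cells_cover])
    show "\<Omega> \<in> sets lborel" using O by simp
    show "(\<Union>p\<in>?U. cell (fst p) (snd p)) \<in> fmeasurable lborel"
      using measure_cells(2,3)[of _ J] by (intro fmeasurable.finite_UN[OF finU]) (auto simp: fmeasurable_def less_top)
  qed
  also have "\<dots> \<le> (\<Sum>p\<in>?U. measure lborel (cell (fst p) (snd p)))"
    using measure_cells(2)[of _ J] by (intro measure_UNION_le finU) auto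
  also have "\<dots> = (\<Sum>p\<in>?U. (1 / 2 ^ fst p) ^ DIM('a))"
    by (intro sum.cong refl) (simp add: measure_cells(1)[of _ J])
  also have "\<dots> = (\<Sum>p\<in>Tset J. (1 / 2 ^ fst p) ^ DIM('a)) + (\<Sum>p\<in>{J} \<times> R J. (1 / 2 ^ fst p) ^ DIM('a))"
    using finite_Tset finite_R Tset_R_disjoint by (intro sum.union_disjoint) auto
  also have "(\<Sum>p\<in>{J} \<times> R J. (1 / 2 ^ fst p) ^ DIM('a)) = (\<Sum>p\<in>{J} \<times> R J. (1 / 2 ^ J) ^ DIM('a))"
    by (intro sum.cong refl) auto
  also have "\<dots> = real (card (R J)) * (1 / 2 ^ J) ^ DIM('a)" by (simp add: card_cartesian_product)
  finally show "measure lborel \<Omega> \<le> (\<Sum>p\<in>Tset J. (1 / 2 ^ fst p) ^ DIM('a)) + real (card (R J)) * (1 / 2 ^ J) ^ DIM('a)" .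
qed

lemma N_D_dyadic_upper:
  assumes l: "l > 0"
  shows "N_D \<Omega> l \<le> enat (\<Sum>p\<in>Tset J \<union> {J} \<times> R J. card {k::'a. k \<in> nat_lattice \<and> norm k < l * (1 / 2 ^ fst p) / pi})"
proof -
  let ?U = "Tset J \<union> {J} \<times> R J"
  interpret cube_cover \<Omega> ?U "\<lambda>p. corner (fst p) (snd p)" "\<lambda>p. 1 / 2 ^ fst p" "\<lambda>p. cell (fst p) (snd p)"
  proof
    show "open \<Omega>" "bounded \<Omega>" by (rule O)+
    show "finite ?U" using finite_Tset finite_R by simp
    show "disjoint_family_on (\<lambda>p. cell (fst p) (snd p)) ?U"
      unfolding disjoint_family_on_def using cells_disjoint[of _ J] by blast
    show "\<Omega> \<subseteq> (\<Union>p\<in>?U. cell (fst p) (snd p))" by (rule cells_cover)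
    fix p assume p: "p \<in> ?U"
    then obtain x where x: "snd p = gidx (fst p) x" using index_gidx by blast
    show "cell (fst p) (snd p) \<in> sets borel" unfolding x by (rule borel_cell)
    show "cell (fst p) (snd p) \<subseteq> cube (corner (fst p) (snd p)) (1 / 2 ^ fst p)" unfolding x by (rule cell_boxes)
    show "cube (corner (fst p) (snd p)) (1 / 2 ^ fst p) - cell (fst p) (snd p) \<in> null_sets lborel" unfolding x by (rule cell_null)
  qed auto
  have "card (modes l) = (\<Sum>p\<in>?U. card {k::'a. k \<in> nat_lattice \<and> norm k < l * (1 / 2 ^ fst p) / pi})"
    unfolding modes_def using T finite_nat_lattice_ball by (intro card_SigmaI) auto
  then show ?thesis using N_D_le_modes[OF l] by simp
qed

lemma N_D_dyadic_lower:
  assumes l: "l > 0"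
  shows "enat (\<Sum>p\<in>Tset J. card {k::'a. k \<in> nat_lattice \<and> (\<forall>b\<in>Basis. k \<bullet> b \<noteq> 0) \<and> norm k < l * (1 / 2 ^ fst p) / pi}) \<le> N_D \<Omega> l"
proof -
  have sub: "box (corner (fst p) (snd p)) (corner (fst p) (snd p) + (1 / 2 ^ fst p) *\<^sub>R One) \<subseteq> cell (fst p) (snd p)" if p: "p \<in> Tset J" for p
  proof -
    obtain x where x: "snd p = gidx (fst p) x" using index_gidx[of p J] p by blast
    show ?thesis unfolding x by (rule cell_boxes)
  qed
  show ?thesis
  proof (rule N_D_ge_cubes[OF O finite_Tset _ _ _ l, where c="\<lambda>p. corner (fst p) (snd p)"])
    fix p assume p: "p \<in> Tset J"
    show "box (corner (fst p) (snd p)) (corner (fst p) (snd p) + (1 / 2 ^ fst p) *\<^sub>R One) \<subseteq> \<Omega>"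
      using sub[OF p] cells_inside[OF p] by blast
    fix q assume q: "q \<in> Tset J" "p \<noteq> q"
    show "box (corner (fst p) (snd p)) (corner (fst p) (snd p) + (1 / 2 ^ fst p) *\<^sub>R One) \<inter>
        box (corner (fst q) (snd q)) (corner (fst q) (snd q) + (1 / 2 ^ fst q) *\<^sub>R One) = {}"
      using sub[OF p] sub[OF q(1)] cells_disjoint[of p J q] p q by blast
  qed auto
qed

end

section \<open>Summing the errors\<close>

lemma exists_dyadic_level:
  fixes l :: real
  assumes "l \<ge> 1"
  obtains J :: nat where "2 ^ J \<le> l" "l < 2 ^ Suc J"
proof -
  define n where "n = (LEAST n. l < 2 ^ n)"
  have ex: "\<exists>n. l < 2 ^ n" using real_arch_pow[of 2 l] by simp
  have n: "l < 2 ^ n" unfolding n_def by (rule LeastI_ex[OF ex])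
  then have "n \<noteq> 0" using assms by (intro notI) simp
  then obtain J where J: "n = Suc J" by (cases n) auto
  have "\<not> l < 2 ^ J" using not_less_Least[of J "\<lambda>n. l < 2 ^ n"] J by (simp add: n_def)
  then show ?thesis using that[of J] n J by auto
qed

context dyadic
begin

text \<open>The choice of \<open>J\<close> makes \<open>l / 2 ^ j \<ge> 1\<close> for all levels
  used, so the lattice asymptotics apply. At the finest level this quantity is at most 2, so each
  boundary cell contributes a bounded number of modes.\<close>

lemma counting_error:
  fixes l :: real
  assumes C0: "C0 \<ge> 0" and asym: "\<And>y. y \<ge> 1 \<Longrightarrow>
     real (card {k::'a. k \<in> nat_lattice \<and> norm k < y / pi}) \<le>
       C_W DIM('a) * y ^ DIM('a) + C0 * y ^ (DIM('a) - 1) \<and>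
     C_W DIM('a) * y ^ DIM('a) - C0 * y ^ (DIM('a) - 1) \<le>
       real (card {k::'a. k \<in> nat_lattice \<and> (\<forall>b\<in>Basis. k \<bullet> b \<noteq> 0) \<and> norm k < y / pi})"
    and J: "2 ^ J \<le> l" "l < 2 ^ Suc J"
  shows "\<exists>n. N_D \<Omega> l = enat n \<and> \<bar>real n - C_W DIM('a) * measure lborel \<Omega> * l ^ DIM('a)\<bar> \<le>
    C0 * (\<Sum>p\<in>Tset J. (l / 2 ^ fst p) ^ (DIM('a) - 1)) + (C_W DIM('a) + C0) * 2 ^ DIM('a) * real (bcount J)"
proof -
  let ?d = "DIM('a)" and ?\<mu> = "measure lborel \<Omega>"
  define c where "c = C_W ?d"
  have c0: "c \<ge> 0" by (simp add: c_def C_W_def)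
  have l: "l > 0" using J(1) by (smt (verit) zero_less_power)
  define E where "E = (\<Sum>p\<in>Tset J. (l / 2 ^ fst p) ^ (?d - 1))"
  define V where "V = (\<Sum>p\<in>Tset J. (1 / 2 ^ fst p) ^ ?d :: real)"
  define r where "r = real (card (R J))"
  have r: "0 \<le> r" "r \<le> real (bcount J)" using card_R[of J] by (auto simp: r_def)
  have y1: "l * (1 / 2 ^ j) \<ge> 1" if "j \<le> J" for j
  proof -
    have "(2::real) ^ j \<le> 2 ^ J" using that by (intro power_increasing) auto
    then have "2 ^ j \<le> l" using J(1) by linarith
    then show ?thesis by simp
  qed
  have TJ: "fst p \<le> J" if "p \<in> Tset J" for p using that by (auto simp: Tset_def)
  have yJ: "l * (1 / 2 ^ J) \<le> 2" using J(2) by (simp add: divide_le_eq mult.commute)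
  have pw: "(l * (1 / 2 ^ J)) ^ ?d \<le> 2 ^ ?d" "(l * (1 / 2 ^ J)) ^ (?d - 1) \<le> 2 ^ ?d"
  proof -
    \<comment> \<open>Both powers are bounded by \<open>2 ^ ?d\<close> so that one constant serves
      for the leading term and for the error.\<close>
    show "(l * (1 / 2 ^ J)) ^ ?d \<le> 2 ^ ?d" using yJ l by (intro power_mono) auto
    have "(l * (1 / 2 ^ J)) ^ (?d - 1) \<le> 2 ^ (?d - 1)" using yJ l by (intro power_mono) auto
    also have "\<dots> \<le> (2::real) ^ ?d" by (intro power_increasing) auto
    finally show "(l * (1 / 2 ^ J)) ^ (?d - 1) \<le> 2 ^ ?d" .
  qed
  have split: "(\<Sum>p\<in>Tset J \<union> {J} \<times> R J. g p) = (\<Sum>p\<in>Tset J. g p) + (\<Sum>p\<in>{J} \<times> R J. g p)" for g :: "nat \<times> 'a \<Rightarrow> real"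
    using finite_Tset finite_R Tset_R_disjoint by (intro sum.union_disjoint) auto
  let ?up = "\<lambda>p. card {k::'a. k \<in> nat_lattice \<and> norm k < l * (1 / 2 ^ fst p) / pi}"
  let ?lo = "\<lambda>p. card {k::'a. k \<in> nat_lattice \<and> (\<forall>b\<in>Basis. k \<bullet> b \<noteq> 0) \<and> norm k < l * (1 / 2 ^ fst p) / pi}"
  have lam: "(\<Sum>p\<in>Tset J. (l * (1 / 2 ^ fst p)) ^ ?d) = l ^ ?d * V"
    by (simp only: V_def sum_distrib_left power_mult_distrib)
  have "(\<Sum>p\<in>Tset J. real (?up p)) \<le> (\<Sum>p\<in>Tset J. c * (l * (1 / 2 ^ fst p)) ^ ?d + C0 * (l * (1 / 2 ^ fst p)) ^ (?d - 1))"
    unfolding c_def using asym y1 TJ by (intro sum_mono) blast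
  also have "\<dots> = c * (\<Sum>p\<in>Tset J. (l * (1 / 2 ^ fst p)) ^ ?d) + C0 * E"
    by (simp add: E_def sum.distrib sum_distrib_left)
  finally have u1: "(\<Sum>p\<in>Tset J. real (?up p)) \<le> c * (l ^ ?d * V) + C0 * E" unfolding lam .
  have "(\<Sum>p\<in>{J} \<times> R J. real (?up p)) \<le> (\<Sum>p\<in>{J} \<times> R J. c * 2 ^ ?d + C0 * 2 ^ ?d)"
  proof (rule sum_mono)
    fix p assume "p \<in> {J} \<times> R J"
    then have "fst p = J" by auto
    then have "real (?up p) \<le> c * (l * (1 / 2 ^ J)) ^ ?d + C0 * (l * (1 / 2 ^ J)) ^ (?d - 1)"
      unfolding c_def using asym[OF y1[of J]] by simp
    also have "\<dots> \<le> c * 2 ^ ?d + C0 * 2 ^ ?d" using pw c0 C0 by (intro add_mono mult_left_mono)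
    finally show "real (?up p) \<le> c * 2 ^ ?d + C0 * 2 ^ ?d" .
  qed
  also have "\<dots> = r * ((c + C0) * 2 ^ ?d)" by (simp add: r_def card_cartesian_product distrib_right)
  finally have u2: "(\<Sum>p\<in>{J} \<times> R J. real (?up p)) \<le> r * ((c + C0) * 2 ^ ?d)" .
  obtain n where n: "N_D \<Omega> l = enat n" "n \<le> (\<Sum>p\<in>Tset J \<union> {J} \<times> R J. ?up p)"
    using N_D_dyadic_upper[OF l, of J] by (cases "N_D \<Omega> l") auto
  have "real n \<le> (\<Sum>p\<in>Tset J \<union> {J} \<times> R J. real (?up p))" unfolding of_nat_sum[symmetric] of_nat_le_iff by (rule n(2))
  then have upper: "real n \<le> c * (l ^ ?d * V) + C0 * E + r * ((c + C0) * 2 ^ ?d)"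
    using u1 u2 unfolding split by linarith
  have "(\<Sum>p\<in>Tset J. ?lo p) \<le> n" using N_D_dyadic_lower[OF l, of J] n(1) by simp
  then have "(\<Sum>p\<in>Tset J. real (?lo p)) \<le> real n" unfolding of_nat_sum[symmetric] of_nat_le_iff .
  moreover have "(\<Sum>p\<in>Tset J. c * (l * (1 / 2 ^ fst p)) ^ ?d - C0 * (l * (1 / 2 ^ fst p)) ^ (?d - 1)) \<le> (\<Sum>p\<in>Tset J. real (?lo p))"
    unfolding c_def using asym y1 TJ by (intro sum_mono) blast
  moreover have "(\<Sum>p\<in>Tset J. c * (l * (1 / 2 ^ fst p)) ^ ?d - C0 * (l * (1 / 2 ^ fst p)) ^ (?d - 1)) = c * (\<Sum>p\<in>Tset J. (l * (1 / 2 ^ fst p)) ^ ?d) - C0 * E"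
    by (simp add: E_def sum_subtractf sum_distrib_left)
  ultimately have lower: "c * (l ^ ?d * V) - C0 * E \<le> real n" unfolding lam by linarith
  \<comment> \<open>\<open>V\<close> is the volume of the inner cells. The volume missing from
    \<open>\<Omega>\<close> is at most that of the boundary layer and costs no more than the modes
    already granted to the layer.\<close>
  have V: "V \<le> ?\<mu>" "?\<mu> \<le> V + r * (1 / 2 ^ J) ^ ?d" using measure_bounds[of J] by (auto simp: V_def r_def)
  have "c * (l ^ ?d * V) \<le> c * (l ^ ?d * ?\<mu>)" using V(1) c0 l by (intro mult_left_mono) auto
  moreover have "c * (l ^ ?d * ?\<mu>) \<le> c * (l ^ ?d * V) + r * (c * 2 ^ ?d)"
  proof -
    have "c * (l ^ ?d * ?\<mu>) \<le> c * (l ^ ?d * (V + r * (1 / 2 ^ J) ^ ?d))"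
      using V(2) c0 l by (intro mult_left_mono) auto
    also have "\<dots> = c * (l ^ ?d * V) + r * (c * (l * (1 / 2 ^ J)) ^ ?d)"
      unfolding power_mult_distrib by (simp only: distrib_left mult_ac)
    also have "\<dots> \<le> c * (l ^ ?d * V) + r * (c * 2 ^ ?d)"
      using pw(1) c0 r(1) by (intro add_left_mono mult_left_mono)
    finally show ?thesis .
  qed
  moreover have "r * (c * 2 ^ ?d) \<le> r * ((c + C0) * 2 ^ ?d)" using C0 c0 r(1) by (intro mult_left_mono mult_right_mono) auto
  moreover have "r * ((c + C0) * 2 ^ ?d) \<le> real (bcount J) * ((c + C0) * 2 ^ ?d)" using r C0 c0 by (intro mult_right_mono) auto
  ultimately have "\<bar>real n - c * (l ^ ?d * ?\<mu>)\<bar> \<le> C0 * E + real (bcount J) * ((c + C0) * 2 ^ ?d)"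
    using upper lower by (simp add: abs_le_iff)
  then show ?thesis using n(1)
    by (intro exI[of _ n]) (simp add: c_def E_def mult_ac)
qed

lemma boundary_layer_sum:
  "(\<Sum>p\<in>Tset J. (l / 2 ^ fst p) ^ m) = (\<Sum>j\<le>J. real (card (W j)) * (l / 2 ^ j) ^ m)" for l :: real
proof -
  have "(\<Sum>p\<in>Tset J. (l / 2 ^ fst p) ^ m) = (\<Sum>j\<le>J. \<Sum>q\<in>W j. (l / 2 ^ j) ^ m)"
    unfolding Tset_def using finite_W by (subst sum.Sigma) (auto simp: case_prod_unfold)
  then show ?thesis by simp
qed

text \<open>\<open>C\<close> is chosen before \<open>M\<close> and \<open>K\<close>: the leading
  coefficient of the error is a fixed multiple of \<open>M\<close>, while \<open>K\<close> enters
  only the lower-order constant \<open>K'\<close>. The little-o estimate depends on this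
  order.\<close>

theorem Weyl_of_boundary_count:
  assumes d: "DIM('a) \<ge> 2" and \<alpha>: "0 < \<alpha>" "\<alpha> < 1"
  shows "\<exists>C\<ge>0. \<forall>M\<ge>0. \<forall>K\<ge>0.
    (\<forall>j. real (bcount j) \<le> M * 2 powr (real j * (real DIM('a) - \<alpha>)) + K) \<longrightarrow>
    (\<exists>K'. \<forall>l\<ge>1. \<exists>n. N_D \<Omega> l = enat n \<and>
       \<bar>real n - C_W DIM('a) * measure lborel \<Omega> * l ^ DIM('a)\<bar> \<le>
         C * M * l powr (real DIM('a) - \<alpha>) + K' * l ^ (DIM('a) - 1))"
proof -
  let ?d = "DIM('a)"
  obtain C0 where C0: "C0 \<ge> 0" and asym: "\<And>y. y \<ge> 1 \<Longrightarrow>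
     real (card {k::'a. k \<in> nat_lattice \<and> norm k < y / pi}) \<le> C_W ?d * y ^ ?d + C0 * y ^ (?d - 1) \<and>
     C_W ?d * y ^ ?d - C0 * y ^ (?d - 1) \<le>
       real (card {k::'a. k \<in> nat_lattice \<and> (\<forall>b\<in>Basis. k \<bullet> b \<noteq> 0) \<and> norm k < y / pi})"
    using lattice_count_asymptotics[where 'a='a] by blast
  define c where "c = C_W ?d"
  have c0: "c \<ge> 0" by (simp add: c_def C_W_def)
  \<comment> \<open>The ratio of the errors of consecutive levels: the number of cells grows by
    \<open>2 powr (?d - \<alpha>)\<close>, and the error per cell shrinks by
    \<open>2 powr (?d - 1)\<close>.\<close>
  define q where "q = 2 powr (1 - \<alpha>)"
  have q1: "q > 1" using \<alpha> by (simp add: q_def)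
  \<comment> \<open>The first summand belongs to the inner cells, with \<open>2 ^ ?d\<close>
    children per boundary cell and a geometric sum of ratio \<open>q\<close>; the second belongs to
    the boundary layer.\<close>
  define C where "C = C0 * 2 ^ ?d / (q - 1) + (c + C0) * 2 ^ ?d"
  show ?thesis
  proof (rule exI[of _ C], intro conjI allI impI)
    show "C \<ge> 0" using C0 c0 q1 by (auto simp: C_def)
    fix M K :: real assume M: "M \<ge> 0" and K: "K \<ge> 0"
      and bc: "\<forall>j. real (bcount j) \<le> M * 2 powr (real j * (real ?d - \<alpha>)) + K"
    define K' where "K' = C0 * real (card (W 0)) + C0 * (2 ^ ?d * (K * 2)) + (c + C0) * 2 ^ ?d * K"
    show "\<exists>K'. \<forall>l\<ge>1. \<exists>n. N_D \<Omega> l = enat n \<and>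
       \<bar>real n - C_W ?d * measure lborel \<Omega> * l ^ ?d\<bar> \<le> C * M * l powr (real ?d - \<alpha>) + K' * l ^ (?d - 1)"
    proof (intro exI[of _ K'] allI impI)
      fix l :: real assume l: "1 \<le> l"
      obtain J where J: "2 ^ J \<le> l" "l < 2 ^ Suc J" by (rule exists_dyadic_level[OF l])
      let ?P = "l powr (real ?d - \<alpha>)" and ?L = "l ^ (?d - 1)"
      have L1: "?L \<ge> 1" using l by (rule one_le_power)
      have lp: "?L * l powr (1 - \<alpha>) = ?P"
      proof -
        have "?L = l powr (real (?d - 1))" by (rule powr_realpow[symmetric]) (use l in simp)
        then show ?thesis using d by (simp add: powr_add[symmetric] of_nat_diff)
      qed
      have step: "(M * 2 powr (real j * (real ?d - \<alpha>)) + K) * (l / 2 ^ j) ^ (?d - 1) \<le> M * ?L * q ^ j + K * ?L * (1/2) ^ j" for j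
      proof -
        have e1: "(l / 2 ^ j) ^ (?d - 1) = ?L * 2 powr (- (real j * real (?d - 1)))"
        proof -
          have "(l / 2 ^ j) ^ m = l ^ m * 2 powr (- (real j * real m))" for m
          proof -
            have "(2::real) ^ (j * m) = 2 powr (real j * real m)" using powr_realpow[of 2 "j * m"] by simp
            moreover have "(l / 2 ^ j) ^ m = l ^ m / 2 ^ (j * m)" by (simp only: power_divide power_mult)
            ultimately show ?thesis by (simp add: powr_minus_divide)
          qed
          then show ?thesis .
        qed
        have alg: "(M * P + K) * (L * Z) = M * L * (P * Z) + K * L * Z" for P L Z :: real
          by (simp add: algebra_simps)
        have e2: "2 powr (real j * (real ?d - \<alpha>)) * 2 powr (- (real j * real (?d - 1))) = q ^ j"
        proof -
          have "real j * (real ?d - \<alpha>) + - (real j * real (?d - 1)) = (1 - \<alpha>) * real j"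
            using d by (simp add: of_nat_diff algebra_simps)
          then have "2 powr (real j * (real ?d - \<alpha>)) * 2 powr (- (real j * real (?d - 1))) = 2 powr ((1 - \<alpha>) * real j)"
            by (simp only: powr_add[symmetric])
          also have "\<dots> = q ^ j" unfolding q_def powr_powr[symmetric] by (simp add: powr_realpow)
          finally show ?thesis .
        qed
        \<comment> \<open>As the dimension is at least 2, the part with \<open>K\<close> decays
          geometrically in \<open>j\<close> and leaves a multiple of
          \<open>l ^ (?d - 1)\<close>.\<close>
        have e3: "2 powr (- (real j * real (?d - 1))) \<le> (1/2) ^ j"
        proof -
          have "2 powr (- (real j * real (?d - 1))) \<le> 2 powr (- real j)"
            using d mult_left_mono[of 1 "real (?d - 1)" "real j"] by (intro powr_mono) auto
          also have "\<dots> = (1/2) ^ j" by (simp add: powr_minus powr_realpow power_one_over inverse_eq_divide)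
          finally show ?thesis .
        qed
        have "(M * 2 powr (real j * (real ?d - \<alpha>)) + K) * (l / 2 ^ j) ^ (?d - 1) =
            M * ?L * (2 powr (real j * (real ?d - \<alpha>)) * 2 powr (- (real j * real (?d - 1)))) + K * ?L * 2 powr (- (real j * real (?d - 1)))"
          unfolding e1 by (rule alg)
        also have "\<dots> = M * ?L * q ^ j + K * ?L * 2 powr (- (real j * real (?d - 1)))" unfolding e2 ..
        also have "\<dots> \<le> M * ?L * q ^ j + K * ?L * (1/2) ^ j"
          using e3 K L1 by (intro add_left_mono mult_left_mono) auto
        finally show ?thesis .
      qed
      have "(\<Sum>j\<le>J. real (card (W j)) * (l / 2 ^ j) ^ (?d - 1)) =
          real (card (W 0)) * ?L + (\<Sum>j<J. real (card (W (Suc j))) * (l / 2 ^ Suc j) ^ (?d - 1))"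
        by (simp add: sum.atMost_shift)
      also have "(\<Sum>j<J. real (card (W (Suc j))) * (l / 2 ^ Suc j) ^ (?d - 1)) \<le>
          (\<Sum>j<J. 2 ^ ?d * (M * ?L * q ^ j + K * ?L * (1/2) ^ j))"
      proof (rule sum_mono)
        fix j
        have "real (card (W (Suc j))) \<le> 2 ^ ?d * real (bcount j)"
          using of_nat_mono[OF card_W_Suc[of j], where 'a=real] by simp
        also have "\<dots> \<le> 2 ^ ?d * (M * 2 powr (real j * (real ?d - \<alpha>)) + K)"
          using bc by (intro mult_left_mono) auto
        finally have 1: "real (card (W (Suc j))) \<le> 2 ^ ?d * (M * 2 powr (real j * (real ?d - \<alpha>)) + K)" .
        \<comment> \<open>Cells of level \<open>Suc j\<close> are counted by boundary cells of level
          \<open>j\<close>. Replacing their side by that of the parent costs only a constant factor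
          and makes \<open>step\<close> applicable.\<close>
        have "(l / 2 ^ Suc j) ^ (?d - 1) \<le> (l / 2 ^ j) ^ (?d - 1)"
          using l by (intro power_mono divide_left_mono power_increasing) auto
        with 1 have "real (card (W (Suc j))) * (l / 2 ^ Suc j) ^ (?d - 1) \<le>
            (2 ^ ?d * (M * 2 powr (real j * (real ?d - \<alpha>)) + K)) * (l / 2 ^ j) ^ (?d - 1)"
          using M K l by (intro mult_mono) auto
        also have "\<dots> \<le> 2 ^ ?d * (M * ?L * q ^ j + K * ?L * (1/2) ^ j)"
          unfolding mult.assoc[of "2 ^ ?d"] by (intro mult_left_mono step) auto
        finally show "real (card (W (Suc j))) * (l / 2 ^ Suc j) ^ (?d - 1) \<le> 2 ^ ?d * (M * ?L * q ^ j + K * ?L * (1/2) ^ j)" .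
      qed
      also have "(\<Sum>j<J. 2 ^ ?d * (M * ?L * q ^ j + K * ?L * (1/2) ^ j)) =
          2 ^ ?d * (M * ?L * (\<Sum>j<J. q ^ j) + K * ?L * (\<Sum>j<J. (1/2) ^ j))"
        by (simp only: sum_distrib_left[symmetric] sum.distrib)
      also have "\<dots> \<le> 2 ^ ?d * (M * ?L * (l powr (1 - \<alpha>) / (q - 1)) + K * ?L * 2)"
      proof (intro mult_left_mono add_mono)
        have "(\<Sum>j<J. q ^ j) = (q ^ J - 1) / (q - 1)" using q1 by (intro geometric_sum) auto
        also have "\<dots> \<le> l powr (1 - \<alpha>) / (q - 1)"
        proof (rule divide_right_mono)
          have "q ^ J = (2 ^ J) powr (1 - \<alpha>)"
            unfolding q_def by (simp add: powr_realpow[symmetric] powr_powr mult.commute)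
          also have "\<dots> \<le> l powr (1 - \<alpha>)" using J(1) \<alpha> by (intro powr_mono2) auto
          finally show "q ^ J - 1 \<le> l powr (1 - \<alpha>)" by simp
        qed (use q1 in simp)
        finally show "(\<Sum>j<J. q ^ j) \<le> l powr (1 - \<alpha>) / (q - 1)" .
        have "(\<Sum>j<J. (1/2) ^ j) = (((1::real)/2) ^ J - 1) / (1/2 - 1)" by (intro geometric_sum) auto
        also have "\<dots> \<le> 2" by (simp add: field_simps)
        finally show "(\<Sum>j<J. ((1::real)/2) ^ j) \<le> 2" .
      qed (use M K L1 in auto)
      also have "M * ?L * (l powr (1 - \<alpha>) / (q - 1)) = M * ?P / (q - 1)"
        unfolding lp[symmetric] by simp
      finally have E: "(\<Sum>p\<in>Tset J. (l / 2 ^ fst p) ^ (?d - 1)) \<le>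
          real (card (W 0)) * ?L + 2 ^ ?d * (M * ?P / (q - 1) + K * ?L * 2)"
        unfolding boundary_layer_sum by simp
      have B: "real (bcount J) \<le> M * ?P + K * ?L"
      proof -
        have "2 powr (real J * (real ?d - \<alpha>)) = (2 ^ J) powr (real ?d - \<alpha>)"
          by (simp add: powr_realpow[symmetric] powr_powr)
        also have "\<dots> \<le> ?P" using J(1) \<alpha> d by (intro powr_mono2) auto
        finally have "M * 2 powr (real J * (real ?d - \<alpha>)) \<le> M * ?P" using M by (rule mult_left_mono)
        moreover have "K * 1 \<le> K * ?L" using L1 K by (rule mult_left_mono)
        ultimately show ?thesis using bc[rule_format, of J] by simp
      qed
      obtain n where n: "N_D \<Omega> l = enat n" "\<bar>real n - C_W ?d * measure lborel \<Omega> * l ^ ?d\<bar> \<le>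
          C0 * (\<Sum>p\<in>Tset J. (l / 2 ^ fst p) ^ (?d - 1)) + (c + C0) * 2 ^ ?d * real (bcount J)"
        using counting_error[OF C0 asym J] unfolding c_def by blast
      have "C0 * (\<Sum>p\<in>Tset J. (l / 2 ^ fst p) ^ (?d - 1)) + (c + C0) * 2 ^ ?d * real (bcount J) \<le>
          C0 * (real (card (W 0)) * ?L + 2 ^ ?d * (M * ?P / (q - 1) + K * ?L * 2)) + (c + C0) * 2 ^ ?d * (M * ?P + K * ?L)"
        using E B C0 c0 by (intro add_mono mult_left_mono) auto
      also have "\<dots> = C * M * ?P + K' * ?L"
        by (simp add: C_def K'_def distrib_left distrib_right mult_ac)
      finally show "\<exists>n. N_D \<Omega> l = enat n \<and> \<bar>real n - C_W ?d * measure lborel \<Omega> * l ^ ?d\<bar> \<le>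
          C * M * ?P + K' * ?L"
        using n by (intro exI[of _ n]) auto
    qed
  qed
qed

end

section \<open>Boundary cells of Hoelder domains\<close>

lemma card_gidx_le_prod:
  fixes S :: "'a::euclidean_space set"
  assumes fin: "\<And>b. b \<in> Basis \<Longrightarrow> finite (F b)"
    and F: "\<And>x b. x \<in> S \<Longrightarrow> b \<in> Basis \<Longrightarrow> \<lfloor>2 ^ j * (x \<bullet> b)\<rfloor> \<in> F b"
  shows "finite (gidx j ` S)" "card (gidx j ` S) \<le> (\<Prod>b\<in>Basis. card (F b))"
proof -
  have sub: "gidx j ` S \<subseteq> (\<lambda>f. \<Sum>b\<in>Basis. of_int (f b) *\<^sub>R b) ` PiE Basis F"
  proof
    fix p assume "p \<in> gidx j ` S"
    then obtain x where x: "x \<in> S" "p = gidx j x" by blast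
    have "restrict (\<lambda>b. \<lfloor>2 ^ j * (x \<bullet> b)\<rfloor>) Basis \<in> PiE Basis F"
      using F[OF x(1)] by (intro restrict_PiE_iff[THEN iffD2] ballI)
    moreover have "p = (\<Sum>b\<in>Basis. of_int (restrict (\<lambda>b. \<lfloor>2 ^ j * (x \<bullet> b)\<rfloor>) Basis b) *\<^sub>R b)"
      by (simp add: x(2) gidx_def)
    ultimately show "p \<in> (\<lambda>f. \<Sum>b\<in>Basis. of_int (f b) *\<^sub>R b) ` PiE Basis F" by blast
  qed
  have finP: "finite (PiE (Basis :: 'a set) F)" by (intro finite_PiE fin) auto
  show "finite (gidx j ` S)" by (rule finite_subset[OF sub]) (intro finite_imageI finP)
  have "card (gidx j ` S) \<le> card (PiE (Basis :: 'a set) F)" by (rule surj_card_le[OF finP sub])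
  then show "card (gidx j ` S) \<le> (\<Prod>b\<in>Basis. card (F b))" by (simp add: card_PiE)
qed

lemma floor_diff_le:
  fixes s t :: real
  assumes "\<bar>s - t\<bar> \<le> real r"
  shows "\<lfloor>s\<rfloor> \<in> {\<lfloor>t\<rfloor> - int r - 1..\<lfloor>t\<rfloor> + int r + 1}"
  using assms by (auto simp: abs_le_iff) linarith+

text \<open>In each coordinate the scaled values stay within \<open>r\<close> of a reference value,
  so their integer parts take at most \<open>2 * r + 3\<close> values.\<close>

lemma card_gidx_small_diameter:
  fixes S :: "'a::euclidean_space set"
  assumes "\<And>x y. x \<in> S \<Longrightarrow> y \<in> S \<Longrightarrow> norm (x - y) \<le> real r / 2 ^ j"
  shows "card (gidx j ` S) \<le> (2 * r + 3) ^ DIM('a)"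
proof (cases "S = {}")
  case False
  then obtain x0 where x0: "x0 \<in> S" by blast
  have "card (gidx j ` S) \<le> (\<Prod>b\<in>(Basis::'a set). card {\<lfloor>2 ^ j * (x0 \<bullet> b)\<rfloor> - int r - 1..\<lfloor>2 ^ j * (x0 \<bullet> b)\<rfloor> + int r + 1})"
  proof (rule card_gidx_le_prod(2))
    fix x b :: 'a assume x: "x \<in> S" and b: "b \<in> Basis"
    have "\<bar>(x - x0) \<bullet> b\<bar> \<le> real r / 2 ^ j"
      using Basis_le_norm[OF b, of "x - x0"] assms[OF x x0] by linarith
    then have "2 ^ j * \<bar>(x - x0) \<bullet> b\<bar> \<le> 2 ^ j * (real r / 2 ^ j)" by (intro mult_left_mono) auto
    also have "2 ^ j * \<bar>(x - x0) \<bullet> b\<bar> = \<bar>2 ^ j * (x \<bullet> b) - 2 ^ j * (x0 \<bullet> b)\<bar>"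
      by (simp add: inner_diff_left abs_mult flip: right_diff_distrib)
    finally have "\<bar>2 ^ j * (x \<bullet> b) - 2 ^ j * (x0 \<bullet> b)\<bar> \<le> real r" by simp
    then show "\<lfloor>2 ^ j * (x \<bullet> b)\<rfloor> \<in> {\<lfloor>2 ^ j * (x0 \<bullet> b)\<rfloor> - int r - 1..\<lfloor>2 ^ j * (x0 \<bullet> b)\<rfloor> + int r + 1}"
      by (rule floor_diff_le)
  qed auto
  also have "\<dots> = (2 * r + 3) ^ DIM('a)" by (simp add: nat_add_distrib nat_mult_distrib add.commute)
  finally show ?thesis .
qed simp

lemma same_cell_norm_le:
  fixes x y :: "'a::euclidean_space"
  assumes "gidx j x = gidx j y"
  shows "norm (x - y) \<le> real DIM('a) / 2 ^ j"
proof -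
  have "norm (x - y) \<le> real DIM('a) * (1 / 2 ^ j)"
  proof (rule norm_le_DIM)
    fix b :: 'a assume b: "b \<in> Basis"
    have "\<lfloor>2 ^ j * (x \<bullet> b)\<rfloor> = \<lfloor>2 ^ j * (y \<bullet> b)\<rfloor>" using assms b by (simp add: gidx_eq_iff)
    then have "\<bar>2 ^ j * (x \<bullet> b) - 2 ^ j * (y \<bullet> b)\<bar> \<le> 1" by linarith
    then have "2 ^ j * \<bar>(x - y) \<bullet> b\<bar> \<le> 1"
      by (simp add: inner_diff_left abs_mult flip: right_diff_distrib)
    then show "\<bar>(x - y) \<bullet> b\<bar> \<le> 1 / 2 ^ j" by (simp add: field_simps)
  qed
  then show ?thesis by simp
qed

text \<open>Charts are rotated, and the grid does not rotate with them. The preimage of one cell is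
  no wider than the cell, so it meets a bounded number of original cells, independently of the
  level.\<close>

lemma card_gidx_orthogonal_transformation:
  fixes U :: "'a::euclidean_space \<Rightarrow> 'a"
  assumes U: "orthogonal_transformation U" and S: "bounded S"
  shows "card (gidx j ` S) \<le> card (gidx j ` (U ` S)) * (2 * DIM('a) + 3) ^ DIM('a)"
proof -
  let ?Q = "gidx j ` (U ` S)" and ?S = "\<lambda>q. {x\<in>S. gidx j (U x) = q}"
  have "bounded_linear U"
    using orthogonal_transformation_linear[OF U] by (simp add: linear_conv_bounded_linear)
  then have "bounded (U ` S)" by (rule bounded_linear_image[OF S])
  then have fin: "finite ?Q" by (rule finite_gidx)
  have "gidx j ` S = (\<Union>q\<in>?Q. gidx j ` ?S q)" by auto
  then have "card (gidx j ` S) = card (\<Union>q\<in>?Q. gidx j ` ?S q)" by simp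
  also have "\<dots> \<le> (\<Sum>q\<in>?Q. card (gidx j ` ?S q))" by (rule card_UN_le[OF fin])
  also have "\<dots> \<le> (\<Sum>q\<in>?Q. (2 * DIM('a) + 3) ^ DIM('a))"
  proof (intro sum_mono card_gidx_small_diameter)
    fix q x y assume "x \<in> ?S q" "y \<in> ?S q"
    then have "norm (U x - U y) \<le> real DIM('a) / 2 ^ j" by (intro same_cell_norm_le) simp
    moreover have "norm (U x - U y) = norm (x - y)"
      using linear_diff[OF orthogonal_transformation_linear[OF U]] orthogonal_transformation_norm[OF U, of "x - y"]
      by simp
    ultimately show "norm (x - y) \<le> real DIM('a) / 2 ^ j" by simp
  qed
  also have "\<dots> = card ?Q * (2 * DIM('a) + 3) ^ DIM('a)" by simp
  finally show ?thesis .
qed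

lemma floor_scaled_bounded:
  fixes t :: real
  assumes "\<bar>t\<bar> \<le> real B"
  shows "\<lfloor>2 ^ j * t\<rfloor> \<in> {- (2 ^ j * int B)..2 ^ j * int B}"
proof -
  have "2 ^ j * \<bar>t\<bar> \<le> 2 ^ j * real B" using assms by (intro mult_left_mono) auto
  then have "\<bar>2 ^ j * t\<bar> \<le> 2 ^ j * real B" by (simp add: abs_mult)
  then have "real_of_int (- (2 ^ j * int B)) \<le> 2 ^ j * t" "2 ^ j * t \<le> real_of_int (2 ^ j * int B)"
    by (simp_all add: abs_le_iff)
  from floor_mono[OF this(1)] floor_mono[OF this(2)] show ?thesis
    by (simp only: floor_of_int atLeastAtMost_iff)
qed

lemma card_floor_range: "card {- (2 ^ j * int B)..2 ^ j * int B} \<le> 2 ^ j * (2 * B + 1)"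
proof -
  have "nat (2 ^ j * int B + 1 - - (2 ^ j * int B)) = 2 ^ j * (2 * B) + 1"
    by (simp add: nat_add_distrib nat_mult_distrib nat_power_eq)
  also have "\<dots> \<le> 2 ^ j * (2 * B + 1)" by simp
  finally show ?thesis by simp
qed

lemma card_gidx_bounded:
  fixes S :: "'a::euclidean_space set"
  assumes "\<And>x. x \<in> S \<Longrightarrow> norm x \<le> real B"
  shows "card (gidx j ` S) \<le> (2 ^ j * (2 * B + 1)) ^ DIM('a)"
proof -
  have "card (gidx j ` S) \<le> (\<Prod>b\<in>(Basis::'a set). card {- (2 ^ j * int B)..2 ^ j * int B})"
  proof (rule card_gidx_le_prod(2))
    fix x b :: 'a assume "x \<in> S" "b \<in> Basis"
    then have "\<bar>x \<bullet> b\<bar> \<le> real B" using assms[of x] Basis_le_norm[of b x] by linarith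
    then show "\<lfloor>2 ^ j * (x \<bullet> b)\<rfloor> \<in> {- (2 ^ j * int B)..2 ^ j * int B}" by (rule floor_scaled_bounded)
  qed auto
  also have "\<dots> \<le> (\<Prod>b\<in>(Basis::'a set). 2 ^ j * (2 * B + 1))"
    by (intro prod_mono conjI card_floor_range) auto
  finally show ?thesis by simp
qed

text \<open>The index in direction \<open>e\<close> is constant, which saves one factor
  \<open>2 ^ j\<close>. This handles the artificial flat faces of a chart.\<close>

lemma card_gidx_hyperplane:
  fixes S :: "'a::euclidean_space set"
  assumes bd: "\<And>x. x \<in> S \<Longrightarrow> norm x \<le> real B" and e: "e \<in> Basis" and S: "\<And>x. x \<in> S \<Longrightarrow> x \<bullet> e = r"
  shows "card (gidx j ` S) \<le> (2 ^ j * (2 * B + 1)) ^ (DIM('a) - 1)"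
proof -
  let ?F = "\<lambda>b. if b = e then {\<lfloor>2 ^ j * r\<rfloor>} else {- (2 ^ j * int B)..2 ^ j * int B}"
  have "card (gidx j ` S) \<le> (\<Prod>b\<in>(Basis::'a set). card (?F b))"
  proof (rule card_gidx_le_prod(2))
    fix x b :: 'a assume "x \<in> S" "b \<in> Basis"
    then have "\<bar>x \<bullet> b\<bar> \<le> real B" using bd[of x] Basis_le_norm[of b x] by linarith
    then show "\<lfloor>2 ^ j * (x \<bullet> b)\<rfloor> \<in> ?F b" using floor_scaled_bounded[of "x \<bullet> b" B j] S[OF \<open>x \<in> S\<close>] by auto
  qed auto
  also have "\<dots> = (\<Prod>b\<in>Basis - {e}. card {- (2 ^ j * int B)..2 ^ j * int B})"
    using e by (subst prod.remove[of Basis e]) auto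
  also have "\<dots> \<le> (\<Prod>b\<in>Basis - {e}. 2 ^ j * (2 * B + 1))"
    by (intro prod_mono conjI card_floor_range) auto
  finally show ?thesis using e by (simp add: card_Diff_singleton)
qed

lemma gidx_Pair:
  fixes x :: "'b::euclidean_space" and t :: real
  shows "gidx j (x, t) = (gidx j x, of_int \<lfloor>2 ^ j * t\<rfloor>)"
proof (rule euclidean_eqI)
  fix b :: "'b \<times> real" assume b: "b \<in> Basis"
  then show "gidx j (x, t) \<bullet> b = (gidx j x, of_int \<lfloor>2 ^ j * t\<rfloor>) \<bullet> b"
    unfolding gidx_inner[OF b] by (auto simp: Basis_prod_def gidx_inner)
qed

text \<open>The cells are counted column by column: there are \<open>O(2 ^ (j * DIM('b)))\<close>
  base cells, and over each the graph varies by at most \<open>w\<close> cell heights.\<close>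

lemma card_gidx_graph:
  fixes f :: "'b::euclidean_space \<Rightarrow> real"
  assumes bd: "\<And>x. x \<in> Q \<Longrightarrow> norm x \<le> real B"
    and osc: "\<And>x y. x \<in> Q \<Longrightarrow> y \<in> Q \<Longrightarrow> norm (x - y) \<le> real DIM('b) / 2 ^ j \<Longrightarrow> 2 ^ j * \<bar>f x - f y\<bar> \<le> w"
    and w: "w \<ge> 0"
  shows "real (card (gidx j ` ((\<lambda>x. (x, f x)) ` Q))) \<le> (2 ^ j * (2 * real B + 1)) ^ DIM('b) * (2 * w + 5)"
proof -
  \<comment> \<open>Rounding \<open>w\<close> up costs at most 1, so the \<open>2 * r + 3\<close>
    cells in a column are at most \<open>2 * w + 5\<close>.\<close>
  define r where "r = nat \<lceil>w\<rceil>"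
  have r: "w \<le> real r" "real r \<le> w + 1" using w by (auto simp: r_def of_nat_ceiling)
  let ?P = "gidx j ` Q"
  have finP: "finite ?P" by (rule finite_gidx) (use bd in \<open>auto simp: bounded_iff\<close>)
  let ?S = "\<lambda>q. {x\<in>Q. gidx j x = q}"
  have "gidx j ` ((\<lambda>x. (x, f x)) ` Q) = (\<Union>q\<in>?P. gidx j ` ((\<lambda>x. (x, f x)) ` ?S q))" by auto
  then have "card (gidx j ` ((\<lambda>x. (x, f x)) ` Q)) = card (\<Union>q\<in>?P. gidx j ` ((\<lambda>x. (x, f x)) ` ?S q))" by simp
  also have "\<dots> \<le> (\<Sum>q\<in>?P. card (gidx j ` ((\<lambda>x. (x, f x)) ` ?S q)))" by (rule card_UN_le[OF finP])
  also have "\<dots> \<le> (\<Sum>q\<in>?P. 2 * r + 3)"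
  proof (rule sum_mono)
    fix q assume "q \<in> ?P"
    then obtain x0 where x0: "x0 \<in> Q" "gidx j x0 = q" by blast
    let ?I = "{\<lfloor>2 ^ j * f x0\<rfloor> - int r - 1..\<lfloor>2 ^ j * f x0\<rfloor> + int r + 1}"
    have "gidx j ` ((\<lambda>x. (x, f x)) ` ?S q) \<subseteq> (\<lambda>m. (q, of_int m)) ` ?I"
    proof
      fix p assume "p \<in> gidx j ` ((\<lambda>x. (x, f x)) ` ?S q)"
      then obtain x where x: "x \<in> Q" "gidx j x = q" "p = (q, of_int \<lfloor>2 ^ j * f x\<rfloor>)"
        by (auto simp: gidx_Pair)
      have "norm (x - x0) \<le> real DIM('b) / 2 ^ j" by (rule same_cell_norm_le) (use x x0 in simp)
      then have "2 ^ j * \<bar>f x - f x0\<bar> \<le> w" by (rule osc[OF x(1) x0(1)])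
      then have "\<bar>2 ^ j * f x - 2 ^ j * f x0\<bar> \<le> real r" using r(1) by (simp add: abs_mult flip: right_diff_distrib)
      then have "\<lfloor>2 ^ j * f x\<rfloor> \<in> ?I" by (rule floor_diff_le)
      then show "p \<in> (\<lambda>m. (q, of_int m)) ` ?I" using x(3) by blast
    qed
    then have "card (gidx j ` ((\<lambda>x. (x, f x)) ` ?S q)) \<le> card ?I" by (rule surj_card_le[rotated]) simp
    also have "\<dots> = 2 * r + 3" by (simp add: nat_add_distrib nat_mult_distrib)
    finally show "card (gidx j ` ((\<lambda>x. (x, f x)) ` ?S q)) \<le> 2 * r + 3" .
  qed
  also have "\<dots> = card ?P * (2 * r + 3)" by simp
  also have "\<dots> \<le> (2 ^ j * (2 * B + 1)) ^ DIM('b) * (2 * r + 3)"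
    by (intro mult_right_mono card_gidx_bounded bd) auto
  finally have "real (card (gidx j ` ((\<lambda>x. (x, f x)) ` Q))) \<le> real ((2 ^ j * (2 * B + 1)) ^ DIM('b) * (2 * r + 3))"
    by (rule of_nat_mono)
  also have "\<dots> = (2 ^ j * (2 * real B + 1)) ^ DIM('b) * (2 * real r + 3)" by (simp add: distrib_left add.commute)
  also have "\<dots> \<le> (2 ^ j * (2 * real B + 1)) ^ DIM('b) * (2 * w + 5)" using r(2) by (intro mult_left_mono) auto
  finally show ?thesis .
qed

section \<open>Hoelder classes as oscillation bounds\<close>

text \<open>A common form for both classes: \<open>Lip \<alpha>\<close> gives \<open>L = 0\<close>,
  while \<open>little_lip \<alpha>\<close> allows any positive \<open>H\<close> with an
  \<open>L\<close> depending on it.\<close>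

definition osc_bound :: "real \<Rightarrow> 'b::euclidean_space set \<Rightarrow> ('b \<Rightarrow> real) \<Rightarrow> real \<Rightarrow> real \<Rightarrow> bool" where
  "osc_bound \<alpha> Q f H L \<longleftrightarrow> H \<ge> 0 \<and> L \<ge> 0 \<and>
     (\<forall>x\<in>Q. \<forall>y\<in>Q. \<bar>f x - f y\<bar> \<le> H * norm (x - y) powr \<alpha> + L * norm (x - y))"

lemma holder_seminorm_less_imp:
  assumes "holder_seminorm \<alpha> Q f < ereal c" "x \<in> Q" "y \<in> Q"
  shows "\<bar>f x - f y\<bar> \<le> c * norm (x - y) powr \<alpha>"
proof (cases "x = y")
  case False
  have "ereal (\<bar>f x - f y\<bar> / norm (x - y) powr \<alpha>) \<le> holder_seminorm \<alpha> Q f"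
    unfolding holder_seminorm_def using assms(2,3) by (intro SUP_upper2[of "(x, y)"]) auto
  then have "\<bar>f x - f y\<bar> / norm (x - y) powr \<alpha> < c"
    using assms(1) by (metis ereal_less_eq(3) less_le_not_le order_le_less_trans linorder_not_le)
  moreover have "norm (x - y) powr \<alpha> > 0" using False by simp
  ultimately show ?thesis by (simp add: pos_divide_less_eq less_imp_le)
qed simp

lemma holder_seminorm_finite_bound:
  assumes "holder_seminorm \<alpha> Q f < \<infinity>"
  obtains c where "c \<ge> 0" "holder_seminorm \<alpha> Q f < ereal c"
proof -
  obtain r where "holder_seminorm \<alpha> Q f < ereal r" using less_PInf_Ex_of_nat[of "holder_seminorm \<alpha> Q f"] assms by auto
  then have "holder_seminorm \<alpha> Q f < ereal (max r 0)" by (simp add: less_le_trans)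
  then show ?thesis using that[of "max r 0"] by simp
qed

lemma Lip_osc_bound:
  assumes "f \<in> Lip \<alpha> Q"
  shows "\<exists>H. osc_bound \<alpha> Q f H 0"
proof -
  obtain c where "c \<ge> 0" "holder_seminorm \<alpha> Q f < ereal c"
    using holder_seminorm_finite_bound assms unfolding Lip_def by blast
  then show ?thesis using holder_seminorm_less_imp by (intro exI[of _ c]) (auto simp: osc_bound_def)
qed

text \<open>A Lipschitz approximant \<open>g\<close> carries the part with \<open>L\<close>, and the
  difference \<open>f - g\<close> has small Hoelder seminorm.\<close>

lemma little_lip_osc_bound:
  assumes "f \<in> little_lip \<alpha> Q" "\<epsilon> > 0"
  shows "\<exists>L. osc_bound \<alpha> Q f \<epsilon> L"
proof -
  obtain g where g: "g \<in> Lip 1 Q" "holder_seminorm \<alpha> Q (\<lambda>x. f x - g x) < ereal \<epsilon>"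
    using assms by (auto simp: little_lip_def)
  obtain c where c: "c \<ge> 0" "holder_seminorm 1 Q g < ereal c"
    using holder_seminorm_finite_bound g(1) unfolding Lip_def by blast
  have "\<bar>f x - f y\<bar> \<le> \<epsilon> * norm (x - y) powr \<alpha> + c * norm (x - y)" if xy: "x \<in> Q" "y \<in> Q" for x y
  proof -
    have "\<bar>(f x - g x) - (f y - g y)\<bar> \<le> \<epsilon> * norm (x - y) powr \<alpha>"
      by (rule holder_seminorm_less_imp[OF g(2) xy])
    moreover have "\<bar>g x - g y\<bar> \<le> c * norm (x - y) powr 1"
      by (rule holder_seminorm_less_imp[OF c(2) xy])
    ultimately show ?thesis by simp
  qed
  then show ?thesis using assms(2) c(1) by (auto simp: osc_bound_def)
qed

lemma osc_bound_bounded: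
  fixes f :: "'b::euclidean_space \<Rightarrow> real"
  assumes osc: "osc_bound \<alpha> Q f H L" and Q: "bounded Q" and \<alpha>: "0 < \<alpha>"
  obtains F where "\<forall>x\<in>Q. \<bar>f x\<bar> \<le> F"
proof (cases "Q = {}")
  case False
  then obtain x0 where x0: "x0 \<in> Q" by blast
  obtain D where D: "\<And>x y. x \<in> Q \<Longrightarrow> y \<in> Q \<Longrightarrow> norm (x - y) \<le> D"
    using diameter_bounded_bound[OF Q] by (auto simp: dist_norm)
  have "\<bar>f x\<bar> \<le> \<bar>f x0\<bar> + (H * D powr \<alpha> + L * D)" if x: "x \<in> Q" for x
  proof -
    have "\<bar>f x - f x0\<bar> \<le> H * norm (x - x0) powr \<alpha> + L * norm (x - x0)"
      using osc x x0 by (auto simp: osc_bound_def)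
    also have "\<dots> \<le> H * D powr \<alpha> + L * D"
      using osc D[OF x x0] \<alpha> by (intro add_mono mult_left_mono powr_mono2) (auto simp: osc_bound_def)
    finally show ?thesis by linarith
  qed
  then show ?thesis by (intro that ballI)
qed (use that in auto)

lemma osc_bound_continuous:
  fixes f :: "'b::euclidean_space \<Rightarrow> real"
  assumes osc: "osc_bound \<alpha> Q f H L" and \<alpha>: "0 < \<alpha>"
  shows "continuous_on Q f"
  unfolding continuous_on_def
proof
  fix x assume x: "x \<in> Q"
  have n: "((\<lambda>y. norm (y - x)) \<longlongrightarrow> 0) (at x within Q)"
  proof -
    have "((\<lambda>y. norm (y - x)) \<longlongrightarrow> norm (x - x)) (at x within Q)" by (intro tendsto_intros)
    then show ?thesis by simp
  qed
  have "((\<lambda>y. H * norm (y - x) powr \<alpha> + L * norm (y - x)) \<longlongrightarrow> H * 0 + L * 0) (at x within Q)"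
  proof (intro tendsto_add tendsto_mult tendsto_const n)
    show "((\<lambda>y. norm (y - x) powr \<alpha>) \<longlongrightarrow> 0) (at x within Q)"
      using tendsto_powr'[OF n tendsto_const[of \<alpha>]] \<alpha> by simp
  qed
  then have z: "((\<lambda>y. H * norm (y - x) powr \<alpha> + L * norm (y - x)) \<longlongrightarrow> 0) (at x within Q)" by simp
  have "((\<lambda>y. f y - f x) \<longlongrightarrow> 0) (at x within Q)"
  proof (rule Lim_null_comparison[OF _ z])
    show "\<forall>\<^sub>F y in at x within Q. norm (f y - f x) \<le> H * norm (y - x) powr \<alpha> + L * norm (y - x)"
      using osc x by (auto simp: eventually_at_filter osc_bound_def)
  qed
  then show "(f \<longlongrightarrow> f x) (at x within Q)" by (rule LIM_zero_cancel)
qed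

section \<open>Boundary cells in a chart and in a finite cover\<close>

text \<open>A limit point over the open base cube lies on the graph or on the bottom, by continuity
  of \<open>f\<close>. Over the boundary of the base, where \<open>f\<close> need not be defined in
  a useful way, it is enough to record a lateral hyperplane.\<close>

lemma chart_boundary_subset:
  fixes f :: "'b::euclidean_space \<Rightarrow> real" and r :: real
  assumes cont: "continuous_on Q f" and Qa: "box l u \<subseteq> Q"
  defines "G \<equiv> {x \<in> subgraph Q f r. fst x \<in> box l u}"
  shows "closure G - G \<subseteq> (\<lambda>x. (x, f x)) ` box l u \<union> {x. snd x = r} \<union>
     (\<Union>e\<in>Basis. {x. fst x \<bullet> e = l \<bullet> e} \<union> {x. fst x \<bullet> e = u \<bullet> e})"
proof
  fix x assume x: "x \<in> closure G - G"
  obtain X where X: "\<And>n. X n \<in> G" "X \<longlonglongrightarrow> x" using x by (auto simp: closure_sequential)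
  have Xn: "fst (X n) \<in> box l u" "r < snd (X n)" "snd (X n) < f (fst (X n))" for n
    using X(1)[of n] by (auto simp: G_def subgraph_def)
  have f1: "(\<lambda>n. fst (X n)) \<longlonglongrightarrow> fst x" and f2: "(\<lambda>n. snd (X n)) \<longlonglongrightarrow> snd x"
    using X(2) by (auto intro: tendsto_fst tendsto_snd)
  have cl: "fst x \<in> cbox l u"
    by (rule closed_sequentially[OF closed_cbox _ f1]) (use Xn box_subset_cbox in blast)
  show "x \<in> (\<lambda>x. (x, f x)) ` box l u \<union> {x. snd x = r} \<union>
     (\<Union>e\<in>Basis. {x. fst x \<bullet> e = l \<bullet> e} \<union> {x. fst x \<bullet> e = u \<bullet> e})"
  proof (cases "fst x \<in> box l u")
    case False
    then obtain e where "e \<in> Basis" "fst x \<bullet> e = l \<bullet> e \<or> fst x \<bullet> e = u \<bullet> e"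
      using cl by (force simp: mem_box)
    then show ?thesis by blast
  next
    case True
    have "(\<lambda>n. f (fst (X n))) \<longlonglongrightarrow> f (fst x)"
      by (rule continuous_on_tendsto_compose[OF cont f1]) (use True Qa Xn in \<open>auto intro!: always_eventually\<close>)
    then have le: "snd x \<le> f (fst x)" using LIMSEQ_le[OF f2] Xn(3) less_imp_le by blast
    have ge: "r \<le> snd x" using LIMSEQ_le_const[OF f2] Xn(2) less_imp_le by blast
    have "\<not> (r < snd x \<and> snd x < f (fst x))"
      using x True Qa by (auto simp: G_def subgraph_def case_prod_beta)
    then have "snd x = r \<or> x = (fst x, f (fst x))" using le ge by (cases x) auto
    then show ?thesis using True by auto
  qed
qed

text \<open>Over \<open>2 ^ (j * n)\<close> base cells, with \<open>n\<close> the dimension of the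
  base, the graph oscillates by about \<open>H * 2 powr (j * (1 - \<alpha>))\<close> cell heights,
  which gives the exponent \<open>n + 1 - \<alpha>\<close>. The flat faces, the part with
  \<open>L\<close> and the rounding are of lower order. \<open>A\<close> is chosen before
  \<open>H\<close> and \<open>L\<close>, \<open>K\<close> after them.\<close>

lemma chart_boundary_count:
  fixes f :: "'b::euclidean_space \<Rightarrow> real" and r :: real
  assumes Q: "bounded Q" and Qa: "box l u \<subseteq> Q" and \<alpha>: "0 < \<alpha>" "\<alpha> < 1"
  defines "G \<equiv> {x \<in> subgraph Q f r. fst x \<in> box l u}"
  shows "\<And>H L. osc_bound \<alpha> Q f H L \<Longrightarrow> bounded (closure G)"
    and "\<exists>A\<ge>0. \<forall>H L. osc_bound \<alpha> Q f H L \<longrightarrow> (\<exists>K\<ge>0. \<forall>j.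
      real (card (gidx j ` (closure G - G))) \<le>
        A * H * 2 powr (real j * (real DIM('b \<times> real) - \<alpha>)) + K * 2 powr (real j * real DIM('b)))"
proof -
  let ?n = "DIM('b)"
  obtain B0 where B0: "\<And>x. x \<in> Q \<Longrightarrow> norm x \<le> B0" using Q by (auto simp: bounded_iff)
  obtain B :: nat where B: "B0 \<le> real B" using real_arch_simple by blast
  have bQ: "norm x \<le> real B" if "x \<in> box l u" for x using B0[of x] B that Qa by force
  have bG: "\<exists>B1::nat. \<forall>x\<in>closure G. norm x \<le> real B1" if osc: "osc_bound \<alpha> Q f H L" for H L
  proof -
    obtain F where F': "\<forall>x\<in>Q. \<bar>f x\<bar> \<le> F" by (rule osc_bound_bounded[OF osc Q \<alpha>(1)])
      have F: "\<bar>f x\<bar> \<le> F" if "x \<in> Q" for x using F' that by blast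
    have "norm x \<le> B0 + (\<bar>r\<bar> + \<bar>F\<bar>)" if "x \<in> G" for x
    proof -
      have x: "fst x \<in> Q" "r < snd x" "snd x < f (fst x)" using that by (auto simp: G_def subgraph_def)
      have "norm x \<le> norm (fst x) + norm (snd x)" using norm_Pair_le[of "fst x" "snd x"] by simp
      then show ?thesis using B0[OF x(1)] F[OF x(1)] x(2,3) by simp
    qed
    then have "bounded G" by (rule boundedI)
    then have "bounded (closure G)" by (rule bounded_closure)
    then obtain B1 where "\<And>x. x \<in> closure G \<Longrightarrow> norm x \<le> B1" by (auto simp: bounded_iff)
    moreover obtain B2 :: nat where "B1 \<le> real B2" using real_arch_simple by blast
    ultimately show ?thesis by (meson order_trans)
  qed
  show "bounded (closure G)" if "osc_bound \<alpha> Q f H L" for H L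
    using bG[OF that] by (auto simp: bounded_iff)
  define N where "N = (2 * real B + 1) ^ ?n"
  \<comment> \<open>\<open>N\<close> stems from the number of base cells, 2 from the two signs of
    the oscillation, and the power from the diameter of a base cell; neither \<open>H\<close> nor
    \<open>L\<close> enters.\<close>
  define A where "A = N * (2 * real ?n powr \<alpha>)"
  show "\<exists>A\<ge>0. \<forall>H L. osc_bound \<alpha> Q f H L \<longrightarrow> (\<exists>K\<ge>0. \<forall>j.
      real (card (gidx j ` (closure G - G))) \<le>
        A * H * 2 powr (real j * (real DIM('b \<times> real) - \<alpha>)) + K * 2 powr (real j * real DIM('b)))"
  proof (rule exI[of _ A], intro conjI allI impI)
    show "A \<ge> 0" by (simp add: A_def N_def)
    fix H L assume osc: "osc_bound \<alpha> Q f H L"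
    have HL: "H \<ge> 0" "L \<ge> 0" using osc by (auto simp: osc_bound_def)
    obtain B1 :: nat where B1: "\<And>x. x \<in> closure G \<Longrightarrow> norm x \<le> real B1" using bG[OF osc] by blast
    define N1 where "N1 = (2 * real B1 + 1) ^ ?n"
    \<comment> \<open>The first summand collects the part with \<open>L\<close> and the rounding in
      the count for the graph, the second the bottom and two lateral faces for each
      coordinate.\<close>
    define K where "K = N * (2 * L * real ?n + 5) + N1 * (1 + 2 * real ?n)"
    have N0: "N \<ge> 0" "N1 \<ge> 0" by (auto simp: N_def N1_def)
    show "\<exists>K\<ge>0. \<forall>j. real (card (gidx j ` (closure G - G))) \<le>
        A * H * 2 powr (real j * (real DIM('b \<times> real) - \<alpha>)) + K * 2 powr (real j * real ?n)"
    proof (intro exI[of _ K] conjI allI)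
      show "K \<ge> 0" using HL N0 by (simp add: K_def)
      fix j :: nat
      let ?P = "2 powr (real j * real ?n)"
      have P: "(2 ^ j) ^ ?n = ?P"
        using powr_realpow[of 2 "j * ?n"] by (simp add: power_mult)
      define S where "S = closure G - G"
      have Sfin: "finite (gidx j ` T)" if "T \<subseteq> S" for T
      proof (rule finite_gidx, rule boundedI)
        show "norm x \<le> real B1" if "x \<in> T" for x
          using that \<open>T \<subseteq> S\<close> B1[of x] by (auto simp: S_def)
      qed
      let ?gr = "(\<lambda>x. (x, f x)) ` box l u"
      let ?h = "\<lambda>e c. S \<inter> {x. fst x \<bullet> e = c}"
      have sub: "S \<subseteq> ?gr \<union> S \<inter> {x. snd x = r} \<union> (\<Union>e\<in>Basis. ?h e (l \<bullet> e) \<union> ?h e (u \<bullet> e))"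
        using chart_boundary_subset[OF osc_bound_continuous[OF osc \<alpha>(1)] Qa, of r] unfolding S_def G_def by blast
      \<comment> \<open>A bound for the oscillation of \<open>f\<close> over one base cell, in units
        of the cell side.\<close>
      define w where "w = 2 ^ j * (H * (real ?n / 2 ^ j) powr \<alpha> + L * (real ?n / 2 ^ j))"
      have g: "real (card (gidx j ` ?gr)) \<le> (2 ^ j * (2 * real B + 1)) ^ ?n * (2 * w + 5)"
      proof (rule card_gidx_graph)
        show "norm x \<le> real B" if "x \<in> box l u" for x using bQ[OF that] .
        show "w \<ge> 0" using HL by (simp add: w_def)
        fix x y :: 'b assume xy: "x \<in> box l u" "y \<in> box l u" "norm (x - y) \<le> real ?n / 2 ^ j"
        have "\<bar>f x - f y\<bar> \<le> H * norm (x - y) powr \<alpha> + L * norm (x - y)"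
          using osc xy Qa by (auto simp: osc_bound_def)
        also have "\<dots> \<le> H * (real ?n / 2 ^ j) powr \<alpha> + L * (real ?n / 2 ^ j)"
          using HL xy(3) \<alpha> by (intro add_mono mult_left_mono powr_mono2) auto
        finally show "2 ^ j * \<bar>f x - f y\<bar> \<le> w" unfolding w_def by (intro mult_left_mono) auto
      qed
      have gf: "finite (gidx j ` ?gr)"
      proof (rule finite_gidx)
        obtain F where F': "\<forall>x\<in>Q. \<bar>f x\<bar> \<le> F" by (rule osc_bound_bounded[OF osc Q \<alpha>(1)])
      have F: "\<bar>f x\<bar> \<le> F" if "x \<in> Q" for x using F' that by blast
        have "norm (x, f x) \<le> real B + F" if "x \<in> box l u" for x
        proof -
          have "x \<in> Q" using that Qa by blast
          then show ?thesis using norm_Pair_le[of x "f x"] bQ[OF that] F[of x] by simp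
        qed
        then show "bounded ?gr" by (intro boundedI[of _ "real B + F"]) auto
      qed
      have bS: "norm x \<le> real B1" if "x \<in> S \<inter> T" for x T using B1 that by (auto simp: S_def)
      have dim: "DIM('b \<times> real) - 1 = ?n" by simp
      have hyp: "real (card (gidx j ` (S \<inter> {x. x \<bullet> e = c}))) \<le> N1 * ?P" if "e \<in> Basis" for e c
      proof -
        have "card (gidx j ` (S \<inter> {x. x \<bullet> e = c})) \<le> (2 ^ j * (2 * B1 + 1)) ^ ?n"
          using card_gidx_hyperplane[of "S \<inter> {x. x \<bullet> e = c}" B1 e c j] bS that unfolding dim by blast
        then have "real (card (gidx j ` (S \<inter> {x. x \<bullet> e = c}))) \<le> real ((2 ^ j * (2 * B1 + 1)) ^ ?n)"
          by (rule of_nat_mono)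
        also have "\<dots> = (2 ^ j * (2 * real B1 + 1)) ^ ?n" by (simp add: distrib_left add.commute)
        also have "\<dots> = N1 * ?P" unfolding N1_def P[symmetric] by (simp only: power_mult_distrib mult.commute)
        finally show ?thesis .
      qed
      have h0: "real (card (gidx j ` (S \<inter> {x. snd x = r}))) \<le> N1 * ?P"
        using hyp[of "(0, 1)" r] by (simp add: Basis_prod_def inner_prod_def)
      have h1: "real (card (gidx j ` (?h e c))) \<le> N1 * ?P" if "e \<in> Basis" for e c
        using hyp[of "(e, 0)" c] that by (simp add: Basis_prod_def inner_prod_def)
      have "gidx j ` S \<subseteq> gidx j ` ?gr \<union> gidx j ` (S \<inter> {x. snd x = r}) \<union> (\<Union>e\<in>Basis. gidx j ` ?h e (l \<bullet> e) \<union> gidx j ` ?h e (u \<bullet> e))"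
        using image_mono[OF sub, of "gidx j"] unfolding image_Un image_UN .
      moreover have "finite (gidx j ` ?gr \<union> gidx j ` (S \<inter> {x. snd x = r}) \<union> (\<Union>e\<in>Basis. gidx j ` ?h e (l \<bullet> e) \<union> gidx j ` ?h e (u \<bullet> e)))"
        using gf Sfin by auto
      ultimately have "card (gidx j ` S) \<le> card (gidx j ` ?gr \<union> gidx j ` (S \<inter> {x. snd x = r}) \<union> (\<Union>e\<in>Basis. gidx j ` ?h e (l \<bullet> e) \<union> gidx j ` ?h e (u \<bullet> e)))"
        by (rule card_mono[rotated])
      also have "\<dots> \<le> card (gidx j ` ?gr) + card (gidx j ` (S \<inter> {x. snd x = r})) + (\<Sum>e\<in>(Basis::'b set). card (gidx j ` ?h e (l \<bullet> e)) + card (gidx j ` ?h e (u \<bullet> e)))"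
        by (intro order_trans[OF card_Un_le] add_mono order_refl order_trans[OF card_UN_le] sum_mono finite_Basis card_Un_le)
      finally have "real (card (gidx j ` S)) \<le> real (card (gidx j ` ?gr) + card (gidx j ` (S \<inter> {x. snd x = r})) + (\<Sum>e\<in>(Basis::'b set). card (gidx j ` ?h e (l \<bullet> e)) + card (gidx j ` ?h e (u \<bullet> e))))"
        by (rule of_nat_mono)
      also have "\<dots> = real (card (gidx j ` ?gr)) + real (card (gidx j ` (S \<inter> {x. snd x = r}))) + (\<Sum>e\<in>(Basis::'b set). real (card (gidx j ` ?h e (l \<bullet> e))) + real (card (gidx j ` ?h e (u \<bullet> e))))"
        by simp
      also have "\<dots> \<le> (2 ^ j * (2 * real B + 1)) ^ ?n * (2 * w + 5) + N1 * ?P + (\<Sum>e\<in>(Basis::'b set). N1 * ?P + N1 * ?P)"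
        by (intro add_mono g h0 h1 sum_mono)
      also have "(2 ^ j * (2 * real B + 1)) ^ ?n = N * ?P" unfolding N_def P[symmetric] by (simp only: power_mult_distrib mult.commute)
      also have "(\<Sum>e\<in>(Basis::'b set). N1 * ?P + N1 * ?P) = real ?n * (2 * N1 * ?P)" by simp
      also have "w = H * real ?n powr \<alpha> * 2 powr (real j * (1 - \<alpha>)) + L * real ?n"
      proof -
        have "(real ?n / 2 ^ j) powr \<alpha> = real ?n powr \<alpha> * 2 powr (- (real j * \<alpha>))"
          by (simp add: powr_divide powr_realpow[symmetric] powr_powr powr_minus_divide)
        moreover have "2 ^ j * 2 powr (- (real j * \<alpha>)) = 2 powr (real j * (1 - \<alpha>))"
          by (simp add: powr_realpow[symmetric] powr_add[symmetric] algebra_simps)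
        moreover have "2 ^ j * (H * (p * q) + L * (real ?n / 2 ^ j)) = H * p * (2 ^ j * q) + L * real ?n" for p q :: real
          by (simp add: distrib_left)
        ultimately show ?thesis unfolding w_def by metis
      qed
      also have "N * ?P * (2 * (H * real ?n powr \<alpha> * 2 powr (real j * (1 - \<alpha>)) + L * real ?n) + 5) + N1 * ?P + real ?n * (2 * N1 * ?P) =
         A * H * (?P * 2 powr (real j * (1 - \<alpha>))) + K * ?P"
        by (simp add: A_def K_def algebra_simps)
      also have "?P * 2 powr (real j * (1 - \<alpha>)) = 2 powr (real j * (real DIM('b \<times> real) - \<alpha>))"
        by (simp add: powr_add[symmetric] algebra_simps)
      finally show "real (card (gidx j ` (closure G - G))) \<le>
        A * H * 2 powr (real j * (real DIM('b \<times> real) - \<alpha>)) + K * ?P" unfolding S_def .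
    qed
  qed
qed

text \<open>Near a frontier point the closure of \<open>\<Omega>\<close> is seen inside the open set
  \<open>Oz\<close>. An open set contains no frontier point of its own, and \<open>U\<close> is
  injective.\<close>

lemma frontier_chart_image:
  fixes U :: "'a::euclidean_space \<Rightarrow> 'a"
  assumes O: "open \<Omega>" and Oz: "open Oz" and U: "orthogonal_transformation U"
  shows "U ` (frontier \<Omega> \<inter> Oz) \<subseteq> closure (U ` (Oz \<inter> \<Omega>)) - U ` (Oz \<inter> \<Omega>)"
proof
  fix x assume "x \<in> U ` (frontier \<Omega> \<inter> Oz)"
  then obtain y where y: "x = U y" "y \<in> frontier \<Omega>" "y \<in> Oz" by blast
  have "y \<notin> \<Omega>" using y(2) O by (simp add: frontier_def interior_open)
  moreover have "y \<in> closure \<Omega>" using y(2) by (simp add: frontier_def)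
  ultimately have "y \<in> closure (Oz \<inter> \<Omega>)" using open_Int_closure_subset[OF Oz, of \<Omega>] y(3) by blast
  have lin: "linear U" by (rule orthogonal_transformation_linear[OF U])
  have "U ` closure (Oz \<inter> \<Omega>) \<subseteq> closure (U ` (Oz \<inter> \<Omega>))"
    by (rule closure_linear_image_subset[OF lin])
  then have "x \<in> closure (U ` (Oz \<inter> \<Omega>))" using \<open>y \<in> closure (Oz \<inter> \<Omega>)\<close> y(1) by blast
  moreover have "x \<notin> U ` (Oz \<inter> \<Omega>)"
    using \<open>y \<notin> \<Omega>\<close> orthogonal_transformation_inj[OF U] y(1) by (auto dest: injD)
  ultimately show "x \<in> closure (U ` (Oz \<inter> \<Omega>)) - U ` (Oz \<inter> \<Omega>)" by simp
qed

text \<open>Compactness of the frontier selects finitely many charts. The set \<open>Z\<close> of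
  their functions and the factors \<open>A\<close> are fixed first; afterwards \<open>H\<close> may
  be chosen for each function.\<close>

lemma domain_boundary_count:
  fixes \<Omega> :: "('b::euclidean_space \<times> real) set"
  assumes O: "open \<Omega>" "bounded \<Omega>" and Q: "bounded Q" and dom: "domain_of_class Q X \<Omega>" and \<alpha>: "0 < \<alpha>" "\<alpha> < 1"
    and X: "\<And>f. f \<in> X \<Longrightarrow> \<exists>H L. osc_bound \<alpha> Q f H L"
  shows "\<exists>Z A. finite Z \<and> Z \<subseteq> X \<and> (\<forall>f\<in>Z. A f \<ge> 0) \<and> (\<forall>H. (\<forall>f\<in>Z. \<exists>L. osc_bound \<alpha> Q f (H f) L) \<longrightarrow>
     (\<exists>K\<ge>0. \<forall>j. real (card (gidx j ` frontier \<Omega>)) \<le>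
       (\<Sum>f\<in>Z. A f * H f) * 2 powr (real j * (real DIM('b \<times> real) - \<alpha>)) + K * 2 powr (real j * real DIM('b))))"
proof -
  let ?D = "real ((2 * DIM('b \<times> real) + 3) ^ DIM('b \<times> real))"
  let ?E = "\<lambda>j. 2 powr (real j * (real DIM('b \<times> real) - \<alpha>))" and ?P = "\<lambda>j. 2 powr (real j * real DIM('b))"
  have loc: "\<exists>Oz f A. open Oz \<and> z \<in> Oz \<and> f \<in> X \<and> A \<ge> 0 \<and> (\<forall>H L. osc_bound \<alpha> Q f H L \<longrightarrow> (\<exists>K\<ge>0. \<forall>j.
     real (card (gidx j ` (frontier \<Omega> \<inter> Oz))) \<le> A * H * ?E j + K * ?P j))" if z: "z \<in> frontier \<Omega>" for z
  proof -
    from bspec[OF dom[unfolded domain_of_class_def] z] obtain Oz U a Qa f b where c: "open Oz" "z \<in> Oz" "orthogonal_transformation U" "is_cube a Qa" "Qa \<subseteq> Q" "f \<in> X"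
      and im: "U ` (Oz \<inter> \<Omega>) = {x \<in> subgraph Q f b. fst x \<in> Qa}"
      by (elim exE conjE) (rule that)
    obtain cc where Qa: "Qa = box cc (cc + a *\<^sub>R One)" using c(4) by (auto simp: is_cube_def)
    define G where "G = {x \<in> subgraph Q f b. fst x \<in> box cc (cc + a *\<^sub>R One)}"
    have sub: "box cc (cc + a *\<^sub>R One) \<subseteq> Q" using c(5) Qa by simp
    obtain A where A: "A \<ge> 0" "\<And>H L. osc_bound \<alpha> Q f H L \<Longrightarrow> \<exists>K\<ge>0. \<forall>j.
        real (card (gidx j ` (closure G - G))) \<le> A * H * ?E j + K * ?P j"
      using chart_boundary_count(2)[OF Q sub \<alpha>, of f b] unfolding G_def by blast
    obtain H0 L0 where o0: "osc_bound \<alpha> Q f H0 L0" using X[OF c(6)] by blast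
    have bG: "bounded (closure G)" unfolding G_def by (rule chart_boundary_count(1)[OF Q sub \<alpha> o0])
    have fs: "U ` (frontier \<Omega> \<inter> Oz) \<subseteq> closure G - G"
      using frontier_chart_image[OF O(1) c(1) c(3)] unfolding im G_def Qa .
    have bF: "bounded (frontier \<Omega> \<inter> Oz)"
      by (rule bounded_subset[OF bounded_closure[OF O(2)]]) (auto simp: frontier_def)
    have cnt: "real (card (gidx j ` (frontier \<Omega> \<inter> Oz))) \<le> real (card (gidx j ` (closure G - G))) * ?D" for j
    proof -
      have "card (gidx j ` (frontier \<Omega> \<inter> Oz)) \<le> card (gidx j ` (U ` (frontier \<Omega> \<inter> Oz))) * (2 * DIM('b \<times> real) + 3) ^ DIM('b \<times> real)"
        by (rule card_gidx_orthogonal_transformation[OF c(3) bF])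
      also have "\<dots> \<le> card (gidx j ` (closure G - G)) * (2 * DIM('b \<times> real) + 3) ^ DIM('b \<times> real)"
        by (intro mult_right_mono card_mono finite_gidx bounded_subset[OF bG] image_mono fs) auto
      finally show ?thesis by (metis of_nat_le_iff of_nat_mult)
    qed
    have "\<exists>K\<ge>0. \<forall>j. real (card (gidx j ` (frontier \<Omega> \<inter> Oz))) \<le> (?D * A) * H * ?E j + K * ?P j"
      if osc: "osc_bound \<alpha> Q f H L" for H L
    proof -
      obtain K where K: "K \<ge> 0" "\<And>j. real (card (gidx j ` (closure G - G))) \<le> A * H * ?E j + K * ?P j"
        using A(2)[OF osc] by blast
      have "real (card (gidx j ` (frontier \<Omega> \<inter> Oz))) \<le> (?D * A) * H * ?E j + (?D * K) * ?P j" for j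
      proof -
        have "real (card (gidx j ` (frontier \<Omega> \<inter> Oz))) \<le> (A * H * ?E j + K * ?P j) * ?D"
          by (rule order_trans[OF cnt mult_right_mono[OF K(2)]]) simp
        also have "\<dots> = (?D * A) * H * ?E j + (?D * K) * ?P j"
        proof -
          have "(A * H * E + K * P) * D = (D * A) * H * E + (D * K) * P" for D E P :: real
            by (simp add: algebra_simps)
          then show ?thesis .
        qed
        finally show ?thesis .
      qed
      then show ?thesis using K(1) by (intro exI[of _ "?D * K"]) (simp only: mult_nonneg_nonneg of_nat_0_le_iff simp_thms)
    qed
    moreover have "?D * A \<ge> 0" using A(1) by (intro mult_nonneg_nonneg) auto
    ultimately show ?thesis using c(1,2,6) by blast
  qed
  then obtain V f A where V: "\<And>z. z \<in> frontier \<Omega> \<Longrightarrow> open (V z) \<and> z \<in> V z \<and> f z \<in> X \<and> A z \<ge> 0 \<and>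
     (\<forall>H L. osc_bound \<alpha> Q (f z) H L \<longrightarrow> (\<exists>K\<ge>0. \<forall>j. real (card (gidx j ` (frontier \<Omega> \<inter> V z))) \<le> A z * H * ?E j + K * ?P j))"
    by metis
  have "compact (frontier \<Omega>)"
    using bounded_subset[OF bounded_closure[OF O(2)], of "frontier \<Omega>"] by (auto simp: compact_eq_bounded_closed frontier_def)
  then obtain Y where Y: "Y \<subseteq> frontier \<Omega>" "finite Y" "frontier \<Omega> \<subseteq> (\<Union>z\<in>Y. V z)"
    using compactE_image[of "frontier \<Omega>" "frontier \<Omega>" V] V by (metis UN_I subsetI)
  define Z where "Z = f ` Y"
  \<comment> \<open>Several charts may share one boundary function; their constants are added, so
    that the bound is indexed by functions instead of charts.\<close>
  define A' where "A' g = (\<Sum>z | z \<in> Y \<and> f z = g. A z)" for g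
  show ?thesis
  proof (rule exI[of _ Z], rule exI[of _ A'], intro conjI ballI allI impI)
    show "finite Z" "Z \<subseteq> X" using Y V by (auto simp: Z_def)
    show "A' g \<ge> 0" for g unfolding A'_def using V Y by (intro sum_nonneg) auto
    fix H assume "\<forall>g\<in>Z. \<exists>L. osc_bound \<alpha> Q g (H g) L"
    then have "\<forall>z\<in>Y. \<exists>K\<ge>0. \<forall>j. real (card (gidx j ` (frontier \<Omega> \<inter> V z))) \<le> A z * H (f z) * ?E j + K * ?P j"
      using V Y(1) unfolding Z_def by blast
    then obtain K where K: "\<And>z. z \<in> Y \<Longrightarrow> K z \<ge> 0"
      "\<And>z j. z \<in> Y \<Longrightarrow> real (card (gidx j ` (frontier \<Omega> \<inter> V z))) \<le> A z * H (f z) * ?E j + K z * ?P j"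
      by metis
    show "\<exists>K\<ge>0. \<forall>j. real (card (gidx j ` frontier \<Omega>)) \<le> (\<Sum>g\<in>Z. A' g * H g) * ?E j + K * ?P j"
    proof (rule exI[of _ "\<Sum>z\<in>Y. K z"], intro conjI allI)
      show "0 \<le> (\<Sum>z\<in>Y. K z)" by (intro sum_nonneg K)
      fix j
      have "gidx j ` frontier \<Omega> = (\<Union>z\<in>Y. gidx j ` (frontier \<Omega> \<inter> V z))" using Y(3) by blast
      then have "card (gidx j ` frontier \<Omega>) \<le> (\<Sum>z\<in>Y. card (gidx j ` (frontier \<Omega> \<inter> V z)))"
        using card_UN_le[OF Y(2)] by simp
      then have "real (card (gidx j ` frontier \<Omega>)) \<le> real (\<Sum>z\<in>Y. card (gidx j ` (frontier \<Omega> \<inter> V z)))"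
        by (rule of_nat_mono)
      also have "\<dots> \<le> (\<Sum>z\<in>Y. A z * H (f z) * ?E j + K z * ?P j)"
        unfolding of_nat_sum by (intro sum_mono K)
      also have "\<dots> = (\<Sum>z\<in>Y. A z * H (f z)) * ?E j + (\<Sum>z\<in>Y. K z) * ?P j"
        by (simp only: sum.distrib sum_distrib_right)
      also have "(\<Sum>z\<in>Y. A z * H (f z)) = (\<Sum>g\<in>Z. A' g * H g)"
      proof -
        have "(\<Sum>g\<in>f ` Y. \<Sum>z | z \<in> Y \<and> f z = g. A z * H (f z)) = (\<Sum>z\<in>Y. A z * H (f z))"
          by (rule sum.image_gen[OF Y(2), symmetric])
        moreover have "(\<Sum>z | z \<in> Y \<and> f z = g. A z * H (f z)) = A' g * H g" for g
          unfolding A'_def sum_distrib_right by (intro sum.cong) auto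
        ultimately show ?thesis by (simp add: Z_def)
      qed
      finally show "real (card (gidx j ` frontier \<Omega>)) \<le> (\<Sum>g\<in>Z. A' g * H g) * ?E j + (\<Sum>z\<in>Y. K z) * ?P j" .
    qed
  qed
qed

text \<open>The quotient of the two powers is \<open>q ^ j\<close> with \<open>q > 1\<close>, which
  eventually exceeds \<open>K / \<epsilon>\<close>. The finitely many earlier levels go into
  \<open>K'\<close>.\<close>

lemma powr_absorb_lower_order:
  fixes d \<alpha> :: real
  assumes "K \<ge> 0" "\<epsilon> > 0" "\<alpha> < 1"
  shows "\<exists>K'\<ge>0. \<forall>j::nat. K * 2 powr (real j * n) \<le> \<epsilon> * 2 powr (real j * (n + 1 - \<alpha>)) + K'"
proof -
  define q where "q = 2 powr (1 - \<alpha>)"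
  have q: "q > 1" using assms by (simp add: q_def)
  obtain N where N: "K / \<epsilon> < q ^ N" using real_arch_pow[OF q] by blast
  define K' where "K' = K * (\<Sum>j\<le>N. 2 powr (real j * n))"
  show ?thesis
  proof (intro exI[of _ K'] conjI allI)
    show "K' \<ge> 0" using assms by (auto simp: K'_def intro!: mult_nonneg_nonneg sum_nonneg)
    fix j :: nat
    show "K * 2 powr (real j * n) \<le> \<epsilon> * 2 powr (real j * (n + 1 - \<alpha>)) + K'"
    proof (cases "j \<le> N")
      case True
      have "2 powr (real j * n) \<le> (\<Sum>j\<le>N. 2 powr (real j * n))"
        using True by (intro member_le_sum[of j "{..N}" "\<lambda>j. 2 powr (real j * n)"]) auto
      then have "K * 2 powr (real j * n) \<le> K'" unfolding K'_def using assms(1) by (intro mult_left_mono)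
      moreover have "0 \<le> \<epsilon> * 2 powr (real j * (n + 1 - \<alpha>))" using assms by simp
      ultimately show ?thesis by linarith
    next
      case False
      have "q ^ N \<le> q ^ j" using False q by (intro power_increasing) auto
      then have "K \<le> \<epsilon> * q ^ j" using N assms(2) by (simp add: pos_divide_less_eq mult.commute) (meson less_imp_le mult_left_mono order_less_le_trans)
      then have "K * 2 powr (real j * n) \<le> \<epsilon> * q ^ j * 2 powr (real j * n)" by (intro mult_right_mono) auto
      also have "\<dots> = \<epsilon> * 2 powr (real j * (n + 1 - \<alpha>))"
      proof -
        have "q ^ j = 2 powr (real j * (1 - \<alpha>))" using q by (simp add: q_def powr_realpow[symmetric] powr_powr mult.commute)
        then have "q ^ j * 2 powr (real j * n) = 2 powr (real j * (1 - \<alpha>) + real j * n)" by (simp add: powr_add)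
        also have "real j * (1 - \<alpha>) + real j * n = real j * (n + 1 - \<alpha>)" by (simp add: algebra_simps)
        finally show ?thesis by (simp add: mult.assoc)
      qed
      also have "\<dots> \<le> \<epsilon> * 2 powr (real j * (n + 1 - \<alpha>)) + K'"
        using \<open>K' \<ge> 0\<close> by simp
      finally show ?thesis .
    qed
  qed
qed

section \<open>The Weyl remainder\<close>

text \<open>The common source of both remainder estimates. \<open>Z\<close>, \<open>A\<close> and
  \<open>C\<close> precede the choice of \<open>H\<close> and \<open>\<eta>\<close>, where
  \<open>\<eta>\<close> pays for boundary cells of lower order.\<close>

lemma Weyl_remainder:
  fixes \<Omega> :: "('b::euclidean_space \<times> real) set"
  assumes O: "open \<Omega>" "bounded \<Omega>" and cube: "is_cube a Q" and dom: "domain_of_class Q X \<Omega>"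
    and \<alpha>: "0 < \<alpha>" "\<alpha> < 1" and X: "\<And>f. f \<in> X \<Longrightarrow> \<exists>H L. osc_bound \<alpha> Q f H L"
  defines "d \<equiv> DIM('b \<times> real)"
  obtains Z A C where "finite Z" "Z \<subseteq> X" "C \<ge> 0" "\<forall>f\<in>Z. A f \<ge> 0"
    "\<forall>H \<eta>. \<eta> > 0 \<and> (\<forall>f\<in>Z. H f \<ge> 0 \<and> (\<exists>L. osc_bound \<alpha> Q f (H f) L)) \<longrightarrow>
     (\<exists>K. \<forall>l\<ge>1. \<exists>n. N_D \<Omega> l = enat n \<and> \<bar>real n - C_W d * measure lebesgue \<Omega> * l ^ d\<bar> \<le>
       C * ((\<Sum>f\<in>Z. A f * H f) + \<eta>) * l powr (real d - \<alpha>) + K * l ^ (d - 1))"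
proof -
  interpret dyadic \<Omega> by unfold_locales (rule O)+
  have Q: "bounded Q" using cube by (auto simp: is_cube_def)
  have d: "real d = real DIM('b) + 1" "d \<ge> 2" using DIM_positive[where 'a='b] by (auto simp: d_def)
  have \<mu>: "measure lebesgue \<Omega> = measure lborel \<Omega>" using O by (intro measure_completion) simp
  obtain Z A where Z: "finite Z" "Z \<subseteq> X" "\<forall>f\<in>Z. A f \<ge> 0"
    and cnt: "\<forall>H. (\<forall>f\<in>Z. \<exists>L. osc_bound \<alpha> Q f (H f) L) \<longrightarrow> (\<exists>K\<ge>0. \<forall>j. real (card (gidx j ` frontier \<Omega>)) \<le>
       (\<Sum>f\<in>Z. A f * H f) * 2 powr (real j * (real DIM('b \<times> real) - \<alpha>)) + K * 2 powr (real j * real DIM('b)))"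
    using domain_boundary_count[OF O Q dom \<alpha> X] by blast
  from Weyl_of_boundary_count[OF d(2)[unfolded d_def] \<alpha>] obtain C where C: "C \<ge> 0" and
    W: "\<forall>M\<ge>0. \<forall>K\<ge>0. (\<forall>j. real (bcount j) \<le> M * 2 powr (real j * (real d - \<alpha>)) + K) \<longrightarrow>
    (\<exists>K'. \<forall>l\<ge>1. \<exists>n. N_D \<Omega> l = enat n \<and> \<bar>real n - C_W d * measure lborel \<Omega> * l ^ d\<bar> \<le>
         C * M * l powr (real d - \<alpha>) + K' * l ^ (d - 1))"
    unfolding d_def[symmetric] by blast
  show ?thesis
  proof (rule that[OF Z(1,2) C Z(3)], intro allI impI)
    fix H and \<eta> :: real
    assume H: "\<eta> > 0 \<and> (\<forall>f\<in>Z. H f \<ge> 0 \<and> (\<exists>L. osc_bound \<alpha> Q f (H f) L))"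
    let ?M = "\<Sum>f\<in>Z. A f * H f"
    obtain K where K: "K \<ge> 0" "\<And>j. real (card (gidx j ` frontier \<Omega>)) \<le>
       ?M * 2 powr (real j * (real DIM('b \<times> real) - \<alpha>)) + K * 2 powr (real j * real DIM('b))"
      using cnt H by blast
    have "\<eta> > 0" using H by simp
    from powr_absorb_lower_order[OF K(1) this \<alpha>(2), of "real DIM('b)"] obtain K1 where K1: "K1 \<ge> 0"
      "\<And>j::nat. K * 2 powr (real j * real DIM('b)) \<le> \<eta> * 2 powr (real j * (real DIM('b) + 1 - \<alpha>)) + K1" by blast
    have "real (bcount j) \<le> (?M + \<eta>) * 2 powr (real j * (real d - \<alpha>)) + K1" for j
      using K(2)[of j] K1(2)[of j] unfolding bcount_def d_def[symmetric] d(1)[symmetric] by (simp add: distrib_right)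
    moreover have "0 \<le> ?M + \<eta>" using H Z(3) by (intro add_nonneg_nonneg sum_nonneg mult_nonneg_nonneg) auto
    ultimately show "\<exists>K. \<forall>l\<ge>1. \<exists>n. N_D \<Omega> l = enat n \<and> \<bar>real n - C_W d * measure lebesgue \<Omega> * l ^ d\<bar> \<le>
       C * (?M + \<eta>) * l powr (real d - \<alpha>) + K * l ^ (d - 1)"
      unfolding \<mu> using W K1(1) by blast
  qed
qed

lemma power_le_powr_eventually:
  fixes K \<epsilon> \<alpha> :: real and d :: nat
  assumes "\<epsilon> > 0" "\<alpha> < 1" "d > 0"
  shows "\<forall>\<^sub>F l in at_top. K * l ^ (d - 1) \<le> \<epsilon> * l powr (real d - \<alpha>)"
proof -
  define b where "b = max (K / \<epsilon>) 1"
  have "K / \<epsilon> \<le> l powr (1 - \<alpha>)" if "l \<ge> b powr (1 / (1 - \<alpha>))" for l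
  proof -
    have "b = (b powr (1 / (1 - \<alpha>))) powr (1 - \<alpha>)" using assms(2) by (simp add: powr_powr b_def)
    also have "\<dots> \<le> l powr (1 - \<alpha>)" using that assms(2) by (intro powr_mono2) auto
    finally show ?thesis by (simp add: b_def)
  qed
  then have "\<forall>\<^sub>F l in at_top. K / \<epsilon> \<le> l powr (1 - \<alpha>)"
    by (rule eventually_mono[OF eventually_ge_at_top])
  then show ?thesis using eventually_ge_at_top[of 1]
  proof eventually_elim
    case (elim l)
    have "K \<le> \<epsilon> * l powr (1 - \<alpha>)" using elim(1) assms(1) by (simp add: pos_divide_le_eq mult.commute)
    then have "K * l ^ (d - 1) \<le> \<epsilon> * l powr (1 - \<alpha>) * l ^ (d - 1)"
      using elim(2) by (intro mult_right_mono) auto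
    also have "\<dots> = \<epsilon> * l powr (1 - \<alpha>) * l powr real (d - 1)"
      using elim(2) powr_realpow[of l "d - 1"] by simp
    also have "\<dots> = \<epsilon> * l powr (real d - \<alpha>)"
      using assms(3) by (simp add: mult.assoc powr_add[symmetric] of_nat_diff)
    finally show ?case .
  qed
qed

text \<open>\<open>N_D\<close> takes values in \<open>enat\<close>, so its finiteness for large
  \<open>l\<close> is asserted along with the asymptotics; it gives \<open>the_enat\<close> its
  meaning. As \<open>real ^ 'm\<close> has positive dimension, \<open>d\<close> is at least
  2.\<close>

theorem corollary1p9:
  fixes \<Omega> :: "((real ^ 'm) \<times> real) set" and \<alpha> :: real and d :: nat
  assumes d: "d = DIM((real ^ 'm) \<times> real)"
    and "open \<Omega>" and "connected \<Omega>" and "bounded \<Omega>"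
    and "0 < \<alpha>" and "\<alpha> < 1"
  shows "(Lip_domain \<alpha> \<Omega> \<longrightarrow>
           eventually (\<lambda>l. N_D \<Omega> l < \<infinity>) at_top \<and>
           (\<lambda>l. real (the_enat (N_D \<Omega> l)) - C_W d * measure lebesgue \<Omega> * l ^ d)
             \<in> O[at_top](\<lambda>l. l powr (real d - \<alpha>)))
       \<and> (little_lip_domain \<alpha> \<Omega> \<longrightarrow>
           eventually (\<lambda>l. N_D \<Omega> l < \<infinity>) at_top \<and>
           (\<lambda>l. real (the_enat (N_D \<Omega> l)) - C_W d * measure lebesgue \<Omega> * l ^ d)
             \<in> o[at_top](\<lambda>l. l powr (real d - \<alpha>)))"
proof -
  let ?r = "\<lambda>l. real (the_enat (N_D \<Omega> l)) - C_W d * measure lebesgue \<Omega> * l ^ d"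
  have d0: "d > 0" by (simp add: d)
  \<comment> \<open>Since \<open>\<alpha> < 1\<close>, the term of order \<open>l ^ (d - 1)\<close>
    is absorbed by an arbitrarily small multiple of \<open>l powr (d - \<alpha>)\<close>.\<close>
  have bound: "eventually (\<lambda>l. N_D \<Omega> l < \<infinity> \<and> \<bar>?r l\<bar> \<le> (B + \<epsilon>) * l powr (real d - \<alpha>)) at_top"
    if "\<forall>l\<ge>1. \<exists>n. N_D \<Omega> l = enat n \<and> \<bar>real n - C_W d * measure lebesgue \<Omega> * l ^ d\<bar> \<le>
       B * l powr (real d - \<alpha>) + K * l ^ (d - 1)" and \<epsilon>: "\<epsilon> > 0" for B K \<epsilon>
    using eventually_ge_at_top[of 1] power_le_powr_eventually[OF \<epsilon> \<open>\<alpha> < 1\<close> d0, of K]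
  proof eventually_elim
    case (elim l)
    from that(1) elim(1) obtain n where n: "N_D \<Omega> l = enat n"
      "\<bar>real n - C_W d * measure lebesgue \<Omega> * l ^ d\<bar> \<le> B * l powr (real d - \<alpha>) + K * l ^ (d - 1)" by blast
    then show ?case using elim(2) by (simp add: distrib_right)
  qed
  have "eventually (\<lambda>l. N_D \<Omega> l < \<infinity>) at_top \<and> ?r \<in> O[at_top](\<lambda>l. l powr (real d - \<alpha>))" if L: "Lip_domain \<alpha> \<Omega>"
  proof -
    obtain a Q where Q: "is_cube a Q" "domain_of_class Q (Lip \<alpha> Q) \<Omega>" using L by (auto simp: Lip_domain_def)
    have osc: "\<exists>H. osc_bound \<alpha> Q f H 0" if "f \<in> Lip \<alpha> Q" for f by (rule Lip_osc_bound[OF that])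
    then have osc': "\<exists>H L. osc_bound \<alpha> Q f H L" if "f \<in> Lip \<alpha> Q" for f using that by blast
    obtain Z A C where Z: "finite Z" "Z \<subseteq> Lip \<alpha> Q" "C \<ge> 0" "\<forall>f\<in>Z. A f \<ge> 0"
      and rem: "\<forall>H \<eta>. \<eta> > 0 \<and> (\<forall>f\<in>Z. H f \<ge> 0 \<and> (\<exists>L. osc_bound \<alpha> Q f (H f) L)) \<longrightarrow>
       (\<exists>K. \<forall>l\<ge>1. \<exists>n. N_D \<Omega> l = enat n \<and> \<bar>real n - C_W d * measure lebesgue \<Omega> * l ^ d\<bar> \<le>
         C * ((\<Sum>f\<in>Z. A f * H f) + \<eta>) * l powr (real d - \<alpha>) + K * l ^ (d - 1))"
      unfolding d
      by (rule Weyl_remainder[OF \<open>open \<Omega>\<close> \<open>bounded \<Omega>\<close> Q \<open>0 < \<alpha>\<close> \<open>\<alpha> < 1\<close> osc']) (assumption | rule that)+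
    have "\<forall>f. \<exists>H. f \<in> Z \<longrightarrow> osc_bound \<alpha> Q f H 0" using osc Z(2) by blast
    from choice[OF this] obtain H where H: "\<forall>f. f \<in> Z \<longrightarrow> osc_bound \<alpha> Q f (H f) 0" by blast
    \<comment> \<open>Any finite coefficient is good enough for the large O, so
      \<open>\<eta>\<close> is simply 1.\<close>
    have "(1::real) > 0 \<and> (\<forall>f\<in>Z. H f \<ge> 0 \<and> (\<exists>L. osc_bound \<alpha> Q f (H f) L))"
      using H by (auto simp: osc_bound_def)
    from rem[rule_format, OF this] obtain K where K: "\<forall>l\<ge>1. \<exists>n. N_D \<Omega> l = enat n \<and> \<bar>real n - C_W d * measure lebesgue \<Omega> * l ^ d\<bar> \<le>
         C * ((\<Sum>f\<in>Z. A f * H f) + 1) * l powr (real d - \<alpha>) + K * l ^ (d - 1)" by blast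
    have ev: "eventually (\<lambda>l. N_D \<Omega> l < \<infinity> \<and> \<bar>?r l\<bar> \<le> (C * ((\<Sum>f\<in>Z. A f * H f) + 1) + 1) * l powr (real d - \<alpha>)) at_top"
      by (rule bound[OF K]) simp
    then have "?r \<in> O[at_top](\<lambda>l. l powr (real d - \<alpha>))"
      by (intro bigoI[of _ "C * ((\<Sum>f\<in>Z. A f * H f) + 1) + 1"]) (auto elim!: eventually_mono)
    with ev show ?thesis by (auto elim!: eventually_mono)
  qed
  moreover have "eventually (\<lambda>l. N_D \<Omega> l < \<infinity>) at_top \<and> ?r \<in> o[at_top](\<lambda>l. l powr (real d - \<alpha>))" if L: "little_lip_domain \<alpha> \<Omega>"
  proof -
    obtain a Q where Q: "is_cube a Q" "domain_of_class Q (little_lip \<alpha> Q) \<Omega>" using L by (auto simp: little_lip_domain_def)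
    have osc: "\<exists>L. osc_bound \<alpha> Q f \<epsilon> L" if "f \<in> little_lip \<alpha> Q" "\<epsilon> > 0" for f \<epsilon> by (rule little_lip_osc_bound[OF that])
    then have osc': "\<exists>H L. osc_bound \<alpha> Q f H L" if "f \<in> little_lip \<alpha> Q" for f using that zero_less_one by blast
    obtain Z A C where Z: "finite Z" "Z \<subseteq> little_lip \<alpha> Q" "C \<ge> 0" "\<forall>f\<in>Z. A f \<ge> 0"
      and rem: "\<forall>H \<eta>. \<eta> > 0 \<and> (\<forall>f\<in>Z. H f \<ge> 0 \<and> (\<exists>L. osc_bound \<alpha> Q f (H f) L)) \<longrightarrow>
       (\<exists>K. \<forall>l\<ge>1. \<exists>n. N_D \<Omega> l = enat n \<and> \<bar>real n - C_W d * measure lebesgue \<Omega> * l ^ d\<bar> \<le>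
         C * ((\<Sum>f\<in>Z. A f * H f) + \<eta>) * l powr (real d - \<alpha>) + K * l ^ (d - 1))"
      unfolding d
      by (rule Weyl_remainder[OF \<open>open \<Omega>\<close> \<open>bounded \<Omega>\<close> Q \<open>0 < \<alpha>\<close> \<open>\<alpha> < 1\<close> osc']) (assumption | rule that)+
    have ev: "eventually (\<lambda>l. N_D \<Omega> l < \<infinity> \<and> \<bar>?r l\<bar> \<le> c * l powr (real d - \<alpha>)) at_top" if c: "c > 0" for c
    proof -
      \<comment> \<open>With the same \<open>\<delta>\<close> for every function, for
        \<open>\<eta>\<close> and for the term absorbed by \<open>bound\<close>, the total
        coefficient is \<open>S * \<delta>\<close>, which is made equal to \<open>c\<close>.\<close>
      define S where "S = C * ((\<Sum>f\<in>Z. A f) + 1) + 1"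
      have "(\<Sum>f\<in>Z. A f) \<ge> 0" using Z(4) by (intro sum_nonneg) auto
      then have S: "S > 0" using Z(3) by (auto simp: S_def intro!: add_nonneg_pos mult_nonneg_nonneg)
      define \<delta> where "\<delta> = c / S"
      have \<delta>: "\<delta> > 0" using c S by (simp add: \<delta>_def)
      have "\<delta> > 0 \<and> (\<forall>f\<in>Z. \<delta> \<ge> 0 \<and> (\<exists>L. osc_bound \<alpha> Q f \<delta> L))" using osc Z(2) \<delta> by auto
      from rem[rule_format, of _ "\<lambda>_. \<delta>", OF this] obtain K where K: "\<forall>l\<ge>1. \<exists>n. N_D \<Omega> l = enat n \<and> \<bar>real n - C_W d * measure lebesgue \<Omega> * l ^ d\<bar> \<le>
         C * ((\<Sum>f\<in>Z. A f * \<delta>) + \<delta>) * l powr (real d - \<alpha>) + K * l ^ (d - 1)" by blast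
      have "C * ((\<Sum>f\<in>Z. A f * \<delta>) + \<delta>) + \<delta> = S * \<delta>"
        unfolding sum_distrib_right[symmetric] by (simp add: S_def algebra_simps)
      also have "\<dots> = c" using S by (simp add: \<delta>_def)
      finally show ?thesis using bound[OF K \<delta>] by simp
    qed
    have "?r \<in> o[at_top](\<lambda>l. l powr (real d - \<alpha>))"
    proof (rule landau_o.smallI)
      fix c :: real assume "c > 0"
      from ev[OF this] show "eventually (\<lambda>l. norm (?r l) \<le> c * norm (l powr (real d - \<alpha>))) at_top"
        by eventually_elim simp
    qed
    with ev[of 1] show ?thesis by (auto elim!: eventually_mono)
  qed
  ultimately show ?thesis by blast
qed

end
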